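(* Let $\Sigma$ be an orientable surface, possibly with boundary, and let $G\subset\Sigma$ be an embedded graph with associated ribbon graph $F$ and edge weights $\mathbf{b}=\{b_e\}_{e\in E(F)}$ (formal commuting variables). Then there is a map $f$, linear over coefficients depending only on $x,y$, sending each monomial in the $b_e$ to a monomial in the variables $\{t_w\}$ (indexed by the chosen representatives $S(\Sigma)$ of conjugacy classes of $\pi_1(\Sigma)$) or to $0$, such that \[ P({\mathcal L}(G);x,y,\{t_w\})=f\!\left(\frac{y}{x-x^{-1}}\left(\frac{y}{x}\right)^{e(G)}B\!\left(G;\,1,\;\left(\frac{b_e}{xy}\right)_{e\in E(G)},\;\frac{x-x^{-1}}{y}\right)\right). \]
   Context: $I=[0,1]$. A ribbon graph is a graph with a fixed cyclic order of half-edges at each vertex, regarded as an orientable surface with boundary (vertex discs joined by untwisted edge bands). A graph $G$ embedded in an orientable surface $\Sigma$ has an associated ribbon graph $F$ (a regular neighbourhood of $G$). A state of $F$ is a spanning sub-ribbon graph; ${\mathcal S}(F)$ denotes the set of states. For a state $H$: $k(H)$ is its number of connected components, $E(H)$ its edge set, $p(H)$ the number of boundary components of $H$ as a surface; $e(G)$ is the number of edges of $G$. The weighted Bollobás–Riordan polynomial is $B(F;a,\mathbf{b},c)=\sum_{H\in{\mathcal S}(F)}a^{k(H)}\left(\prod_{e\in E(H)}b_e\right)c^{p(H)}$, and $B(G):=B(F)$. The link ${\mathcal L}(G)\subset\Sigma\times I$: each edge of $G$ is replaced by a fixed oriented one-crossing tangle on its band (Jaeger's tangle), these being connected along the vertex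 disc boundaries according to the cyclic orders at vertices. The crossing is positive; its oriented smoothing gives the arcs corresponding to the edge being absent, and switching it gives a tangle isotopic to the two arcs along both sides of the edge band, so that for each state $H$ the crossing-free link obtained by switching at edges of $H$ and smoothing elsewhere is $\partial H$ with boundary orientation. HOMFLY polynomial in $\Sigma\times I$: the product of links $L_1\cdot L_2$ places $L_1$ in $\Sigma\times[1/2,1]$ above $L_2$ in $\Sigma\times[0,1/2]$. A knot is descending if it is isotopic to a knot $K'$ with a basepoint $a$ such that travelling along $K'$ from $a$ the height (the $I$-coordinate) decreases until a point $a'$ lying over the same point of $\Sigma$ as $a$, from which $K'$ returns vertically to $a$. Isotopy classes of descending knots correspond bijectively to conjugacy classes of $\pi_1(\Sigma)$; fix a set $S(\Sigma)=\{t_w\}$ of canonical representatives (Lieberum's choice), regarded as commuting indeterminates, so a descending knot $K$ gives $t_K\in S(\Sigma)$ (with $t_{\text{unknot}}=1$). A descending link is one isotopic to a product of descending knots; it determines the monomial $t_L$ = product of the $t_K$ of its components. $P(L)=P(L;x,y,\{t_w\})\in\mathbb{Z}[x^{\pm1},y^{\pm1}]\otimes\mathbb{Z}[\{t_w\}]$ is the unique isotopy invariant of oriented links in $\Sigma\times I$ satisfying $xP(L_+)-x^{-1}P(L_-)=yP(L_0)$ and $P(L)=t_L\left((x-x^{-1})/y\right)^{k(L)-1}$ for descending links $L$ with $k(L)$ components. *)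

theory Defs
  imports
    "HOL-Complex_Analysis.Complex_Analysis"
    "HOL-Library.Poly_Mapping"
    "HOL-Computational_Algebra.Fraction_Field"
begin

section \<open>Oriented surfaces\<close>

definition positive_at :: "(complex \<Rightarrow> complex) \<Rightarrow> complex \<Rightarrow> bool" where
  "positive_at h z \<longleftrightarrow>
     (\<forall>\<^sub>F r in at_right 0. winding_number (h \<circ> circlepath z r) (h z) = 1)"

text \<open>
  A chart is an open set together with a homeomorphism onto a relatively open subset of the closed
  upper half plane. Orientability is witnessed by an atlas all of whose transition maps have local
  degree \<open>1\<close>; the atlas is the chosen orientation.
\<close>

type_synonym 'a atlas = "('a set \<times> ('a \<Rightarrow> complex)) set"

definition oriented_surface :: "'a::metric_space set \<Rightarrow> 'a atlas \<Rightarrow> bool" where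
  "oriented_surface \<Sigma> \<A> \<longleftrightarrow>
     second_countable (top_of_set \<Sigma>) \<and>
     (\<Union>(U, \<phi>)\<in>\<A>. U) = \<Sigma> \<and>
     (\<forall>(U, \<phi>)\<in>\<A>. openin (top_of_set \<Sigma>) U \<and>
        (\<exists>V \<psi>. openin (top_of_set {z. 0 \<le> Im z}) V \<and> homeomorphism U V \<phi> \<psi>)) \<and>
     (\<forall>(U, \<phi>)\<in>\<A>. \<forall>(U', \<phi>')\<in>\<A>. \<forall>z\<in>interior (\<phi> ` (U \<inter> U')).
        positive_at (\<phi>' \<circ> inv_into U \<phi>) z)"

definition surface_interior :: "'a atlas \<Rightarrow> 'a set" where
  "surface_interior \<A> = {p. \<exists>(U, \<phi>)\<in>\<A>. p \<in> U \<and> 0 < Im (\<phi> p)}"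

definition positive_embedding ::
    "'a::metric_space atlas \<Rightarrow> complex set \<Rightarrow> (complex \<Rightarrow> 'a) \<Rightarrow> bool" where
  "positive_embedding \<A> D \<beta> \<longleftrightarrow>
     continuous_on D \<beta> \<and> inj_on \<beta> D \<and> \<beta> ` D \<subseteq> surface_interior \<A> \<and>
     (\<forall>z\<in>interior D. \<forall>(U, \<phi>)\<in>\<A>. \<beta> z \<in> U \<longrightarrow> positive_at (\<phi> \<circ> \<beta>) z)"


section \<open>Oriented links in the thickened surface\<close>

text \<open>
  An oriented closed 1-manifold is represented by a set of parametrised loops, one for each
  component; \<open>carries\<close> says that it is the union of a family of oriented paths, each running in the
  positive direction.
\<close>

definition runs_along :: "(real \<Rightarrow> 'b) \<Rightarrow> (real \<Rightarrow> 'b) \<Rightarrow> bool" where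
  "runs_along a \<gamma> \<longleftrightarrow>
     (\<exists>u. continuous_on {0..1} u \<and> strict_mono_on {0..1} u \<and> (\<forall>s\<in>{0..1}. a s = \<gamma> (frac (u s))))"

definition trace :: "(real \<Rightarrow> 'b::topological_space) set \<Rightarrow> 'b set" where
  "trace T = (\<Union>a\<in>T. path_image a)"

definition carries :: "(real \<Rightarrow> 'b::topological_space) set \<Rightarrow> (real \<Rightarrow> 'b) set \<Rightarrow> bool" where
  "carries L T \<longleftrightarrow> trace L = trace T \<and> (\<forall>a\<in>T. \<exists>\<gamma>\<in>L. runs_along a \<gamma>)"

type_synonym 'a knot = "real \<Rightarrow> 'a \<times> real"
type_synonym 'a link = "'a knot set"

definition ambient_isotopy ::
    "'a::metric_space set \<Rightarrow> (real \<Rightarrow> 'a \<times> real \<Rightarrow> 'a \<times> real) \<Rightarrow> bool" where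
  "ambient_isotopy \<Sigma> h \<longleftrightarrow>
     continuous_on ({0..1} \<times> (\<Sigma> \<times> {0..1})) (\<lambda>(t, p). h t p) \<and>
     (\<forall>t\<in>{0..1}. \<exists>g. homeomorphism (\<Sigma> \<times> {0..1}) (\<Sigma> \<times> {0..1}) (h t) g) \<and>
     (\<forall>p\<in>\<Sigma> \<times> {0..1}. h 0 p = p)"

definition isotopic :: "'a::metric_space set \<Rightarrow> 'a link \<Rightarrow> 'a link \<Rightarrow> bool" where
  "isotopic \<Sigma> L L' \<longleftrightarrow> (\<exists>h. ambient_isotopy \<Sigma> h \<and> carries L' ((\<lambda>\<gamma>. h 1 \<circ> \<gamma>) ` L))"

definition loop_system :: "'a::metric_space atlas \<Rightarrow> 'a link \<Rightarrow> bool" where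
  "loop_system \<A> L \<longleftrightarrow>
     finite L \<and> L \<noteq> {} \<and>
     (\<forall>\<gamma>\<in>L. simple_path \<gamma> \<and> pathfinish \<gamma> = pathstart \<gamma> \<and>
        path_image \<gamma> \<subseteq> surface_interior \<A> \<times> {0<..<1}) \<and>
     pairwise (\<lambda>\<gamma> \<gamma>'. disjnt (path_image \<gamma>) (path_image \<gamma>')) L"

text \<open>
  Model tangles in \<open>[-1,1]\<^sup>2 \<times> [0,1]\<close>. All strands at a crossing run upwards, and the smoothing
  is the oriented one.
\<close>

definition square :: "complex set" where
  "square = {z. \<bar>Re z\<bar> \<le> 1 \<and> \<bar>Im z\<bar> \<le> 1}"

definition open_square :: "complex set" where
  "open_square = {z. \<bar>Re z\<bar> < 1 \<and> \<bar>Im z\<bar> < 1}"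

definition strand :: "real \<Rightarrow> complex \<Rightarrow> complex \<Rightarrow> complex knot" where
  "strand \<epsilon> a b = (\<lambda>s. (linepath a b s, 1/2 + \<epsilon> * min s (1 - s)))"

definition crossing_pos :: "complex knot set" where
  "crossing_pos =
     {strand (1/2) (Complex (-1) (-1)) (Complex 1 1), strand (-1/2) (Complex 1 (-1)) (Complex (-1) 1)}"

definition crossing_neg :: "complex knot set" where
  "crossing_neg =
     {strand (-1/2) (Complex (-1) (-1)) (Complex 1 1), strand (1/2) (Complex 1 (-1)) (Complex (-1) 1)}"

definition crossing_smooth :: "complex knot set" where
  "crossing_smooth =
     {strand 0 (Complex (-1) (-1)) (Complex (-1/2) 0), strand 0 (Complex (-1/2) 0) (Complex (-1) 1),
      strand 0 (Complex 1 (-1)) (Complex (1/2) 0), strand 0 (Complex (1/2) 0) (Complex 1 1)}"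

definition place :: "(complex \<Rightarrow> 'a) \<Rightarrow> complex knot set \<Rightarrow> 'a knot set" where
  "place \<beta> T = (\<lambda>a. map_prod \<beta> id \<circ> a) ` T"

text \<open>
  Links are tame: up to isotopy they project to a diagram, that is, the projection to the surface is
  injective except for finitely many crossings.
\<close>

definition has_diagram :: "'a::metric_space atlas \<Rightarrow> 'a link \<Rightarrow> bool" where
  "has_diagram \<A> L \<longleftrightarrow>
     (\<exists>\<Phi>. finite \<Phi> \<and>
        (\<forall>\<phi>\<in>\<Phi>. positive_embedding \<A> square \<phi> \<and>
           trace L \<inter> (\<phi> ` square \<times> UNIV)
             \<in> {trace (place \<phi> crossing_pos), trace (place \<phi> crossing_neg)}) \<and>
        pairwise (\<lambda>\<phi> \<phi>'. disjnt (\<phi> ` square) (\<phi>' ` square)) \<Phi> \<and>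
        inj_on fst (trace L - (\<Union>\<phi>\<in>\<Phi>. \<phi> ` open_square) \<times> UNIV))"

definition oriented_link :: "'a::metric_space set \<Rightarrow> 'a atlas \<Rightarrow> 'a link \<Rightarrow> bool" where
  "oriented_link \<Sigma> \<A> L \<longleftrightarrow>
     loop_system \<A> L \<and> (\<exists>L'. loop_system \<A> L' \<and> has_diagram \<A> L' \<and> isotopic \<Sigma> L L')"

definition skein_triple ::
    "'a::metric_space set \<Rightarrow> 'a atlas \<Rightarrow> 'a link \<Rightarrow> 'a link \<Rightarrow> 'a link \<Rightarrow> bool" where
  "skein_triple \<Sigma> \<A> Lp Lm L0 \<longleftrightarrow>
     oriented_link \<Sigma> \<A> Lp \<and> oriented_link \<Sigma> \<A> Lm \<and> oriented_link \<Sigma> \<A> L0 \<and>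
     (\<exists>\<phi> C. positive_embedding \<A> square \<phi> \<and>
        trace C \<inter> (\<phi> ` open_square \<times> UNIV) = {} \<and>
        carries Lp (C \<union> place \<phi> crossing_pos) \<and>
        carries Lm (C \<union> place \<phi> crossing_neg) \<and>
        carries L0 (C \<union> place \<phi> crossing_smooth))"


section \<open>Descending links\<close>

definition stack :: "'a link \<Rightarrow> 'a link \<Rightarrow> 'a link" where
  "stack L1 L2 =
     (\<lambda>\<gamma>. map_prod id (\<lambda>z. (1 + z) / 2) \<circ> \<gamma>) ` L1 \<union> (\<lambda>\<gamma>. map_prod id (\<lambda>z. z / 2) \<circ> \<gamma>) ` L2"

definition descending_knot :: "'a::metric_space set \<Rightarrow> 'a atlas \<Rightarrow> 'a knot \<Rightarrow> bool" where
  "descending_knot \<Sigma> \<A> K \<longleftrightarrow>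
     oriented_link \<Sigma> \<A> {K} \<and>
     (\<exists>K' c. oriented_link \<Sigma> \<A> {K'} \<and> isotopic \<Sigma> {K} {K'} \<and> 0 < c \<and> c < 1 \<and>
        (\<forall>s\<in>{0..c}. \<forall>t\<in>{0..c}. s < t \<longrightarrow> snd (K' t) < snd (K' s)) \<and>
        (\<forall>s\<in>{c..1}. fst (K' s) = fst (K' 0)))"

fun stack_knots :: "'a knot list \<Rightarrow> 'a link" where
  "stack_knots [] = {}"
| "stack_knots [K] = {K}"
| "stack_knots (K # Ks) = stack {K} (stack_knots Ks)"

text \<open>
  Conjugacy in the fundamental group: loops based at different points are compared after transport
  along a path.
\<close>

definition pi1_conjugate ::
    "'a::topological_space set \<Rightarrow> (real \<Rightarrow> 'a) \<Rightarrow> (real \<Rightarrow> 'a) \<Rightarrow> bool" where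
  "pi1_conjugate \<Sigma> p q \<longleftrightarrow>
     (\<exists>r. path r \<and> path_image r \<subseteq> \<Sigma> \<and> pathstart r = pathstart p \<and> pathfinish r = pathstart q \<and>
        homotopic_paths \<Sigma> p (r +++ q +++ reversepath r))"

definition null_homotopic :: "'a::topological_space set \<Rightarrow> (real \<Rightarrow> 'a) \<Rightarrow> bool" where
  "null_homotopic \<Sigma> p \<longleftrightarrow> homotopic_paths \<Sigma> p (\<lambda>_. pathstart p)"

definition canonical_representatives ::
    "'a::metric_space set \<Rightarrow> 'a atlas \<Rightarrow> 'a knot set \<Rightarrow> bool" where
  "canonical_representatives \<Sigma> \<A> S \<longleftrightarrow>
     (\<forall>s\<in>S. descending_knot \<Sigma> \<A> s) \<and>
     (\<forall>p. path p \<and> path_image p \<subseteq> \<Sigma> \<and> pathfinish p = pathstart p \<longrightarrow>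
        (\<exists>!s. s \<in> S \<and> pi1_conjugate \<Sigma> p (fst \<circ> s)))"

definition representative :: "'a::metric_space set \<Rightarrow> 'a knot set \<Rightarrow> 'a knot \<Rightarrow> 'a knot" where
  "representative \<Sigma> S K = (THE s. s \<in> S \<and> pi1_conjugate \<Sigma> (fst \<circ> K) (fst \<circ> s))"


section \<open>Coefficients and polynomials\<close>

text \<open>The field \<open>\<rat>(x,y)\<close>, as the field of fractions of \<open>\<int>[x][y]\<close>, and \<open>\<int>[x\<^sup>\<plusminus>\<^sup>1,y\<^sup>\<plusminus>\<^sup>1]\<close> inside it.\<close>

type_synonym ratfun = "int poly poly fract"

definition x_var :: ratfun where
  "x_var = Fract [:[:0, 1:]:] 1"

definition y_var :: ratfun where
  "y_var = Fract [:0, 1:] 1"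

definition laurent :: "ratfun set" where
  "laurent = {r. \<exists>p m n. r = Fract p 1 / (x_var ^ m * y_var ^ n)}"

text \<open>Polynomials over \<open>\<rat>(x,y)\<close> in variables indexed by a type.\<close>

type_synonym 'i mpoly = "('i \<Rightarrow>\<^sub>0 nat) \<Rightarrow>\<^sub>0 ratfun"

definition const :: "ratfun \<Rightarrow> 'i mpoly" where
  "const r = Poly_Mapping.single 0 r"

definition monomial :: "('i \<Rightarrow>\<^sub>0 nat) \<Rightarrow> 'i mpoly" where
  "monomial m = Poly_Mapping.single m 1"

definition var :: "'i \<Rightarrow> 'i mpoly" where
  "var i = monomial (Poly_Mapping.single i 1)"


section \<open>The HOMFLY polynomial\<close>

text \<open>The class of the unknot contributes \<open>1\<close> rather than an indeterminate.\<close>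

definition indeterminates :: "'a::metric_space set \<Rightarrow> 'a knot set \<Rightarrow> 'a knot set" where
  "indeterminates \<Sigma> S = {s\<in>S. \<not> null_homotopic \<Sigma> (fst \<circ> s)}"

definition t_knot :: "'a::metric_space set \<Rightarrow> 'a knot set \<Rightarrow> 'a knot \<Rightarrow> 'a knot mpoly" where
  "t_knot \<Sigma> S K = (if null_homotopic \<Sigma> (fst \<circ> K) then 1 else var (representative \<Sigma> S K))"

definition t_link :: "'a::metric_space set \<Rightarrow> 'a knot set \<Rightarrow> 'a link \<Rightarrow> 'a knot mpoly" where
  "t_link \<Sigma> S L = (\<Prod>K\<in>L. t_knot \<Sigma> S K)"

text \<open>
  The relation \<open>R\<close> restricts the order in which descending knots are multiplied, from top to bottom.
  If \<open>R\<close> is the full relation \<open>S \<times> S\<close>, the result is an arbitrary product of descending knots.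
  If \<open>R\<close> is a linear order, each family of conjugacy classes has one product up to isotopy. The
  order matters: if \<open>a\<close> and \<open>b\<close> are simple closed curves meeting once, then \<open>a \<cdot> b\<close>, \<open>b \<cdot> a\<close> and a
  simple closed curve form a skein triple, so that no invariant can have the prescribed value
  on both products.
\<close>

definition descending_link ::
    "'a::metric_space set \<Rightarrow> 'a atlas \<Rightarrow> 'a knot set \<Rightarrow> 'a knot rel \<Rightarrow> 'a link \<Rightarrow> bool" where
  "descending_link \<Sigma> \<A> S R L \<longleftrightarrow>
     oriented_link \<Sigma> \<A> L \<and>
     (\<exists>Ks. Ks \<noteq> [] \<and> (\<forall>K\<in>set Ks. descending_knot \<Sigma> \<A> K) \<and>
        sorted_wrt (\<lambda>K K'. (representative \<Sigma> S K, representative \<Sigma> S K') \<in> R) Ks \<and>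
        isotopic \<Sigma> L (stack_knots Ks))"

definition homfly_polynomial ::
    "'a::metric_space set \<Rightarrow> 'a atlas \<Rightarrow> 'a knot set \<Rightarrow> 'a knot rel \<Rightarrow>
     ('a link \<Rightarrow> 'a knot mpoly) \<Rightarrow> bool" where
  "homfly_polynomial \<Sigma> \<A> S R P \<longleftrightarrow>
     (\<forall>L. oriented_link \<Sigma> \<A> L \<longrightarrow>
        (\<forall>m\<in>Poly_Mapping.keys (P L).
           Poly_Mapping.keys m \<subseteq> indeterminates \<Sigma> S \<and> Poly_Mapping.lookup (P L) m \<in> laurent)) \<and>
     (\<forall>L L'. oriented_link \<Sigma> \<A> L \<and> oriented_link \<Sigma> \<A> L' \<and> isotopic \<Sigma> L L' \<longrightarrow> P L = P L') \<and>
     (\<forall>Lp Lm L0. skein_triple \<Sigma> \<A> Lp Lm L0 \<longrightarrow>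
        const x_var * P Lp - const (inverse x_var) * P Lm = const y_var * P L0) \<and>
     (\<forall>L. descending_link \<Sigma> \<A> S R L \<longrightarrow>
        P L = t_link \<Sigma> S L * const ((x_var - inverse x_var) / y_var) ^ (card L - 1))"


section \<open>Embedded graphs and ribbon graphs\<close>

record ('a, 'v, 'e) egraph =
  verts :: "'v set"
  edges :: "'e set"
  vpoint :: "'v \<Rightarrow> 'a"
  ecurve :: "'e \<Rightarrow> real \<Rightarrow> 'a"

definition embedded_graph :: "'a::metric_space atlas \<Rightarrow> ('a, 'v, 'e) egraph \<Rightarrow> bool" where
  "embedded_graph \<A> G \<longleftrightarrow>
     finite (verts G) \<and> verts G \<noteq> {} \<and> finite (edges G) \<and>
     inj_on (vpoint G) (verts G) \<and> vpoint G ` verts G \<subseteq> surface_interior \<A> \<and>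
     (\<forall>e\<in>edges G. simple_path (ecurve G e) \<and> path_image (ecurve G e) \<subseteq> surface_interior \<A> \<and>
        pathstart (ecurve G e) \<in> vpoint G ` verts G \<and>
        pathfinish (ecurve G e) \<in> vpoint G ` verts G \<and>
        disjnt (ecurve G e ` {0<..<1}) (vpoint G ` verts G)) \<and>
     pairwise (\<lambda>e e'. disjnt (ecurve G e ` {0<..<1}) (ecurve G e' ` {0<..<1})) (edges G)"

text \<open>
  In the coordinates of \<open>vmap v\<close> the disc of the vertex \<open>v\<close> is the unit disc. In those of \<open>emap e\<close>,
  defined on \<open>[-2,2] \<times> [-1,1]\<close>, the band of the edge \<open>e\<close> is \<open>[-1,1] \<times> [-1/2,1/2]\<close>, and the
  vertex discs are the parts with \<open>\<bar>Re z\<bar> \<ge> 1\<close>. The larger domains are collars.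
\<close>

record ('a, 'v, 'e) ribbon =
  vmap :: "'v \<Rightarrow> complex \<Rightarrow> 'a"
  emap :: "'e \<Rightarrow> complex \<Rightarrow> 'a"

definition edge_box :: "complex set" where
  "edge_box = {z. \<bar>Re z\<bar> \<le> 2 \<and> \<bar>Im z\<bar> \<le> 1}"

definition band :: "complex set" where
  "band = {z. \<bar>Re z\<bar> \<le> 1 \<and> \<bar>Im z\<bar> \<le> 1/2}"

text \<open>
  In the last two conditions, the edges of the graph are the cores of the bands, extended radially
  to the centres of the vertex discs.
\<close>

definition regular_neighbourhood ::
    "'a::metric_space atlas \<Rightarrow> ('a, 'v, 'e) egraph \<Rightarrow> ('a, 'v, 'e) ribbon \<Rightarrow> bool" where
  "regular_neighbourhood \<A> G F \<longleftrightarrow>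
     (\<forall>v\<in>verts G. positive_embedding \<A> (cball 0 2) (vmap F v) \<and> vmap F v 0 = vpoint G v) \<and>
     (\<forall>e\<in>edges G. positive_embedding \<A> edge_box (emap F e)) \<and>
     pairwise (\<lambda>v v'. disjnt (vmap F v ` cball 0 1) (vmap F v' ` cball 0 1)) (verts G) \<and>
     pairwise (\<lambda>e e'. disjnt (emap F e ` edge_box) (emap F e' ` edge_box)) (edges G) \<and>
     (\<forall>e\<in>edges G. \<forall>z\<in>edge_box.
        (emap F e z \<in> (\<Union>v\<in>verts G. vmap F v ` ball 0 1) \<longleftrightarrow> \<bar>Re z\<bar> > 1) \<and>
        (emap F e z \<in> (\<Union>v\<in>verts G. vmap F v ` sphere 0 1) \<longleftrightarrow> \<bar>Re z\<bar> = 1)) \<and>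
     (\<forall>e\<in>edges G.
        path_image (ecurve G e) - (\<Union>v\<in>verts G. vmap F v ` ball 0 1) =
        emap F e ` {z. \<bar>Re z\<bar> \<le> 1 \<and> Im z = 0}) \<and>
     (\<forall>e\<in>edges G. \<forall>v\<in>verts G.
        path_image (ecurve G e) \<inter> vmap F v ` cball 0 1 =
        vmap F v ` {of_real r * \<zeta> |r \<zeta>. 0 \<le> r \<and> r \<le> 1 \<and> norm \<zeta> = 1 \<and>
                      vmap F v \<zeta> \<in> {emap F e (-1), emap F e 1}})"

text \<open>A state is given by its set of edges; it contains all vertex discs.\<close>

definition states :: "('a, 'v, 'e) egraph \<Rightarrow> 'e set set" where
  "states G = Pow (edges G)"

definition state_surface ::
    "('a, 'v, 'e) egraph \<Rightarrow> ('a, 'v, 'e) ribbon \<Rightarrow> 'e set \<Rightarrow> 'a set" where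
  "state_surface G F H = (\<Union>v\<in>verts G. vmap F v ` cball 0 1) \<union> (\<Union>e\<in>H. emap F e ` band)"

definition num_components ::
    "('a::metric_space, 'v, 'e) egraph \<Rightarrow> ('a, 'v, 'e) ribbon \<Rightarrow> 'e set \<Rightarrow> nat" where
  "num_components G F H = card (components (state_surface G F H))"

text \<open>
  The ribbon graph lies in the interior of \<open>\<Sigma>\<close>, so the boundary of a state is its frontier in \<open>\<Sigma>\<close>.
\<close>

definition num_boundary_components ::
    "'a::metric_space set \<Rightarrow> ('a, 'v, 'e) egraph \<Rightarrow> ('a, 'v, 'e) ribbon \<Rightarrow> 'e set \<Rightarrow> nat" where
  "num_boundary_components \<Sigma> G F H =
     card (components (top_of_set \<Sigma> frontier_of state_surface G F H))"

definition bollobas_riordan ::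
    "'a::metric_space set \<Rightarrow> ('a, 'v, 'e) egraph \<Rightarrow> ('a, 'v, 'e) ribbon \<Rightarrow>
     'r::comm_ring_1 \<Rightarrow> ('e \<Rightarrow> 'r) \<Rightarrow> 'r \<Rightarrow> 'r" where
  "bollobas_riordan \<Sigma> G F a b c =
     (\<Sum>H\<in>states G. a ^ num_components G F H * (\<Prod>e\<in>H. b e) * c ^ num_boundary_components \<Sigma> G F H)"


section \<open>The link of an embedded graph\<close>

text \<open>
  The two strands of the tangle in an edge box run in opposite directions and make a full positive
  twist around each other, with crossings at \<open>-1/2\<close> and \<open>1/2\<close>. (Its ends are not interlaced on the
  boundary of the box, so the number of crossings of the two strands is even.) The crossing that
  is smoothed or switched is the one at \<open>-1/2\<close>. Switching it leaves one strand above the other, and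
  the strands separate into arcs along the two sides of the band. Smoothing it leaves an arc along
  each vertex disc, the one on the right with a kink.
\<close>

definition jaeger_tangle :: "complex knot set" where
  "jaeger_tangle =
     place (\<lambda>z. -1/2 + z/4) crossing_pos \<union> place (\<lambda>z. 1/2 - z/4) crossing_pos \<union>
     {strand 0 (Complex (-1) (-1)) (Complex (-3/4) (-1/4)),
      strand 0 (Complex (-3/4) (1/4)) (Complex (-1) 1),
      strand 0 (Complex (-1/4) (1/4)) (Complex (1/4) (1/4)),
      strand 0 (Complex (3/4) (-1/4)) (Complex 1 (-1)),
      strand 0 (Complex 1 1) (Complex (3/4) (1/4)),
      strand 0 (Complex (1/4) (-1/4)) (Complex (-1/4) (-1/4))}"

definition vertex_arcs :: "('a, 'v, 'e) egraph \<Rightarrow> ('a, 'v, 'e) ribbon \<Rightarrow> 'a knot set" where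
  "vertex_arcs G F =
     {\<lambda>s. (vmap F v (cis (\<theta> + s * \<tau>)), 1/2) |v \<theta> \<tau>.
        v \<in> verts G \<and> 0 < \<tau> \<and> \<tau> \<le> 2 * pi \<and>
        (\<forall>s\<in>{0..1}. vmap F v (cis (\<theta> + s * \<tau>)) \<notin>
           (\<Union>e\<in>edges G. emap F e ` {z. \<bar>Re z\<bar> \<le> 2 \<and> \<bar>Im z\<bar> < 1}))}"

definition jaeger_link ::
    "'a::metric_space set \<Rightarrow> 'a atlas \<Rightarrow> ('a, 'v, 'e) egraph \<Rightarrow> ('a, 'v, 'e) ribbon \<Rightarrow>
     'a link \<Rightarrow> bool" where
  "jaeger_link \<Sigma> \<A> G F L \<longleftrightarrow>
     oriented_link \<Sigma> \<A> L \<and>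
     carries L (vertex_arcs G F \<union> (\<Union>e\<in>edges G. place (emap F e) jaeger_tangle))"

end

theory Submission
  imports Defs
begin

text \<open>
  Resolving one crossing of every edge tangle by the skein relation expands \<open>P(L)\<close> over the states \<open>H\<close>:
  switching at \<open>e \<in> H\<close> contributes \<open>x\<^sup>-\<^sup>2\<close>, smoothing at \<open>e \<notin> H\<close> contributes \<open>y/x\<close>. In a switched tangle the
  strands lie at separated heights and can be pushed off each other; in a smoothed one a kink is left, which
  untwists. Both moves are performed by shears \<open>u \<mapsto> e\<^sup>m u / ((1 - u) + e\<^sup>m u)\<close> of \<open>[0,1]\<close>, whose parameter \<open>m\<close>
  is a function of the remaining coordinates vanishing on the boundary of a box, so that they extend to
  ambient isotopies. This turns the resolved link into \<open>\<partial>H\<close> at one level. Curves at a single level can be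
  stacked in any order, and each of them is descending because its height may be prescribed freely, so the
  link contributes \<open>t\<^sub>\<partial>\<^sub>H ((x - x\<^sup>-\<^sup>1)/y)\<^bsup>p(H) - 1\<^esup>\<close>; \<open>f\<close> sends the monomial of \<open>H\<close> to \<open>t\<^sub>\<partial>\<^sub>H\<close> and all other
  monomials to \<open>0\<close>.
\<close>

section \<open>Arcs on simple closed curves\<close>

text \<open>In the coordinate \<open>logit\<close> a shear is a translation: parameters add up, the
  inverse has the opposite parameter, and any two interior heights are joined by one explicit
  parameter. So an ambient isotopy only needs a continuous parameter function, prescribed on a
  compact set and extended by Tietze. The obstacle is that a vertical shear cannot exchange or
  separate strands sideways, and a sideways shear does not distinguish strands over the same real
  part. Hence heights are separated before anything moves sideways; afterwards the height itself is
  the label by which two strands are pushed in opposite directions. Links are sets of parametrised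
  loops, and smoothing a crossing cuts and rejoins them. Statements about directed pieces
  (\<open>carries\<close>) have to survive this surgery, which is the reason for the bookkeeping of
  arcs. The orientation of the boundary of a state is never compared with anything:
  \<open>t_link\<close> is read off the resolved link, and of the boundary only its point set and
  its components enter.\<close>

definition subarc_of :: "(real \<Rightarrow> 'b) \<Rightarrow> (real \<Rightarrow> 'b) \<Rightarrow> bool" where
  "subarc_of b p \<longleftrightarrow>
     (\<exists>v. continuous_on {0..1} v \<and> strict_mono_on {0..1} v \<and> v ` {0..1} \<subseteq> {0..1} \<and>
          (\<forall>s\<in>{0..1}. b s = p (v s)))"

lemma subarc_of_refl: "subarc_of p p"
  unfolding subarc_of_def by (rule exI[of _ "\<lambda>s. s"]) (auto simp: strict_mono_on_def)

lemma subarc_of_join1: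
  assumes "subarc_of b p" shows "subarc_of b (p +++ q)"
proof -
  obtain v where v: "continuous_on {0..1} v" "strict_mono_on {0..1} v" "v ` {0..1} \<subseteq> {0..1}"
    "\<forall>s\<in>{0..1}. b s = p (v s)" using assms unfolding subarc_of_def by blast
  then show ?thesis unfolding subarc_of_def
    by (intro exI[of _ "\<lambda>s. v s / 2"])
       (auto intro!: continuous_intros simp: strict_mono_on_def joinpaths_def image_subset_iff)
qed

lemma subarc_of_join2:
  assumes "subarc_of b q" "pathfinish p = pathstart q" shows "subarc_of b (p +++ q)"
proof -
  obtain v where v: "continuous_on {0..1} v" "strict_mono_on {0..1} v" "v ` {0..1} \<subseteq> {0..1}"
    "\<forall>s\<in>{0..1}. b s = q (v s)" using assms unfolding subarc_of_def by blast
  have *: "q (v s) = (p +++ q) (1/2 + v s / 2)" if "s \<in> {0..1}" for s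
  proof (cases "v s = 0")
    case True then show ?thesis using assms(2)
      by (simp add: joinpaths_def pathfinish_def pathstart_def)
  next
    case False
    then have "v s > 0" using v(3) that by force
    then show ?thesis by (simp add: joinpaths_def)
  qed
  show ?thesis unfolding subarc_of_def using v *
    by (intro exI[of _ "\<lambda>s. 1/2 + v s / 2"])
       (auto intro!: continuous_intros simp: strict_mono_on_def image_subset_iff)
qed

lemma subarc_of_imp_runs_along:
  assumes "subarc_of b g" "pathfinish g = pathstart g" shows "runs_along b g"
proof -
  obtain v where v: "continuous_on {0..1} v" "strict_mono_on {0..1} v" "v ` {0..1} \<subseteq> {0..1}"
    "\<forall>s\<in>{0..1}. b s = g (v s)" using assms unfolding subarc_of_def by blast
  have "g (v s) = g (frac (v s))" if "s \<in> {0..1}" for s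
  proof (cases "v s = 1")
    case True then show ?thesis using assms(2) by (simp add: pathfinish_def pathstart_def)
  next
    case False
    then have "0 \<le> v s" "v s < 1" using v(3) that by force+
    then show ?thesis by (simp add: frac_eq)
  qed
  then show ?thesis unfolding runs_along_def using v by (intro exI[of _ v]) auto
qed

lemma runs_along_cong:
  assumes "pathfinish g = pathstart g" "\<And>s. s \<in> {0..1} \<Longrightarrow> a s = g s"
  shows "runs_along a g"
  using assms by (intro subarc_of_imp_runs_along)
    (auto simp: subarc_of_def strict_mono_on_def intro!: exI[of _ "\<lambda>s. s"])

lemma runs_along_map:
  assumes "runs_along a g" "\<And>s. s \<in> {0..1} \<Longrightarrow> a' s = h (a s)" "\<And>s. s \<in> {0..1} \<Longrightarrow> g' s = h (g s)"
  shows "runs_along a' g'"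
proof -
  obtain u where u: "continuous_on {0..1} u" "strict_mono_on {0..1} u" "\<forall>s\<in>{0..1}. a s = g (frac (u s))"
    using assms(1) unfolding runs_along_def by blast
  have "frac (x::real) \<in> {0..1}" for x by (simp add: frac_lt_1 less_imp_le)
  then show ?thesis unfolding runs_along_def using u assms(2,3)
    by (intro exI[of _ u]) auto
qed

lemma runs_along_image: "runs_along a g \<Longrightarrow> path_image a \<subseteq> path_image g"
  by (force simp: runs_along_def path_image_def frac_lt_1 less_imp_le)

text \<open>A closed path extends to a 1-periodic function on the line. Between consecutive integers
  it is a translate of \<open>g\<close>, and the translates agree at integers because the ends of
  \<open>g\<close> coincide; near any point two such closed intervals suffice.\<close>

lemma continuous_loop_frac:
  fixes g :: "real \<Rightarrow> 'b::topological_space"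
  assumes "path g" "pathfinish g = pathstart g"
  shows "continuous_on UNIV (\<lambda>w. g (frac w))"
proof -
  have g: "continuous_on {0..1} g" using assms(1) by (simp add: path_def)
  have piece: "continuous_on {of_int n..of_int n + 1} (\<lambda>w. g (frac w))" for n :: int
  proof -
    have "g (frac w) = g (w - of_int n)" if "w \<in> {of_int n..of_int n + 1}" for w
    proof (cases "w = of_int n + 1")
      case True
      then show ?thesis using assms(2) by (simp add: pathfinish_def pathstart_def frac_def)
    next
      case False
      then have "\<lfloor>w\<rfloor> = n" using that by (simp add: floor_eq_iff)
      then show ?thesis by (simp add: frac_def)
    qed
    moreover have "continuous_on {of_int n..of_int n + 1} (\<lambda>w. g (w - of_int n))"
      by (rule continuous_on_compose2[OF g]) (auto intro!: continuous_intros)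
    ultimately show ?thesis by (metis (no_types, lifting) continuous_on_eq)
  qed
  have "isCont (\<lambda>w. g (frac w)) w" for w
  proof -
    let ?n = "\<lfloor>w\<rfloor>"
    have "continuous_on ({of_int (?n-1)..of_int (?n-1) + 1} \<union> {of_int ?n..of_int ?n + 1}) (\<lambda>w. g (frac w))"
      by (intro continuous_on_closed_Un piece) auto
    moreover have "{of_int ?n - 1<..<of_int ?n + 1} \<subseteq> {of_int (?n-1)..of_int (?n-1) + 1} \<union> {of_int ?n..of_int ?n + (1::real)}"
      by auto
    ultimately have "continuous_on {of_int ?n - 1<..<of_int ?n + (1::real)} (\<lambda>w. g (frac w))"
      by (rule continuous_on_subset)
    moreover have "w \<in> {of_int ?n - 1<..<of_int ?n + (1::real)}"
      by simp linarith
    ultimately show ?thesis by (simp add: continuous_on_eq_continuous_at)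
  qed
  then show ?thesis by (simp add: continuous_at_imp_continuous_on)
qed

section \<open>Arcs of a loop through its lift to the real line\<close>

lemma simple_loop_frac_inj:
  assumes "simple_path g" "g (frac a) = g (frac b)"
  shows "\<exists>k::int. a = b + of_int k"
proof -
  have "frac a \<in> {0..1}" "frac b \<in> {0..1}" "frac a \<noteq> 1" "frac b \<noteq> 1"
    using frac_lt_1[of a] frac_lt_1[of b] by auto
  then have "frac a = frac b" using assms unfolding simple_path_def loop_free_def by blast
  then have "a = b + of_int (\<lfloor>a\<rfloor> - \<lfloor>b\<rfloor>)" by (simp add: frac_def algebra_simps)
  then show ?thesis by blast
qed

lemma frac_add_int: "frac (x + of_int k) = frac x" for x :: real
  by (simp add: frac_def)

text \<open>The bounds are parameters on the universal cover of the circle, so that an arc may pass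
  the base point of \<open>g\<close> without a case distinction.\<close>

definition loop_arc :: "(real \<Rightarrow> 'b) \<Rightarrow> real \<Rightarrow> real \<Rightarrow> real \<Rightarrow> 'b" where
  "loop_arc g l r = (\<lambda>s. g (frac (l + s * (r - l))))"

lemma loop_arc_ends: "pathstart (loop_arc g l r) = g (frac l)" "pathfinish (loop_arc g l r) = g (frac r)"
  by (auto simp: loop_arc_def pathstart_def pathfinish_def)

lemma path_image_loop_arc:
  assumes "l < r" shows "path_image (loop_arc g l r) = (\<lambda>w. g (frac w)) ` {l..r}"
proof -
  have "{l..r} = (\<lambda>s. l + s * (r - l)) ` {0..1}"
  proof (intro equalityI subsetI)
    fix w assume "w \<in> {l..r}"
    then show "w \<in> (\<lambda>s. l + s * (r - l)) ` {0..1}" using assms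
      by (intro image_eqI[of _ _ "(w - l)/(r - l)"]) (auto simp: field_simps)
  next
    fix w assume "w \<in> (\<lambda>s. l + s * (r - l)) ` {0..1}"
    then obtain s where s: "w = l + s * (r - l)" "0 \<le> s" "s \<le> 1" by fastforce
    have "0 \<le> s * (r - l)" "s * (r - l) \<le> 1 * (r - l)"
      using s assms by (auto intro!: mult_right_mono)
    then show "w \<in> {l..r}" using s by auto
  qed
  then show ?thesis unfolding path_image_def loop_arc_def by (simp add: image_image)
qed

text \<open>Parameters with equal values differ by an integer, and on an interval shorter than 1
  this integer is 0.\<close>

lemma arc_loop_arc:
  assumes "simple_path g" "pathfinish g = pathstart g" "l < r" "r < l + 1"
  shows "arc (loop_arc g l r)"
  unfolding arc_def
proof
  show "path (loop_arc g l r)"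
    unfolding path_def loop_arc_def
    by (rule continuous_on_compose2[OF continuous_loop_frac])
       (use assms in \<open>auto simp: simple_path_imp_path intro!: continuous_intros\<close>)
  show "inj_on (loop_arc g l r) {0..1}"
  proof (rule inj_onI)
    fix s t assume st: "s \<in> {0..1}" "t \<in> {0..1}" "loop_arc g l r s = loop_arc g l r t"
    then obtain k :: int where k: "l + s * (r - l) = l + t * (r - l) + of_int k"
      using simple_loop_frac_inj[OF assms(1)] unfolding loop_arc_def by blast
    then have kk: "of_int k = (s - t) * (r - l)" by (simp add: algebra_simps)
    have "\<bar>s - t\<bar> \<le> 1" using st by auto
    then have "\<bar>s - t\<bar> * (r - l) \<le> r - l" using assms(3) mult_right_mono[of "\<bar>s - t\<bar>" 1 "r - l"] by auto
    moreover have "\<bar>(of_int k :: real)\<bar> = \<bar>s - t\<bar> * (r - l)" unfolding kk using assms(3) by (simp add: abs_mult)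
    ultimately have "\<bar>(of_int k :: real)\<bar> < 1" using assms by linarith
    then have "k = 0" by linarith
    then show "s = t" using kk assms(3) by simp
  qed
qed

lemma subarc_of_loop_arc:
  assumes "continuous_on {0..1} w" "strict_mono_on {0..1} w" "\<forall>s\<in>{0..1}. b s = g (frac (w s))"
    "l < r" "w ` {0..1} \<subseteq> {l + of_int k..r + of_int k}"
  shows "subarc_of b (loop_arc g l r)"
  unfolding subarc_of_def
proof (intro exI[of _ "\<lambda>s. (w s - of_int k - l) / (r - l)"] conjI ballI)
  show "continuous_on {0..1} (\<lambda>s. (w s - of_int k - l) / (r - l))"
    using assms by (intro continuous_intros) auto
  show "strict_mono_on {0..1} (\<lambda>s. (w s - of_int k - l) / (r - l))"
    using assms(2,4) by (auto simp: strict_mono_on_def divide_strict_right_mono)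
  show "(\<lambda>s. (w s - of_int k - l) / (r - l)) ` {0..1} \<subseteq> {0..1}"
    using assms(4,5) by (auto simp: image_subset_iff field_simps)
  fix s :: real assume s: "s \<in> {0..1}"
  have "l + (w s - of_int k - l) / (r - l) * (r - l) = w s + of_int (- k)"
    using assms(4) by simp
  then show "b s = loop_arc g l r ((w s - of_int k - l) / (r - l))"
    using assms(3) s unfolding loop_arc_def by (simp only: frac_add_int)
qed

text \<open>The lift of an injective path stays below one full period: otherwise it would reach
  \<open>u 0 + 1\<close>, where the loop is back at the initial point of \<open>a\<close>.\<close>

lemma arc_runs_along_bounds:
  assumes "arc a" "simple_path g" "pathfinish g = pathstart g"
    "continuous_on {0..1} u" "strict_mono_on {0..1} u" "\<forall>s\<in>{0..1}. a s = g (frac (u s))"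
  shows "u 0 < u 1" "u 1 < u 0 + 1" "path_image a = (\<lambda>w. g (frac w)) ` {u 0..u 1}"
proof -
  show lt: "u 0 < u 1" using assms(5) by (auto simp: strict_mono_on_def)
  have im: "u ` {0..1} = {u 0..u 1}"
  proof
    show "u ` {0..1} \<subseteq> {u 0..u 1}"
      using strict_mono_on_imp_mono_on[OF assms(5)] by (auto simp: mono_on_def)
    show "{u 0..u 1} \<subseteq> u ` {0..1}"
      using IVT'[of u 0 _ 1] assms(4) by (fastforce simp: image_iff)
  qed
  show "path_image a = (\<lambda>w. g (frac w)) ` {u 0..u 1}"
    unfolding im[symmetric] path_image_def using assms(6) by (auto simp: image_iff)
  show "u 1 < u 0 + 1"
  proof (rule ccontr)
    assume "\<not> ?thesis"
    then have "u 0 + 1 \<in> u ` {0..1}" unfolding im by auto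
    then obtain s where s: "s \<in> {0..1}" "u s = u 0 + 1" by auto
    have "frac (u 0 + 1) = frac (u 0)" using frac_add_int[of "u 0" 1] by simp
    then have "a s = a 0" using assms(6) s by auto
    then have "s = 0" using assms(1) s by (auto simp: arc_def inj_on_def)
    then show False using s by auto
  qed
qed

lemma strict_mono_gap:
  fixes w :: "real \<Rightarrow> real"
  assumes "continuous_on {0..1} w" "strict_mono_on {0..1} w" "p < q"
    "\<And>s. s \<in> {0..1} \<Longrightarrow> w s \<notin> {p<..<q}"
  shows "w ` {0..1} \<subseteq> {..p} \<or> w ` {0..1} \<subseteq> {q..}"
proof (rule ccontr)
  assume "\<not> ?thesis"
  then obtain s t where st: "s \<in> {0..1}" "t \<in> {0..1}" "w s > p" "w t < q" by force
  then have "w s \<ge> q" "w t \<le> p" using assms(4) by force+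
  moreover have "connected (w ` {0..1})" using assms(1) by (intro connected_continuous_image) auto
  moreover have "w s \<in> w ` {0..1}" "w t \<in> w ` {0..1}" using st by auto
  ultimately have "(p + q)/2 \<in> w ` {0..1}"
    using assms(3) connected_contains_Icc[of "w ` {0..1}"] by force
  then obtain r where "r \<in> {0..1}" "w r = (p+q)/2" by auto
  then show False using assms(3) assms(4)[of r] by auto
qed

text \<open>All integer translates of the interval from \<open>u0\<close> to \<open>u1\<close> are
  forbidden for the lift \<open>w\<close>. The image of \<open>w\<close> is connected, hence
  confined to one gap between consecutive translates.\<close>

lemma runs_along_avoids_arc:
  assumes "simple_path g" "u0 < u1" "u1 < u0 + 1"
    "continuous_on {0..1} w" "strict_mono_on {0..1} w" "\<forall>s\<in>{0..1}. b s = g (frac (w s))"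
    "path_image b \<inter> (\<lambda>w. g (frac w)) ` {u0<..<u1} = {}"
  shows "\<exists>k::int. w ` {0..1} \<subseteq> {u1 + of_int k..u0 + 1 + of_int k}"
proof -
  \<comment> \<open>The floor selects the period in which the lift starts; since the lift increases
    strictly, it has the forbidden interval of this period behind it and that of the next one
    ahead.\<close>
  define k where "k = \<lfloor>w 0 - u0\<rfloor>"
  have av: "w s \<notin> {u0 + of_int j<..<u1 + of_int j}" if "s \<in> {0..1}" for s and j :: int
  proof
    assume "w s \<in> {u0 + of_int j<..<u1 + of_int j}"
    then have "w s + of_int (-j) \<in> {u0<..<u1}" by auto
    moreover have "b s = g (frac (w s + of_int (-j)))" using assms(6) that by (simp only: frac_add_int)
    ultimately show False using assms(7) that unfolding path_image_def by blast
  qed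
  have w0: "u0 + of_int k \<le> w 0" "w 0 < u0 + of_int k + 1" unfolding k_def by linarith+
  have wmono: "w 0 \<le> w s" if "s \<in> {0..1}" for s
    using strict_mono_on_imp_mono_on[OF assms(5)] that by (auto simp: mono_on_def)
  have g1: "w ` {0..1} \<subseteq> {u1 + of_int k..}"
  proof -
    consider "w ` {0..1} \<subseteq> {..u0 + of_int k}" | "w ` {0..1} \<subseteq> {u1 + of_int k..}"
      using strict_mono_gap[OF assms(4,5), of "u0 + of_int k" "u1 + of_int k"] av assms(2) by auto
    then show ?thesis
    proof cases
      case 1
      have "w 0 < w 1" using assms(5) by (auto simp: strict_mono_on_def)
      moreover have "w 1 \<le> u0 + of_int k" using 1 by (auto simp: image_subset_iff)
      ultimately show ?thesis using w0 by linarith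
    qed
  qed
  have "w ` {0..1} \<subseteq> {..u0 + of_int (k+1)} \<or> w ` {0..1} \<subseteq> {u1 + of_int (k+1)..}"
    by (intro strict_mono_gap[OF assms(4,5)] av) (use assms(2) in auto)
  moreover have "\<not> w ` {0..1} \<subseteq> {u1 + of_int (k+1)..}" using w0 assms(2) by (auto simp: image_subset_iff intro!: bexI[of _ 0])
  ultimately have "w ` {0..1} \<subseteq> {..u0 + of_int (k+1)}" by blast
  then show ?thesis using g1 by (intro exI[of _ k]) (auto simp: image_subset_iff algebra_simps)
qed

lemma simple_loop_period_inj:
  assumes "simple_path g" "g (frac x) = g (frac y)" "x \<in> {c..c+1}" "y \<in> {c..c+1}"
  shows "x = y \<or> (x = c \<and> y = c + 1) \<or> (x = c + 1 \<and> y = c)"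
proof -
  obtain k :: int where k: "x = y + of_int k" using simple_loop_frac_inj[OF assms(1,2)] by blast
  then have "\<bar>(of_int k::real)\<bar> \<le> 1" using assms(3,4) by auto
  then have "k = 0 \<or> k = 1 \<or> k = -1" by linarith
  then show ?thesis using k assms(3,4) by auto
qed

lemma path_image_loop_period:
  assumes "pathfinish g = pathstart g"
  shows "path_image g = (\<lambda>w. g (frac w)) ` {c..c+1}"
proof
  show "(\<lambda>w. g (frac w)) ` {c..c+1} \<subseteq> path_image g"
    by (force simp: path_image_def frac_lt_1 less_imp_le)
  show "path_image g \<subseteq> (\<lambda>w. g (frac w)) ` {c..c+1}"
  proof
    fix p assume "p \<in> path_image g"
    then obtain s where s: "s \<in> {0..1}" "p = g s" by (auto simp: path_image_def)
    have "p = g (frac s)"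
    proof (cases "s = 1")
      case True then show ?thesis using s assms by (simp add: pathfinish_def pathstart_def)
    next
      case False then show ?thesis using s by (simp add: frac_eq)
    qed
    also have "\<dots> = g (frac (c + frac (s - c)))"
    proof -
      have "c + frac (s - c) = s + of_int (- \<lfloor>s - c\<rfloor>)" by (simp add: frac_def)
      then show ?thesis by (simp only: frac_add_int)
    qed
    finally show "p \<in> (\<lambda>w. g (frac w)) ` {c..c+1}"
      by (rule image_eqI) (auto simp: frac_lt_1 less_imp_le)
  qed
qed

text \<open>\<open>A\<close> is the loop over the lifted interval from \<open>u 1\<close> to
  \<open>u 0 + 1\<close>. The last conclusion is what lets \<open>carries\<close> survive surgery: a
  directed piece of the loop that meets \<open>s\<close> at most in its ends is a directed piece of
  \<open>A\<close>.\<close>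

lemma cut_loop_once:
  assumes g: "simple_path g" "pathfinish g = pathstart g" and s: "arc s" "runs_along s g"
  obtains A where "arc A" "pathstart A = pathfinish s" "pathfinish A = pathstart s"
    "path_image g = path_image s \<union> path_image A"
    "path_image s \<inter> path_image A \<subseteq> {pathstart s, pathfinish s}"
    "\<And>b. runs_along b g \<Longrightarrow> path_image b \<inter> path_image s \<subseteq> {pathstart s, pathfinish s} \<Longrightarrow> subarc_of b A"
proof -
  obtain u where u: "continuous_on {0..1} u" "strict_mono_on {0..1} u" "\<forall>r\<in>{0..1}. s r = g (frac (u r))"
    using s(2) unfolding runs_along_def by blast
  note ub = arc_runs_along_bounds[OF s(1) g u]
  let ?A = "loop_arc g (u 1) (u 0 + 1)"
  have imA: "path_image ?A = (\<lambda>w. g (frac w)) ` {u 1..u 0 + 1}"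
    using ub by (intro path_image_loop_arc) auto
  have f1: "frac (u 0 + 1) = frac (u 0)" using frac_add_int[of "u 0" 1] by simp
  have ends: "pathstart s = g (frac (u 0))" "pathfinish s = g (frac (u 1))"
    using u(3) by (auto simp: pathstart_def pathfinish_def)
  have inj: "x = y \<or> (x = u 0 \<and> y = u 0 + 1) \<or> (x = u 0 + 1 \<and> y = u 0)"
    if "g (frac x) = g (frac y)" "x \<in> {u 0..u 0 + 1}" "y \<in> {u 0..u 0 + 1}" for x y
    using simple_loop_period_inj[OF g(1) that] .
  show ?thesis
  proof (rule that)
    show "arc ?A" by (rule arc_loop_arc[OF g]) (use ub in auto)
    show "pathstart ?A = pathfinish s" "pathfinish ?A = pathstart s"
      by (simp_all add: loop_arc_ends ends f1)
    have "{u 0..u 0 + 1} = {u 0..u 1} \<union> {u 1..u 0 + 1}" using ub by auto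
    then show "path_image g = path_image s \<union> path_image ?A"
      unfolding imA ub(3) path_image_loop_period[OF g(2), of "u 0"] by (simp add: image_Un)
    show "path_image s \<inter> path_image ?A \<subseteq> {pathstart s, pathfinish s}"
    proof
      fix p assume "p \<in> path_image s \<inter> path_image ?A"
      then obtain x y where xy: "x \<in> {u 0..u 1}" "y \<in> {u 1..u 0 + 1}" "p = g (frac x)" "g (frac x) = g (frac y)"
        unfolding imA ub(3) by auto
      then have "x = u 1 \<or> x = u 0" using inj[OF xy(4)] ub by auto
      then show "p \<in> {pathstart s, pathfinish s}" using xy ends by auto
    qed
    fix b assume b: "runs_along b g" "path_image b \<inter> path_image s \<subseteq> {pathstart s, pathfinish s}"
    obtain w where w: "continuous_on {0..1} w" "strict_mono_on {0..1} w" "\<forall>r\<in>{0..1}. b r = g (frac (w r))"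
      using b(1) unfolding runs_along_def by blast
    have "path_image b \<inter> (\<lambda>w. g (frac w)) ` {u 0<..<u 1} = {}"
    proof (rule ccontr)
      assume "\<not> ?thesis"
      then obtain x where x: "x \<in> {u 0<..<u 1}" "g (frac x) \<in> path_image b" by blast
      then have "g (frac x) \<in> {pathstart s, pathfinish s}" using b(2) ub(3) by auto
      then show False using inj[of x "u 0"] inj[of x "u 1"] x(1) ub ends by auto
    qed
    from runs_along_avoids_arc[OF g(1) ub(1,2) w this]
    obtain k :: int where "w ` {0..1} \<subseteq> {u 1 + of_int k..u 0 + 1 + of_int k}" by blast
    then show "subarc_of b ?A" using ub by (intro subarc_of_loop_arc[OF w]) auto
  qed
qed

text \<open>Removing the lifts of both arcs from one period leaves two intervals: \<open>B\<close>
  leads from \<open>s\<close> to \<open>t\<close>, and \<open>A\<close> from \<open>t\<close> back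
  to \<open>s\<close>.\<close>

lemma cut_loop_twice:
  assumes g: "simple_path g" "pathfinish g = pathstart g" and s: "arc s" "runs_along s g"
    and t: "arc t" "runs_along t g" and disj: "path_image s \<inter> path_image t = {}"
  obtains A B where "arc A" "arc B" "pathstart A = pathfinish t" "pathfinish A = pathstart s"
    "pathstart B = pathfinish s" "pathfinish B = pathstart t"
    "path_image g = path_image s \<union> path_image t \<union> path_image A \<union> path_image B"
    "path_image A \<inter> path_image B = {}"
    "path_image A \<inter> path_image s \<subseteq> {pathstart s}" "path_image A \<inter> path_image t \<subseteq> {pathfinish t}"
    "path_image B \<inter> path_image s \<subseteq> {pathfinish s}" "path_image B \<inter> path_image t \<subseteq> {pathstart t}"
    "\<And>b. runs_along b g \<Longrightarrow> path_image b \<inter> path_image s \<subseteq> {pathstart s, pathfinish s} \<Longrightarrow>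
       path_image b \<inter> path_image t \<subseteq> {pathstart t, pathfinish t} \<Longrightarrow> subarc_of b A \<or> subarc_of b B"
proof -
  obtain u where u: "continuous_on {0..1} u" "strict_mono_on {0..1} u" "\<forall>r\<in>{0..1}. s r = g (frac (u r))"
    using s(2) unfolding runs_along_def by blast
  note ub = arc_runs_along_bounds[OF s(1) g u]
  obtain w' where w': "continuous_on {0..1} w'" "strict_mono_on {0..1} w'" "\<forall>r\<in>{0..1}. t r = g (frac (w' r))"
    using t(2) unfolding runs_along_def by blast
  have "path_image t \<inter> (\<lambda>w. g (frac w)) ` {u 0<..<u 1} = {}"
  proof -
    have "(\<lambda>w. g (frac w)) ` {u 0<..<u 1} \<subseteq> path_image s" using ub(3) by auto
    then show ?thesis using disj by blast
  qed
  from runs_along_avoids_arc[OF g(1) ub(1,2) w' this]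
  obtain k :: int where k: "w' ` {0..1} \<subseteq> {u 1 + of_int k..u 0 + 1 + of_int k}" by blast
  \<comment> \<open>The lift of \<open>t\<close> is determined up to an integer only; this translate
    lies in the period that starts at \<open>u 0\<close>.\<close>
  define w where "w = (\<lambda>r. w' r + of_int (-k))"
  have w: "continuous_on {0..1} w" "strict_mono_on {0..1} w" "\<forall>r\<in>{0..1}. t r = g (frac (w r))"
    using w' unfolding w_def by (auto intro!: continuous_intros simp: strict_mono_on_def frac_add_int simp del: of_int_minus)
  note wb = arc_runs_along_bounds[OF t(1) g w]
  have "w ` {0..1} \<subseteq> {u 1..u 0 + 1}" using k unfolding w_def by (auto simp: image_subset_iff algebra_simps)
  then have w01: "u 1 \<le> w 0" "w 1 \<le> u 0 + 1" by (auto simp: image_subset_iff)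
  have f1: "frac (u 0 + 1) = frac (u 0)" using frac_add_int[of "u 0" 1] by simp
  have ends: "pathstart s = g (frac (u 0))" "pathfinish s = g (frac (u 1))"
    "pathstart t = g (frac (w 0))" "pathfinish t = g (frac (w 1))"
    using u(3) w(3) by (auto simp: pathstart_def pathfinish_def)
  \<comment> \<open>Disjointness of the two arcs makes both remaining intervals
    nondegenerate.\<close>
  have "pathfinish s \<noteq> pathstart t" "pathstart s \<noteq> pathfinish t"
    using disj pathstart_in_path_image pathfinish_in_path_image by (metis disjoint_iff)+
  then have w01': "u 1 < w 0" "w 1 < u 0 + 1" using w01 f1 unfolding ends
    by (metis order_le_less)+
  have inj: "x = y \<or> (x = u 0 \<and> y = u 0 + 1) \<or> (x = u 0 + 1 \<and> y = u 0)"
    if "g (frac x) = g (frac y)" "x \<in> {u 0..u 0 + 1}" "y \<in> {u 0..u 0 + 1}" for x y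
    using simple_loop_period_inj[OF g(1) that] .
  let ?A = "loop_arc g (w 1) (u 0 + 1)" and ?B = "loop_arc g (u 1) (w 0)"
  have imA: "path_image ?A = (\<lambda>w. g (frac w)) ` {w 1..u 0 + 1}"
    using w01' by (intro path_image_loop_arc) auto
  have imB: "path_image ?B = (\<lambda>w. g (frac w)) ` {u 1..w 0}"
    using w01' by (intro path_image_loop_arc) auto
  show ?thesis
  proof (rule that)
    show "arc ?A" "arc ?B" by (rule arc_loop_arc[OF g]; use ub wb w01' in linarith)+
    show "pathstart ?A = pathfinish t" "pathfinish ?A = pathstart s"
     "pathstart ?B = pathfinish s" "pathfinish ?B = pathstart t"
      by (simp_all add: loop_arc_ends ends f1)
    have "{u 0..u 0 + 1} = {u 0..u 1} \<union> {w 0..w 1} \<union> {w 1..u 0 + 1} \<union> {u 1..w 0}" using ub wb w01' by auto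
    then show "path_image g = path_image s \<union> path_image t \<union> path_image ?A \<union> path_image ?B"
      unfolding imA imB ub(3) wb(3) path_image_loop_period[OF g(2), of "u 0"] by (simp only: image_Un)
    show "path_image ?A \<inter> path_image ?B = {}" unfolding imA imB
      using ub wb w01' by (auto dest!: inj)
    show "path_image ?A \<inter> path_image s \<subseteq> {pathstart s}" unfolding imA ub(3) ends
      using ub wb w01' by (auto dest!: inj simp: f1)
    show "path_image ?A \<inter> path_image t \<subseteq> {pathfinish t}" unfolding imA wb(3) ends
      using ub wb w01' by (auto dest!: inj)
    show "path_image ?B \<inter> path_image s \<subseteq> {pathfinish s}" unfolding imB ub(3) ends
      using ub wb w01' by (auto dest!: inj)
    show "path_image ?B \<inter> path_image t \<subseteq> {pathstart t}" unfolding imB wb(3) ends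
      using ub wb w01' by (auto dest!: inj)
    fix b assume b: "runs_along b g" "path_image b \<inter> path_image s \<subseteq> {pathstart s, pathfinish s}"
      "path_image b \<inter> path_image t \<subseteq> {pathstart t, pathfinish t}"
    obtain v where v: "continuous_on {0..1} v" "strict_mono_on {0..1} v" "\<forall>r\<in>{0..1}. b r = g (frac (v r))"
      using b(1) unfolding runs_along_def by blast
    have "path_image b \<inter> (\<lambda>w. g (frac w)) ` {u 0<..<u 1} = {}"
    proof (rule ccontr)
      assume "\<not> ?thesis"
      then obtain x where x: "x \<in> {u 0<..<u 1}" "g (frac x) \<in> path_image b" by blast
      then have "g (frac x) \<in> {pathstart s, pathfinish s}" using b(2) ub(3) by auto
      then show False using inj[of x "u 0"] inj[of x "u 1"] x(1) ub ends by auto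
    qed
    from runs_along_avoids_arc[OF g(1) ub(1,2) v this]
    obtain k :: int where kv: "v ` {0..1} \<subseteq> {u 1 + of_int k..u 0 + 1 + of_int k}" by blast
    have "v r \<notin> {w 0 + of_int k<..<w 1 + of_int k}" if "r \<in> {0..1}" for r
    proof
      assume "v r \<in> {w 0 + of_int k<..<w 1 + of_int k}"
      then have x: "v r + of_int (-k) \<in> {w 0<..<w 1}" by auto
      have "b r = g (frac (v r + of_int (-k)))" using v(3) that by (simp only: frac_add_int)
      then have "g (frac (v r + of_int (-k))) \<in> path_image b \<inter> path_image t"
        using x wb(3) that by (auto simp: path_image_def image_iff) (metis atLeastAtMost_iff less_imp_le)+
      then have "g (frac (v r + of_int (-k))) \<in> {pathstart t, pathfinish t}" using b(3) by blast
      then show False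
        using inj[of "v r + of_int (-k)" "w 0"] inj[of "v r + of_int (-k)" "w 1"] x ub wb w01' ends by auto
    qed
    then have "v ` {0..1} \<subseteq> {..w 0 + of_int k} \<or> v ` {0..1} \<subseteq> {w 1 + of_int k..}"
      using wb by (intro strict_mono_gap[OF v(1,2)]) auto
    then have "v ` {0..1} \<subseteq> {u 1 + of_int k..w 0 + of_int k} \<or> v ` {0..1} \<subseteq> {w 1 + of_int k..u 0 + 1 + of_int k}"
      using kv by (auto simp: image_subset_iff)
    then show "subarc_of b ?A \<or> subarc_of b ?B"
      using subarc_of_loop_arc[OF v, of "u 1" "w 0" k] subarc_of_loop_arc[OF v, of "w 1" "u 0 + 1" k] w01' by auto
  qed
qed

text \<open>What is left of \<open>loop_system\<close> without the surface and without the
  requirement of being nonempty; the surgery below takes place in any Hausdorff space.\<close>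

definition closed_curves :: "(real \<Rightarrow> 'b::topological_space) set \<Rightarrow> bool" where
  "closed_curves L \<longleftrightarrow> finite L \<and> (\<forall>\<gamma>\<in>L. simple_path \<gamma> \<and> pathfinish \<gamma> = pathstart \<gamma>) \<and>
     pairwise (\<lambda>\<gamma> \<gamma>'. disjnt (path_image \<gamma>) (path_image \<gamma>')) L"

text \<open>Each new arc starts where one old arc started and ends where the other one ended, so the
  remaining pieces of the loops keep their direction. If \<open>s\<close> and \<open>t\<close> lie
  on one loop, it splits into two; if they lie on different loops, these merge.\<close>

lemma oriented_smoothing:
  fixes L :: "(real \<Rightarrow> 'b::t2_space) set"
  assumes L: "closed_curves L" "carries L (C \<union> {s, t})"
    and arcs: "arc s" "arc t" "arc r" "arc q"
    and ends: "pathstart r = pathstart s" "pathfinish r = pathfinish t" "pathstart q = pathstart t" "pathfinish q = pathfinish s"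
    and disj: "path_image s \<inter> path_image t = {}" "path_image r \<inter> path_image q = {}"
    and C: "trace C \<inter> path_image s \<subseteq> {pathstart s, pathfinish s}"
      "trace C \<inter> path_image t \<subseteq> {pathstart t, pathfinish t}"
      "trace C \<inter> path_image r \<subseteq> {pathstart s, pathfinish t}"
      "trace C \<inter> path_image q \<subseteq> {pathstart t, pathfinish s}"
  obtains L' where "closed_curves L'" "L' \<noteq> {}" "trace L' = trace C \<union> path_image r \<union> path_image q"
    "\<And>b. b \<in> C \<or> subarc_of b r \<or> subarc_of b q \<Longrightarrow> \<exists>\<gamma>\<in>L'. runs_along b \<gamma>"
proof -
  have tr: "trace L = trace C \<union> path_image s \<union> path_image t" using L(2) by (auto simp: carries_def trace_def)
  have run: "\<exists>\<gamma>\<in>L. runs_along b \<gamma>" if "b \<in> C \<union> {s,t}" for b using L(2) that by (auto simp: carries_def)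
  obtain g h where g: "g \<in> L" "runs_along s g" and h: "h \<in> L" "runs_along t h"
    using run[of s] run[of t] by auto
  have simp: "simple_path \<gamma>" "pathfinish \<gamma> = pathstart \<gamma>" if "\<gamma> \<in> L" for \<gamma>
    using L(1) that by (auto simp: closed_curves_def)
  have dL: "path_image \<gamma> \<inter> path_image \<delta> = {}" if "\<gamma> \<in> L" "\<delta> \<in> L" "\<gamma> \<noteq> \<delta>" for \<gamma> \<delta>
    using L(1) that by (auto simp: closed_curves_def pairwise_def disjnt_def)
  have subL: "path_image \<gamma> \<subseteq> trace L" if "\<gamma> \<in> L" for \<gamma> using that by (auto simp: trace_def)
  have subC: "path_image b \<subseteq> trace C" if "b \<in> C" for b using that by (auto simp: trace_def)
  have sg: "path_image s \<subseteq> path_image g" "path_image t \<subseteq> path_image h" using g h runs_along_image by auto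
  have e: "pathstart s \<in> path_image s" "pathfinish s \<in> path_image s" "pathstart t \<in> path_image t" "pathfinish t \<in> path_image t"
    "pathstart s \<in> path_image r" "pathfinish t \<in> path_image r" "pathstart t \<in> path_image q" "pathfinish s \<in> path_image q"
    using ends by (metis pathstart_in_path_image pathfinish_in_path_image)+
  have other: "path_image \<gamma> \<subseteq> trace C \<and> path_image \<gamma> \<inter> (path_image r \<union> path_image q) = {}" if "\<gamma> \<in> L - {g,h}" for \<gamma>
  proof -
    have "path_image \<gamma> \<inter> path_image g = {}" "path_image \<gamma> \<inter> path_image h = {}" using dL[of \<gamma>] that g h by auto
    then show ?thesis using subL[of \<gamma>] that tr sg C(3,4) e by blast
  qed
  show ?thesis
  proof (cases "g = h")
    \<comment> \<open>One loop contains both arcs: its two complementary arcs \<open>A\<close> and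
      \<open>B\<close> are closed up separately, by \<open>r\<close> and by
      \<open>q\<close>.\<close>
    case True
    obtain A B where AB: "arc A" "arc B" "pathstart A = pathfinish t" "pathfinish A = pathstart s"
    "pathstart B = pathfinish s" "pathfinish B = pathstart t"
    "path_image g = path_image s \<union> path_image t \<union> path_image A \<union> path_image B"
    "path_image A \<inter> path_image B = {}"
    "path_image A \<inter> path_image s \<subseteq> {pathstart s}" "path_image A \<inter> path_image t \<subseteq> {pathfinish t}"
    "path_image B \<inter> path_image s \<subseteq> {pathfinish s}" "path_image B \<inter> path_image t \<subseteq> {pathstart t}"
    and sub: "\<And>b. runs_along b g \<Longrightarrow> path_image b \<inter> path_image s \<subseteq> {pathstart s, pathfinish s} \<Longrightarrow>
       path_image b \<inter> path_image t \<subseteq> {pathstart t, pathfinish t} \<Longrightarrow> subarc_of b A \<or> subarc_of b B"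
      using cut_loop_twice[OF simp[OF g(1)] arcs(1) g(2) arcs(2) h(2)[folded True] disj(1)] by metis
    have A: "path_image A \<subseteq> trace C \<union> {pathstart s, pathfinish t}"
      using AB(7,9,10) subL[OF g(1)] tr by blast
    have B: "path_image B \<subseteq> trace C \<union> {pathfinish s, pathstart t}"
      using AB(7,11,12) subL[OF g(1)] tr by blast
    have Ar: "path_image A \<inter> path_image q = {}" "path_image B \<inter> path_image r = {}"
    proof -
      have "pathstart t \<noteq> pathfinish t" "pathstart s \<noteq> pathfinish s"
        using arcs arc_distinct_ends by metis+
      then have "pathstart t \<notin> path_image A" "pathfinish s \<notin> path_image A"
        "pathstart s \<notin> path_image B" "pathfinish t \<notin> path_image B"
        using AB(9-12) e by auto
      then show "path_image A \<inter> path_image q = {}" "path_image B \<inter> path_image r = {}"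
        using A B C(3,4) e disj(2) by blast+
    qed
    have j1: "simple_path (r +++ A)"
      by (rule simple_path_join_loop) (use arcs AB ends A C(3) in auto)
    have j2: "simple_path (q +++ B)"
      by (rule simple_path_join_loop) (use arcs AB ends B C(4) in auto)
    have i1: "path_image (r +++ A) = path_image r \<union> path_image A" using AB ends by (simp add: path_image_join)
    have i2: "path_image (q +++ B) = path_image q \<union> path_image B" using AB ends by (simp add: path_image_join)
    let ?L = "insert (r +++ A) (insert (q +++ B) (L - {g}))"
    have gd: "path_image \<gamma> \<inter> path_image g = {}" if "\<gamma> \<in> L - {g}" for \<gamma> using dL[of \<gamma> g] that g by auto
    have oth: "path_image \<gamma> \<subseteq> trace C \<and> path_image \<gamma> \<inter> (path_image r \<union> path_image q) = {}" if "\<gamma> \<in> L - {g}" for \<gamma>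
      using other[of \<gamma>] that True by auto
    show ?thesis
    proof (rule that)
      show "closed_curves ?L" unfolding closed_curves_def
      proof (intro conjI)
        show "finite ?L" using L(1) by (auto simp: closed_curves_def)
        show "\<forall>\<gamma>\<in>?L. simple_path \<gamma> \<and> pathfinish \<gamma> = pathstart \<gamma>"
          using j1 j2 simp AB ends by auto
        have "path_image (r +++ A) \<inter> path_image (q +++ B) = {}"
          unfolding i1 i2 using Ar disj(2) AB(8) by blast
        moreover have "path_image (r +++ A) \<inter> path_image \<gamma> = {} \<and> path_image (q +++ B) \<inter> path_image \<gamma> = {}" if "\<gamma> \<in> L - {g}" for \<gamma>
          unfolding i1 i2 using oth[OF that] gd[OF that] AB(7) by blast
        ultimately show "pairwise (\<lambda>\<gamma> \<gamma>'. disjnt (path_image \<gamma>) (path_image \<gamma>')) ?L"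
          unfolding pairwise_def disjnt_def using dL by (auto simp: Int_commute)
      qed
      show "?L \<noteq> {}" by simp
      have "trace ?L = path_image r \<union> path_image A \<union> path_image q \<union> path_image B \<union> trace (L - {g})"
        using i1 i2 by (auto simp: trace_def)
      moreover have "trace (L - {g}) \<subseteq> trace C" using oth by (auto simp: trace_def)
      moreover have "trace L = path_image g \<union> trace (L - {g})" using g by (auto simp: trace_def)
      ultimately show "trace ?L = trace C \<union> path_image r \<union> path_image q"
        using A B tr AB(7) C(1,2) e by blast
      fix b assume "b \<in> C \<or> subarc_of b r \<or> subarc_of b q"
      then consider "b \<in> C" | "subarc_of b r" | "subarc_of b q" by blast
      then show "\<exists>\<gamma>\<in>?L. runs_along b \<gamma>"
      proof cases
        case 1
        then obtain \<gamma> where \<gamma>: "\<gamma> \<in> L" "runs_along b \<gamma>" using run by auto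
        show ?thesis
        proof (cases "\<gamma> = g")
          case True
          then have "subarc_of b A \<or> subarc_of b B" using sub[of b] \<gamma> subC[OF 1] C(1,2) by blast
          then have "runs_along b (r +++ A) \<or> runs_along b (q +++ B)"
            using AB ends by (auto intro!: subarc_of_imp_runs_along subarc_of_join2)
          then show ?thesis by auto
        qed (use \<gamma> in auto)
      next
        case 2
        then have "runs_along b (r +++ A)" using AB ends by (auto intro!: subarc_of_imp_runs_along subarc_of_join1)
        then show ?thesis by auto
      next
        case 3
        then have "runs_along b (q +++ B)" using AB ends by (auto intro!: subarc_of_imp_runs_along subarc_of_join1)
        then show ?thesis by auto
      qed
    qed
  next
    \<comment> \<open>Two loops merge: the remainders \<open>A\<close> and \<open>B\<close> are
      traversed in turn, with \<open>r\<close> and \<open>q\<close> as bridges.\<close>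
    case False
    obtain B where B: "arc B" "pathstart B = pathfinish s" "pathfinish B = pathstart s"
      "path_image g = path_image s \<union> path_image B" "path_image s \<inter> path_image B \<subseteq> {pathstart s, pathfinish s}"
      and subB: "\<And>b. runs_along b g \<Longrightarrow> path_image b \<inter> path_image s \<subseteq> {pathstart s, pathfinish s} \<Longrightarrow> subarc_of b B"
      using cut_loop_once[OF simp[OF g(1)] arcs(1) g(2)] by metis
    obtain A where A: "arc A" "pathstart A = pathfinish t" "pathfinish A = pathstart t"
      "path_image h = path_image t \<union> path_image A" "path_image t \<inter> path_image A \<subseteq> {pathstart t, pathfinish t}"
      and subA: "\<And>b. runs_along b h \<Longrightarrow> path_image b \<inter> path_image t \<subseteq> {pathstart t, pathfinish t} \<Longrightarrow> subarc_of b A"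
      using cut_loop_once[OF simp[OF h(1)] arcs(2) h(2)] by metis
    have gh: "path_image g \<inter> path_image h = {}" using dL g h False by blast
    have Bi: "path_image B \<subseteq> trace C \<union> {pathstart s, pathfinish s}"
    proof -
      have "path_image B \<subseteq> path_image g" "path_image g \<inter> path_image t = {}" using B(4) gh sg by auto
      then show ?thesis using B(5) subL[OF g(1)] tr by auto
    qed
    have Ai: "path_image A \<subseteq> trace C \<union> {pathstart t, pathfinish t}"
    proof -
      have "path_image A \<subseteq> path_image h" "path_image h \<inter> path_image s = {}" using A(4) gh sg by auto
      then show ?thesis using A(5) subL[OF h(1)] tr by auto
    qed
    have AB: "path_image A \<inter> path_image B = {}" using gh A(4) B(4) by blast
    have x1: "path_image r \<inter> path_image A \<subseteq> {pathfinish t}" "path_image q \<inter> path_image B \<subseteq> {pathfinish s}"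
       "path_image r \<inter> path_image B \<subseteq> {pathstart s}" "path_image q \<inter> path_image A \<subseteq> {pathstart t}"
    proof -
      have "pathstart s \<notin> path_image A" "pathfinish s \<notin> path_image A"
        "pathstart t \<notin> path_image B" "pathfinish t \<notin> path_image B"
        using gh sg A(4) B(4) e by auto
      moreover have "pathstart t \<notin> path_image r" "pathfinish s \<notin> path_image r"
        "pathstart s \<notin> path_image q" "pathfinish t \<notin> path_image q"
        using disj(2) e by auto
      ultimately show "path_image r \<inter> path_image A \<subseteq> {pathfinish t}" "path_image q \<inter> path_image B \<subseteq> {pathfinish s}"
       "path_image r \<inter> path_image B \<subseteq> {pathstart s}" "path_image q \<inter> path_image A \<subseteq> {pathstart t}"
        using Ai Bi C(3,4) by auto
    qed
    have a1: "arc (r +++ A)" by (rule arc_join) (use arcs A ends x1 in auto)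
    have a2: "arc (q +++ B)" by (rule arc_join) (use arcs B ends x1 in auto)
    have i1: "path_image (r +++ A) = path_image r \<union> path_image A" using A ends by (simp add: path_image_join)
    have i2: "path_image (q +++ B) = path_image q \<union> path_image B" using B ends by (simp add: path_image_join)
    let ?g = "(r +++ A) +++ (q +++ B)"
    have sg': "simple_path ?g"
      by (rule simple_path_join_loop[OF a1 a2]) (use A B ends i1 i2 AB x1 disj(2) in auto)
    have i: "path_image ?g = path_image r \<union> path_image A \<union> path_image q \<union> path_image B"
      using A B ends by (simp add: path_image_join i1 i2 Un_assoc)
    let ?L = "insert ?g (L - {g,h})"
    have od: "path_image \<gamma> \<inter> path_image ?g = {}" if "\<gamma> \<in> L - {g,h}" for \<gamma>
      using other[OF that] dL[of \<gamma> g] dL[of \<gamma> h] g h that A(4) B(4) unfolding i by blast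
    have join: "runs_along b ?g" if "subarc_of b r \<or> subarc_of b A \<or> subarc_of b q \<or> subarc_of b B" for b
    proof -
      have "subarc_of b (r +++ A) \<or> subarc_of b (q +++ B)"
        using that A B ends by (auto intro: subarc_of_join1 subarc_of_join2)
      then have "subarc_of b ?g" using that A B ends by (auto intro: subarc_of_join1 subarc_of_join2)
      then show ?thesis using A B ends by (auto intro: subarc_of_imp_runs_along)
    qed
    show ?thesis
    proof (rule that)
      show "closed_curves ?L" unfolding closed_curves_def
      proof (intro conjI)
        show "finite ?L" using L(1) by (auto simp: closed_curves_def)
        show "\<forall>\<gamma>\<in>?L. simple_path \<gamma> \<and> pathfinish \<gamma> = pathstart \<gamma>"
          using sg' simp A B ends by auto
        show "pairwise (\<lambda>\<gamma> \<gamma>'. disjnt (path_image \<gamma>) (path_image \<gamma>')) ?L"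
          unfolding pairwise_def disjnt_def using dL od by (auto simp: Int_commute)
      qed
      show "?L \<noteq> {}" by simp
      have "trace ?L = path_image ?g \<union> trace (L - {g,h})"
        by (auto simp: trace_def)
      moreover have "trace (L - {g,h}) \<subseteq> trace C" using other by (auto simp: trace_def)
      moreover have "trace L = path_image g \<union> path_image h \<union> trace (L - {g,h})" using g h by (auto simp: trace_def)
      ultimately show "trace ?L = trace C \<union> path_image r \<union> path_image q"
        using Ai Bi tr A(4) B(4) C(1,2) e unfolding i by auto
      fix b assume "b \<in> C \<or> subarc_of b r \<or> subarc_of b q"
      then consider "b \<in> C" | "subarc_of b r \<or> subarc_of b q" by blast
      then show "\<exists>\<gamma>\<in>?L. runs_along b \<gamma>"
      proof cases
        case 1
        then obtain \<gamma> where \<gamma>: "\<gamma> \<in> L" "runs_along b \<gamma>" using run by auto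
        show ?thesis
        proof (cases "\<gamma> = g \<or> \<gamma> = h")
          case True
          then have "subarc_of b A \<or> subarc_of b B" using subA[of b] subB[of b] \<gamma> subC[OF 1] C(1,2) by blast
          then show ?thesis using join by auto
        qed (use \<gamma> in auto)
      next
        case 2
        then show ?thesis using join by auto
      qed
    qed
  qed
qed

section \<open>Ambient isotopies\<close>

definition slide :: "real \<Rightarrow> real \<Rightarrow> real" where
  "slide m u = exp m * u / ((1 - u) + exp m * u)"

text \<open>The coordinate in which \<open>slide m\<close> is translation by m: the odds u / (1 - u)
  are multiplied by exp m.\<close>

definition logit :: "real \<Rightarrow> real" where
  "logit u = ln u - ln (1 - u)"

lemma slide_denominator_pos: "0 \<le> u \<Longrightarrow> u \<le> 1 \<Longrightarrow> 0 < (1 - u) + exp m * u" for u m :: real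
proof (cases "u = 0")
  case False
  assume "0 \<le> u" "u \<le> 1"
  then have "0 < exp m * u" using False by simp
  then show ?thesis using \<open>u \<le> 1\<close> by linarith
qed simp

lemma slide_bounds: "0 \<le> u \<Longrightarrow> u \<le> 1 \<Longrightarrow> 0 \<le> slide m u" "0 \<le> u \<Longrightarrow> u \<le> 1 \<Longrightarrow> slide m u \<le> 1"
  using slide_denominator_pos[of u m] by (auto simp: slide_def)

lemma slide_pos: "0 < u \<Longrightarrow> u \<le> 1 \<Longrightarrow> 0 < slide m u"
  using slide_denominator_pos[of u m] by (auto simp: slide_def)

lemma slide_strict_bounds: "0 < u \<Longrightarrow> u < 1 \<Longrightarrow> 0 < slide m u" "0 < u \<Longrightarrow> u < 1 \<Longrightarrow> slide m u < 1"
  using slide_denominator_pos[of u m] by (auto simp: slide_def)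

lemma slide_0 [simp]: "slide 0 u = u" "slide m 0 = 0" "slide m 1 = 1"
  by (auto simp: slide_def)

lemma slide_slide: "0 \<le> u \<Longrightarrow> u \<le> 1 \<Longrightarrow> slide m (slide n u) = slide (m + n) u"
proof -
  assume u: "0 \<le> u" "u \<le> 1"
  define d where "d = (1 - u) + exp n * u"
  have d: "d > 0" using slide_denominator_pos[OF u] by (simp add: d_def)
  have d2: "(1 - u) + exp m * (exp n * u) > 0" using slide_denominator_pos[OF u, of "m + n"] by (simp add: exp_add mult.assoc)
  have s: "slide n u = exp n * u / d" by (simp add: slide_def d_def)
  have "1 - slide n u + exp m * slide n u = ((1 - u) + exp m * (exp n * u)) / d"
    unfolding s using d by (simp add: field_simps) (simp add: d_def algebra_simps)
  then have "slide m (slide n u) = (exp m * (exp n * u / d)) / (((1 - u) + exp m * (exp n * u)) / d)"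
    unfolding slide_def[of m "slide n u"] by (simp add: s)
  also have "\<dots> = slide (m + n) u" using d d2 by (simp add: slide_def exp_add field_simps)
  finally show ?thesis .
qed

lemma slide_inverse [simp]: "0 \<le> u \<Longrightarrow> u \<le> 1 \<Longrightarrow> slide (- m) (slide m u) = u"
   "0 \<le> u \<Longrightarrow> u \<le> 1 \<Longrightarrow> slide m (slide (- m) u) = u"
  by (simp_all add: slide_slide)

lemma slide_mirror: "0 \<le> u \<Longrightarrow> u \<le> 1 \<Longrightarrow> slide (- m) (1 - u) = 1 - slide m u"
proof -
  assume u: "0 \<le> u" "u \<le> 1"
  have "slide (- m) (1 - u) = exp (-m) * (1 - u) / (exp (-m) * ((1 - u) + exp m * u))"
    unfolding slide_def by (simp add: algebra_simps flip: exp_add)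
  also have "\<dots> = (1 - u) / ((1 - u) + exp m * u)" by simp
  also have "\<dots> = 1 - slide m u" using slide_denominator_pos[OF u, of m] by (simp add: slide_def field_simps)
  finally show ?thesis .
qed

lemma slide_to:
  assumes "0 < u" "u < 1" "0 < v" "v < 1" shows "slide (logit v - logit u) u = v"
proof -
  have "exp (logit v - logit u) = (v / (1 - v)) * ((1 - u) / u)"
    using assms by (simp add: logit_def exp_diff)
  moreover have "(1 - u) + (v / (1 - v)) * (1 - u) = (1 - u) / (1 - v)" using assms by (simp add: field_simps)
  ultimately show ?thesis using assms by (simp add: slide_def)
qed

lemma slide_mono:
  assumes "0 \<le> u" "u \<le> 1" "0 \<le> m" shows "u \<le> slide m u"
proof -
  have "u * ((1 - u) + exp m * u) \<le> exp m * u"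
  proof -
    have "exp m * u - u * ((1 - u) + exp m * u) = u * (1 - u) * (exp m - 1)" by (simp add: algebra_simps)
    also have "\<dots> \<ge> 0" using assms by simp
    finally show ?thesis by simp
  qed
  then show ?thesis using slide_denominator_pos[OF assms(1,2), of m] by (simp add: slide_def field_simps)
qed

lemma slide_strict_mono:
  assumes "0 < u" "u < 1" "0 < m" shows "u < slide m u"
proof -
  have "u * ((1 - u) + exp m * u) < exp m * u"
  proof -
    have "exp m * u - u * ((1 - u) + exp m * u) = u * (1 - u) * (exp m - 1)" by (simp add: algebra_simps)
    also have "\<dots> > 0" using assms by simp
    finally show ?thesis by simp
  qed
  then show ?thesis using slide_denominator_pos[of u m] assms by (simp add: slide_def field_simps)
qed

lemma continuous_on_slide [continuous_intros]:
  assumes "continuous_on S f" "continuous_on S g" "\<And>x. x \<in> S \<Longrightarrow> 0 \<le> g x \<and> g x \<le> 1"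
  shows "continuous_on S (\<lambda>x. slide (f x) (g x))"
proof -
  have "1 - g x + exp (f x) * g x \<noteq> 0" if "x \<in> S" for x
    using slide_denominator_pos[of "g x" "f x"] assms(3)[OF that] by auto
  then show ?thesis unfolding slide_def using assms(1,2) by (intro continuous_intros) auto
qed

section \<open>Ambient isotopies by vertical shears\<close>

lemma ambient_isotopy_compose:
  assumes h: "ambient_isotopy \<Sigma> h" and k: "ambient_isotopy \<Sigma> k"
  shows "ambient_isotopy \<Sigma> (\<lambda>t p. k t (h t p))"
  unfolding ambient_isotopy_def
proof (intro conjI ballI)
  let ?X = "\<Sigma> \<times> {0..1::real}"
  have im: "h t ` ?X = ?X" if "t \<in> {0..1}" for t
    using h that unfolding ambient_isotopy_def homeomorphism_def by blast
  have ch: "continuous_on ({0..1} \<times> ?X) (\<lambda>q. h (fst q) (snd q))"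
    and ck: "continuous_on ({0..1} \<times> ?X) (\<lambda>q. k (fst q) (snd q))"
    using h k unfolding ambient_isotopy_def by (simp_all add: split_def)
  have "continuous_on ({0..1} \<times> ?X) (\<lambda>q. (\<lambda>q. k (fst q) (snd q)) (fst q, h (fst q) (snd q)))"
  proof (rule continuous_on_compose2[OF ck])
    show "continuous_on ({0..1} \<times> ?X) (\<lambda>q. (fst q, h (fst q) (snd q)))"
      by (intro continuous_intros ch)
    show "(\<lambda>q. (fst q, h (fst q) (snd q))) ` ({0..1} \<times> ?X) \<subseteq> {0..1} \<times> ?X"
    proof (rule image_subsetI)
      fix q assume q: "q \<in> {0..1::real} \<times> ?X"
      then have "h (fst q) (snd q) \<in> ?X" using im[of "fst q"] by (metis imageI mem_Times_iff)
      then show "(fst q, h (fst q) (snd q)) \<in> {0..1} \<times> ?X" using q by (simp add: mem_Times_iff)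
    qed
  qed
  then show "continuous_on ({0..1} \<times> ?X) (\<lambda>(t, p). k t (h t p))" by (simp add: split_def)
  fix t :: real assume t: "t \<in> {0..1}"
  obtain g where "homeomorphism ?X ?X (h t) g" using h t unfolding ambient_isotopy_def by blast
  moreover obtain l where "homeomorphism ?X ?X (k t) l" using k t unfolding ambient_isotopy_def by blast
  ultimately have "homeomorphism ?X ?X (k t \<circ> h t) (g \<circ> l)" by (rule homeomorphism_compose)
  then show "\<exists>g. homeomorphism ?X ?X (\<lambda>p. k t (h t p)) g" by (auto simp: o_def)
next
  fix p assume "p \<in> \<Sigma> \<times> {0..1::real}"
  then show "k 0 (h 0 p) = p" using h k unfolding ambient_isotopy_def by auto
qed

definition lift_by :: "('a \<Rightarrow> real) \<Rightarrow> real \<Rightarrow> 'a \<times> real \<Rightarrow> 'a \<times> real" where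
  "lift_by M t p = (fst p, slide (t * M (fst p)) (snd p))"

text \<open>Each stage preserves the vertical fibres, along which it is inverted by the opposite
  parameter; no condition on \<open>M\<close> beyond continuity is involved.\<close>

lemma ambient_isotopy_lift_by:
  fixes \<Sigma> :: "'a::metric_space set"
  assumes M: "continuous_on \<Sigma> M"
  shows "ambient_isotopy \<Sigma> (lift_by M)"
  unfolding ambient_isotopy_def
proof (intro conjI ballI)
  let ?X = "\<Sigma> \<times> {0..1::real}"
  have c: "continuous_on ({0..1} \<times> ?X) (\<lambda>q. (fst (snd q), slide (fst q * N (fst (snd q))) (snd (snd q))))"
    if "continuous_on \<Sigma> N" for N
    using that by (intro continuous_intros continuous_on_compose2[OF that]) auto
  then show "continuous_on ({0..1} \<times> ?X) (\<lambda>(t, p). lift_by M t p)"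
    using M by (simp add: lift_by_def split_def)
  fix t :: real assume t: "t \<in> {0..1}"
  have c1: "continuous_on ?X (\<lambda>p. (fst p, slide (N (fst p)) (snd p)))" if "continuous_on \<Sigma> N" for N
    using that by (intro continuous_intros continuous_on_compose2[OF that]) auto
  have "homeomorphism ?X ?X (lift_by M t) (lift_by (\<lambda>x. - M x) t)"
  proof (intro homeomorphismI)
    show "continuous_on ?X (lift_by M t)" "continuous_on ?X (lift_by (\<lambda>x. - M x) t)"
      unfolding lift_by_def using M by (intro c1 continuous_intros; simp)+
  qed (auto simp: lift_by_def slide_bounds)
  then show "\<exists>g. homeomorphism ?X ?X (lift_by M t) g" by blast
next
  fix p assume "p \<in> \<Sigma> \<times> {0..1::real}"
  then show "lift_by M 0 p = p" by (simp add: lift_by_def)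
qed

text \<open>A shear parameter is prescribed only over the projection of a link, which is compact and
  hence closed in the normal space \<Sigma>.\<close>

lemma Tietze_compact_real:
  fixes \<Sigma> :: "'a::metric_space set" and m :: "'a \<Rightarrow> real"
  assumes "compact C" "C \<subseteq> \<Sigma>" "continuous_on C m"
  obtains M where "continuous_on \<Sigma> M" "\<And>p. p \<in> C \<Longrightarrow> M p = m p"
proof -
  have "normal_space (top_of_set \<Sigma>)"
    by (intro metrizable_imp_normal_space metrizable_space_subtopology metrizable_space_euclidean)
  moreover have "closedin (top_of_set \<Sigma>) C"
    using assms by (intro closed_subset compact_imp_closed)
  moreover have "continuous_map (subtopology (top_of_set \<Sigma>) C) euclideanreal m"
    using assms by (simp add: subtopology_subtopology inf.absorb2 continuous_map_iff_continuous)
  ultimately obtain g where "continuous_map (top_of_set \<Sigma>) euclideanreal g" "\<And>x. x \<in> C \<Longrightarrow> g x = m x"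
    using Tietze_extension_realinterval[of "top_of_set \<Sigma>" C "UNIV::real set" m] by auto
  then show ?thesis using that by (auto simp: continuous_map_iff_continuous)
qed

text \<open>Invariance of domain in a chart: near an interior point the chart has values in the open
  half plane, so a small open set has an open image there, which is pulled back to \<Sigma>. This is
  what allows maps of a coordinate box to be extended by the identity.\<close>

lemma openin_embedding:
  fixes \<beta> :: "complex \<Rightarrow> 'a::metric_space"
  assumes surf: "oriented_surface \<Sigma> \<A>" and \<beta>: "continuous_on D \<beta>" "inj_on \<beta> D" "\<beta> ` D \<subseteq> surface_interior \<A>"
    and W: "open W" "W \<subseteq> D"
  shows "openin (top_of_set \<Sigma>) (\<beta> ` W)"
proof (subst openin_subopen, intro ballI)
  fix p assume "p \<in> \<beta> ` W"
  then obtain z where z: "z \<in> W" "p = \<beta> z" by auto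
  then have "p \<in> surface_interior \<A>" using \<beta>(3) W(2) by auto
  then obtain U \<phi> where U: "(U, \<phi>) \<in> \<A>" "p \<in> U" "0 < Im (\<phi> p)" by (auto simp: surface_interior_def)
  then obtain V \<psi> where oU: "openin (top_of_set \<Sigma>) U" and hom: "homeomorphism U V \<phi> \<psi>"
    using surf unfolding oriented_surface_def by blast
  have c\<phi>: "continuous_on U \<phi>" using hom by (auto simp: homeomorphism_def)
  have inj\<phi>: "inj_on \<phi> U" using hom by (auto simp: homeomorphism_def inj_on_def) metis
  have USig: "U \<subseteq> \<Sigma>" using oU openin_imp_subset by blast
  define U' where "U' = U \<inter> \<phi> -` {z. 0 < Im z}"
  have "openin (top_of_set U) U'" unfolding U'_def
    by (rule continuous_openin_preimage_gen[OF c\<phi>]) (simp add: open_halfspace_Im_gt)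
  then have oU': "openin (top_of_set \<Sigma>) U'" using oU openin_trans by blast
  have "openin (top_of_set W) (W \<inter> \<beta> -` U')"
  proof -
    have "\<beta> \<in> W \<rightarrow> \<Sigma>"
    proof
      fix w assume "w \<in> W"
      then have "\<beta> w \<in> surface_interior \<A>" using \<beta>(3) W(2) by auto
      then show "\<beta> w \<in> \<Sigma>" using surf unfolding oriented_surface_def surface_interior_def by blast
    qed
    then show ?thesis
    using continuous_on_open_gen[of \<beta> W \<Sigma>] continuous_on_subset[OF \<beta>(1) W(2)] oU' by blast
  qed
  then have oW: "open (W \<inter> \<beta> -` U')" using W(1) openin_open_trans by blast
  define W' where "W' = W \<inter> \<beta> -` U'"
  have "continuous_on W' (\<phi> \<circ> \<beta>)"
  proof (rule continuous_on_compose)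
    show "continuous_on W' \<beta>" by (rule continuous_on_subset[OF \<beta>(1)]) (use W(2) in \<open>auto simp: W'_def\<close>)
    show "continuous_on (\<beta> ` W') \<phi>" by (rule continuous_on_subset[OF c\<phi>]) (auto simp: W'_def U'_def)
  qed
  moreover have "inj_on (\<phi> \<circ> \<beta>) W'"
  proof (rule comp_inj_on)
    show "inj_on \<beta> W'" by (rule inj_on_subset[OF \<beta>(2)]) (use W(2) in \<open>auto simp: W'_def\<close>)
    show "inj_on \<phi> (\<beta> ` W')" by (rule inj_on_subset[OF inj\<phi>]) (auto simp: W'_def U'_def)
  qed
  ultimately have op: "open ((\<phi> \<circ> \<beta>) ` W')"
    using oW invariance_of_domain[of W' "\<phi> \<circ> \<beta>"] unfolding W'_def by blast
  have eq: "\<beta> ` W' = U \<inter> \<phi> -` ((\<phi> \<circ> \<beta>) ` W')"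
  proof
    show "\<beta> ` W' \<subseteq> U \<inter> \<phi> -` ((\<phi> \<circ> \<beta>) ` W')" by (auto simp: W'_def U'_def)
    show "U \<inter> \<phi> -` ((\<phi> \<circ> \<beta>) ` W') \<subseteq> \<beta> ` W'"
    proof
      fix q assume "q \<in> U \<inter> \<phi> -` ((\<phi> \<circ> \<beta>) ` W')"
      then obtain w where w: "q \<in> U" "w \<in> W'" "\<phi> q = \<phi> (\<beta> w)" by auto
      moreover have "\<beta> w \<in> U" using w by (auto simp: W'_def U'_def)
      ultimately show "q \<in> \<beta> ` W'" using inj\<phi> by (auto simp: inj_on_def)
    qed
  qed
  have "openin (top_of_set U) (\<beta> ` W')" unfolding eq
    by (rule continuous_openin_preimage_gen[OF c\<phi> op])
  then have "openin (top_of_set \<Sigma>) (\<beta> ` W')" using oU openin_trans by blast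
  moreover have "p \<in> \<beta> ` W'" using z U by (auto simp: W'_def U'_def)
  moreover have "\<beta> ` W' \<subseteq> \<beta> ` W" by (auto simp: W'_def)
  ultimately show "\<exists>T. openin (top_of_set \<Sigma>) T \<and> p \<in> T \<and> T \<subseteq> \<beta> ` W" by blast
qed

section \<open>Isotopies supported in coordinate boxes\<close>

definition open_box :: "complex set" where
  "open_box = {z. \<bar>Re z\<bar> < 2 \<and> \<bar>Im z\<bar> < 1}"

lemma open_open_box: "open open_box"
  unfolding open_box_def by (intro open_Collect_conj open_Collect_less continuous_intros)

lemma compact_edge_box: "compact edge_box"
proof -
  have eq: "edge_box = cbox (Complex (-2) (-1)) (Complex 2 1)"
    by (auto simp: edge_box_def in_cbox_complex_iff abs_le_iff)
  show ?thesis unfolding eq by (rule compact_cbox)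
qed

lemma open_box_subset: "open_box \<subseteq> edge_box" by (auto simp: open_box_def edge_box_def)

definition glue :: "(complex \<Rightarrow> 'a) \<Rightarrow> (complex \<times> real \<Rightarrow> complex \<times> real) \<Rightarrow> 'a \<times> real \<Rightarrow> 'a \<times> real" where
  "glue \<beta> f p = (if fst p \<in> \<beta> ` edge_box
     then map_prod \<beta> id (f (inv_into edge_box \<beta> (fst p), snd p)) else p)"

lemma glue_inside:
  "inj_on \<beta> edge_box \<Longrightarrow> z \<in> edge_box \<Longrightarrow> glue \<beta> f (\<beta> z, s) = map_prod \<beta> id (f (z, s))"
  by (simp add: glue_def)

lemma glue_outside: "p \<notin> \<beta> ` edge_box \<Longrightarrow> glue \<beta> f (p, s) = (p, s)"
  by (simp add: glue_def)

definition box_map :: "(complex \<times> real \<Rightarrow> complex \<times> real) \<Rightarrow> bool" where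
  "box_map f \<longleftrightarrow> f ` (edge_box \<times> {0..1}) \<subseteq> edge_box \<times> {0..1} \<and>
     (\<forall>z\<in>edge_box - open_box. \<forall>s\<in>{0..1}. f (z, s) = (z, s))"

text \<open>\<Sigma> is the union of two relatively closed sets, the image of the box and the
  complement of the image of the open box, and on their overlap the box map is the identity. The
  extra variable \<open>x\<close> serves as time, or as a dummy for a single map.\<close>

lemma continuous_on_glue:
  fixes \<Sigma> :: "'a::metric_space set" and X :: "'x::topological_space set"
  assumes \<beta>: "continuous_on edge_box \<beta>" "inj_on \<beta> edge_box" "\<beta> ` edge_box \<subseteq> \<Sigma>"
    and op: "openin (top_of_set \<Sigma>) (\<beta> ` open_box)"
    and f: "continuous_on (X \<times> (edge_box \<times> {0..1})) (\<lambda>(x, p). f x p)" "\<And>x. x \<in> X \<Longrightarrow> box_map (f x)"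
  shows "continuous_on (X \<times> (\<Sigma> \<times> {0..1})) (\<lambda>(x, p). glue \<beta> (f x) p)"
proof -
  let ?B = "\<beta> ` edge_box" and ?R = "\<Sigma> - \<beta> ` open_box"
  have inv: "continuous_on ?B (inv_into edge_box \<beta>)"
    using \<beta> compact_edge_box by (intro continuous_on_inv) auto
  have cB: "closedin (top_of_set \<Sigma>) ?B"
    using \<beta> compact_edge_box by (intro closed_subset compact_imp_closed compact_continuous_image)
  have cR: "closedin (top_of_set \<Sigma>) ?R" using op by (metis closedin_diff closedin_subtopology_refl topspace_euclidean_subtopology closedin_topspace)
  have un: "X \<times> (\<Sigma> \<times> {0..1}) = (X \<times> (?B \<times> {0..1})) \<union> (X \<times> (?R \<times> {0..1::real}))"
    using \<beta>(3) open_box_subset by blast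
  have cl: "closedin (top_of_set (X \<times> (\<Sigma> \<times> {0..1::real}))) (X \<times> (T \<times> {0..1}))" if "closedin (top_of_set \<Sigma>) T" for T
    using that by (intro closedin_Times) auto
  have c1: "continuous_on (X \<times> (?B \<times> {0..1})) (\<lambda>q. map_prod \<beta> id (f (fst q) (inv_into edge_box \<beta> (fst (snd q)), snd (snd q))))"
  proof -
    have "continuous_on (X \<times> (?B \<times> {0..1})) (\<lambda>q. (\<lambda>(x,p). f x p) (fst q, inv_into edge_box \<beta> (fst (snd q)), snd (snd q)))"
      by (rule continuous_on_compose2[OF f(1)])
         (auto intro!: continuous_intros continuous_on_compose2[OF inv] inv_into_into)
    then have c: "continuous_on (X \<times> (?B \<times> {0..1})) (\<lambda>q. f (fst q) (inv_into edge_box \<beta> (fst (snd q)), snd (snd q)))" by simp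
    have m: "continuous_on (edge_box \<times> {0..1}) (\<lambda>p. (\<beta> (fst p), snd p :: real))"
      by (intro continuous_intros continuous_on_compose2[OF \<beta>(1)]) auto
    have "continuous_on (X \<times> (?B \<times> {0..1})) (\<lambda>q. (\<lambda>p. (\<beta> (fst p), snd p)) (f (fst q) (inv_into edge_box \<beta> (fst (snd q)), snd (snd q))))"
    proof (rule continuous_on_compose2[OF m c], rule image_subsetI)
      fix q assume q: "q \<in> X \<times> (?B \<times> {0..1::real})"
      then have "inv_into edge_box \<beta> (fst (snd q)) \<in> edge_box" by (auto intro!: inv_into_into)
      then show "f (fst q) (inv_into edge_box \<beta> (fst (snd q)), snd (snd q)) \<in> edge_box \<times> {0..1}"
        using f(2)[of "fst q"] q unfolding box_map_def image_subset_iff by auto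
    qed
    then show ?thesis by (simp add: map_prod_def split_def)
  qed
  have c2: "continuous_on (X \<times> (?R \<times> {0..1::real})) (\<lambda>q. snd q)" by (intro continuous_intros)
  have "continuous_on ((X \<times> (?B \<times> {0..1})) \<union> (X \<times> (?R \<times> {0..1}))) (\<lambda>q. if fst (snd q) \<in> ?B
     then map_prod \<beta> id (f (fst q) (inv_into edge_box \<beta> (fst (snd q)), snd (snd q))) else snd q)"
  proof (rule continuous_on_cases_local)
    fix q assume q: "q \<in> X \<times> ?B \<times> {0..1} \<and> fst (snd q) \<notin> ?B \<or> q \<in> X \<times> ?R \<times> {0..1::real} \<and> fst (snd q) \<in> ?B"
    then obtain z where z: "z \<in> edge_box" "fst (snd q) = \<beta> z" by auto
    with q have "z \<in> edge_box - open_box" by auto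
    then show "map_prod \<beta> id (f (fst q) (inv_into edge_box \<beta> (fst (snd q)), snd (snd q))) = snd q"
      using f(2)[of "fst q"] q z \<beta>(2) by (auto simp: box_map_def)
  qed (use cl[OF cB] cl[OF cR] un c1 c2 in auto)
  then show ?thesis unfolding un by (simp add: glue_def split_def)
qed

text \<open>Bijectivity at each time is enough, since a continuous bijection of the compact box has
  a continuous inverse.\<close>

definition box_isotopy :: "(real \<Rightarrow> complex \<times> real \<Rightarrow> complex \<times> real) \<Rightarrow> bool" where
  "box_isotopy h \<longleftrightarrow>
     continuous_on ({0..1} \<times> (edge_box \<times> {0..1})) (\<lambda>(t, p). h t p) \<and>
     (\<forall>t\<in>{0..1}. box_map (h t) \<and> bij_betw (h t) (edge_box \<times> {0..1}) (edge_box \<times> {0..1})) \<and>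
     (\<forall>p\<in>edge_box \<times> {0..1}. h 0 p = p)"

lemma ambient_isotopy_glue:
  fixes \<Sigma> :: "'a::metric_space set"
  assumes \<beta>: "continuous_on edge_box \<beta>" "inj_on \<beta> edge_box" "\<beta> ` edge_box \<subseteq> \<Sigma>"
    and op: "openin (top_of_set \<Sigma>) (\<beta> ` open_box)" and h: "box_isotopy h"
  shows "ambient_isotopy \<Sigma> (\<lambda>t. glue \<beta> (h t))"
  unfolding ambient_isotopy_def
proof (intro conjI ballI)
  let ?B = "edge_box \<times> {0..1::real}"
  show "continuous_on ({0..1} \<times> (\<Sigma> \<times> {0..1})) (\<lambda>(t, p). glue \<beta> (h t) p)"
    using h by (intro continuous_on_glue[OF \<beta> op]) (auto simp: box_isotopy_def)
  fix t :: real assume t: "t \<in> {0..1}"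
  define k where "k = inv_into ?B (h t)"
  have bm: "box_map (h t)" and bij: "bij_betw (h t) ?B ?B" using h t by (auto simp: box_isotopy_def)
  have ct: "continuous_on ?B (h t)"
  proof -
    have "continuous_on ?B (\<lambda>p. (\<lambda>(t,p). h t p) (t, p))"
      by (rule continuous_on_compose2[of "{0..1} \<times> ?B"]) (use h t in \<open>auto simp: box_isotopy_def intro!: continuous_intros\<close>)
    then show ?thesis by simp
  qed
  have kh: "k (h t p) = p" "h t (k p) = p" "k p \<in> ?B" "h t p \<in> ?B" if "p \<in> ?B" for p
    using bij that unfolding k_def bij_betw_def by (auto simp: f_inv_into_f inv_into_into)
  have ck: "continuous_on ?B k"
    using continuous_on_inv[OF ct, of k] bij compact_edge_box kh(1) unfolding bij_betw_def
    by (auto simp: compact_Times)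
  have bk: "box_map k" unfolding box_map_def
  proof (intro conjI ballI)
    show "k ` ?B \<subseteq> ?B" using kh(3) by (intro image_subsetI)
    fix z and s :: real assume "z \<in> edge_box - open_box" "s \<in> {0..1}"
    then show "k (z, s) = (z, s)" using bm kh(1)[of "(z,s)"] unfolding box_map_def by auto
  qed
  have cont: "continuous_on (\<Sigma> \<times> {0..1}) (glue \<beta> f)" if "continuous_on ?B f" "box_map f" for f
  proof -
    have "continuous_on ({0..1::real} \<times> (\<Sigma> \<times> {0..1})) (\<lambda>(x, p). glue \<beta> ((\<lambda>_. f) x) p)"
    proof (rule continuous_on_glue[OF \<beta> op])
      have "continuous_on ({0..1::real} \<times> ?B) (\<lambda>q. f (snd q))"
        by (rule continuous_on_compose2[OF that(1)]) (auto intro!: continuous_intros)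
      then show "continuous_on ({0..1::real} \<times> ?B) (\<lambda>(x, p). f p)" by (simp add: split_def)
    qed (use that in auto)
    then have "continuous_on ({0..1::real} \<times> (\<Sigma> \<times> {0..1})) (\<lambda>q. glue \<beta> f (snd q))" by (simp add: split_def)
    then have "continuous_on (\<Sigma> \<times> {0..1}) (\<lambda>p. (\<lambda>q. glue \<beta> f (snd q)) (0::real, p))"
      by (rule continuous_on_compose2) (auto intro!: continuous_intros)
    then show ?thesis by simp
  qed
  have maps: "glue \<beta> f p \<in> \<Sigma> \<times> {0..1}" "fst p \<in> \<beta> ` edge_box \<Longrightarrow> fst (glue \<beta> f p) \<in> \<beta> ` edge_box" if "box_map f" "p \<in> \<Sigma> \<times> {0..1}" for f p
  proof -
    have "f (inv_into edge_box \<beta> (fst p), snd p) \<in> ?B" if "fst p \<in> \<beta> ` edge_box"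
      using \<open>box_map f\<close> that \<open>p \<in> _\<close> by (auto simp: box_map_def image_subset_iff mem_Times_iff inv_into_into)
    then show "glue \<beta> f p \<in> \<Sigma> \<times> {0..1}" "fst p \<in> \<beta> ` edge_box \<Longrightarrow> fst (glue \<beta> f p) \<in> \<beta> ` edge_box"
      using \<beta>(3) that(2) by (auto simp: glue_def mem_Times_iff)
  qed
  have inv: "glue \<beta> f (glue \<beta> g p) = p"
    if fg: "\<And>q. q \<in> ?B \<Longrightarrow> f (g q) = q" "\<And>q. q \<in> ?B \<Longrightarrow> g q \<in> ?B" "p \<in> \<Sigma> \<times> {0..1}" for f g p
  proof (cases "fst p \<in> \<beta> ` edge_box")
    case True
    then obtain z s where z: "z \<in> edge_box" "p = (\<beta> z, s)" "s \<in> {0..1}" using fg(3) by (cases p) auto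
    then obtain z' s' where z': "g (z,s) = (z',s')" "z' \<in> edge_box" using fg(2)[of "(z,s)"] by (cases "g (z,s)") auto
    then show ?thesis using fg(1)[of "(z,s)"] z \<beta>(2) by (simp add: glue_inside)
  qed (simp add: glue_def)
  have "homeomorphism (\<Sigma> \<times> {0..1}) (\<Sigma> \<times> {0..1}) (glue \<beta> (h t)) (glue \<beta> k)"
    by (intro homeomorphismI cont ck ct bk bm image_subsetI maps inv) (use kh in auto)
  then show "\<exists>g. homeomorphism (\<Sigma> \<times> {0..1}) (\<Sigma> \<times> {0..1}) (glue \<beta> (h t)) g" by blast
next
  fix p assume p: "p \<in> \<Sigma> \<times> {0..1::real}"
  show "glue \<beta> (h 0) p = p"
  proof (cases "fst p \<in> \<beta> ` edge_box")
    case True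
    then obtain z s where z: "z \<in> edge_box" "p = (\<beta> z, s)" "s \<in> {0..1}" using p by (cases p) auto
    then show ?thesis using h \<beta>(2) by (simp add: glue_inside box_isotopy_def)
  qed (simp add: glue_def)
qed

text \<open>The boxes are added one at a time by composition. Each factor is the identity over the
  boxes of the others, so over a given box the final map is that of its own factor.\<close>

lemma ambient_isotopy_glue_family:
  fixes \<Sigma> :: "'a::metric_space set"
  assumes "finite E"
    and \<beta>: "\<And>e. e \<in> E \<Longrightarrow> continuous_on edge_box (\<beta> e)" "\<And>e. e \<in> E \<Longrightarrow> inj_on (\<beta> e) edge_box"
      "\<And>e. e \<in> E \<Longrightarrow> \<beta> e ` edge_box \<subseteq> \<Sigma>"
    and op: "\<And>e. e \<in> E \<Longrightarrow> openin (top_of_set \<Sigma>) (\<beta> e ` open_box)"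
    and disj: "pairwise (\<lambda>e e'. disjnt (\<beta> e ` edge_box) (\<beta> e' ` edge_box)) E"
    and h: "\<And>e. e \<in> E \<Longrightarrow> box_isotopy (h e)"
  shows "\<exists>H. ambient_isotopy \<Sigma> H \<and>
     (\<forall>e\<in>E. \<forall>z\<in>edge_box. \<forall>s\<in>{0..1}. H 1 (\<beta> e z, s) = map_prod (\<beta> e) id (h e 1 (z, s))) \<and>
     (\<forall>p s. p \<notin> (\<Union>e\<in>E. \<beta> e ` edge_box) \<longrightarrow> H 1 (p, s) = (p, s))"
  using assms
proof (induction E)
  case empty
  have "ambient_isotopy \<Sigma> (\<lambda>t p. p)"
    unfolding ambient_isotopy_def by (auto intro!: exI[of _ "\<lambda>p. p"] continuous_intros homeomorphism_ident simp: split_def)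
  then show ?case by auto
next
  case (insert e E)
  then obtain H where H: "ambient_isotopy \<Sigma> H"
     "\<And>e z s. e\<in>E \<Longrightarrow> z\<in>edge_box \<Longrightarrow> s\<in>{0..1} \<Longrightarrow> H 1 (\<beta> e z, s) = map_prod (\<beta> e) id (h e 1 (z, s))"
     "\<And>p s. p \<notin> (\<Union>e\<in>E. \<beta> e ` edge_box) \<Longrightarrow> H 1 (p, s) = (p, s)"
  proof -
    have "\<exists>H. ambient_isotopy \<Sigma> H \<and>
     (\<forall>e\<in>E. \<forall>z\<in>edge_box. \<forall>s\<in>{0..1}. H 1 (\<beta> e z, s) = map_prod (\<beta> e) id (h e 1 (z, s))) \<and>
     (\<forall>p s. p \<notin> (\<Union>e\<in>E. \<beta> e ` edge_box) \<longrightarrow> H 1 (p, s) = (p, s))"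
      by (rule insert.IH) (use insert.prems in \<open>auto simp: pairwise_insert\<close>)
    then show ?thesis using that by blast
  qed
  have G: "ambient_isotopy \<Sigma> (\<lambda>t. glue (\<beta> e) (h e t))"
    using insert.prems by (intro ambient_isotopy_glue) auto
  have de: "\<beta> e z \<notin> \<beta> e' ` edge_box" "\<beta> e' z \<notin> \<beta> e ` edge_box" if "e' \<in> E" "z \<in> edge_box" for e' z
    using insert.prems(5) insert.hyps that unfolding pairwise_insert disjnt_def by blast+
  have bm: "h e' 1 (z, s) \<in> edge_box \<times> {0..1}" if "e' \<in> insert e E" "z \<in> edge_box" "s \<in> {0..1}" for e' z s
    using insert.prems(6)[OF that(1)] that unfolding box_isotopy_def box_map_def image_subset_iff by auto
  show ?case
  proof (intro exI[of _ "\<lambda>t p. glue (\<beta> e) (h e t) (H t p)"] conjI ballI allI impI)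
    show "ambient_isotopy \<Sigma> (\<lambda>t p. glue (\<beta> e) (h e t) (H t p))"
      by (rule ambient_isotopy_compose[OF H(1) G])
  next
    fix e' z and s :: real assume *: "e' \<in> insert e E" "z \<in> edge_box" "s \<in> {0..1}"
    show "glue (\<beta> e) (h e 1) (H 1 (\<beta> e' z, s)) = map_prod (\<beta> e') id (h e' 1 (z, s))"
    proof (cases "e' = e")
      case True
      then have "H 1 (\<beta> e z, s) = (\<beta> e z, s)" using H(3) de * by auto
      then show ?thesis using True * insert.prems(2)[of e] by (simp add: glue_inside)
    next
      case False
      then have "e' \<in> E" using * by auto
      then show ?thesis using H(2)[of e' z s] * de(2)[of e'] bm[OF *] by (cases "h e' 1 (z,s)") (auto simp: glue_outside)
    qed
  next
    fix p s assume "p \<notin> (\<Union>e\<in>insert e E. \<beta> e ` edge_box)"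
    then show "glue (\<beta> e) (h e 1) (H 1 (p, s)) = (p, s)" using H(3) by (simp add: glue_outside)
  qed
qed

section \<open>Shears of a box in the three coordinate directions\<close>

definition box_lift :: "(complex \<Rightarrow> real) \<Rightarrow> real \<Rightarrow> complex \<times> real \<Rightarrow> complex \<times> real" where
  "box_lift M t p = (fst p, slide (t * M (fst p)) (snd p))"

text \<open>The affine change (1 + Im z) / 2 carries the imaginary side of the box to the unit
  interval. \<open>N\<close> reads only the real part and the height, which this shear preserves;
  hence the shear with \<open>- N\<close> is its inverse.\<close>

definition box_slide_Im :: "(real \<Rightarrow> real \<Rightarrow> real) \<Rightarrow> real \<Rightarrow> complex \<times> real \<Rightarrow> complex \<times> real" where
  "box_slide_Im N t p = (Complex (Re (fst p))
     (2 * slide (t * N (Re (fst p)) (snd p)) ((1 + Im (fst p)) / 2) - 1), snd p)"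

text \<open>The two parts of the interval from -2 to 2 on either side of \<open>c\<close> are
  sheared independently, each rescaled so that \<open>c\<close> corresponds to 0; a positive
  parameter moves points away from \<open>c\<close>.\<close>

definition slide_about :: "real \<Rightarrow> real \<Rightarrow> real \<Rightarrow> real \<Rightarrow> real" where
  "slide_about c m n x = (if x \<le> c then c - (c + 2) * slide m ((c - x) / (c + 2))
     else c + (2 - c) * slide n ((x - c) / (2 - c)))"

definition box_slide_Re :: "real \<Rightarrow> (real \<Rightarrow> real \<Rightarrow> real) \<Rightarrow> (real \<Rightarrow> real \<Rightarrow> real) \<Rightarrow> real \<Rightarrow> complex \<times> real \<Rightarrow> complex \<times> real" where
  "box_slide_Re c N N' t p = (Complex (slide_about c (t * N (Im (fst p)) (snd p)) (t * N' (Im (fst p)) (snd p)) (Re (fst p)))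
     (Im (fst p)), snd p)"

lemma box_isotopyI:
  assumes "continuous_on ({0..1} \<times> (edge_box \<times> {0..1})) (\<lambda>q. h (fst q) (snd q))"
    "\<And>t z s. t \<in> {0..1} \<Longrightarrow> z \<in> edge_box \<Longrightarrow> s \<in> {0..1} \<Longrightarrow> h t (z, s) \<in> edge_box \<times> {0..1}"
    "\<And>t z s. t \<in> {0..1} \<Longrightarrow> z \<in> edge_box \<Longrightarrow> s \<in> {0..1} \<Longrightarrow> k t (z, s) \<in> edge_box \<times> {0..1}"
    "\<And>t z s. t \<in> {0..1} \<Longrightarrow> z \<in> edge_box \<Longrightarrow> s \<in> {0..1} \<Longrightarrow> k t (h t (z, s)) = (z, s)"
    "\<And>t z s. t \<in> {0..1} \<Longrightarrow> z \<in> edge_box \<Longrightarrow> s \<in> {0..1} \<Longrightarrow> h t (k t (z, s)) = (z, s)"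
    "\<And>t z s. t \<in> {0..1} \<Longrightarrow> z \<in> edge_box - open_box \<Longrightarrow> s \<in> {0..1} \<Longrightarrow> h t (z, s) = (z, s)"
    "\<And>z s. z \<in> edge_box \<Longrightarrow> s \<in> {0..1} \<Longrightarrow> h 0 (z, s) = (z, s)"
  shows "box_isotopy h"
  unfolding box_isotopy_def box_map_def
proof (intro conjI ballI)
  show "continuous_on ({0..1} \<times> (edge_box \<times> {0..1})) (\<lambda>(t, p). h t p)" using assms(1) by (simp add: split_def)
  fix t :: real assume t: "t \<in> {0..1}"
  show "h t ` (edge_box \<times> {0..1}) \<subseteq> edge_box \<times> {0..1}" using assms(2)[OF t] by (intro image_subsetI) auto
  show "bij_betw (h t) (edge_box \<times> {0..1}) (edge_box \<times> {0..1})"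
    by (rule bij_betw_byWitness[of _ "k t"]) (use assms(2-5)[OF t] in \<open>auto intro!: image_subsetI\<close>)
qed (use assms(6,7) in auto)

lemma box_isotopy_lift:
  assumes M: "continuous_on edge_box M" "\<And>z. z \<in> edge_box - open_box \<Longrightarrow> M z = 0"
  shows "box_isotopy (box_lift M)"
proof (rule box_isotopyI[where k = "box_lift (\<lambda>z. - M z)"])
  show "continuous_on ({0..1} \<times> (edge_box \<times> {0..1})) (\<lambda>q. box_lift M (fst q) (snd q))"
    unfolding box_lift_def by (intro continuous_intros continuous_on_compose2[OF M(1)]) auto
qed (use M(2) in \<open>auto simp: box_lift_def slide_bounds\<close>)

lemma box_isotopy_slide_Im:
  assumes N: "continuous_on ({-2..2} \<times> {0..1}) (\<lambda>(x, s). N x s)" "\<And>x s. \<bar>x\<bar> = 2 \<Longrightarrow> N x s = 0"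
  shows "box_isotopy (box_slide_Im N)"
proof (rule box_isotopyI[where k = "box_slide_Im (\<lambda>x s. - N x s)"])
  have "continuous_on ({0..1::real} \<times> (edge_box \<times> {0..1})) (\<lambda>q. (\<lambda>(x, s). N x s) (Re (fst (snd q)), snd (snd q)))"
    by (rule continuous_on_compose2[OF N(1)]) (auto intro!: continuous_intros simp: edge_box_def)
  then have "continuous_on ({0..1::real} \<times> (edge_box \<times> {0..1})) (\<lambda>q. N (Re (fst (snd q))) (snd (snd q)))" by simp
  then show "continuous_on ({0..1} \<times> (edge_box \<times> {0..1})) (\<lambda>q. box_slide_Im N (fst q) (snd q))"
    unfolding box_slide_Im_def Complex_eq by (intro continuous_intros) (auto simp: edge_box_def)
  fix t z and s :: real
  { fix m :: real assume "z \<in> edge_box"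
    then have "0 \<le> slide m ((1 + Im z)/2)" "slide m ((1 + Im z)/2) \<le> 1"
      by (auto intro!: slide_bounds simp: edge_box_def)
    then have "\<bar>2 * slide m ((1 + Im z)/2) - 1\<bar> \<le> 1" by (auto simp: abs_le_iff) } note b = this
  show "z \<in> edge_box \<Longrightarrow> s \<in> {0..1} \<Longrightarrow> box_slide_Im N t (z, s) \<in> edge_box \<times> {0..1}"
    and "z \<in> edge_box \<Longrightarrow> s \<in> {0..1} \<Longrightarrow> box_slide_Im (\<lambda>x s. - N x s) t (z, s) \<in> edge_box \<times> {0..1}"
    using b by (auto simp: box_slide_Im_def edge_box_def)
  show "box_slide_Im (\<lambda>x s. - N x s) t (box_slide_Im N t (z, s)) = (z, s)" if "z \<in> edge_box"
    using that by (auto simp: box_slide_Im_def edge_box_def complex_eq_iff field_simps)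
  show "box_slide_Im N t (box_slide_Im (\<lambda>x s. - N x s) t (z, s)) = (z, s)" if "z \<in> edge_box"
    using that by (auto simp: box_slide_Im_def edge_box_def complex_eq_iff field_simps)
  show "box_slide_Im N t (z, s) = (z, s)" if "z \<in> edge_box - open_box"
  proof -
    \<comment> \<open>On the sides Im z = 1 and Im z = -1 the shear is trivial because
      \<open>slide\<close> fixes 1 and 0; on the sides with |Re z| = 2 it is trivial because
      \<open>N\<close> vanishes.\<close>
    have "\<bar>Re z\<bar> = 2 \<or> Im z = 1 \<or> Im z = -1" using that by (auto simp: edge_box_def open_box_def)
    then show ?thesis using N(2) by (auto simp: box_slide_Im_def complex_eq_iff field_simps)
  qed
  show "box_slide_Im N 0 (z, s) = (z, s)" by (simp add: box_slide_Im_def complex_eq_iff field_simps)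
qed

lemma slide_about_bounds:
  assumes "-2 < c" "c < 2" "\<bar>x\<bar> \<le> 2"
  shows "\<bar>slide_about c m n x\<bar> \<le> 2" "x \<le> c \<Longrightarrow> slide_about c m n x \<le> c" "c \<le> x \<Longrightarrow> c \<le> slide_about c m n x"
proof -
  let ?l = "slide m ((c - x) / (c + 2))" and ?r = "slide n ((x - c) / (2 - c))"
  have l: "0 \<le> ?l" "?l \<le> 1" if "x \<le> c" using assms that by (auto intro!: slide_bounds)
  have r: "0 \<le> ?r" "?r \<le> 1" if "c \<le> x" using assms that by (auto intro!: slide_bounds)
  have l': "0 \<le> (c + 2) * ?l" "(c + 2) * ?l \<le> c + 2" if "x \<le> c"
    using l[OF that] assms by (auto intro!: mult_left_le)
  have r': "0 \<le> (2 - c) * ?r" "(2 - c) * ?r \<le> 2 - c" if "c \<le> x"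
    using r[OF that] assms by (auto intro!: mult_left_le)
  show "\<bar>slide_about c m n x\<bar> \<le> 2" "x \<le> c \<Longrightarrow> slide_about c m n x \<le> c" "c \<le> x \<Longrightarrow> c \<le> slide_about c m n x"
  proof -
    define a b where "a = (c + 2) * ?l" and "b = (2 - c) * ?r"
    have "slide_about c m n x = (if x \<le> c then c - a else c + b)" by (simp add: slide_about_def a_def b_def)
    moreover have "a = 0" if "x = c" using that by (simp add: a_def)
    ultimately show "\<bar>slide_about c m n x\<bar> \<le> 2" "x \<le> c \<Longrightarrow> slide_about c m n x \<le> c" "c \<le> x \<Longrightarrow> c \<le> slide_about c m n x"
      using l'[folded a_def] r'[folded b_def] assms by (auto split: if_splits)
  qed
qed

lemma slide_about_inverse:
  assumes "-2 < c" "c < 2" "\<bar>x\<bar> \<le> 2"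
  shows "slide_about c (- m) (- n) (slide_about c m n x) = x"
proof (cases "x \<le> c")
  case True
  then have "slide_about c m n x \<le> c" using slide_about_bounds assms by blast
  moreover have "(c - slide_about c m n x) / (c + 2) = slide m ((c - x) / (c + 2))"
    using True assms by (simp add: slide_about_def)
  moreover have "0 \<le> (c - x) / (c + 2)" "(c - x) / (c + 2) \<le> 1" using True assms by auto
  ultimately show ?thesis unfolding slide_about_def[of c "- m"] using assms by simp
next
  case False
  \<comment> \<open>Strictness keeps the image strictly to the right of \<open>c\<close>, so that
    the inverse uses the same branch of the definition.\<close>
  have "0 < slide n ((x - c) / (2 - c))" using False assms by (intro slide_pos) auto
  then have "c < slide_about c m n x" using False assms by (simp add: slide_about_def)
  moreover have "(slide_about c m n x - c) / (2 - c) = slide n ((x - c) / (2 - c))"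
    using False assms by (simp add: slide_about_def)
  moreover have "0 \<le> (x - c) / (2 - c)" "(x - c) / (2 - c) \<le> 1" using False assms by auto
  ultimately show ?thesis unfolding slide_about_def[of c "- m"] using assms by simp
qed

lemma continuous_on_slide_about:
  assumes c: "-2 < c" "c < 2" and f: "continuous_on S f" "continuous_on S g" "continuous_on S x"
    "\<And>p. p \<in> S \<Longrightarrow> \<bar>x p\<bar> \<le> 2"
  shows "continuous_on S (\<lambda>p. slide_about c (f p) (g p) (x p))"
proof -
  have "continuous_on ({p\<in>S. x p \<le> c} \<union> {p\<in>S. c \<le> x p}) (\<lambda>p. if x p \<le> c then c - (c + 2) * slide (f p) ((c - x p) / (c + 2))
     else c + (2 - c) * slide (g p) ((x p - c) / (2 - c)))"
  proof (rule continuous_on_cases_local)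
    have S: "{p\<in>S. x p \<le> c} \<union> {p\<in>S. c \<le> x p} = S" by auto
    have "{p\<in>S. x p \<le> c} = S \<inter> x -` {..c}" "{p\<in>S. c \<le> x p} = S \<inter> x -` {c..}" by auto
    then show "closedin (top_of_set ({p\<in>S. x p \<le> c} \<union> {p\<in>S. c \<le> x p})) {p\<in>S. x p \<le> c}"
      "closedin (top_of_set ({p\<in>S. x p \<le> c} \<union> {p\<in>S. c \<le> x p})) {p\<in>S. c \<le> x p}"
      unfolding S using continuous_closedin_preimage[OF f(3)] by simp_all
    have "0 \<le> (c - x p) / (c + 2) \<and> (c - x p) / (c + 2) \<le> 1" if "p \<in> S" "x p \<le> c" for p
      using f(4)[OF that(1)] that c by auto
    then show "continuous_on {p\<in>S. x p \<le> c} (\<lambda>p. c - (c + 2) * slide (f p) ((c - x p) / (c + 2)))"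
      using c by (intro continuous_intros continuous_on_subset[OF f(1)] continuous_on_subset[OF f(3)]) auto
    have "0 \<le> (x p - c) / (2 - c) \<and> (x p - c) / (2 - c) \<le> 1" if "p \<in> S" "c \<le> x p" for p
      using f(4)[OF that(1)] that c by auto
    then show "continuous_on {p\<in>S. c \<le> x p} (\<lambda>p. c + (2 - c) * slide (g p) ((x p - c) / (2 - c)))"
      using c by (intro continuous_intros continuous_on_subset[OF f(2)] continuous_on_subset[OF f(3)]) auto
  qed auto
  moreover have "{p\<in>S. x p \<le> c} \<union> {p\<in>S. c \<le> x p} = S" by auto
  ultimately show ?thesis unfolding slide_about_def by simp
qed

lemma box_isotopy_slide_Re:
  assumes c: "-2 < c" "c < 2"
    and N: "continuous_on ({-1..1} \<times> {0..1}) (\<lambda>(y, s). N y s)" "\<And>y s. \<bar>y\<bar> = 1 \<Longrightarrow> N y s = 0"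
    and N': "continuous_on ({-1..1} \<times> {0..1}) (\<lambda>(y, s). N' y s)" "\<And>y s. \<bar>y\<bar> = 1 \<Longrightarrow> N' y s = 0"
  shows "box_isotopy (box_slide_Re c N N')"
proof (rule box_isotopyI[where k = "box_slide_Re c (\<lambda>x s. - N x s) (\<lambda>x s. - N' x s)"])
  have *: "continuous_on ({0..1::real} \<times> (edge_box \<times> {0..1})) (\<lambda>q. N (Im (fst (snd q))) (snd (snd q)))"
    if "continuous_on ({-1..1} \<times> {0..1}) (\<lambda>(y, s). N y s)" for N :: "real \<Rightarrow> real \<Rightarrow> real"
  proof -
    have "continuous_on ({0..1::real} \<times> (edge_box \<times> {0..1})) (\<lambda>q. (\<lambda>(x, s). N x s) (Im (fst (snd q)), snd (snd q)))"
      by (rule continuous_on_compose2[OF that]) (auto intro!: continuous_intros simp: edge_box_def)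
    then show ?thesis by simp
  qed
  show "continuous_on ({0..1} \<times> (edge_box \<times> {0..1})) (\<lambda>q. box_slide_Re c N N' (fst q) (snd q))"
    unfolding box_slide_Re_def Complex_eq using *[OF N(1)] *[OF N'(1)]
    by (intro continuous_intros continuous_on_slide_about c) (auto simp: edge_box_def)
  fix t z and s :: real
  show "z \<in> edge_box \<Longrightarrow> s \<in> {0..1} \<Longrightarrow> box_slide_Re c N N' t (z, s) \<in> edge_box \<times> {0..1}"
    and "z \<in> edge_box \<Longrightarrow> s \<in> {0..1} \<Longrightarrow> box_slide_Re c (\<lambda>x s. - N x s) (\<lambda>x s. - N' x s) t (z, s) \<in> edge_box \<times> {0..1}"
    using slide_about_bounds(1)[OF c] by (auto simp: box_slide_Re_def edge_box_def)
  show "box_slide_Re c (\<lambda>x s. - N x s) (\<lambda>x s. - N' x s) t (box_slide_Re c N N' t (z, s)) = (z, s)" if "z \<in> edge_box"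
    using that c by (auto simp: box_slide_Re_def edge_box_def complex_eq_iff slide_about_inverse)
  show "box_slide_Re c N N' t (box_slide_Re c (\<lambda>x s. - N x s) (\<lambda>x s. - N' x s) t (z, s)) = (z, s)" if "z \<in> edge_box"
    using that c slide_about_inverse[OF c, of "Re z" "- (t * N (Im z) s)" "- (t * N' (Im z) s)"]
    by (auto simp: box_slide_Re_def edge_box_def complex_eq_iff)
  have id: "slide_about c 0 0 x = x" for x using c by (simp add: slide_about_def)
  show "box_slide_Re c N N' t (z, s) = (z, s)" if "z \<in> edge_box - open_box"
  proof -
    have "\<bar>Im z\<bar> = 1 \<or> Re z = 2 \<or> Re z = -2" using that by (auto simp: edge_box_def open_box_def)
    then show ?thesis using N(2) N'(2) c by (auto simp: box_slide_Re_def complex_eq_iff id) (auto simp: slide_about_def)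
  qed
  show "box_slide_Re c N N' 0 (z, s) = (z, s)" by (simp add: box_slide_Re_def complex_eq_iff id)
qed

lemma box_isotopy_compose:
  assumes h: "box_isotopy h" and k: "box_isotopy k"
  shows "box_isotopy (\<lambda>t p. k t (h t p))"
  unfolding box_isotopy_def
proof (intro conjI ballI)
  let ?X = "edge_box \<times> {0..1::real}"
  have im: "h t ` ?X \<subseteq> ?X" if "t \<in> {0..1}" for t
    using h that unfolding box_isotopy_def box_map_def by blast
  have ch: "continuous_on ({0..1} \<times> ?X) (\<lambda>q. h (fst q) (snd q))"
    and ck: "continuous_on ({0..1} \<times> ?X) (\<lambda>q. k (fst q) (snd q))"
    using h k unfolding box_isotopy_def by (simp_all add: split_def)
  have "continuous_on ({0..1} \<times> ?X) (\<lambda>q. (\<lambda>q. k (fst q) (snd q)) (fst q, h (fst q) (snd q)))"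
  proof (rule continuous_on_compose2[OF ck])
    show "continuous_on ({0..1} \<times> ?X) (\<lambda>q. (fst q, h (fst q) (snd q)))"
      by (intro continuous_intros ch)
    show "(\<lambda>q. (fst q, h (fst q) (snd q))) ` ({0..1} \<times> ?X) \<subseteq> {0..1} \<times> ?X"
    proof (rule image_subsetI)
      fix q assume q: "q \<in> {0..1::real} \<times> ?X"
      then have "h (fst q) (snd q) \<in> ?X" using im[of "fst q"] by (metis image_subset_iff mem_Times_iff)
      then show "(fst q, h (fst q) (snd q)) \<in> {0..1} \<times> ?X" using q by (simp add: mem_Times_iff)
    qed
  qed
  then show "continuous_on ({0..1} \<times> ?X) (\<lambda>(t, p). k t (h t p))" by (simp add: split_def)
  fix t :: real assume t: "t \<in> {0..1}"
  have b: "box_map (h t)" "bij_betw (h t) ?X ?X" "box_map (k t)" "bij_betw (k t) ?X ?X"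
    using h k t unfolding box_isotopy_def by auto
  show "bij_betw (\<lambda>p. k t (h t p)) ?X ?X" using bij_betw_trans[OF b(2,4)] by (simp add: o_def)
  show "box_map (\<lambda>p. k t (h t p))" unfolding box_map_def
  proof (intro conjI ballI)
    show "(\<lambda>p. k t (h t p)) ` ?X \<subseteq> ?X" using b(1,3) unfolding box_map_def image_subset_iff by blast
  qed (use b in \<open>auto simp: box_map_def\<close>)
next
  fix p assume "p \<in> edge_box \<times> {0..1::real}"
  then show "k 0 (h 0 p) = p" using h k unfolding box_isotopy_def by auto
qed

section \<open>Straightening the resolved tangles\<close>

lemma path_image_strand_graph:
  assumes "x0 \<noteq> x1"
    and "\<And>x. min x0 x1 \<le> x \<Longrightarrow> x \<le> max x0 x1 \<Longrightarrow>
      F x = (Complex x (y0 + (y1 - y0) * ((x - x0) / (x1 - x0))),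
       1/2 + \<epsilon> * min ((x - x0) / (x1 - x0)) (1 - (x - x0) / (x1 - x0)))"
  shows "path_image (strand \<epsilon> (Complex x0 y0) (Complex x1 y1)) = F ` {min x0 x1..max x0 x1}"
proof -
  have S: "strand \<epsilon> (Complex x0 y0) (Complex x1 y1) s = F (x0 + s * (x1 - x0))" if "s \<in> {0..1}" for s
  proof -
    have "min x0 x1 \<le> x0 + s * (x1 - x0) \<and> x0 + s * (x1 - x0) \<le> max x0 x1"
    proof (cases "x0 \<le> x1")
      case True
      then have "0 \<le> s * (x1 - x0)" "s * (x1 - x0) \<le> x1 - x0" using that by (auto intro: mult_left_le_one_le)
      then show ?thesis using True by auto
    next
      case False
      then have "0 \<le> s * (x0 - x1)" "s * (x0 - x1) \<le> x0 - x1" using that by (auto intro: mult_left_le_one_le)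
      then show ?thesis using False by (auto simp: algebra_simps)
    qed
    moreover have "(x0 + s * (x1 - x0) - x0) / (x1 - x0) = s" using assms(1) by simp
    ultimately show ?thesis using assms(2)[of "x0 + s * (x1 - x0)"]
      by (simp add: strand_def linepath_def complex_eq_iff algebra_simps)
  qed
  have "(\<lambda>s. x0 + s * (x1 - x0)) ` {0..1} = {min x0 x1..max x0 x1}"
  proof -
    have "(\<lambda>s. x0 + s * (x1 - x0)) ` {0..1} = closed_segment x0 x1"
      unfolding closed_segment_image_interval by (intro image_cong) (auto simp: algebra_simps)
    then show ?thesis by (auto simp: closed_segment_eq_real_ivl)
  qed
  then have "F ` {min x0 x1..max x0 x1} = (\<lambda>s. F (x0 + s * (x1 - x0))) ` {0..1}" by (metis image_image)
  then show ?thesis using S unfolding path_image_def by (metis (no_types, lifting) image_cong)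
qed

lemma path_image_strand_cograph:
  assumes "y0 < y1"
    and "\<And>y. y0 \<le> y \<Longrightarrow> y \<le> y1 \<Longrightarrow> F y = (Complex (x0 + (x1 - x0) * ((y - y0) / (y1 - y0))) y, 1/2)"
  shows "path_image (strand 0 (Complex x0 y0) (Complex x1 y1)) = F ` {y0..y1}"
proof -
  have S: "strand 0 (Complex x0 y0) (Complex x1 y1) s = F (y0 + s * (y1 - y0))" if "s \<in> {0..1}" for s
  proof -
    have "0 \<le> s * (y1 - y0)" "s * (y1 - y0) \<le> y1 - y0" using that assms(1) by (auto intro: mult_left_le_one_le)
    moreover have "(y0 + s * (y1 - y0) - y0) / (y1 - y0) = s" using assms(1) by simp
    ultimately show ?thesis using assms(2)[of "y0 + s * (y1 - y0)"]
      by (simp add: strand_def linepath_def complex_eq_iff algebra_simps)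
  qed
  have "(\<lambda>s. y0 + s * (y1 - y0)) ` {0..1} = {y0..y1}"
  proof -
    have "(\<lambda>s. y0 + s * (y1 - y0)) ` {0..1} = closed_segment y0 y1"
      unfolding closed_segment_image_interval by (intro image_cong) (auto simp: algebra_simps)
    then show ?thesis using assms(1) by (auto simp: closed_segment_eq_real_ivl)
  qed
  then have "F ` {y0..y1} = (\<lambda>s. F (y0 + s * (y1 - y0))) ` {0..1}" by (metis image_image)
  then show ?thesis using S unfolding path_image_def by (metis (no_types, lifting) image_cong)
qed

section \<open>The resolved tangles as graphs of piecewise linear functions\<close>

definition left_square :: "complex \<Rightarrow> complex" where "left_square z = -1/2 + z/4"
text \<open>The negative factor is a half turn: it preserves the sign of the crossing and makes its
  strands run downwards.\<close>

definition right_square :: "complex \<Rightarrow> complex" where "right_square z = 1/2 - z/4"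

definition tangle_rest :: "complex knot set" where
  "tangle_rest = place right_square crossing_pos \<union>
     {strand 0 (Complex (-1) (-1)) (Complex (-3/4) (-1/4)),
      strand 0 (Complex (-3/4) (1/4)) (Complex (-1) 1),
      strand 0 (Complex (-1/4) (1/4)) (Complex (1/4) (1/4)),
      strand 0 (Complex (3/4) (-1/4)) (Complex 1 (-1)),
      strand 0 (Complex 1 1) (Complex (3/4) (1/4)),
      strand 0 (Complex (1/4) (-1/4)) (Complex (-1/4) (-1/4))}"

definition tangle :: "complex knot set \<Rightarrow> complex knot set" where
  "tangle X = place left_square X \<union> tangle_rest"

lemma jaeger_tangle_eq: "jaeger_tangle = tangle crossing_pos"
  unfolding jaeger_tangle_def tangle_def tangle_rest_def left_square_def[abs_def] right_square_def[abs_def]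
  by (simp only: Un_assoc)

lemma place_strand_left: "map_prod left_square id \<circ> strand \<epsilon> a b = strand \<epsilon> (left_square a) (left_square b)"
  by (auto simp: fun_eq_iff strand_def left_square_def linepath_def complex_eq_iff field_simps)

lemma place_strand_right: "map_prod right_square id \<circ> strand \<epsilon> a b = strand \<epsilon> (right_square a) (right_square b)"
  by (auto simp: fun_eq_iff strand_def right_square_def linepath_def complex_eq_iff field_simps)

lemma left_square_Complex: "left_square (Complex x y) = Complex (x/4 - 1/2) (y/4)"
  by (simp add: left_square_def complex_eq_iff)

lemma right_square_Complex: "right_square (Complex x y) = Complex (1/2 - x/4) (- y/4)"
  by (simp add: right_square_def complex_eq_iff)

lemma place_left_neg: "place left_square crossing_neg =
   {strand (-1/2) (Complex (-3/4) (-1/4)) (Complex (-1/4) (1/4)), strand (1/2) (Complex (-1/4) (-1/4)) (Complex (-3/4) (1/4))}"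
  by (simp add: place_def crossing_neg_def place_strand_left left_square_Complex)

lemma place_left_smooth: "place left_square crossing_smooth =
   {strand 0 (Complex (-3/4) (-1/4)) (Complex (-5/8) 0), strand 0 (Complex (-5/8) 0) (Complex (-3/4) (1/4)),
    strand 0 (Complex (-1/4) (-1/4)) (Complex (-3/8) 0), strand 0 (Complex (-3/8) 0) (Complex (-1/4) (1/4))}"
  by (simp add: place_def crossing_smooth_def place_strand_left left_square_Complex)

lemma place_right_pos: "place right_square crossing_pos =
   {strand (1/2) (Complex (3/4) (1/4)) (Complex (1/4) (-1/4)), strand (-1/2) (Complex (1/4) (1/4)) (Complex (3/4) (-1/4))}"
  by (simp add: place_def crossing_pos_def place_strand_right right_square_Complex)

lemma trace_insert [simp]: "trace (insert a T) = path_image a \<union> trace T" "trace {} = {}"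
  "trace (T \<union> T') = trace T \<union> trace T'"
  by (auto simp: trace_def)

text \<open>The two strands of the switched tangle, and the right strand of the smoothed one, consist of an upper
  part, the graph of a function \<open>q\<close> of the real part at height \<open>1/2 + D\<close>, and its mirror image below.\<close>

definition q_neg :: "real \<Rightarrow> real" where "q_neg x = max (max (-1/4) (\<bar>x\<bar> - 1/2)) (3 * \<bar>x\<bar> - 2)"
definition D_neg :: "real \<Rightarrow> real" where "D_neg x = max 0 (1/4 - \<bar>\<bar>x\<bar> - 1/2\<bar>)"
definition q_smooth :: "real \<Rightarrow> real" where
  "q_smooth x = max (max (- 2 * x - 3/4) (-1/4)) (max (x - 1/2) (3 * x - 2))"
definition D_smooth :: "real \<Rightarrow> real" where "D_smooth x = max 0 (1/4 - \<bar>x - 1/2\<bar>)"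
text \<open>The left arc of the smoothed tangle is a graph over the imaginary part instead. It bends
  at Im z = 0, where the real part is -5/8, and at |Im z| = 1/4, where it is -3/4.\<close>

definition left_end :: "real \<Rightarrow> real" where "left_end y = max (- 5/8 - \<bar>y\<bar>/2) (- 2/3 - \<bar>y\<bar>/3)"

lemma D_neg_bounds: "0 \<le> D_neg x" "D_neg x \<le> 1/4"
  unfolding D_neg_def by simp (rule max.boundedI; simp)

lemma D_smooth_bounds: "0 \<le> D_smooth x" "D_smooth x \<le> 1/4"
  unfolding D_smooth_def by simp (rule max.boundedI; simp)

definition upper :: "(real \<Rightarrow> real) \<Rightarrow> (real \<Rightarrow> real) \<Rightarrow> real \<Rightarrow> complex \<times> real" where
  "upper q D x = (Complex x (q x), 1/2 + D x)"
definition lower :: "(real \<Rightarrow> real) \<Rightarrow> (real \<Rightarrow> real) \<Rightarrow> real \<Rightarrow> complex \<times> real" where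
  "lower q D x = (Complex x (- q x), 1/2 - D x)"

text \<open>Once the crossing at -1/2 is switched, the strand joining the two corners with Im z = 1
  passes above at both crossings, and its mirror image passes below at both. The five segments of
  each are the linear pieces of \<open>q_neg\<close>.\<close>

lemma trace_tangle_neg:
  "trace (tangle crossing_neg) = upper q_neg D_neg ` {-1..1} \<union> lower q_neg D_neg ` {-1..1}"
proof -
  note defs = upper_def lower_def q_neg_def D_neg_def max_def min_def abs_if field_simps
  have u: "path_image (strand 0 (Complex (-3/4) (1/4)) (Complex (-1) 1)) = upper q_neg D_neg ` {-1..-3/4}"
    "path_image (strand (1/2) (Complex (-1/4) (-1/4)) (Complex (-3/4) (1/4))) = upper q_neg D_neg ` {-3/4..-1/4}"
    "path_image (strand 0 (Complex (1/4) (-1/4)) (Complex (-1/4) (-1/4))) = upper q_neg D_neg ` {-1/4..1/4}"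
    "path_image (strand (1/2) (Complex (3/4) (1/4)) (Complex (1/4) (-1/4))) = upper q_neg D_neg ` {1/4..3/4}"
    "path_image (strand 0 (Complex 1 1) (Complex (3/4) (1/4))) = upper q_neg D_neg ` {3/4..1}"
    by (subst path_image_strand_graph[where F = "upper q_neg D_neg"]; force simp: defs)+
  have l: "path_image (strand 0 (Complex (-1) (-1)) (Complex (-3/4) (-1/4))) = lower q_neg D_neg ` {-1..-3/4}"
    "path_image (strand (-1/2) (Complex (-3/4) (-1/4)) (Complex (-1/4) (1/4))) = lower q_neg D_neg ` {-3/4..-1/4}"
    "path_image (strand 0 (Complex (-1/4) (1/4)) (Complex (1/4) (1/4))) = lower q_neg D_neg ` {-1/4..1/4}"
    "path_image (strand (-1/2) (Complex (1/4) (1/4)) (Complex (3/4) (-1/4))) = lower q_neg D_neg ` {1/4..3/4}"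
    "path_image (strand 0 (Complex (3/4) (-1/4)) (Complex 1 (-1))) = lower q_neg D_neg ` {3/4..1}"
    by (subst path_image_strand_graph[where F = "lower q_neg D_neg"]; force simp: defs)+
  have i: "{-1..1::real} = {-1..-3/4} \<union> {-3/4..-1/4} \<union> {-1/4..1/4} \<union> {1/4..3/4} \<union> {3/4..1}" by auto
  show ?thesis unfolding tangle_def tangle_rest_def place_left_neg place_right_pos trace_insert u l i image_Un
    by (simp only: Un_ac Un_empty_right Un_empty_left)
qed

text \<open>The right strand folds back at its leftmost point, with real part -3/8. The half that
  ends at the corner with Im z = 1 passes above at the remaining crossing; the other half is its
  mirror image and passes below.\<close>

lemma trace_tangle_smooth:
  "trace (tangle crossing_smooth) = upper q_smooth D_smooth ` {-3/8..1} \<union> lower q_smooth D_smooth ` {-3/8..1} \<union>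
     (\<lambda>y. (Complex (left_end y) y, 1/2)) ` {-1..1}"
proof -
  note defs = upper_def lower_def q_smooth_def D_smooth_def max_def min_def abs_if field_simps
  have u: "path_image (strand 0 (Complex (-1/4) (-1/4)) (Complex (-3/8) 0)) = upper q_smooth D_smooth ` {-3/8..-1/4}"
    "path_image (strand 0 (Complex (1/4) (-1/4)) (Complex (-1/4) (-1/4))) = upper q_smooth D_smooth ` {-1/4..1/4}"
    "path_image (strand (1/2) (Complex (3/4) (1/4)) (Complex (1/4) (-1/4))) = upper q_smooth D_smooth ` {1/4..3/4}"
    "path_image (strand 0 (Complex 1 1) (Complex (3/4) (1/4))) = upper q_smooth D_smooth ` {3/4..1}"
    by (subst path_image_strand_graph[where F = "upper q_smooth D_smooth"]; force simp: defs)+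
  have l: "path_image (strand 0 (Complex (-3/8) 0) (Complex (-1/4) (1/4))) = lower q_smooth D_smooth ` {-3/8..-1/4}"
    "path_image (strand 0 (Complex (-1/4) (1/4)) (Complex (1/4) (1/4))) = lower q_smooth D_smooth ` {-1/4..1/4}"
    "path_image (strand (-1/2) (Complex (1/4) (1/4)) (Complex (3/4) (-1/4))) = lower q_smooth D_smooth ` {1/4..3/4}"
    "path_image (strand 0 (Complex (3/4) (-1/4)) (Complex 1 (-1))) = lower q_smooth D_smooth ` {3/4..1}"
    by (subst path_image_strand_graph[where F = "lower q_smooth D_smooth"]; force simp: defs)+
  let ?F = "\<lambda>y. (Complex (left_end y) y, 1/2::real)"
  have y: "path_image (strand 0 (Complex (-1) (-1)) (Complex (-3/4) (-1/4))) = ?F ` {-1..-1/4}"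
    "path_image (strand 0 (Complex (-3/4) (-1/4)) (Complex (-5/8) 0)) = ?F ` {-1/4..0}"
    "path_image (strand 0 (Complex (-5/8) 0) (Complex (-3/4) (1/4))) = ?F ` {0..1/4}"
    "path_image (strand 0 (Complex (-3/4) (1/4)) (Complex (-1) 1)) = ?F ` {1/4..1}"
    by (subst path_image_strand_cograph[where F = ?F]; force simp: left_end_def max_def abs_if field_simps)+
  have i: "{-3/8..1::real} = {-3/8..-1/4} \<union> {-1/4..1/4} \<union> {1/4..3/4} \<union> {3/4..1}" by auto
  have j: "{-1..1::real} = {-1..-1/4} \<union> {-1/4..0} \<union> {0..1/4} \<union> {1/4..1}" by auto
  show ?thesis unfolding tangle_def tangle_rest_def place_left_smooth place_right_pos trace_insert u l y i j image_Un
    by (simp only: Un_ac Un_empty_right Un_empty_left)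
qed

text \<open>Where \<open>e\<close> vanishes the quotient has no limit in general, but the clamped
  factor stays bounded by 1 while \<open>C\<close> tends to 0.\<close>

lemma continuous_on_mult_clamp:
  fixes C e w :: "'p::topological_space \<Rightarrow> real"
  assumes "continuous_on S C" "continuous_on S e" "continuous_on S w" "\<And>p. p \<in> S \<Longrightarrow> e p = 0 \<Longrightarrow> C p = 0"
  shows "continuous_on S (\<lambda>p. C p * max (-1) (min 1 (w p / e p)))"
  unfolding continuous_on_def
proof
  fix p assume p: "p \<in> S"
  have t: "(C \<longlongrightarrow> C p) (at p within S)" "(e \<longlongrightarrow> e p) (at p within S)" "(w \<longlongrightarrow> w p) (at p within S)"
    using assms(1-3) p by (auto simp: continuous_on_def)
  show "((\<lambda>p. C p * max (-1) (min 1 (w p / e p))) \<longlongrightarrow> C p * max (-1) (min 1 (w p / e p))) (at p within S)"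
  proof (cases "e p = 0")
    case False
    then show ?thesis using t by (intro tendsto_intros) auto
  next
    case True
    then have C0: "C p = 0" using assms(4) p by auto
    have Cz: "((\<lambda>p. \<bar>C p\<bar>) \<longlongrightarrow> 0) (at p within S)" using t(1) C0 tendsto_rabs_zero by auto
    have "\<bar>C p * max (-1) (min 1 v)\<bar> \<le> \<bar>C p\<bar>" for p v
    proof -
      have "\<bar>max (-1) (min 1 v)\<bar> \<le> (1::real)" by (auto simp: max_def min_def)
      then show ?thesis by (simp add: abs_mult mult_left_le)
    qed
    note bd = this
    have "((\<lambda>p. C p * max (-1) (min 1 (w p / e p))) \<longlongrightarrow> 0) (at p within S)"
    proof (rule Lim_null_comparison)
      show "\<forall>\<^sub>F p in at p within S. norm (C p * max (-1) (min 1 (w p / e p))) \<le> \<bar>C p\<bar>"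
        unfolding real_norm_def by (rule always_eventually) (rule allI, rule bd)
      show "((\<lambda>p. \<bar>C p\<bar>) \<longlongrightarrow> 0) (at p within S)" by (rule Cz)
    qed
    then show ?thesis using C0 by simp
  qed
qed

lemma continuous_on_logit [continuous_intros]:
  assumes "continuous_on S f" "\<And>x. x \<in> S \<Longrightarrow> 0 < f x \<and> f x < 1"
  shows "continuous_on S (\<lambda>x. logit (f x))"
proof -
  have "f x \<noteq> 0" "1 - f x \<noteq> 0" if "x \<in> S" for x using assms(2)[OF that] by auto
  then show ?thesis unfolding logit_def using assms(1) by (intro continuous_intros) auto
qed

text \<open>After separating the heights, the upper part is pushed up and the lower part down to the graphs
  of \<open>\<plusminus> max q lev\<close>.\<close>

lemma separate_strands:
  fixes q D lev :: "real \<Rightarrow> real"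
  assumes ab: "-2 < a" "a < b" "b < 2"
    and cont: "continuous_on UNIV q" "continuous_on UNIV D" "continuous_on UNIV lev"
    and bounds: "\<And>x. a \<le> x \<Longrightarrow> x \<le> b \<Longrightarrow> -1 < q x \<and> q x \<le> 1 \<and> 0 \<le> D x \<and> D x < 1/2 \<and> 0 \<le> lev x \<and> lev x < 1"
    and sep: "\<And>x. a \<le> x \<Longrightarrow> x \<le> b \<Longrightarrow> q x < lev x \<Longrightarrow> 0 < D x \<or> q x \<noteq> 0"
    and ends: "lev a \<le> q a" "lev b \<le> q b"
  obtains h su where "box_isotopy h" "\<And>x. a \<le> x \<Longrightarrow> x \<le> b \<Longrightarrow> 0 < su x \<and> su x < 1"
    "\<And>x. a \<le> x \<Longrightarrow> x \<le> b \<Longrightarrow> h 1 (upper q D x) = (Complex x (max (q x) (lev x)), su x)"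
    "\<And>x. a \<le> x \<Longrightarrow> x \<le> b \<Longrightarrow> h 1 (lower q D x) = (Complex x (- max (q x) (lev x)), 1 - su x)"
    "\<And>z s. q a = 0 \<Longrightarrow> z \<in> edge_box \<Longrightarrow> s \<in> {0..1} \<Longrightarrow> Re z \<le> a \<Longrightarrow> h 1 (z, s) = (z, s)"
proof -
  \<comment> \<open>Functions on [a, b] are continued constantly to the whole box. At both ends
    \<open>lev\<close> is at most \<open>q\<close>, so the motion in the imaginary direction
    vanishes outside [a, b].\<close>
  define clip where "clip = (\<lambda>x. max a (min b x))"
  have clip: "a \<le> clip x" "clip x \<le> b" for x using ab by (auto simp: clip_def)
  have clip_id: "clip x = x" if "a \<le> x" "x \<le> b" for x using that by (auto simp: clip_def)
  \<comment> \<open>The factors 1 - (Im z)^2 and 4 - (Re z)^2 vanish on the rim of the box. With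
    them, \<open>M\<close> is a nonnegative multiple of q^2 on the graph of \<open>q\<close> and the
    opposite of it on the mirror image: inside the box the heights are driven apart wherever the two
    graphs differ, even if \<open>D\<close> is 0.\<close>
  define M where "M = (\<lambda>z. Im z * (1 - (Im z)\<^sup>2) * (4 - (Re z)\<^sup>2) * q (clip (Re z)))"
  define su where "su = (\<lambda>x. slide (q x * (1 - (q x)\<^sup>2) * (4 - x\<^sup>2) * q x) (1/2 + D x))"
  define C where "C = (\<lambda>x. logit ((1 + lev x)/2) - logit ((1 + min (q x) (lev x))/2))"
  \<comment> \<open>The clamped quotient is 1 at the height of the upper strand and -1 at that of
    the lower one, so a parameter that sees only the real part and the height moves the two in
    opposite directions.\<close>
  define N where "N = (\<lambda>x s. C (clip x) * max (-1) (min 1 ((s - 1/2) / (su (clip x) - 1/2))))"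
  have cclip: "continuous_on S clip" for S unfolding clip_def by (intro continuous_intros)
  have ccq: "continuous_on S (\<lambda>x. f (clip x))" if "continuous_on UNIV f" for S and f :: "real \<Rightarrow> real"
    by (rule continuous_on_compose2[OF that cclip]) auto
  have four: "0 < 4 - x\<^sup>2" if "a \<le> x" "x \<le> b" for x
  proof -
    have "\<bar>x\<bar> < 2" using that ab by auto
    then have "x\<^sup>2 < 2\<^sup>2" by (intro abs_square_less_1[THEN iffD2] power2_strict_mono) auto
    then show ?thesis by simp
  qed
  have q2: "(q x)\<^sup>2 \<le> 1" if "a \<le> x" "x \<le> b" for x
    using bounds[OF that] by (auto simp: abs_square_le_1 abs_le_iff)
  have mnonneg: "0 \<le> q x * (1 - (q x)\<^sup>2) * (4 - x\<^sup>2) * q x" if "a \<le> x" "x \<le> b" for x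
  proof -
    have "0 \<le> (q x)\<^sup>2 * (1 - (q x)\<^sup>2) * (4 - x\<^sup>2)" using four[OF that] q2[OF that] by (intro mult_nonneg_nonneg) auto
    then show ?thesis by (simp add: power2_eq_square mult_ac)
  qed
  have su_ge: "1/2 \<le> su x" if "a \<le> x" "x \<le> b" for x
    using slide_mono[of "1/2 + D x", OF _ _ mnonneg[OF that]] bounds[OF that] unfolding su_def by auto
  \<comment> \<open>Heights have to be separated wherever the strands will be moved. Either
    \<open>D\<close> has done this, or \<open>M\<close> does it because there \<open>q\<close> is
    nonzero and of absolute value less than 1.\<close>
  have su_gt: "1/2 < su x" if "a \<le> x" "x \<le> b" "q x < lev x" for x
  proof (cases "0 < D x")
    case True
    then show ?thesis using slide_mono[of "1/2 + D x", OF _ _ mnonneg[OF that(1,2)]] bounds[OF that(1,2)] unfolding su_def by auto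
  next
    case False
    then have "q x \<noteq> 0" using sep that by auto
    moreover have "(q x)\<^sup>2 < 1" using bounds[OF that(1,2)] that(3) by (auto simp: abs_square_less_1 abs_less_iff)
    ultimately have "0 < (q x)\<^sup>2 * (1 - (q x)\<^sup>2) * (4 - x\<^sup>2)" using four[OF that(1,2)] by (intro mult_pos_pos) auto
    then have "0 < q x * (1 - (q x)\<^sup>2) * (4 - x\<^sup>2) * q x" by (simp add: power2_eq_square mult_ac)
    then show ?thesis using slide_strict_mono[of "1/2 + D x"] bounds[OF that(1,2)] unfolding su_def by fastforce
  qed
  have su_b: "0 < su x \<and> su x < 1" if "a \<le> x" "x \<le> b" for x
    using slide_strict_bounds[of "1/2 + D x"] bounds[OF that] unfolding su_def by auto
  have C0: "C x = 0" if "lev x \<le> q x" for x using that by (simp add: C_def min_def)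
  have hV: "box_isotopy (box_lift M)"
  proof (rule box_isotopy_lift)
    show "continuous_on edge_box M" unfolding M_def
      by (intro continuous_intros continuous_on_compose2[OF ccq[OF cont(1), of UNIV]]) auto
    fix z assume "z \<in> edge_box - open_box"
    then have "Re z = 2 \<or> Re z = -2 \<or> Im z = 1 \<or> Im z = -1" by (auto simp: edge_box_def open_box_def)
    then show "M z = 0" by (auto simp: M_def)
  qed
  have hH: "box_isotopy (box_slide_Im N)"
  proof (rule box_isotopy_slide_Im)
    have rng: "0 < (1 + lev (clip x))/2 \<and> (1 + lev (clip x))/2 < 1" "0 < (1 + min (q (clip x)) (lev (clip x)))/2 \<and> (1 + min (q (clip x)) (lev (clip x)))/2 < 1"
      "0 \<le> 1/2 + D (clip x) \<and> 1/2 + D (clip x) \<le> 1" for x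
      using bounds[OF clip(1,2)[of x]] by (auto simp: min_def)
    have cx: "continuous_on ({-2..2} \<times> {0..1}) (\<lambda>p. f (clip (fst p)))" if "continuous_on UNIV f" for f :: "real \<Rightarrow> real"
      by (rule continuous_on_compose2[OF ccq[OF that, of UNIV]]) (auto intro!: continuous_intros)
    have cc: "continuous_on ({-2..2} \<times> {0..1::real}) (\<lambda>p. clip (fst p))"
      by (rule continuous_on_compose2[OF cclip[of UNIV]]) (auto intro!: continuous_intros)
    have "continuous_on ({-2..2} \<times> {0..1::real}) (\<lambda>p. C (clip (fst p)) * max (-1) (min 1 ((snd p - 1/2) / (su (clip (fst p)) - 1/2))))"
    proof (rule continuous_on_mult_clamp)
      show "continuous_on ({-2..2} \<times> {0..1::real}) (\<lambda>p. C (clip (fst p)))"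
        unfolding C_def by (intro continuous_intros cx cont rng) auto
      show "continuous_on ({-2..2} \<times> {0..1::real}) (\<lambda>p. su (clip (fst p)) - 1/2)"
        unfolding su_def by (intro continuous_intros cx cc cont rng)
      show "continuous_on ({-2..2} \<times> {0..1::real}) (\<lambda>p. snd p - 1/2)" by (intro continuous_intros)
      fix p :: "real \<times> real" assume "su (clip (fst p)) - 1/2 = 0"
      then have "\<not> q (clip (fst p)) < lev (clip (fst p))" using su_gt[OF clip(1,2)[of "fst p"]] by auto
      then show "C (clip (fst p)) = 0" by (intro C0) auto
    qed
    then show "continuous_on ({-2..2} \<times> {0..1}) (\<lambda>(x, s). N x s)" by (simp add: N_def split_def)
    fix x s :: real assume "\<bar>x\<bar> = 2"
    then have "clip x = a \<or> clip x = b" using ab by (auto simp: clip_def abs_if split: if_splits)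
    then show "N x s = 0" using C0[of a] C0[of b] ends by (auto simp: N_def)
  qed
  have up: "box_slide_Im N 1 (box_lift M 1 (upper q D x)) = (Complex x (max (q x) (lev x)), su x)"
    and lo: "box_slide_Im N 1 (box_lift M 1 (lower q D x)) = (Complex x (- max (q x) (lev x)), 1 - su x)"
    if x: "a \<le> x" "x \<le> b" for x
  proof -
    note bx = bounds[OF x] and cx = clip_id[OF x]
    have lu: "box_lift M 1 (upper q D x) = (Complex x (q x), su x)"
      by (simp add: box_lift_def upper_def M_def su_def cx)
    have "M (Complex x (- q x)) = - (q x * (1 - (q x)\<^sup>2) * (4 - x\<^sup>2) * q x)"
      by (simp add: M_def cx)
    moreover have "1/2 - D x = 1 - (1/2 + D x)" by simp
    ultimately have ll: "box_lift M 1 (lower q D x) = (Complex x (- q x), 1 - su x)"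
      unfolding box_lift_def lower_def su_def using bx slide_mirror[of "1/2 + D x"] by simp
    have "2 * slide (N x (su x)) ((1 + q x)/2) - 1 = max (q x) (lev x) \<and>
        2 * slide (N x (1 - su x)) ((1 - q x)/2) - 1 = - max (q x) (lev x)"
    proof (cases "q x < lev x")
      case False
      then show ?thesis using C0[of x] cx by (simp add: N_def max_def field_simps)
    next
      case True
      then have s: "1/2 < su x" using su_gt x by auto
      have n1: "N x (su x) = C x" using s cx by (simp add: N_def)
      have "(1 - su x - 1/2) / (su x - 1/2) = -1" using s by (simp add: field_simps)
      then have n2: "N x (1 - su x) = - C x" using cx by (simp add: N_def)
      have "slide (C x) ((1 + q x)/2) = (1 + lev x)/2" unfolding C_def using True bx
        slide_to[of "(1 + q x)/2" "(1 + lev x)/2"] by (simp add: min_def)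
      moreover have "(1 - q x)/2 = 1 - (1 + q x)/2" by (simp add: field_simps)
      ultimately show ?thesis unfolding n1 n2 using True bx slide_mirror[of "(1 + q x)/2" "C x"]
        by (simp add: max_def field_simps)
    qed
    then show "box_slide_Im N 1 (box_lift M 1 (upper q D x)) = (Complex x (max (q x) (lev x)), su x)"
      "box_slide_Im N 1 (box_lift M 1 (lower q D x)) = (Complex x (- max (q x) (lev x)), 1 - su x)"
      unfolding lu ll by (auto simp: box_slide_Im_def)
  qed
  \<comment> \<open>If \<open>q a\<close> is 0, both shears are trivial to the left of
    \<open>a\<close>; for the smoothed tangle this keeps the left arc in place.\<close>
  have fixed: "box_slide_Im N 1 (box_lift M 1 (z, s)) = (z, s)" if "q a = 0" "Re z \<le> a" for z s
  proof -
    have "clip (Re z) = a" using that ab by (auto simp: clip_def)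
    then show ?thesis using that C0[of a] ends by (simp add: box_slide_Im_def box_lift_def M_def N_def complex_eq_iff field_simps)
  qed
  show ?thesis by (rule that[OF box_isotopy_compose[OF hV hH]]) (use up lo fixed su_b in auto)
qed

lemma slide_mono_arg:
  assumes "0 \<le> u" "u \<le> v" "v \<le> 1" shows "slide m u \<le> slide m v"
proof -
  have "exp m * u * ((1 - v) + exp m * v) \<le> exp m * v * ((1 - u) + exp m * u)"
  proof -
    have "exp m * v * ((1 - u) + exp m * u) - exp m * u * ((1 - v) + exp m * v) = exp m * (v - u)"
      by (simp add: algebra_simps)
    then show ?thesis using assms by (smt (verit) exp_ge_zero mult_nonneg_nonneg)
  qed
  then show ?thesis using slide_denominator_pos[of u m] slide_denominator_pos[of v m] assms
    unfolding slide_def by (simp add: divide_simps mult_ac)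
qed

text \<open>The part of the boundary of a state that lies in an edge box is \<open>banded\<close> if
  the state contains the edge and \<open>unbanded\<close> if it does not.\<close>

definition banded :: "complex set" where
  "banded = {z. \<bar>Re z\<bar> \<le> 1 \<and> \<bar>Im z\<bar> = 1/2} \<union> {z. \<bar>Re z\<bar> = 1 \<and> 1/2 \<le> \<bar>Im z\<bar> \<and> \<bar>Im z\<bar> \<le> 1}"

definition unbanded :: "complex set" where
  "unbanded = {z. \<bar>Re z\<bar> = 1 \<and> \<bar>Im z\<bar> \<le> 1}"

text \<open>With level 1/2 the separated strands become the graphs of max(\<open>q_neg\<close>, 1/2)
  and its negative: flat up to |x| = 5/6, then rising with slope 3. A shear in the real direction
  makes the slopes vertical and stretches the flat part to the full length of the band.\<close>

lemma straighten_neg: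
  obtains h where "box_isotopy h" "inj_on fst (h 1 ` trace (tangle crossing_neg))"
    "fst ` h 1 ` trace (tangle crossing_neg) = banded" "snd ` h 1 ` trace (tangle crossing_neg) \<subseteq> {0<..<1}"
proof -
  obtain h su where h: "box_isotopy h" and sub: "\<And>x. -1 \<le> x \<Longrightarrow> x \<le> 1 \<Longrightarrow> 0 < su x \<and> su x < 1"
    and hu: "\<And>x. -1 \<le> x \<Longrightarrow> x \<le> 1 \<Longrightarrow> h 1 (upper q_neg D_neg x) = (Complex x (max (q_neg x) (1/2)), su x)"
    and hl: "\<And>x. -1 \<le> x \<Longrightarrow> x \<le> 1 \<Longrightarrow> h 1 (lower q_neg D_neg x) = (Complex x (- max (q_neg x) (1/2)), 1 - su x)"
  proof (rule separate_strands[of "-1" 1 q_neg D_neg "\<lambda>_. 1/2"])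
    show "continuous_on UNIV q_neg" "continuous_on UNIV D_neg"
      unfolding q_neg_def D_neg_def by (intro continuous_intros)+
    show "-1 < q_neg x \<and> q_neg x \<le> 1 \<and> 0 \<le> D_neg x \<and> D_neg x < 1/2 \<and> 0 \<le> (1/2::real) \<and> 1/2 < (1::real)"
      if "-1 \<le> x" "x \<le> 1" for x using that D_neg_bounds[of x] by (auto simp: q_neg_def less_max_iff_disj)
    show "0 < D_neg x \<or> q_neg x \<noteq> 0" if "-1 \<le> x" "x \<le> 1" "q_neg x < 1/2" for x
      unfolding q_neg_def D_neg_def by linarith
    show "1/2 \<le> q_neg (-1)" "1/2 \<le> q_neg 1" by (auto simp: q_neg_def)
  qed auto
  \<comment> \<open>(|y| + 2) / 3 is the value of |x| for which 3 |x| - 2 equals |y|, and 5/6 is its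
    value at |y| = 1/2. The halves come from the rescaling of the interval from 0 to 2 in
    \<open>slide_about 0\<close>, which turns the target 1 into 1/2.\<close>
  define P where "P = (\<lambda>y::real. logit (1/2) - logit (max (5/6) ((\<bar>y\<bar> + 2)/3) / 2))"
  define k where "k = box_slide_Re 0 (\<lambda>y s. P y) (\<lambda>y s. P y)"
  define r where "r = (\<lambda>x. max (q_neg x) (1/2))"
  define \<psi> where "\<psi> = (\<lambda>y x. slide_about 0 (P y) (P y) x)"
  have k: "box_isotopy k" unfolding k_def
  proof (rule box_isotopy_slide_Re)
    have "continuous_on ({-1..1} \<times> {0..1::real}) (\<lambda>p. P (fst p))" unfolding P_def
      by (intro continuous_intros) (auto simp: max_def)
    then show "continuous_on ({-1..1} \<times> {0..1::real}) (\<lambda>(y, s). P y)"  "continuous_on ({-1..1} \<times> {0..1::real}) (\<lambda>(y, s). P y)"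
      by (simp_all add: split_def)
    show "\<bar>y\<bar> = 1 \<Longrightarrow> P y = 0" "\<bar>y\<bar> = 1 \<Longrightarrow> P y = 0" for y by (auto simp: P_def max_def)
  qed auto
  have Pm: "P (- y) = P y" for y by (simp add: P_def)
  have ku: "k 1 (h 1 (upper q_neg D_neg x)) = (Complex (\<psi> (r x) x) (r x), su x)"
    and kl: "k 1 (h 1 (lower q_neg D_neg x)) = (Complex (\<psi> (r x) x) (- r x), 1 - su x)" if "-1 \<le> x" "x \<le> 1" for x
    using that hu hl by (auto simp: k_def box_slide_Re_def r_def \<psi>_def Pm)
  have \<psi>1: "\<psi> (r x) x = (if 0 < x then 1 else -1)" "r x = 3 * \<bar>x\<bar> - 2" if "5/6 \<le> \<bar>x\<bar>" "\<bar>x\<bar> \<le> 1" for x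
  proof -
    show r: "r x = 3 * \<bar>x\<bar> - 2" using that unfolding r_def q_neg_def by linarith
    have "max (5/6) ((\<bar>r x\<bar> + 2)/3) = \<bar>x\<bar>" unfolding r using that by (auto simp: max_def)
    then have P: "P (r x) = logit (1/2) - logit (\<bar>x\<bar>/2)" by (simp add: P_def)
    have "slide (P (r x)) (\<bar>x\<bar>/2) = 1/2" unfolding P using that by (intro slide_to) auto
    then show "\<psi> (r x) x = (if 0 < x then 1 else -1)" using that by (cases "0 < x") (auto simp: \<psi>_def slide_about_def)
  qed
  have r2: "r x = 1/2" if "\<bar>x\<bar> \<le> 5/6" for x using that unfolding r_def q_neg_def by linarith
  have \<psi>e: "\<psi> (1/2) (5/6) = 1" "\<psi> (1/2) (-5/6) = -1"
  proof -
    have r: "r (5/6) = 1/2" "r (-5/6) = 1/2" by (rule r2; simp)+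
    show "\<psi> (1/2) (5/6) = 1" unfolding r(1)[symmetric] by (subst \<psi>1(1)) auto
    show "\<psi> (1/2) (-5/6) = -1" unfolding r(2)[symmetric] by (subst \<psi>1(1)) auto
  qed
  have \<psi>2: "\<bar>\<psi> (1/2) x\<bar> \<le> 1" if "\<bar>x\<bar> \<le> 5/6" for x
  proof -
    have "slide (P (1/2)) (\<bar>x\<bar>/2) \<le> slide (P (1/2)) ((5/6)/2)" using that by (intro slide_mono_arg) auto
    moreover have "2 * slide (P (1/2)) ((5/6)/2) = 1" using \<psi>e(1) by (simp add: \<psi>_def slide_about_def)
    moreover have "0 \<le> slide (P (1/2)) (\<bar>x\<bar>/2)" using that by (intro slide_bounds) auto
    ultimately show ?thesis by (auto simp: \<psi>_def slide_about_def abs_if split: if_splits)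
  qed
  have \<psi>3: "\<exists>x. \<bar>x\<bar> \<le> 5/6 \<and> \<psi> (1/2) x = v" if v1: "\<bar>v\<bar> \<le> 1" for v
  proof -
    have "continuous_on {-5/6..5/6} (\<psi> (1/2))" unfolding \<psi>_def
      by (intro continuous_on_slide_about continuous_intros) auto
    then obtain x where "-5/6 \<le> x" "x \<le> 5/6" "\<psi> (1/2) x = v"
      using IVT'[of "\<psi> (1/2)" "-5/6" v "5/6"] \<psi>e v1 by (auto simp: abs_le_iff)
    then show ?thesis by (intro exI[of _ x]) (auto simp: abs_le_iff)
  qed
  have \<psi>inj: "x = x'" if "\<psi> y x = \<psi> y x'" "\<bar>x\<bar> \<le> 1" "\<bar>x'\<bar> \<le> 1" for x x' y
  proof -
    have "slide_about 0 (- P y) (- P y) (\<psi> y v) = v" if "\<bar>v\<bar> \<le> 1" for v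
      unfolding \<psi>_def using that by (intro slide_about_inverse) auto
    then show ?thesis using that by metis
  qed
  have rpos: "0 < r x" for x by (simp add: r_def)
  let ?I = "{-1..1::real}"
  have im: "(\<lambda>p. k 1 (h 1 p)) ` trace (tangle crossing_neg) =
      (\<lambda>x. (Complex (\<psi> (r x) x) (r x), su x)) ` ?I \<union> (\<lambda>x. (Complex (\<psi> (r x) x) (- r x), 1 - su x)) ` ?I"
    unfolding trace_tangle_neg image_Un image_image using ku kl by (auto intro!: arg_cong2[of _ _ _ _ "(\<union>)"] image_cong)
  show ?thesis
  proof (rule that[OF box_isotopy_compose[OF h k]])
    show "snd ` (\<lambda>p. k 1 (h 1 p)) ` trace (tangle crossing_neg) \<subseteq> {0<..<1}"
      unfolding im using sub by auto
    show "inj_on fst ((\<lambda>p. k 1 (h 1 p)) ` trace (tangle crossing_neg))"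
      unfolding im
    proof (rule inj_onI)
      fix p p' assume p: "p \<in> (\<lambda>x. (Complex (\<psi> (r x) x) (r x), su x)) ` ?I \<union> (\<lambda>x. (Complex (\<psi> (r x) x) (- r x), 1 - su x)) ` ?I"
        "p' \<in> (\<lambda>x. (Complex (\<psi> (r x) x) (r x), su x)) ` ?I \<union> (\<lambda>x. (Complex (\<psi> (r x) x) (- r x), 1 - su x)) ` ?I" "fst p = fst p'"
      obtain x where x: "\<bar>x\<bar> \<le> 1" "p = (Complex (\<psi> (r x) x) (r x), su x) \<or> p = (Complex (\<psi> (r x) x) (- r x), 1 - su x)"
        using p(1) by (auto simp: abs_le_iff)
      obtain x' where x': "\<bar>x'\<bar> \<le> 1" "p' = (Complex (\<psi> (r x') x') (r x'), su x') \<or> p' = (Complex (\<psi> (r x') x') (- r x'), 1 - su x')"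
        using p(2) by (auto simp: abs_le_iff)
      have "r x = r x'" using x(2) x'(2) p(3) rpos[of x] rpos[of x'] by auto
      then have "x = x'" using \<psi>inj[of "r x" x x'] x x' p(3) by auto
      then show "p = p'" using x(2) x'(2) p(3) rpos[of x] by auto
    qed
    show "fst ` (\<lambda>p. k 1 (h 1 p)) ` trace (tangle crossing_neg) = banded"
    proof
      have "Complex (\<psi> (r x) x) (r x) \<in> banded \<and> Complex (\<psi> (r x) x) (- r x) \<in> banded" if "x \<in> ?I" for x
      proof (cases "\<bar>x\<bar> \<le> 5/6")
        case True then show ?thesis unfolding r2[OF True] using \<psi>2[OF True] by (simp add: banded_def)
      next
        case False then show ?thesis using that \<psi>1[of x] by (auto simp: banded_def abs_le_iff)
      qed
      then show "fst ` (\<lambda>p. k 1 (h 1 p)) ` trace (tangle crossing_neg) \<subseteq> banded" unfolding im by auto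
      have ex: "z \<in> fst ` ((\<lambda>x. (Complex (\<psi> (r x) x) (r x), su x)) ` ?I \<union> (\<lambda>x. (Complex (\<psi> (r x) x) (- r x), 1 - su x)) ` ?I)"
        if "\<bar>x\<bar> \<le> 1" "\<psi> (r x) x = Re z" "r x = \<bar>Im z\<bar>" for x z
      proof (cases "0 \<le> Im z")
        case True
        then have "z = Complex (\<psi> (r x) x) (r x)" using that by (simp add: complex_eq_iff)
        then show ?thesis using that(1) by (force simp: abs_le_iff)
      next
        case False
        then have "z = Complex (\<psi> (r x) x) (- r x)" using that by (simp add: complex_eq_iff)
        then show ?thesis using that(1) by (force simp: abs_le_iff)
      qed
      show "banded \<subseteq> fst ` (\<lambda>p. k 1 (h 1 p)) ` trace (tangle crossing_neg)" unfolding im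
      proof
        fix z assume "z \<in> banded"
        then consider "\<bar>Re z\<bar> \<le> 1" "\<bar>Im z\<bar> = 1/2" | "\<bar>Re z\<bar> = 1" "1/2 \<le> \<bar>Im z\<bar>" "\<bar>Im z\<bar> \<le> 1" by (auto simp: banded_def)
        then show "z \<in> fst ` ((\<lambda>x. (Complex (\<psi> (r x) x) (r x), su x)) ` ?I \<union> (\<lambda>x. (Complex (\<psi> (r x) x) (- r x), 1 - su x)) ` ?I)"
        proof cases
          case 1
          obtain x where x: "\<bar>x\<bar> \<le> 5/6" "\<psi> (1/2) x = Re z" using \<psi>3[OF 1(1)] by auto
          show ?thesis
          proof (rule ex)
            show "\<bar>x\<bar> \<le> 1" using x(1) by simp
            show "\<psi> (r x) x = Re z" "r x = \<bar>Im z\<bar>" unfolding r2[OF x(1)] using x(2) 1(2) by simp_all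
          qed
        next
          case 2
          define x where "x = Re z * ((\<bar>Im z\<bar> + 2)/3)"
          have ax: "\<bar>x\<bar> = (\<bar>Im z\<bar> + 2)/3" using 2 by (simp add: x_def abs_mult)
          have "Re z = (if 0 < x then 1 else -1)" using 2(1) by (auto simp: x_def abs_if zero_less_mult_iff split: if_splits)
          then show ?thesis using ax 2 \<psi>1[of x] by (intro ex[of x]) auto
        qed
      qed
    qed
  qed
qed

text \<open>The kink is opened to the graphs of \<open>r\<close> and its negative, which meet at the
  tip only. The inverse \<open>XR\<close> of \<open>r\<close> gives the real part of the curve at a
  prescribed |Im z|, and thereby the shear that takes it to the line Re z = 1.\<close>

lemma straighten_smooth:
  obtains h where "box_isotopy h" "inj_on fst (h 1 ` trace (tangle crossing_smooth))"
    "fst ` h 1 ` trace (tangle crossing_smooth) = unbanded" "snd ` h 1 ` trace (tangle crossing_smooth) \<subseteq> {0<..<1}"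
proof -
  \<comment> \<open>The line through the tip (-3/8, 0) and the point (7/8, 5/8), where it meets the
    last piece 3 x - 2 of \<open>q_smooth\<close>. It has to vanish at the tip, where
    \<open>q_smooth\<close> is 0, and to increase, so that the opened graph can be inverted.\<close>
  define lev where "lev = (\<lambda>x::real. x/2 + 3/16)"
  obtain h su where h: "box_isotopy h" and sub: "\<And>x. -3/8 \<le> x \<Longrightarrow> x \<le> 1 \<Longrightarrow> 0 < su x \<and> su x < 1"
    and hu: "\<And>x. -3/8 \<le> x \<Longrightarrow> x \<le> 1 \<Longrightarrow> h 1 (upper q_smooth D_smooth x) = (Complex x (max (q_smooth x) (lev x)), su x)"
    and hl: "\<And>x. -3/8 \<le> x \<Longrightarrow> x \<le> 1 \<Longrightarrow> h 1 (lower q_smooth D_smooth x) = (Complex x (- max (q_smooth x) (lev x)), 1 - su x)"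
    and hf: "\<And>z s. q_smooth (-3/8) = 0 \<Longrightarrow> z \<in> edge_box \<Longrightarrow> s \<in> {0..1} \<Longrightarrow> Re z \<le> -3/8 \<Longrightarrow> h 1 (z, s) = (z, s)"
  proof (rule separate_strands[of "-3/8" 1 q_smooth D_smooth lev])
    show "continuous_on UNIV q_smooth" "continuous_on UNIV D_smooth" "continuous_on UNIV lev"
      unfolding q_smooth_def D_smooth_def lev_def by (intro continuous_intros; simp)+
    show "-1 < q_smooth x \<and> q_smooth x \<le> 1 \<and> 0 \<le> D_smooth x \<and> D_smooth x < 1/2 \<and> 0 \<le> lev x \<and> lev x < 1"
      if "-3/8 \<le> x" "x \<le> 1" for x using that D_smooth_bounds[of x] by (auto simp: q_smooth_def lev_def less_max_iff_disj)
    show "0 < D_smooth x \<or> q_smooth x \<noteq> 0" if "-3/8 \<le> x" "x \<le> 1" "q_smooth x < lev x" for x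
      using that unfolding q_smooth_def D_smooth_def lev_def by linarith
    show "lev (-3/8) \<le> q_smooth (-3/8)" "lev 1 \<le> q_smooth 1" by (auto simp: q_smooth_def lev_def)
  qed auto
  have q0: "q_smooth (-3/8) = 0" "D_smooth (-3/8) = 0" by (auto simp: q_smooth_def D_smooth_def)
  define XR where "XR = (\<lambda>y::real. min ((\<bar>y\<bar> + 2)/3) (2 * \<bar>y\<bar> - 3/8))"
  \<comment> \<open>The shear is about the line Re z = -1/2, which separates the left arc, with real
    part at most -5/8, from the kink, with real part at least -3/8. The two sides have lengths 3/2
    and 5/2; relative to them -1 lies at 1/3 and 1 at 3/5.\<close>
  define P where "P = (\<lambda>y::real. logit (1/3) - logit ((- 1/2 - left_end y) / (3/2)))"
  define Q where "Q = (\<lambda>y::real. logit (3/5) - logit ((XR y + 1/2) / (5/2)))"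
  define k where "k = box_slide_Re (-1/2) (\<lambda>y s. P y) (\<lambda>y s. Q y)"
  define r where "r = (\<lambda>x. max (q_smooth x) (lev x))"
  have XRb: "-3/8 \<le> XR y" "XR y \<le> 1" if "\<bar>y\<bar> \<le> 1" for y using that unfolding XR_def min_def by auto
  have leb: "-1 \<le> left_end y" "left_end y \<le> -5/8" if "\<bar>y\<bar> \<le> 1" for y using that unfolding left_end_def max_def by auto
  have k: "box_isotopy k" unfolding k_def
  proof (rule box_isotopy_slide_Re)
    have "continuous_on ({-1..1} \<times> {0..1::real}) (\<lambda>p. P (fst p))" unfolding P_def
    proof (intro continuous_intros)
      show "continuous_on ({-1..1} \<times> {0..1::real}) (\<lambda>p. left_end (fst p))" unfolding left_end_def by (intro continuous_intros) auto
      show "x \<in> {-1..1} \<times> {0..1::real} \<Longrightarrow> 0 < (- 1/2 - left_end (fst x)) / (3/2) \<and> (- 1/2 - left_end (fst x)) / (3/2) < 1" for x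
        using leb[of "fst x"] by (auto simp: abs_le_iff)
    qed auto
    then show "continuous_on ({-1..1} \<times> {0..1::real}) (\<lambda>(y, s). P y)" by (simp add: split_def)
    have "continuous_on ({-1..1} \<times> {0..1::real}) (\<lambda>p. Q (fst p))" unfolding Q_def
    proof (intro continuous_intros)
      show "continuous_on ({-1..1} \<times> {0..1::real}) (\<lambda>p. XR (fst p))" unfolding XR_def by (intro continuous_intros) auto
      show "x \<in> {-1..1} \<times> {0..1::real} \<Longrightarrow> 0 < (XR (fst x) + 1/2) / (5/2) \<and> (XR (fst x) + 1/2) / (5/2) < 1" for x
        using XRb[of "fst x"] by (auto simp: abs_le_iff)
    qed auto
    then show "continuous_on ({-1..1} \<times> {0..1::real}) (\<lambda>(y, s). Q y)" by (simp add: split_def)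
    show "\<bar>y\<bar> = 1 \<Longrightarrow> P y = 0" "\<bar>y\<bar> = 1 \<Longrightarrow> Q y = 0" for y by (auto simp: P_def Q_def XR_def left_end_def max_def)
  qed auto
  have Qm: "Q (- y) = Q y" for y by (simp add: Q_def XR_def)
  have r_eq: "r x = (if x \<le> 7/8 then x/2 + 3/16 else 3 * x - 2)" if "-3/8 \<le> x" for x
  proof (cases "x \<le> 7/8")
    case True
    then have "q_smooth x \<le> lev x" using that by (auto simp: q_smooth_def lev_def)
    then show ?thesis using True by (simp add: r_def lev_def max_def)
  next
    case False
    then have "q_smooth x = 3 * x - 2" by (simp add: q_smooth_def max_def)
    then show ?thesis using False by (simp add: r_def lev_def max_def)
  qed
  have XRr: "XR (r x) = x" "0 \<le> r x" "r x \<le> 1" if "-3/8 \<le> x" "x \<le> 1" for x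
    using that by (auto simp: XR_def r_eq min_def)
  have rXR: "r (XR y) = y" if "0 \<le> y" "y \<le> 1" for y
    using that XRb[of y] by (subst r_eq) (auto simp: XR_def min_def field_simps)
  have sa: "slide_about (-1/2) (P (r x)) (Q (r x)) x = 1" "slide_about (-1/2) (P (- r x)) (Q (- r x)) x = 1" if "-3/8 \<le> x" "x \<le> 1" for x
  proof -
    have "slide (Q (r x)) ((x + 1/2) / (5/2)) = 3/5" unfolding Q_def XRr(1)[OF that] using that by (intro slide_to) auto
    then show "slide_about (-1/2) (P (r x)) (Q (r x)) x = 1" "slide_about (-1/2) (P (- r x)) (Q (- r x)) x = 1"
      using that unfolding Qm by (auto simp: slide_about_def)
  qed
  have ku: "k 1 (h 1 (upper q_smooth D_smooth x)) = (Complex 1 (r x), su x)"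
    and kl: "k 1 (h 1 (lower q_smooth D_smooth x)) = (Complex 1 (- r x), 1 - su x)" if "-3/8 \<le> x" "x \<le> 1" for x
    using hu[OF that] hl[OF that] sa[OF that] by (simp_all add: k_def box_slide_Re_def r_def)
  have kle: "k 1 (h 1 (Complex (left_end y) y, 1/2)) = (Complex (-1) y, 1/2)" if "\<bar>y\<bar> \<le> 1" for y
  proof -
    have "h 1 (Complex (left_end y) y, 1/2) = (Complex (left_end y) y, 1/2)"
      by (rule hf) (use leb[OF that] that q0 in \<open>auto simp: edge_box_def\<close>)
    moreover have "slide (P y) ((- 1/2 - left_end y) / (3/2)) = 1/3" unfolding P_def using leb[OF that] by (intro slide_to) auto
    ultimately show ?thesis using leb[OF that] by (simp add: k_def box_slide_Re_def slide_about_def)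
  qed
  \<comment> \<open>Both graphs pass through the tip, so its final height is its own mirror image.
    This settles injectivity of the projection at the one point where the graphs meet.\<close>
  have tip: "su (-3/8) = 1/2"
  proof -
    have "upper q_smooth D_smooth (-3/8) = lower q_smooth D_smooth (-3/8)" unfolding upper_def lower_def q0 by simp
    then show ?thesis using hu[of "-3/8"] hl[of "-3/8"] by simp
  qed
  let ?I = "{-3/8..1::real}"
  have im: "(\<lambda>p. k 1 (h 1 p)) ` trace (tangle crossing_smooth) =
      (\<lambda>x. (Complex 1 (r x), su x)) ` ?I \<union> (\<lambda>x. (Complex 1 (- r x), 1 - su x)) ` ?I \<union> (\<lambda>y. (Complex (-1) y, 1/2)) ` {-1..1}"
    unfolding trace_tangle_smooth image_Un image_image using ku kl kle
    by (auto intro!: arg_cong2[of _ _ _ _ "(\<union>)"] image_cong simp: abs_le_iff)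
  show ?thesis
  proof (rule that[OF box_isotopy_compose[OF h k]])
    show "snd ` (\<lambda>p. k 1 (h 1 p)) ` trace (tangle crossing_smooth) \<subseteq> {0<..<1}"
      unfolding im using sub by auto
    show "inj_on fst ((\<lambda>p. k 1 (h 1 p)) ` trace (tangle crossing_smooth))"
      unfolding im
    proof (rule inj_onI)
      fix p p' assume p: "p \<in> (\<lambda>x. (Complex 1 (r x), su x)) ` ?I \<union> (\<lambda>x. (Complex 1 (- r x), 1 - su x)) ` ?I \<union> (\<lambda>y. (Complex (-1) y, 1/2)) ` {-1..1}"
        "p' \<in> (\<lambda>x. (Complex 1 (r x), su x)) ` ?I \<union> (\<lambda>x. (Complex 1 (- r x), 1 - su x)) ` ?I \<union> (\<lambda>y. (Complex (-1) y, 1/2)) ` {-1..1}" "fst p = fst p'"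
      have same: "snd p = snd p'" if "x \<in> ?I" "x' \<in> ?I" "p = (Complex 1 (r x), su x) \<or> p = (Complex 1 (- r x), 1 - su x)"
         "p' = (Complex 1 (r x'), su x') \<or> p' = (Complex 1 (- r x'), 1 - su x')" for x x'
      proof -
        have rr: "r x = r x'" using that p(3) XRr(2)[of x] XRr(2)[of x'] by auto
        then have xx: "x = x'" using XRr(1)[of x] XRr(1)[of x'] that(1,2) by (metis atLeastAtMost_iff)
        show ?thesis
        proof (cases "r x = 0")
          case True
          then have "x = -3/8" using XRr(1)[of x] that(1) by (auto simp: XR_def)
          then show ?thesis using that(3,4) xx tip by auto
        qed (use that(3,4) xx p(3) in auto)
      qed
      consider "Re (fst p) = 1" | "Re (fst p) = -1" using p(1) by auto
      then have "snd p = snd p'"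
      proof cases
        case 1
        then have "Re (fst p') = 1" using p(3) by simp
        then obtain x' where x': "x' \<in> ?I" "p' = (Complex 1 (r x'), su x') \<or> p' = (Complex 1 (- r x'), 1 - su x')"
          using p(2) by auto
        obtain x where "x \<in> ?I" "p = (Complex 1 (r x), su x) \<or> p = (Complex 1 (- r x), 1 - su x)"
          using p(1) 1 by auto
        then show ?thesis using same x' by blast
      next
        case 2
        then have "Re (fst p') = -1" using p(3) by simp
        then show ?thesis using 2 p(1,2) by auto
      qed
      then show "p = p'" using p(3) by (simp add: prod_eq_iff)
    qed
    show "fst ` (\<lambda>p. k 1 (h 1 p)) ` trace (tangle crossing_smooth) = unbanded"
    proof
      show "fst ` (\<lambda>p. k 1 (h 1 p)) ` trace (tangle crossing_smooth) \<subseteq> unbanded"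
      proof -
        have "\<bar>r x\<bar> \<le> 1" if "x \<in> ?I" for x using XRr(2,3)[of x] that by auto
        then show ?thesis unfolding im by (auto simp: unbanded_def abs_le_iff)
      qed
      show "unbanded \<subseteq> fst ` (\<lambda>p. k 1 (h 1 p)) ` trace (tangle crossing_smooth)" unfolding im
      proof
        fix z assume z: "z \<in> unbanded"
        have x: "XR \<bar>Im z\<bar> \<in> ?I" "r (XR \<bar>Im z\<bar>) = \<bar>Im z\<bar>" using XRb[of "\<bar>Im z\<bar>"] rXR[of "\<bar>Im z\<bar>"] z by (auto simp: unbanded_def)
        have "z = Complex (-1) (Im z) \<and> Im z \<in> {-1..1} \<or> z = Complex 1 (r (XR \<bar>Im z\<bar>)) \<or> z = Complex 1 (- r (XR \<bar>Im z\<bar>))"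
          using z x(2) by (auto simp: unbanded_def complex_eq_iff abs_if split: if_splits)
        then show "z \<in> fst ` ((\<lambda>x. (Complex 1 (r x), su x)) ` ?I \<union> (\<lambda>x. (Complex 1 (- r x), 1 - su x)) ` ?I \<union> (\<lambda>y. (Complex (-1) y, 1/2)) ` {-1..1})"
          using x(1) by (force simp del: atLeastAtMost_iff)
      qed
    qed
  qed
qed

section \<open>Skein triples\<close>

definition corners :: "complex set" where
  "corners = {z. \<bar>Re z\<bar> = 1 \<and> \<bar>Im z\<bar> = 1}"

definition strand_pp :: "real \<Rightarrow> complex knot" where
  "strand_pp \<epsilon> = strand \<epsilon> (Complex (-1) (-1)) (Complex 1 1)"
definition strand_pm :: "real \<Rightarrow> complex knot" where
  "strand_pm \<epsilon> = strand \<epsilon> (Complex 1 (-1)) (Complex (-1) 1)"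

lemma strand_pp_eq: "strand_pp \<epsilon> s = (Complex (2 * s - 1) (2 * s - 1), 1/2 + \<epsilon> * min s (1 - s))"
  by (simp add: strand_pp_def strand_def linepath_def complex_eq_iff)
lemma strand_pm_eq: "strand_pm \<epsilon> s = (Complex (1 - 2 * s) (2 * s - 1), 1/2 + \<epsilon> * min s (1 - s))"
  by (simp add: strand_pm_def strand_def linepath_def complex_eq_iff)

lemma crossing_pos_eq: "crossing_pos = {strand_pp (1/2), strand_pm (-1/2)}"
  by (simp add: crossing_pos_def strand_pp_def strand_pm_def)
lemma crossing_neg_eq: "crossing_neg = {strand_pp (-1/2), strand_pm (1/2)}"
  by (simp add: crossing_neg_def strand_pp_def strand_pm_def)

definition smooth_left :: "complex knot" where
  "smooth_left = strand 0 (Complex (-1) (-1)) (Complex (-1/2) 0) +++ strand 0 (Complex (-1/2) 0) (Complex (-1) 1)"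
definition smooth_right :: "complex knot" where
  "smooth_right = strand 0 (Complex 1 (-1)) (Complex (1/2) 0) +++ strand 0 (Complex (1/2) 0) (Complex 1 1)"

lemma path_strand: "path (strand \<epsilon> a b)"
  unfolding path_def strand_def by (intro continuous_intros)

lemma strand_ends [simp]: "pathstart (strand \<epsilon> a b) = (a, 1/2)" "pathfinish (strand \<epsilon> a b) = (b, 1/2)"
  by (auto simp: pathstart_def pathfinish_def strand_def linepath_def)

lemma arc_strand: "a \<noteq> b \<Longrightarrow> arc (strand \<epsilon> a b)"
  using arc_linepath[of a b] path_strand[of \<epsilon> a b] unfolding arc_def inj_on_def strand_def by auto

lemma strand_0_image: "path_image (strand 0 a b) = closed_segment a b \<times> {1/2}"
  unfolding path_image_def strand_def linepath_image_01[symmetric] by auto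

lemma Re_closed_segment: "z \<in> closed_segment a b \<Longrightarrow> min (Re a) (Re b) \<le> Re z \<and> Re z \<le> max (Re a) (Re b)"
proof -
  assume "z \<in> closed_segment a b"
  then obtain u where u: "0 \<le> u" "u \<le> 1" "z = (1 - u) *\<^sub>R a + u *\<^sub>R b" by (auto simp: closed_segment_def)
  have "Re z \<in> closed_segment (Re a) (Re b)" unfolding closed_segment_def using u by (intro CollectI exI[of _ u]) auto
  then show ?thesis by (auto simp: closed_segment_eq_real_ivl split: if_splits)
qed

lemma Im_closed_segment: "z \<in> closed_segment a b \<Longrightarrow> min (Im a) (Im b) \<le> Im z \<and> Im z \<le> max (Im a) (Im b)"
proof -
  assume "z \<in> closed_segment a b"
  then obtain u where u: "0 \<le> u" "u \<le> 1" "z = (1 - u) *\<^sub>R a + u *\<^sub>R b" by (auto simp: closed_segment_def)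
  have "Im z \<in> closed_segment (Im a) (Im b)" unfolding closed_segment_def using u by (intro CollectI exI[of _ u]) auto
  then show ?thesis by (auto simp: closed_segment_eq_real_ivl split: if_splits)
qed

lemma Re_Im_closed_segment: "z \<in> closed_segment a b \<Longrightarrow>
   (min (Re a) (Re b) \<le> Re z \<and> Re z \<le> max (Re a) (Re b)) \<and> min (Im a) (Im b) \<le> Im z \<and> Im z \<le> max (Im a) (Im b)"
  using Re_closed_segment Im_closed_segment by blast

lemma smooth_arcs:
  "arc smooth_left" "arc smooth_right"
  "path_image smooth_left \<subseteq> {z. \<bar>Re z\<bar> \<le> 1 \<and> \<bar>Im z\<bar> \<le> 1 \<and> Re z < 0} \<times> {1/2}"
  "path_image smooth_right \<subseteq> {z. \<bar>Re z\<bar> \<le> 1 \<and> \<bar>Im z\<bar> \<le> 1 \<and> 0 < Re z} \<times> {1/2}"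
  "pathstart smooth_left = (Complex (-1) (-1), 1/2)" "pathfinish smooth_left = (Complex (-1) 1, 1/2)"
  "pathstart smooth_right = (Complex 1 (-1), 1/2)" "pathfinish smooth_right = (Complex 1 1, 1/2)"
proof -
  have il: "path_image smooth_left = closed_segment (Complex (-1) (-1)) (Complex (-1/2) 0) \<times> {1/2} \<union>
      closed_segment (Complex (-1/2) 0) (Complex (-1) 1) \<times> {1/2}"
    unfolding smooth_left_def by (simp add: path_image_join strand_0_image)
  have ir: "path_image smooth_right = closed_segment (Complex 1 (-1)) (Complex (1/2) 0) \<times> {1/2} \<union>
      closed_segment (Complex (1/2) 0) (Complex 1 1) \<times> {1/2}"
    unfolding smooth_right_def by (simp add: path_image_join strand_0_image)
  show "path_image smooth_left \<subseteq> {z. \<bar>Re z\<bar> \<le> 1 \<and> \<bar>Im z\<bar> \<le> 1 \<and> Re z < 0} \<times> {1/2}"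
    unfolding il by (auto dest!: Re_Im_closed_segment simp: abs_le_iff)
  show "path_image smooth_right \<subseteq> {z. \<bar>Re z\<bar> \<le> 1 \<and> \<bar>Im z\<bar> \<le> 1 \<and> 0 < Re z} \<times> {1/2}"
    unfolding ir by (auto dest!: Re_Im_closed_segment simp: abs_le_iff)
  \<comment> \<open>The imaginary part increases along both segments, so they can meet in their
    common end only.\<close>
  have s0: "z = c" if sc: "z \<in> closed_segment a c" "z \<in> closed_segment c b" "Im a < Im c" "Im c < Im b" for z a b c
  proof -
    obtain u where u: "0 \<le> u" "z = (1 - u) *\<^sub>R a + u *\<^sub>R c" using sc(1) by (auto simp: closed_segment_def)
    have "Im z = Im c" using Im_closed_segment[OF sc(1)] Im_closed_segment[OF sc(2)] sc by auto
    then have "(1 - u) * (Im c - Im a) = 0" using u(2) by (simp add: algebra_simps)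
    then have "u = 1" using sc by simp
    then show ?thesis using u by simp
  qed
  show "arc smooth_left" unfolding smooth_left_def
    by (rule arc_join[OF arc_strand arc_strand]) (auto simp: strand_0_image dest: s0)
  show "arc smooth_right" unfolding smooth_right_def
    by (rule arc_join[OF arc_strand arc_strand]) (auto simp: strand_0_image dest: s0)
qed (auto simp: smooth_left_def smooth_right_def)

lemma strand_square:
  "s \<in> {0..1} \<Longrightarrow> fst (strand_pp \<epsilon> s) \<in> square" "s \<in> {0..1} \<Longrightarrow> fst (strand_pm \<epsilon> s) \<in> square"
  by (auto simp: strand_pp_eq strand_pm_eq square_def)

lemma trace_crossing:
  assumes "X \<in> {crossing_pos, crossing_neg, crossing_smooth}" "p \<in> trace X"
  shows "fst p \<in> square" "1/4 \<le> snd p" "snd p \<le> 3/4" "fst p \<notin> open_square \<or> X = crossing_smooth \<Longrightarrow> snd p = 1/2"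
proof -
  have half: "\<bar>1/2::real\<bar> = 1/2" "\<bar>-1/2::real\<bar> = 1/2" by simp_all
  have m: "0 \<le> min s (1 - s)" "min s (1 - s) \<le> 1/2" if "s \<in> {0..1}" for s :: real using that by (auto simp: min_def)
  have mo: "min s (1 - s) = 0" if "s \<in> {0..1}" "Complex (2 * s-1) (2 * s-1) \<notin> open_square \<or> Complex (1-2 * s) (2 * s-1) \<notin> open_square" for s :: real
  proof -
    have "s = 0 \<or> s = 1" using that by (auto simp: open_square_def)
    then show ?thesis by auto
  qed
  have "fst p \<in> square \<and> 1/4 \<le> snd p \<and> snd p \<le> 3/4 \<and> (fst p \<notin> open_square \<or> X = crossing_smooth \<longrightarrow> snd p = 1/2)"
  proof (cases "X = crossing_smooth")
    case True
    then show ?thesis using assms(2)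
      by (auto simp: crossing_smooth_def strand_0_image square_def abs_le_iff dest!: Re_Im_closed_segment)
  next
    case False
    then obtain \<epsilon> s where es: "\<bar>\<epsilon>\<bar> = 1/2" "s \<in> {0..1}" "p = strand_pp \<epsilon> s \<or> p = strand_pm \<epsilon> s"
    proof -
      have "\<exists>\<epsilon>. \<bar>\<epsilon>\<bar> = 1/2 \<and> (p \<in> path_image (strand_pp \<epsilon>) \<or> p \<in> path_image (strand_pm \<epsilon>))"
      proof (cases "X = crossing_pos")
        case True
        then have "p \<in> path_image (strand_pp (1/2)) \<or> p \<in> path_image (strand_pm (-1/2))"
          using assms(2) by (simp add: crossing_pos_eq)
        then show ?thesis using half by blast
      next
        case False
        then have "p \<in> path_image (strand_pp (-1/2)) \<or> p \<in> path_image (strand_pm (1/2))"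
          using assms \<open>X \<noteq> crossing_smooth\<close> by (auto simp: crossing_neg_eq)
        then show ?thesis using half by blast
      qed
      then show ?thesis using that unfolding path_image_def by blast
    qed
    have "\<bar>\<epsilon> * min s (1 - s)\<bar> = 1/2 * \<bar>min s (1 - s)\<bar>" unfolding abs_mult es(1) ..
    then have "\<bar>\<epsilon> * min s (1 - s)\<bar> \<le> 1/4" using m[OF es(2)] by simp
    moreover have "fst p \<in> square" using es strand_square by auto
    moreover have "min s (1 - s) = 0" if "fst p \<notin> open_square"
      by (rule mo[OF es(2)]) (use es(3) that in \<open>auto simp: strand_pp_eq strand_pm_eq\<close>)
    ultimately show ?thesis using es(3) False by (auto simp: strand_pp_eq strand_pm_eq abs_le_iff)
  qed
  then show "fst p \<in> square" "1/4 \<le> snd p" "snd p \<le> 3/4" "fst p \<notin> open_square \<or> X = crossing_smooth \<Longrightarrow> snd p = 1/2" by auto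
qed

lemma corners_in_crossing:
  assumes "X \<in> {crossing_pos, crossing_neg, crossing_smooth}" shows "corners \<times> {1/2} \<subseteq> trace X"
proof
  fix p :: "complex \<times> real" assume "p \<in> corners \<times> {1/2}"
  then have p: "p = (Complex 1 1, 1/2) \<or> p = (Complex 1 (-1), 1/2) \<or> p = (Complex (-1) 1, 1/2) \<or> p = (Complex (-1) (-1), 1/2)"
    by (cases p) (auto simp: corners_def complex_eq_iff abs_if split: if_splits)
  have "(a, 1/2) \<in> path_image (strand \<epsilon> a b)" "(b, 1/2) \<in> path_image (strand \<epsilon> a b)" for a b \<epsilon>
    by (metis pathstart_in_path_image strand_ends(1)) (metis pathfinish_in_path_image strand_ends(2))
  then show "p \<in> trace X" using p assms by (auto simp: crossing_pos_def crossing_neg_def crossing_smooth_def)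
qed

section \<open>Transport of arcs and loops along maps\<close>

lemma trace_place: "trace (place \<phi> T) = map_prod \<phi> id ` trace T"
  by (auto simp: trace_def place_def path_image_compose)

lemma place_Un: "place \<phi> (T \<union> T') = place \<phi> T \<union> place \<phi> T'" by (auto simp: place_def)

lemma place_place: "place \<phi> (place \<psi> T) = place (\<phi> \<circ> \<psi>) T"
  by (force simp: place_def image_image o_def map_prod_def split_def)

lemma arc_place:
  assumes "arc a" "path_image a \<subseteq> Q \<times> UNIV" "continuous_on Q \<phi>" "inj_on \<phi> Q"
  shows "arc (map_prod \<phi> id \<circ> a :: real \<Rightarrow> 'a::topological_space \<times> real)"
  unfolding arc_def
proof
  have c: "continuous_on (Q \<times> UNIV) (map_prod \<phi> (id::real\<Rightarrow>real))"
    unfolding map_prod_def split_def id_def by (intro continuous_intros continuous_on_compose2[OF assms(3)]) auto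
  show "path (map_prod \<phi> id \<circ> a)"
    using assms(1) continuous_on_subset[OF c assms(2)] by (intro path_continuous_image) (auto simp: arc_def)
  have "inj_on (map_prod \<phi> (id::real\<Rightarrow>real)) (Q \<times> UNIV)" using assms(4) by (auto simp: inj_on_def)
  then show "inj_on (map_prod \<phi> id \<circ> a) {0..1}"
    using assms(1,2) unfolding arc_def path_image_def by (intro comp_inj_on) (auto intro: inj_on_subset)
qed

lemma closed_curves_loop_system:
  "loop_system \<A> L \<longleftrightarrow> closed_curves L \<and> L \<noteq> {} \<and> trace L \<subseteq> surface_interior \<A> \<times> {0<..<1}"
  by (auto simp: loop_system_def closed_curves_def trace_def)

lemma compact_trace: "closed_curves L \<Longrightarrow> compact (trace L)"
  unfolding trace_def closed_curves_def by (intro compact_UN) (auto intro: compact_path_image simple_path_imp_path)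

text \<open>Only the restriction of \<open>f\<close> to the trace counts, so that a map may be used
  which makes sense on the link but is not continuous on the thickened surface.\<close>

lemma closed_curves_image:
  assumes L: "closed_curves L" and f: "continuous_on (trace L) f" "inj_on f (trace L)"
  shows "closed_curves ((\<lambda>\<gamma>. f \<circ> \<gamma>) ` L)" "trace ((\<lambda>\<gamma>. f \<circ> \<gamma>) ` L) = f ` trace L"
    "card ((\<lambda>\<gamma>. f \<circ> \<gamma>) ` L) = card L"
proof -
  have sub: "path_image \<gamma> \<subseteq> trace L" if "\<gamma> \<in> L" for \<gamma> using that by (auto simp: trace_def)
  show "trace ((\<lambda>\<gamma>. f \<circ> \<gamma>) ` L) = f ` trace L" by (auto simp: trace_def path_image_compose)
  have d: "path_image \<gamma> \<inter> path_image \<delta> = {}" if "\<gamma> \<in> L" "\<delta> \<in> L" "\<gamma> \<noteq> \<delta>" for \<gamma> \<delta>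
    using L that by (auto simp: closed_curves_def pairwise_def disjnt_def)
  have d': "f ` path_image \<gamma> \<inter> f ` path_image \<delta> = {}" if "\<gamma> \<in> L" "\<delta> \<in> L" "\<gamma> \<noteq> \<delta>" for \<gamma> \<delta>
    using d[OF that] sub[OF that(1)] sub[OF that(2)] f(2) unfolding inj_on_def by blast
  show "closed_curves ((\<lambda>\<gamma>. f \<circ> \<gamma>) ` L)" unfolding closed_curves_def
  proof (intro conjI ballI)
    show "finite ((\<lambda>\<gamma>. f \<circ> \<gamma>) ` L)" using L by (auto simp: closed_curves_def)
    fix \<delta> assume "\<delta> \<in> (\<lambda>\<gamma>. f \<circ> \<gamma>) ` L"
    then obtain \<gamma> where \<gamma>: "\<gamma> \<in> L" "\<delta> = f \<circ> \<gamma>" by auto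
    show "simple_path \<delta>" unfolding \<gamma>(2) using L \<gamma>(1) sub[OF \<gamma>(1)] f
      by (intro simple_path_continuous_image) (auto simp: closed_curves_def intro: continuous_on_subset inj_on_subset)
    show "pathfinish \<delta> = pathstart \<delta>" using L \<gamma> by (auto simp: closed_curves_def pathfinish_def pathstart_def)
  next
    show "pairwise (\<lambda>\<gamma> \<gamma>'. disjnt (path_image \<gamma>) (path_image \<gamma>')) ((\<lambda>\<gamma>. f \<circ> \<gamma>) ` L)"
      using d' by (auto simp: pairwise_def disjnt_def path_image_compose)
  qed
  have "inj_on (\<lambda>\<gamma>. f \<circ> \<gamma>) L"
  proof (rule inj_onI)
    fix \<gamma> \<delta> assume *: "\<gamma> \<in> L" "\<delta> \<in> L" "f \<circ> \<gamma> = f \<circ> \<delta>"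
    then have "f ` path_image \<gamma> = f ` path_image \<delta>" by (metis path_image_compose)
    then show "\<gamma> = \<delta>" using d'[OF *(1,2)] by (metis Int_absorb image_is_empty path_image_nonempty)
  qed
  then show "card ((\<lambda>\<gamma>. f \<circ> \<gamma>) ` L) = card L" by (rule card_image)
qed

text \<open>Heights are reflected in 1/2 over the crossing square and kept elsewhere. On the rim of
  the square, and on \<open>C\<close> over the square, the height is 1/2 already; so this is a
  continuous injection of the trace, which exchanges the two kinds of crossing and respects the
  course of every loop.\<close>

lemma skein_switch:
  fixes \<phi> :: "complex \<Rightarrow> 'a::metric_space"
  assumes \<phi>: "continuous_on square \<phi>" "inj_on \<phi> square" and op: "openin (top_of_set \<Sigma>) (\<phi> ` open_square)"
    and C: "trace C \<inter> (\<phi> ` square \<times> UNIV) \<subseteq> \<phi> ` corners \<times> {1/2}"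
    and L: "closed_curves L" "trace L \<subseteq> \<Sigma> \<times> {0<..<1}" "carries L (C \<union> place \<phi> crossing_pos)"
  shows "\<exists>L'. closed_curves L' \<and> (L \<noteq> {} \<longrightarrow> L' \<noteq> {}) \<and> carries L' (C \<union> place \<phi> crossing_neg)"
proof -
  define \<Psi> where "\<Psi> = (\<lambda>p::'a \<times> real. if fst p \<in> \<phi> ` square then (fst p, 1 - snd p) else p)"
  have os: "open_square \<subseteq> square" by (auto simp: open_square_def square_def)
  have tr: "trace L = trace C \<union> trace (place \<phi> crossing_pos)" using L(3) by (simp add: carries_def)
  have half: "snd p = 1/2" if p: "p \<in> trace L" "fst p \<in> \<phi> ` square" "fst p \<notin> \<phi> ` open_square \<or> p \<in> trace C" for p
  proof (cases "p \<in> trace C")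
    case True then show ?thesis using C p by (cases p) auto
  next
    case False
    then obtain q where q: "q \<in> trace crossing_pos" "p = map_prod \<phi> id q" using p tr by (auto simp: trace_place)
    have "fst q \<notin> open_square" using p False q by (cases q) auto
    then show ?thesis using trace_crossing(4)[OF _ q(1)] q(2) by (cases q) auto
  qed
  have "closedin (top_of_set (trace L)) (trace L \<inter> (\<phi> ` square \<times> UNIV))"
  proof -
    have "closed (\<phi> ` square)"
    proof -
      have "square = cbox (Complex (-1) (-1)) (Complex 1 1)"
        by (auto simp: square_def in_cbox_complex_iff abs_le_iff)
      then have "compact square" by (metis compact_cbox)
      then show ?thesis using \<phi>(1) by (intro compact_imp_closed compact_continuous_image)
    qed
    then show ?thesis by (intro closedin_closed_Int closed_Times) auto
  qed
  moreover have "closedin (top_of_set (trace L)) (trace L \<inter> ((\<Sigma> - \<phi> ` open_square) \<times> UNIV))"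
  proof -
    have "closedin (top_of_set \<Sigma>) (\<Sigma> - \<phi> ` open_square)" using op by (metis closedin_diff closedin_topspace topspace_euclidean_subtopology)
    then have "closedin (top_of_set (\<Sigma> \<times> (UNIV::real set))) ((\<Sigma> - \<phi> ` open_square) \<times> UNIV)" by (intro closedin_Times) auto
    then obtain T where T: "closed T" "(\<Sigma> - \<phi> ` open_square) \<times> UNIV = \<Sigma> \<times> (UNIV::real set) \<inter> T" by (auto simp: closedin_closed)
    have "trace L \<inter> ((\<Sigma> - \<phi> ` open_square) \<times> UNIV) = trace L \<inter> T" unfolding T(2) using L(2) by auto
    then show ?thesis using T(1) by (auto simp: closedin_closed)
  qed
  ultimately have cont: "continuous_on (trace L) \<Psi>"
  proof -
    assume cl: "closedin (top_of_set (trace L)) (trace L \<inter> (\<phi> ` square \<times> UNIV))"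
      "closedin (top_of_set (trace L)) (trace L \<inter> ((\<Sigma> - \<phi> ` open_square) \<times> UNIV))"
    have un: "trace L = (trace L \<inter> (\<phi> ` square \<times> UNIV)) \<union> (trace L \<inter> ((\<Sigma> - \<phi> ` open_square) \<times> UNIV))" (is "_ = ?A \<union> ?B")
      using L(2) os by force
    have "continuous_on (?A \<union> ?B) (\<lambda>p. if fst p \<in> \<phi> ` square then (fst p, 1 - snd p) else p)"
    proof (rule continuous_on_cases_local)
      show "closedin (top_of_set (?A \<union> ?B)) ?A" "closedin (top_of_set (?A \<union> ?B)) ?B" using cl un by auto
      fix p assume "p \<in> ?A \<and> fst p \<notin> \<phi> ` square \<or> p \<in> ?B \<and> fst p \<in> \<phi> ` square"
      then have "snd p = 1/2" using half[of p] by auto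
      then show "(fst p, 1 - snd p) = p" by (cases p) auto
    qed (intro continuous_intros)+
    then show ?thesis unfolding \<Psi>_def using un by simp
  qed
  have inj: "inj_on \<Psi> (trace L)" by (auto simp: inj_on_def \<Psi>_def prod_eq_iff split: if_splits)
  have \<Psi>C: "\<Psi> p = p" if "p \<in> trace C" for p
    using half[of p] that tr by (auto simp: \<Psi>_def prod_eq_iff)
  have fsq: "fst (strand_pp \<epsilon> s) \<in> square" "fst (strand_pm \<epsilon> s) \<in> square" if "s \<in> {0..1}" for \<epsilon> s using strand_square that by auto
  have \<Psi>s: "\<Psi> ((map_prod \<phi> id \<circ> strand_pp \<epsilon>) s) = (map_prod \<phi> id \<circ> strand_pp (-\<epsilon>)) s"
     "\<Psi> ((map_prod \<phi> id \<circ> strand_pm \<epsilon>) s) = (map_prod \<phi> id \<circ> strand_pm (-\<epsilon>)) s" if "s \<in> {0..1}" for \<epsilon> s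
    using fsq[OF that, of \<epsilon>] unfolding \<Psi>_def strand_pp_eq strand_pm_eq by auto
  define g where "g = (\<lambda>a::complex knot. (map_prod \<phi> id :: complex \<times> real \<Rightarrow> 'a \<times> real) \<circ> a)"
  have pos: "place \<phi> crossing_pos = {g (strand_pp (1/2)), g (strand_pm (-1/2))}"
    and neg: "place \<phi> crossing_neg = {g (strand_pp (-1/2)), g (strand_pm (1/2))}"
    by (auto simp: place_def crossing_pos_eq crossing_neg_eq g_def)
  have gs: "\<Psi> (g (strand_pp (1/2)) s) = g (strand_pp (-1/2)) s" "\<Psi> (g (strand_pm (-1/2)) s) = g (strand_pm (1/2)) s" if "s \<in> {0..1}" for s
    using \<Psi>s[OF that] unfolding g_def by force+
  have im: "\<Psi> ` path_image (g (strand_pp (1/2))) = path_image (g (strand_pp (-1/2)))"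
     "\<Psi> ` path_image (g (strand_pm (-1/2))) = path_image (g (strand_pm (1/2)))"
    unfolding path_image_def image_image using gs by (auto intro!: image_cong)
  let ?L = "(\<lambda>\<gamma>. \<Psi> \<circ> \<gamma>) ` L"
  have "carries ?L (C \<union> place \<phi> crossing_neg)" unfolding carries_def
  proof (intro conjI ballI)
    have \<Psi>C': "\<Psi> ` trace C = trace C" using \<Psi>C by force
    show "trace ?L = trace (C \<union> place \<phi> crossing_neg)"
      unfolding closed_curves_image(2)[OF L(1) cont inj] tr pos neg trace_insert image_Un im \<Psi>C' by auto
    fix b assume b: "b \<in> C \<union> place \<phi> crossing_neg"
    have "\<exists>a\<in>C \<union> place \<phi> crossing_pos. \<forall>s\<in>{0..1}. b s = \<Psi> (a s)"
    proof (cases "b \<in> C")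
      case True
      then have "\<Psi> (b s) = b s" if "s \<in> {0..1}" for s using \<Psi>C[of "b s"] that unfolding trace_def path_image_def by blast
      then show ?thesis using True by (intro bexI[of _ b]) auto
    next
      case False
      then have "b = g (strand_pp (-1/2)) \<or> b = g (strand_pm (1/2))" using b neg by auto
      then show ?thesis unfolding pos using gs by auto
    qed
    then obtain a where a: "a \<in> C \<union> place \<phi> crossing_pos" "\<forall>s\<in>{0..1}. b s = \<Psi> (a s)" by blast
    then obtain \<gamma> where \<gamma>: "\<gamma> \<in> L" "runs_along a \<gamma>" using L(3) unfolding carries_def by blast
    have "runs_along b (\<Psi> \<circ> \<gamma>)" by (rule runs_along_map[OF \<gamma>(2), of _ \<Psi>]) (use a in auto)
    then show "\<exists>\<gamma>\<in>?L. runs_along b \<gamma>" using \<gamma> by auto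
  qed
  then show ?thesis using closed_curves_image(1)[OF L(1) cont inj] by blast
qed

text \<open>The four segments of \<open>crossing_smooth\<close> are joined in pairs to two arcs, for
  which \<open>oriented_smoothing\<close> provides the new loops; afterwards each segment is
  recovered as a directed piece of its arc.\<close>

lemma skein_smooth:
  fixes \<phi> :: "complex \<Rightarrow> 'a::metric_space"
  assumes \<phi>: "continuous_on square \<phi>" "inj_on \<phi> square"
    and C: "trace C \<inter> (\<phi> ` square \<times> UNIV) \<subseteq> \<phi> ` corners \<times> {1/2}"
    and L: "closed_curves L" "carries L (C \<union> place \<phi> crossing_pos)"
  shows "\<exists>L'. closed_curves L' \<and> L' \<noteq> {} \<and> carries L' (C \<union> place \<phi> crossing_smooth)"
proof -
  define g where "g = (\<lambda>a::complex knot. (map_prod \<phi> id :: complex \<times> real \<Rightarrow> 'a \<times> real) \<circ> a)"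
  let ?s = "g (strand_pp (1/2))" and ?t = "g (strand_pm (-1/2))" and ?r = "g smooth_left" and ?q = "g smooth_right"
  have im: "path_image (g a) = map_prod \<phi> id ` path_image a" for a by (simp add: g_def path_image_compose)
  have st: "pathstart (g a) = map_prod \<phi> id (pathstart a)" "pathfinish (g a) = map_prod \<phi> id (pathfinish a)" for a
    by (auto simp: g_def pathstart_def pathfinish_def)
  have pos: "place \<phi> crossing_pos = {?s, ?t}" by (auto simp: place_def crossing_pos_eq g_def)
  have sq: "path_image (strand_pp \<epsilon>) \<subseteq> square \<times> UNIV" "path_image (strand_pm \<epsilon>) \<subseteq> square \<times> UNIV" for \<epsilon>
    unfolding path_image_def by (intro image_subsetI; simp add: mem_Times_iff strand_square)+
  have sq2: "path_image smooth_left \<subseteq> square \<times> UNIV" "path_image smooth_right \<subseteq> square \<times> UNIV"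
    using smooth_arcs(3,4) by (auto simp: square_def)
  have inj: "inj_on (map_prod \<phi> (id::real\<Rightarrow>real)) (square \<times> UNIV)" using \<phi>(2) by (auto simp: inj_on_def)
  have ends: "trace C \<inter> path_image (g a) \<subseteq> {pathstart (g a'), pathfinish (g b')}"
    if a: "path_image a \<subseteq> square \<times> UNIV" "path_image a \<inter> (corners \<times> {1/2}) \<subseteq> {pathstart a', pathfinish b'}" for a a' b'
  proof
    fix p assume p: "p \<in> trace C \<inter> path_image (g a)"
    then obtain w where w: "w \<in> path_image a" "p = map_prod \<phi> id w" unfolding im by auto
    then have ws: "w \<in> square \<times> UNIV" using a by auto
    then have "p \<in> \<phi> ` corners \<times> {1/2}" using C p w by (cases w) auto
    then obtain v where v: "v \<in> corners" "p = (\<phi> v, 1/2)" by auto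
    then have "w = (v, 1/2)" using w(2) ws \<phi>(2) by (cases w) (auto simp: inj_on_def corners_def square_def)
    then have "w \<in> {pathstart a', pathfinish b'}" using a(2) w(1) v(1) by auto
    then show "p \<in> {pathstart (g a'), pathfinish (g b')}" unfolding st w(2) by auto
  qed
  have disj: "path_image (g a) \<inter> path_image (g b) = {}" if "path_image a \<subseteq> square \<times> UNIV" "path_image b \<subseteq> square \<times> UNIV" "path_image a \<inter> path_image b = {}" for a b
    unfolding im inj_on_image_Int[OF inj that(1,2), symmetric] that(3) by simp
  \<comment> \<open>The projections of the strands meet in the centre only, where the heights are
    3/4 and 1/4.\<close>
  have pst: "path_image (strand_pp (1/2)) \<inter> path_image (strand_pm (-1/2)) = {}"
  proof -
    have False if "s \<in> {0..1}" "t \<in> {0..1}" "strand_pp (1/2) s = strand_pm (-1/2) t" for s t :: real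
    proof -
      have "2 * s - 1 = 1 - 2 * t" "2 * s - 1 = 2 * t - 1" "1/2 + 1/2 * min s (1 - s) = 1/2 + (-1/2) * min t (1 - t)"
        using that(3) unfolding strand_pp_eq strand_pm_eq prod.inject complex.inject by blast+
      moreover from calculation(1,2) have "s = 1/2" "t = 1/2" by auto
      ultimately show False by simp
    qed
    then show ?thesis unfolding path_image_def by blast
  qed
  have prq: "path_image smooth_left \<inter> path_image smooth_right = {}" using smooth_arcs(3,4) by fastforce
  have e: "pathstart (strand_pp \<epsilon>) = (Complex (-1) (-1), 1/2)" "pathfinish (strand_pp \<epsilon>) = (Complex 1 1, 1/2)"
    "pathstart (strand_pm \<epsilon>) = (Complex 1 (-1), 1/2)" "pathfinish (strand_pm \<epsilon>) = (Complex (-1) 1, 1/2)" for \<epsilon>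
    by (simp_all add: strand_pp_def strand_pm_def)
  have cor: "w \<in> {(Complex (-1) (-1), 1/2), (Complex (-1) 1, 1/2)}" if "w \<in> corners \<times> {1/2}" "Re (fst w) < 0" for w :: "complex \<times> real"
    using that by (cases w) (auto simp: corners_def complex_eq_iff abs_if split: if_splits)
  have cor': "w \<in> {(Complex 1 (-1), 1/2), (Complex 1 1, 1/2)}" if "w \<in> corners \<times> {1/2}" "Re (fst w) > 0" for w :: "complex \<times> real"
    using that by (cases w) (auto simp: corners_def complex_eq_iff abs_if split: if_splits)
  obtain L' where L': "closed_curves L'" "L' \<noteq> {}" "trace L' = trace C \<union> path_image ?r \<union> path_image ?q"
    "\<And>b. b \<in> C \<or> subarc_of b ?r \<or> subarc_of b ?q \<Longrightarrow> \<exists>\<gamma>\<in>L'. runs_along b \<gamma>"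
  proof (rule oriented_smoothing[of L C ?s ?t ?r ?q])
    show "closed_curves L" by (rule L)
    show "carries L (C \<union> {?s, ?t})" using L(2) pos by simp
    show "arc ?s" "arc ?t" "arc ?r" "arc ?q" unfolding g_def
      by (rule arc_place[OF _ _ \<phi>]; use sq sq2 smooth_arcs in \<open>simp add: strand_pp_def strand_pm_def arc_strand\<close>)+
    show "pathstart ?r = pathstart ?s" "pathfinish ?r = pathfinish ?t" "pathstart ?q = pathstart ?t" "pathfinish ?q = pathfinish ?s"
      unfolding st e smooth_arcs by simp_all
    show "path_image ?s \<inter> path_image ?t = {}" by (rule disj[OF sq pst])
    show "path_image ?r \<inter> path_image ?q = {}" by (rule disj[OF sq2 prq])
    show "trace C \<inter> path_image ?s \<subseteq> {pathstart ?s, pathfinish ?s}"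
      by (rule ends[OF sq(1)], unfold e) (auto simp: path_image_def strand_pp_eq corners_def)
    show "trace C \<inter> path_image ?t \<subseteq> {pathstart ?t, pathfinish ?t}"
      by (rule ends[OF sq(2)], unfold e) (auto simp: path_image_def strand_pm_eq corners_def)
    show "trace C \<inter> path_image ?r \<subseteq> {pathstart ?s, pathfinish ?t}"
    proof (rule ends[OF sq2(1)], unfold e, rule subsetI)
      fix w assume "w \<in> path_image smooth_left \<inter> corners \<times> {1/2}"
      then show "w \<in> {(Complex (-1) (-1), 1/2), (Complex (-1) 1, 1/2)}" using smooth_arcs(3) by (intro cor) auto
    qed
    show "trace C \<inter> path_image ?q \<subseteq> {pathstart ?t, pathfinish ?s}"
    proof (rule ends[OF sq2(2)], unfold e, rule subsetI)
      fix w assume "w \<in> path_image smooth_right \<inter> corners \<times> {1/2}"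
      then show "w \<in> {(Complex 1 (-1), 1/2), (Complex 1 1, 1/2)}" using smooth_arcs(4) by (intro cor') auto
    qed
  qed blast
  have r: "?r = g (strand 0 (Complex (-1) (-1)) (Complex (-1/2) 0)) +++ g (strand 0 (Complex (-1/2) 0) (Complex (-1) 1))"
    and q: "?q = g (strand 0 (Complex 1 (-1)) (Complex (1/2) 0)) +++ g (strand 0 (Complex (1/2) 0) (Complex 1 1))"
    unfolding g_def smooth_left_def smooth_right_def path_compose_join by simp_all
  have sm: "place \<phi> crossing_smooth = {g (strand 0 (Complex (-1) (-1)) (Complex (-1/2) 0)), g (strand 0 (Complex (-1/2) 0) (Complex (-1) 1)),
     g (strand 0 (Complex 1 (-1)) (Complex (1/2) 0)), g (strand 0 (Complex (1/2) 0) (Complex 1 1))}"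
    by (auto simp: place_def crossing_smooth_def g_def)
  have jn: "pathfinish (g (strand 0 a b)) = pathstart (g (strand 0 b c))" for a b c by (simp add: st)
  have "carries L' (C \<union> place \<phi> crossing_smooth)" unfolding carries_def
  proof (intro conjI ballI)
    show "trace L' = trace (C \<union> place \<phi> crossing_smooth)" unfolding L'(3) sm r q
      by (simp add: path_image_join jn Un_ac)
    fix b assume "b \<in> C \<union> place \<phi> crossing_smooth"
    then have "b \<in> C \<or> subarc_of b ?r \<or> subarc_of b ?q" unfolding sm r q
      using subarc_of_join1[OF subarc_of_refl] subarc_of_join2[OF subarc_of_refl jn] by blast
    then show "\<exists>\<gamma>\<in>L'. runs_along b \<gamma>" by (rule L'(4))
  qed
  then show ?thesis using L' by blast
qed

section \<open>Position of the tangle inside an edge box\<close>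

definition six_strands :: "complex knot set" where
  "six_strands =
     {strand 0 (Complex (-1) (-1)) (Complex (-3/4) (-1/4)),
      strand 0 (Complex (-3/4) (1/4)) (Complex (-1) 1),
      strand 0 (Complex (-1/4) (1/4)) (Complex (1/4) (1/4)),
      strand 0 (Complex (3/4) (-1/4)) (Complex 1 (-1)),
      strand 0 (Complex 1 1) (Complex (3/4) (1/4)),
      strand 0 (Complex (1/4) (-1/4)) (Complex (-1/4) (-1/4))}"

lemma tangle_rest_eq: "tangle_rest = place right_square crossing_pos \<union> six_strands"
  by (simp add: tangle_rest_def six_strands_def)

lemma trace_six_strands:
  assumes "p \<in> trace six_strands"
  shows "snd p = 1/2 \<and> ((3/4 \<le> \<bar>Re (fst p)\<bar> \<and> \<bar>Re (fst p)\<bar> \<le> 1 \<and> \<bar>Im (fst p)\<bar> = 3 * \<bar>Re (fst p)\<bar> - 2) \<or>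
     (\<bar>Re (fst p)\<bar> \<le> 1/4 \<and> \<bar>Im (fst p)\<bar> = 1/4))"
proof -
  have *: "\<exists>u. 0 \<le> u \<and> u \<le> 1 \<and> Re z = (1 - u) * Re a + u * Re b \<and> Im z = (1 - u) * Im a + u * Im b" if "z \<in> closed_segment a b" for z a b
    using that by (auto simp: closed_segment_def)
  show ?thesis using assms unfolding six_strands_def
    by (auto simp: strand_0_image dest!: * simp: abs_if field_simps)
qed

abbreviation resolutions :: "complex knot set set" where
  "resolutions \<equiv> {crossing_pos, crossing_neg, crossing_smooth}"

lemma left_square_image: "z \<in> left_square ` square \<Longrightarrow> -3/4 \<le> Re z \<and> Re z \<le> -1/4 \<and> \<bar>Im z\<bar> \<le> 1/4"
  and right_square_image: "z \<in> right_square ` square \<Longrightarrow> 1/4 \<le> Re z \<and> Re z \<le> 3/4 \<and> \<bar>Im z\<bar> \<le> 1/4"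
  by (auto simp: left_square_def right_square_def square_def abs_le_iff)

lemma left_square_corner: "(Re z = -3/4 \<or> Re z = -1/4) \<Longrightarrow> \<bar>Im z\<bar> = 1/4 \<Longrightarrow> z \<in> left_square ` corners"
  by (rule image_eqI[of _ _ "4 * z + 2"]) (auto simp: left_square_def corners_def abs_if complex_eq_iff field_simps split: if_splits)

lemma right_square_corner: "(Re z = 3/4 \<or> Re z = 1/4) \<Longrightarrow> \<bar>Im z\<bar> = 1/4 \<Longrightarrow> z \<in> right_square ` corners"
  by (rule image_eqI[of _ _ "2 - 4 * z"]) (auto simp: right_square_def corners_def abs_if complex_eq_iff field_simps split: if_splits)

lemma trace_place_square:
  assumes "X \<in> resolutions" "p \<in> trace (place \<phi> X)"
  shows "fst p \<in> \<phi> ` square" "1/4 \<le> snd p" "snd p \<le> 3/4" "fst p \<notin> \<phi> ` open_square \<or> X = crossing_smooth \<Longrightarrow> snd p = 1/2"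
proof -
  obtain q where q: "q \<in> trace X" "p = map_prod \<phi> id q" using assms(2) by (auto simp: trace_place)
  note tc = trace_crossing[OF assms(1) q(1)]
  show "fst p \<in> \<phi> ` square" "1/4 \<le> snd p" "snd p \<le> 3/4" using tc q(2) by (cases q; auto)+
  show "fst p \<notin> \<phi> ` open_square \<or> X = crossing_smooth \<Longrightarrow> snd p = 1/2" using tc q(2) by (cases q) auto
qed

lemma trace_tangle_cases:
  assumes "X \<in> resolutions" "p \<in> trace (tangle X)"
  obtains "p \<in> trace (place left_square X)" "fst p \<in> left_square ` square"
  | "p \<in> trace (place right_square crossing_pos)" "fst p \<in> right_square ` square"
  | "p \<in> trace six_strands"
proof -
  have "p \<in> trace (place left_square X) \<or> p \<in> trace (place right_square crossing_pos) \<or> p \<in> trace six_strands"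
    using assms(2) unfolding tangle_def tangle_rest_eq by auto
  moreover have "fst p \<in> right_square ` square" if "p \<in> trace (place right_square crossing_pos)"
    using trace_place_square(1)[OF _ that] by simp
  ultimately show ?thesis using that trace_place_square(1)[OF assms(1)] by blast
qed

lemma trace_tangle_bounds:
  assumes "X \<in> resolutions" "p \<in> trace (tangle X)"
  shows "\<bar>Re (fst p)\<bar> \<le> 1" "\<bar>Im (fst p)\<bar> \<le> 1" "1/4 \<le> snd p" "snd p \<le> 3/4" "fst p \<in> edge_box"
proof -
  have "\<bar>Re (fst p)\<bar> \<le> 1 \<and> \<bar>Im (fst p)\<bar> \<le> 1 \<and> 1/4 \<le> snd p \<and> snd p \<le> 3/4"
    using assms
  proof (cases rule: trace_tangle_cases)
    case 1 then show ?thesis using left_square_image[OF 1(2)] trace_place_square[OF assms(1) 1(1)] by (auto simp: abs_le_iff)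
  next
    case 2 then show ?thesis using right_square_image[OF 2(2)] trace_place_square[OF _ 2(1)] by (auto simp: abs_le_iff)
  next
    case 3 then show ?thesis using trace_six_strands[OF 3] by auto
  qed
  then show "\<bar>Re (fst p)\<bar> \<le> 1" "\<bar>Im (fst p)\<bar> \<le> 1" "1/4 \<le> snd p" "snd p \<le> 3/4" "fst p \<in> edge_box"
    by (auto simp: edge_box_def)
qed

text \<open>Supplies the hypothesis on \<open>C\<close> in the two skein lemmas. The right crossing
  is disjoint from the left square, and a straight segment enters that square only where |Re z| is
  1/4 or 3/4; there |Im z| is 1/4.\<close>

lemma trace_tangle_rest_left:
  assumes "p \<in> trace tangle_rest" "fst p \<in> left_square ` square"
  shows "p \<in> left_square ` corners \<times> {1/2}"
proof -
  have "p \<notin> trace (place right_square crossing_pos)"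
    using trace_place_square(1)[of crossing_pos p right_square] right_square_image[of "fst p"] left_square_image[OF assms(2)] by auto
  then have "p \<in> trace six_strands" using assms(1) unfolding tangle_rest_eq by simp
  note s = trace_six_strands[OF this] left_square_image[OF assms(2)]
  then have "(Re (fst p) = -3/4 \<or> Re (fst p) = -1/4) \<and> \<bar>Im (fst p)\<bar> = 1/4" by (auto simp: abs_if split: if_splits)
  then show ?thesis using s left_square_corner[of "fst p"] by (cases p) auto
qed

lemma trace_tangle_right:
  assumes "X \<in> resolutions" "p \<in> trace (tangle X)" "fst p \<in> right_square ` square"
  shows "p \<in> trace (place right_square crossing_pos)"
  using assms(1,2)
proof (cases rule: trace_tangle_cases)
  case 1 then show ?thesis using left_square_image[OF 1(2)] right_square_image[OF assms(3)] by auto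
next
  case 3
  note s = trace_six_strands[OF 3] right_square_image[OF assms(3)]
  then have "(Re (fst p) = 3/4 \<or> Re (fst p) = 1/4) \<and> \<bar>Im (fst p)\<bar> = 1/4" by (auto simp: abs_if split: if_splits)
  then have "p \<in> map_prod right_square id ` (corners \<times> {1/2})" using s right_square_corner[of "fst p"] by (cases p) force
  then show ?thesis using corners_in_crossing[of crossing_pos] unfolding trace_place by auto
qed

lemma trace_tangle_left:
  assumes "X \<in> resolutions" "p \<in> trace (tangle X)" "fst p \<in> left_square ` square"
  shows "p \<in> trace (place left_square X)"
proof (cases "p \<in> trace (place left_square X)")
  case False
  then have "p \<in> trace tangle_rest" using assms(2) by (simp add: tangle_def)
  then have "p \<in> left_square ` corners \<times> {1/2}" using trace_tangle_rest_left assms by blast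
  then have "p \<in> map_prod left_square id ` (corners \<times> {1/2})" by force
  then show ?thesis using corners_in_crossing[OF assms(1)] unfolding trace_place by blast
qed

lemma trace_tangle_half:
  assumes "X \<in> resolutions" "p \<in> trace (tangle X)"
    "X \<noteq> crossing_smooth \<Longrightarrow> fst p \<notin> left_square ` open_square" "fst p \<notin> right_square ` open_square"
  shows "snd p = 1/2"
  using assms(1,2)
proof (cases rule: trace_tangle_cases)
  case 1 then show ?thesis using trace_place_square(4)[OF assms(1) 1(1)] assms(3) by auto
next
  case 2 then show ?thesis using trace_place_square(4)[OF _ 2(1)] assms(4) by auto
next
  case 3 then show ?thesis using trace_six_strands by blast
qed

section \<open>Orientation of rotated and rescaled squares\<close>

lemma circlepath_negative_radius: "circlepath c (- r) = shiftpath (1/2) (circlepath c r)"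
proof
  fix x
  have e: "exp (2 * of_real pi * \<i> * of_real (x + 1/2)) = - exp (2 * of_real pi * \<i> * of_real x)"
    "exp (2 * of_real pi * \<i> * of_real (x - 1/2)) = - exp (2 * of_real pi * \<i> * of_real x)"
    by (simp_all add: algebra_simps exp_add exp_diff)
  have "1/2 + x = x + 1/2" "1/2 + x - 1 = x - 1/2" by auto
  then show "circlepath c (- r) x = shiftpath (1/2) (circlepath c r) x"
    unfolding shiftpath_def circlepath by (simp only: e of_real_minus) simp
qed

text \<open>Small circles are scaled by the real factor \<open>b\<close>. If \<open>b\<close> is
  negative, the circle is traversed in the same sense from the opposite point, and winding numbers
  do not depend on the starting point. The right crossing square is an instance of this
  case.\<close>

lemma positive_embedding_affine:
  fixes b :: real
  assumes \<beta>: "positive_embedding \<A> D \<beta>" and surf: "oriented_surface \<Sigma> \<A>" and b: "b \<noteq> 0"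
    and f: "\<And>z. f z = a + of_real b * z" "f ` D' \<subseteq> D"
  shows "positive_embedding \<A> D' (\<beta> \<circ> f)"
  unfolding positive_embedding_def
proof (intro conjI ballI)
  have cf: "continuous_on S f" for S unfolding f(1) by (intro continuous_intros)
  have inj: "inj_on f S" for S using b by (auto simp: inj_on_def f(1))
  show "continuous_on D' (\<beta> \<circ> f)" using \<beta> f(2) cf unfolding positive_embedding_def
    by (intro continuous_on_compose) (auto intro: continuous_on_subset)
  show "inj_on (\<beta> \<circ> f) D'" using \<beta> f(2) inj unfolding positive_embedding_def
    by (intro comp_inj_on) (auto intro: inj_on_subset)
  show "(\<beta> \<circ> f) ` D' \<subseteq> surface_interior \<A>" using \<beta> f(2) unfolding positive_embedding_def by auto
  fix z c assume z: "z \<in> interior D'" and c: "c \<in> \<A>"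
  obtain U \<phi> where U: "c = (U, \<phi>)" by (cases c)
  have "f ` interior D' \<subseteq> interior D"
  proof (rule interior_maximal)
    show "f ` interior D' \<subseteq> D" using f(2) interior_subset by blast
    show "open (f ` interior D')" by (rule invariance_of_domain[OF cf open_interior inj])
  qed
  then have fz: "f z \<in> interior D" using z by auto
  have "positive_at (\<phi> \<circ> (\<beta> \<circ> f)) z" if zU: "(\<beta> \<circ> f) z \<in> U"
  proof -
    define h where "h = \<phi> \<circ> \<beta>"
    have "positive_at h (f z)" using \<beta> fz c zU U unfolding positive_embedding_def h_def by fastforce
    then obtain \<rho> where \<rho>: "\<rho> > 0" "\<And>r. 0 < r \<Longrightarrow> r < \<rho> \<Longrightarrow> winding_number (h \<circ> circlepath (f z) r) (h (f z)) = 1"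
      unfolding positive_at_def eventually_at_right_field by auto
    obtain V \<psi> where oU: "openin (top_of_set \<Sigma>) U" and hom: "homeomorphism U V \<phi> \<psi>"
      using surf c U unfolding oriented_surface_def by blast
    have c\<beta>: "continuous_on D \<beta>" and i\<beta>: "inj_on \<beta> D" using \<beta> by (auto simp: positive_embedding_def)
    have "openin (top_of_set (interior D)) (interior D \<inter> \<beta> -` U)"
    proof -
      have "\<beta> \<in> interior D \<rightarrow> \<Sigma>"
      proof
        fix w assume "w \<in> interior D"
        then have "\<beta> w \<in> surface_interior \<A>" using \<beta> interior_subset unfolding positive_embedding_def by blast
        then show "\<beta> w \<in> \<Sigma>" using surf unfolding oriented_surface_def surface_interior_def by blast
      qed
      moreover have "continuous_on (interior D) \<beta>" by (rule continuous_on_subset[OF c\<beta> interior_subset])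
      ultimately show ?thesis using continuous_on_open_gen[of \<beta> "interior D" \<Sigma>] oU by blast
    qed
    then have "open (interior D \<inter> \<beta> -` U)" using openin_open_trans by blast
    moreover have "f z \<in> interior D \<inter> \<beta> -` U" using fz zU by auto
    \<comment> \<open>In this disc the composite with the chart is continuous and injective. Hence
      the image of a small circle avoids the image of the centre, as shifting its starting point
      requires.\<close>
    ultimately obtain \<delta> where \<delta>: "\<delta> > 0" "cball (f z) \<delta> \<subseteq> interior D \<inter> \<beta> -` U" by (meson open_contains_cball)
    have ch: "continuous_on (cball (f z) \<delta>) h" unfolding h_def
    proof (rule continuous_on_compose)
      show "continuous_on (cball (f z) \<delta>) \<beta>" by (rule continuous_on_subset[OF c\<beta>]) (use \<delta>(2) interior_subset[of D] in auto)
      have "continuous_on U \<phi>" using hom by (auto simp: homeomorphism_def)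
      then show "continuous_on (\<beta> ` cball (f z) \<delta>) \<phi>" by (rule continuous_on_subset) (use \<delta>(2) in auto)
    qed
    have ih: "inj_on h (cball (f z) \<delta>)" unfolding h_def
    proof (rule comp_inj_on)
      show "inj_on \<beta> (cball (f z) \<delta>)" by (rule inj_on_subset[OF i\<beta>]) (use \<delta>(2) interior_subset[of D] in auto)
      have "inj_on \<phi> U" using hom by (auto simp: homeomorphism_def inj_on_def) metis
      then show "inj_on \<phi> (\<beta> ` cball (f z) \<delta>)" by (rule inj_on_subset) (use \<delta>(2) in auto)
    qed
    have fc: "f \<circ> circlepath z r = circlepath (f z) (b * r)" for r
      by (auto simp: fun_eq_iff circlepath f(1) algebra_simps)
    have "winding_number (h \<circ> f \<circ> circlepath z r) (h (f z)) = 1" if r: "0 < r" "r < min \<rho> \<delta> / \<bar>b\<bar>" for r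
    proof -
      have br: "0 < \<bar>b\<bar> * r" "\<bar>b\<bar> * r < \<rho>" "\<bar>b\<bar> * r < \<delta>" using r b by (auto simp: field_simps)
      have w1: "winding_number (h \<circ> circlepath (f z) (\<bar>b\<bar> * r)) (h (f z)) = 1" using \<rho>(2) br by auto
      have "winding_number (h \<circ> circlepath (f z) (b * r)) (h (f z)) = 1"
      proof (cases "b > 0")
        case True then show ?thesis using w1 by simp
      next
        case False
        then have eq: "b * r = - (\<bar>b\<bar> * r)" by simp
        let ?c = "circlepath (f z) (\<bar>b\<bar> * r)"
        have im: "path_image ?c = sphere (f z) (\<bar>b\<bar> * r)" using br by simp
        then have sub: "path_image ?c \<subseteq> cball (f z) \<delta>" using br by auto
        have "path (h \<circ> ?c)" using continuous_on_subset[OF ch sub] by (intro path_continuous_image) auto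
        moreover have "h (f z) \<notin> path_image (h \<circ> ?c)"
        proof
          assume "h (f z) \<in> path_image (h \<circ> ?c)"
          then obtain w where "w \<in> path_image ?c" "h (f z) = h w" by (auto simp: path_image_compose)
          then have "w = f z" using ih sub \<delta>(1) by (metis centre_in_cball inj_onD less_imp_le subsetD)
          then show False using \<open>w \<in> path_image ?c\<close> br unfolding im by auto
        qed
        moreover have "pathfinish (h \<circ> ?c) = pathstart (h \<circ> ?c)" by (simp add: pathfinish_compose pathstart_compose)
        ultimately have "winding_number (shiftpath (1/2) (h \<circ> ?c)) (h (f z)) = 1"
          using winding_number_shiftpath[of "h \<circ> ?c" "h (f z)" "1/2"] w1 by simp
        moreover have "shiftpath (1/2) (h \<circ> ?c) = h \<circ> circlepath (f z) (b * r)"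
          unfolding eq circlepath_negative_radius by (auto simp: shiftpath_def fun_eq_iff)
        ultimately show ?thesis by simp
      qed
      then show ?thesis using fc by (simp add: o_assoc[symmetric])
    qed
    then show ?thesis unfolding positive_at_def eventually_at_right_field h_def
      using \<rho>(1) \<delta>(1) b by (intro exI[of _ "min \<rho> \<delta> / \<bar>b\<bar>"]) (auto simp: o_assoc)
  qed
  then show "case c of (U, \<phi>) \<Rightarrow> (\<beta> \<circ> f) z \<in> U \<longrightarrow> positive_at (\<phi> \<circ> (\<beta> \<circ> f)) z" using U by auto
qed

lemma ambient_isotopy_ident: "ambient_isotopy \<Sigma> (\<lambda>t p. p)"
  unfolding ambient_isotopy_def by (auto intro!: exI[of _ "\<lambda>p. p"] continuous_intros homeomorphism_ident simp: split_def)

lemma isotopic_refl: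
  assumes "closed_curves L" shows "isotopic \<Sigma> L L"
  unfolding isotopic_def
proof (intro exI conjI)
  show "ambient_isotopy \<Sigma> (\<lambda>t p. p)" by (rule ambient_isotopy_ident)
  have "(\<lambda>\<gamma>. (\<lambda>p. p) \<circ> \<gamma>) ` L = L" by (simp add: o_def)
  moreover have "runs_along \<gamma> \<gamma>" if "\<gamma> \<in> L" for \<gamma>
    using assms that by (intro runs_along_cong) (auto simp: closed_curves_def)
  ultimately show "carries L ((\<lambda>\<gamma>. (\<lambda>p. p) \<circ> \<gamma>) ` L)" unfolding carries_def by auto
qed

lemma inj_on_fst_level: "(\<And>p. p \<in> S \<Longrightarrow> snd p = c) \<Longrightarrow> inj_on fst S"
  by (metis inj_onI prod_eqI)

section \<open>The partially resolved links of a ribbon graph\<close>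

locale ribbon_in_surface =
  fixes \<Sigma> :: "'a::metric_space set" and \<A> :: "'a atlas" and G :: "('a, 'v, 'e) egraph" and F :: "('a, 'v, 'e) ribbon"
  assumes surf: "oriented_surface \<Sigma> \<A>" and graph: "embedded_graph \<A> G" and nbhd: "regular_neighbourhood \<A> G F"
begin

lemma finite_graph: "finite (edges G)" "finite (verts G)"
  using graph by (auto simp: embedded_graph_def)

lemma interior_subset_surface: "surface_interior \<A> \<subseteq> \<Sigma>"
  using surf unfolding oriented_surface_def surface_interior_def by blast

lemma emap:
  assumes "e \<in> edges G"
  shows "positive_embedding \<A> edge_box (emap F e)" "continuous_on edge_box (emap F e)" "inj_on (emap F e) edge_box"
    "emap F e ` edge_box \<subseteq> surface_interior \<A>"
  using nbhd assms unfolding regular_neighbourhood_def positive_embedding_def by auto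

lemma vmap:
  assumes "v \<in> verts G"
  shows "continuous_on (cball 0 2) (vmap F v)" "inj_on (vmap F v) (cball 0 2)" "vmap F v ` cball 0 2 \<subseteq> surface_interior \<A>"
  using nbhd assms unfolding regular_neighbourhood_def positive_embedding_def by auto

lemma boxes_disjoint: "pairwise (\<lambda>e e'. disjnt (emap F e ` edge_box) (emap F e' ` edge_box)) (edges G)"
  using nbhd unfolding regular_neighbourhood_def by (elim conjE)

lemma discs_disjoint: "pairwise (\<lambda>v v'. disjnt (vmap F v ` cball 0 1) (vmap F v' ` cball 0 1)) (verts G)"
  using nbhd unfolding regular_neighbourhood_def by (elim conjE)

lemma boxes_meet_discs: "\<forall>e\<in>edges G. \<forall>z\<in>edge_box.
        (emap F e z \<in> (\<Union>v\<in>verts G. vmap F v ` ball 0 1) \<longleftrightarrow> \<bar>Re z\<bar> > 1) \<and>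
        (emap F e z \<in> (\<Union>v\<in>verts G. vmap F v ` sphere 0 1) \<longleftrightarrow> \<bar>Re z\<bar> = 1)"
  using nbhd unfolding regular_neighbourhood_def by (elim conjE)

lemma emap_disjoint:
  assumes "e \<in> edges G" "e' \<in> edges G" "z \<in> edge_box" "z' \<in> edge_box" "emap F e z = emap F e' z'"
  shows "e = e'" "z = z'"
proof -
  show "e = e'"
  proof (rule ccontr)
    assume "e \<noteq> e'"
    then have "disjnt (emap F e ` edge_box) (emap F e' ` edge_box)"
      using boxes_disjoint assms unfolding pairwise_def by blast
    then show False using assms unfolding disjnt_def by blast
  qed
  then show "z = z'" using emap(3)[OF assms(1)] assms unfolding inj_on_def by auto
qed

lemma emap_sphere:
  assumes "e \<in> edges G" "z \<in> edge_box"
  shows "emap F e z \<in> (\<Union>v\<in>verts G. vmap F v ` ball 0 1) \<longleftrightarrow> \<bar>Re z\<bar> > 1"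
    "emap F e z \<in> (\<Union>v\<in>verts G. vmap F v ` sphere 0 1) \<longleftrightarrow> \<bar>Re z\<bar> = 1"
  using boxes_meet_discs assms by simp_all

text \<open>\<open>\<kappa>\<close> chooses the filling of the left crossing square of each edge;
  the right crossing is always kept. The constant choice \<open>crossing_pos\<close> describes the
  link of the graph.\<close>

definition arcs :: "('e \<Rightarrow> complex knot set) \<Rightarrow> 'a knot set" where
  "arcs \<kappa> = vertex_arcs G F \<union> (\<Union>e\<in>edges G. place (emap F e) (tangle (\<kappa> e)))"

lemma trace_vertex_arcs:
  assumes "p \<in> trace (vertex_arcs G F)"
  shows "snd p = 1/2" "fst p \<in> (\<Union>v\<in>verts G. vmap F v ` sphere 0 1)"
    "fst p \<notin> (\<Union>e\<in>edges G. emap F e ` {z. \<bar>Re z\<bar> \<le> 2 \<and> \<bar>Im z\<bar> < 1})"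
proof -
  obtain v \<theta> \<tau> s where v: "v \<in> verts G" "s \<in> {0..1}" "p = (vmap F v (cis (\<theta> + s * \<tau>)), 1/2)"
    "\<forall>s\<in>{0..1}. vmap F v (cis (\<theta> + s * \<tau>)) \<notin> (\<Union>e\<in>edges G. emap F e ` {z. \<bar>Re z\<bar> \<le> 2 \<and> \<bar>Im z\<bar> < 1})"
    using assms unfolding trace_def vertex_arcs_def path_image_def by blast
  show "snd p = 1/2" using v by simp
  show "fst p \<notin> (\<Union>e\<in>edges G. emap F e ` {z. \<bar>Re z\<bar> \<le> 2 \<and> \<bar>Im z\<bar> < 1})" using v by simp
  have "cis (\<theta> + s * \<tau>) \<in> sphere 0 1" by simp
  then show "fst p \<in> (\<Union>v\<in>verts G. vmap F v ` sphere 0 1)" using v(1,3) by (metis UN_I fst_conv imageI)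
qed

lemma trace_arcs:
  "trace (arcs \<kappa>) = trace (vertex_arcs G F) \<union> (\<Union>e\<in>edges G. map_prod (emap F e) id ` trace (tangle (\<kappa> e)))"
  unfolding arcs_def trace_place[symmetric] by (auto simp: trace_def)

lemma trace_arcs_bounds:
  assumes "range \<kappa> \<subseteq> resolutions" shows "trace (arcs \<kappa>) \<subseteq> surface_interior \<A> \<times> {1/4..3/4}"
proof
  fix p assume "p \<in> trace (arcs \<kappa>)"
  then consider "p \<in> trace (vertex_arcs G F)" | e q where "e \<in> edges G" "q \<in> trace (tangle (\<kappa> e))" "p = map_prod (emap F e) id q"
    unfolding trace_arcs by auto
  then show "p \<in> surface_interior \<A> \<times> {1/4..3/4}"
  proof cases
    case 1
    then obtain v \<zeta> where "v \<in> verts G" "\<zeta> \<in> sphere 0 1" "fst p = vmap F v \<zeta>" using trace_vertex_arcs(2)[OF 1] by blast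
    moreover have "\<zeta> \<in> cball 0 2" using calculation by auto
    ultimately show ?thesis using vmap(3)[of v] trace_vertex_arcs(1)[OF 1] by (cases p) auto
  next
    case 2
    have X: "\<kappa> e \<in> resolutions" using assms by auto
    show ?thesis using trace_tangle_bounds[OF X 2(2)] emap(4)[OF 2(1)] 2(3) by (cases q) auto
  qed
qed

text \<open>Vertex arcs lie on vertex circles, and these meet a box exactly in |Re z| = 1; the
  tangles of other edges lie in disjoint boxes.\<close>

lemma trace_arcs_in_box:
  assumes \<kappa>: "range \<kappa> \<subseteq> resolutions" and p: "p \<in> trace (arcs \<kappa>)" and e: "e \<in> edges G" "z \<in> edge_box" "\<bar>Re z\<bar> < 1" "fst p = emap F e z"
  shows "(z, snd p) \<in> trace (tangle (\<kappa> e))"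
proof -
  have "p \<notin> trace (vertex_arcs G F)"
    using trace_vertex_arcs(2)[of p] emap_sphere(2)[OF e(1,2)] e(3,4) by auto
  then obtain e' q where q: "e' \<in> edges G" "q \<in> trace (tangle (\<kappa> e'))" "p = map_prod (emap F e') id q"
    using p unfolding trace_arcs by auto
  have X: "\<kappa> e' \<in> resolutions" using \<kappa> by auto
  have "emap F e' (fst q) = emap F e z" using q(3) e(4) by (cases q) auto
  then have "e' = e" "fst q = z" using emap_disjoint[OF q(1) e(1) trace_tangle_bounds(5)[OF X q(2)] e(2)] by auto
  then show ?thesis using q by (cases q) auto
qed

lemma squares_in_box:
  "left_square ` square \<subseteq> edge_box" "right_square ` square \<subseteq> edge_box"
  using left_square_image right_square_image by (fastforce simp: edge_box_def abs_le_iff)+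

lemma square_embeddings:
  assumes "e \<in> edges G"
  shows "positive_embedding \<A> square (emap F e \<circ> left_square)" "positive_embedding \<A> square (emap F e \<circ> right_square)"
  by (rule positive_embedding_affine[OF emap(1)[OF assms] surf, of "1/4" _ "-1/2"]; use squares_in_box in \<open>simp add: left_square_def\<close>)
     (rule positive_embedding_affine[OF emap(1)[OF assms] surf, of "-1/4" _ "1/2"]; use squares_in_box in \<open>simp add: right_square_def\<close>)

text \<open>The crossings are the right square of every edge and the left square of every edge that
  is not smoothed. Outside these squares the link lies at height 1/2, so that its points are
  determined by their projections.\<close>

lemma has_diagram_arcs:
  assumes \<kappa>: "range \<kappa> \<subseteq> resolutions" and L: "trace L = trace (arcs \<kappa>)"
  shows "has_diagram \<A> L"
proof -
  let ?l = "\<lambda>e. emap F e \<circ> left_square" and ?r = "\<lambda>e. emap F e \<circ> right_square"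
  let ?\<Phi> = "?l ` {e \<in> edges G. \<kappa> e \<noteq> crossing_smooth} \<union> ?r ` edges G"
  have X: "\<kappa> e \<in> resolutions" for e using \<kappa> by auto
  have tl: "trace L \<inter> (?l e ` square \<times> UNIV) = trace (place (?l e) (\<kappa> e))" if e: "e \<in> edges G" for e
  proof
    show "trace L \<inter> (?l e ` square \<times> UNIV) \<subseteq> trace (place (?l e) (\<kappa> e))"
    proof
      fix p assume "p \<in> trace L \<inter> (?l e ` square \<times> UNIV)"
      then obtain w where w: "p \<in> trace (arcs \<kappa>)" "w \<in> square" "fst p = emap F e (left_square w)" using L by (cases p) auto
      have "left_square w \<in> edge_box" "\<bar>Re (left_square w)\<bar> < 1" using squares_in_box(1) w(2) left_square_image[of "left_square w"] by auto
      then have "(left_square w, snd p) \<in> trace (tangle (\<kappa> e))" using trace_arcs_in_box[OF \<kappa> w(1) e _ _ w(3)] by auto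
      then have "(left_square w, snd p) \<in> trace (place left_square (\<kappa> e))" using trace_tangle_left[OF X[of e]] w(2) by auto
      then have "map_prod (emap F e) id (left_square w, snd p) \<in> trace (place (emap F e) (place left_square (\<kappa> e)))" unfolding trace_place[of "emap F e"] by blast
      then show "p \<in> trace (place (?l e) (\<kappa> e))" using w(3) unfolding place_place by (cases p) auto
    qed
    have "trace (place (?l e) (\<kappa> e)) \<subseteq> trace (arcs \<kappa>)"
      unfolding arcs_def tangle_def place_Un place_place using e by (auto simp: trace_def)
    then show "trace (place (?l e) (\<kappa> e)) \<subseteq> trace L \<inter> (?l e ` square \<times> UNIV)"
      using trace_place_square(1)[OF X] L by (force simp: mem_Times_iff)
  qed
  have tr: "trace L \<inter> (?r e ` square \<times> UNIV) = trace (place (?r e) crossing_pos)" if e: "e \<in> edges G" for e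
  proof
    show "trace L \<inter> (?r e ` square \<times> UNIV) \<subseteq> trace (place (?r e) crossing_pos)"
    proof
      fix p assume "p \<in> trace L \<inter> (?r e ` square \<times> UNIV)"
      then obtain w where w: "p \<in> trace (arcs \<kappa>)" "w \<in> square" "fst p = emap F e (right_square w)" using L by (cases p) auto
      have "right_square w \<in> edge_box" "\<bar>Re (right_square w)\<bar> < 1" using squares_in_box(2) w(2) right_square_image[of "right_square w"] by auto
      then have "(right_square w, snd p) \<in> trace (tangle (\<kappa> e))" using trace_arcs_in_box[OF \<kappa> w(1) e _ _ w(3)] by auto
      then have "(right_square w, snd p) \<in> trace (place right_square crossing_pos)" using trace_tangle_right[OF X[of e]] w(2) by auto
      then have "map_prod (emap F e) id (right_square w, snd p) \<in> trace (place (emap F e) (place right_square crossing_pos))" unfolding trace_place[of "emap F e"] by blast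
      then show "p \<in> trace (place (?r e) crossing_pos)" using w(3) unfolding place_place by (cases p) auto
    qed
    have "trace (place (?r e) crossing_pos) \<subseteq> trace (arcs \<kappa>)"
      unfolding arcs_def tangle_def tangle_rest_eq place_Un place_place using e by (auto simp: trace_def)
    then show "trace (place (?r e) crossing_pos) \<subseteq> trace L \<inter> (?r e ` square \<times> UNIV)"
      using trace_place_square(1)[of crossing_pos] L by (force simp: mem_Times_iff)
  qed
  have lr: "left_square w \<noteq> right_square w'" if "w \<in> square" "w' \<in> square" for w w'
    using left_square_image[of "left_square w"] right_square_image[of "right_square w'"] that by auto
  show ?thesis unfolding has_diagram_def
  proof (intro exI[of _ ?\<Phi>] conjI ballI)
    show "finite ?\<Phi>" using finite_graph by auto
    fix \<phi> assume \<phi>: "\<phi> \<in> ?\<Phi>"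
    show "positive_embedding \<A> square \<phi>" using \<phi> square_embeddings by auto
    show "trace L \<inter> (\<phi> ` square \<times> UNIV) \<in> {trace (place \<phi> crossing_pos), trace (place \<phi> crossing_neg)}"
    proof -
      consider e where "e \<in> edges G" "\<kappa> e \<noteq> crossing_smooth" "\<phi> = ?l e" | e where "e \<in> edges G" "\<phi> = ?r e" using \<phi> by auto
      then show ?thesis
      proof cases
        case 1 then show ?thesis using tl[OF 1(1)] X[of e] by auto
      next
        case 2 then show ?thesis using tr[OF 2(1)] by simp
      qed
    qed
  next
    have sq: "\<exists>e\<in>edges G. \<exists>z\<in>edge_box. p = emap F e z \<and> ((\<phi> = ?l e \<and> z \<in> left_square ` square) \<or> (\<phi> = ?r e \<and> z \<in> right_square ` square))"
      if pp: "\<phi> \<in> ?\<Phi>" "p \<in> \<phi> ` square" for \<phi> p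
    proof -
      obtain w where w: "w \<in> square" "p = \<phi> w" using pp by auto
      consider e where "e \<in> edges G" "\<phi> = ?l e" | e where "e \<in> edges G" "\<phi> = ?r e" using pp(1) by auto
      then show ?thesis
      proof cases
        case 1 then show ?thesis using w squares_in_box by (intro bexI[of _ e] bexI[of _ "left_square w"]) auto
      next
        case 2 then show ?thesis using w squares_in_box by (intro bexI[of _ e] bexI[of _ "right_square w"]) auto
      qed
    qed
    show "pairwise (\<lambda>\<phi> \<phi>'. disjnt (\<phi> ` square) (\<phi>' ` square)) ?\<Phi>"
      unfolding pairwise_def disjnt_def
    proof (intro ballI impI, rule ccontr)
      fix \<phi> \<phi>' assume *: "\<phi> \<in> ?\<Phi>" "\<phi>' \<in> ?\<Phi>" "\<phi> \<noteq> \<phi>'" "\<phi> ` square \<inter> \<phi>' ` square \<noteq> {}"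
      then obtain p where p: "p \<in> \<phi> ` square" "p \<in> \<phi>' ` square" by blast
      obtain e z where z: "e \<in> edges G" "z \<in> edge_box" "p = emap F e z" "(\<phi> = ?l e \<and> z \<in> left_square ` square) \<or> (\<phi> = ?r e \<and> z \<in> right_square ` square)"
        using sq[OF *(1) p(1)] by blast
      obtain e' z' where z': "e' \<in> edges G" "z' \<in> edge_box" "p = emap F e' z'" "(\<phi>' = ?l e' \<and> z' \<in> left_square ` square) \<or> (\<phi>' = ?r e' \<and> z' \<in> right_square ` square)"
        using sq[OF *(2) p(2)] by blast
      have "e = e'" "z = z'" using emap_disjoint[OF z(1) z'(1) z(2) z'(2)] z(3) z'(3) by auto
      moreover have "\<not> (z \<in> left_square ` square \<and> z \<in> right_square ` square)"
        using lr by blast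
      ultimately show False using z(4) z'(4) *(3) by blast
    qed
    show "inj_on fst (trace L - (\<Union>\<phi>\<in>?\<Phi>. \<phi> ` open_square) \<times> UNIV)"
    proof -
      have "snd p = 1/2" if p: "p \<in> trace L - (\<Union>\<phi>\<in>?\<Phi>. \<phi> ` open_square) \<times> UNIV" for p
      proof (cases "p \<in> trace (vertex_arcs G F)")
        case True then show ?thesis using trace_vertex_arcs by auto
      next
        case False
        have "p \<in> trace (arcs \<kappa>)" using p L by blast
        with False obtain e q where q: "e \<in> edges G" "q \<in> trace (tangle (\<kappa> e))" "p = map_prod (emap F e) id q"
          unfolding trace_arcs by (metis (no_types, lifting) UN_E UnE imageE)
        have np: "fst p \<notin> (\<Union>\<phi>\<in>?\<Phi>. \<phi> ` open_square)" using p by (auto simp: mem_Times_iff)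
        have "fst q \<notin> left_square ` open_square" if "\<kappa> e \<noteq> crossing_smooth"
        proof
          assume "fst q \<in> left_square ` open_square"
          then have "fst p \<in> ?l e ` open_square" using q(3) by (cases q) auto
          then show False using np q(1) that by blast
        qed
        moreover have "fst q \<notin> right_square ` open_square"
        proof
          assume "fst q \<in> right_square ` open_square"
          then have "fst p \<in> ?r e ` open_square" using q(3) by (cases q) auto
          then show False using np q(1) by blast
        qed
        ultimately have "snd q = 1/2" using trace_tangle_half[OF X q(2)] by blast
        then show ?thesis using q(3) by (cases q) auto
      qed
      then show ?thesis by (rule inj_on_fst_level)
    qed
  qed
qed

lemma oriented_link_arcs:
  assumes \<kappa>: "range \<kappa> \<subseteq> resolutions" and L: "closed_curves L" "L \<noteq> {}" "trace L = trace (arcs \<kappa>)"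
  shows "oriented_link \<Sigma> \<A> L"
proof -
  have "surface_interior \<A> \<times> {1/4..3/4::real} \<subseteq> surface_interior \<A> \<times> {0<..<1}" by auto
  then have "loop_system \<A> L" unfolding closed_curves_loop_system L(3) using trace_arcs_bounds[OF \<kappa>] L(1,2) by blast
  then show ?thesis unfolding oriented_link_def
    using has_diagram_arcs[OF \<kappa> L(3)] isotopic_refl[OF L(1)] by blast
qed

text \<open>\<open>C\<close> collects everything but the left crossing of \<open>e\<close> and meets
  the square of that crossing only in corners at height 1/2. Therefore switching and smoothing apply
  to the same \<open>C\<close>, as a skein triple demands.\<close>

lemma skein_step:
  assumes \<kappa>: "range \<kappa> \<subseteq> resolutions" and e: "e \<in> edges G" "\<kappa> e = crossing_pos"
    and L: "closed_curves L" "L \<noteq> {}" "carries L (arcs \<kappa>)"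
  obtains L' L0 where "closed_curves L'" "L' \<noteq> {}" "carries L' (arcs (\<kappa>(e := crossing_neg)))"
    "closed_curves L0" "L0 \<noteq> {}" "carries L0 (arcs (\<kappa>(e := crossing_smooth)))" "skein_triple \<Sigma> \<A> L L' L0"
proof -
  define \<phi> where "\<phi> = emap F e \<circ> left_square"
  define C where "C = vertex_arcs G F \<union> (\<Union>e'\<in>edges G - {e}. place (emap F e') (tangle (\<kappa> e'))) \<union> place (emap F e) tangle_rest"
  have arcs: "arcs (\<kappa>(e := X)) = C \<union> place \<phi> X" for X
  proof -
    have "(\<Union>e'\<in>edges G. place (emap F e') (tangle ((\<kappa>(e := X)) e'))) =
       (\<Union>e'\<in>edges G - {e}. place (emap F e') (tangle (\<kappa> e'))) \<union> place (emap F e) (tangle X)"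
      using e(1) by (auto split: if_splits)
    then show ?thesis unfolding arcs_def C_def tangle_def[of X] place_Un place_place \<phi>_def by auto
  qed
  have arcs0: "arcs \<kappa> = C \<union> place \<phi> crossing_pos" using arcs[of crossing_pos] e(2) by (metis fun_upd_triv)
  have pe: "positive_embedding \<A> square \<phi>" unfolding \<phi>_def by (rule square_embeddings[OF e(1)])
  then have \<phi>: "continuous_on square \<phi>" "inj_on \<phi> square" "\<phi> ` square \<subseteq> surface_interior \<A>" by (auto simp: positive_embedding_def)
  have os: "open_square \<subseteq> square" by (auto simp: open_square_def square_def)
  have oos: "open open_square" unfolding open_square_def by (intro open_Collect_conj open_Collect_less continuous_intros)
  have op: "openin (top_of_set \<Sigma>) (\<phi> ` open_square)"
    by (rule openin_embedding[OF surf \<phi> oos os])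
  have C: "trace C \<inter> (\<phi> ` square \<times> UNIV) \<subseteq> \<phi> ` corners \<times> {1/2}"
  proof
    fix p assume p: "p \<in> trace C \<inter> (\<phi> ` square \<times> UNIV)"
    then obtain w where w: "w \<in> square" "fst p = emap F e (left_square w)" by (auto simp: \<phi>_def mem_Times_iff)
    have lw: "left_square w \<in> edge_box" "\<bar>Re (left_square w)\<bar> < 1" using squares_in_box(1) w(1) left_square_image[of "left_square w"] by auto
    have "p \<notin> trace (vertex_arcs G F)"
      using trace_vertex_arcs(2)[of p] emap_sphere(2)[OF e(1) lw(1)] lw(2) w(2) by auto
    moreover have "p \<notin> trace (\<Union>e'\<in>edges G - {e}. place (emap F e') (tangle (\<kappa> e')))"
    proof
      assume "p \<in> trace (\<Union>e'\<in>edges G - {e}. place (emap F e') (tangle (\<kappa> e')))"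
      then obtain e' where e': "e' \<in> edges G" "e' \<noteq> e" "p \<in> trace (place (emap F e') (tangle (\<kappa> e')))" by (auto simp: trace_def)
      then obtain q where q: "q \<in> trace (tangle (\<kappa> e'))" "p = map_prod (emap F e') id q" by (auto simp: trace_place)
      have X: "\<kappa> e' \<in> resolutions" using \<kappa> by auto
      show False using emap_disjoint(1)[OF e'(1) e(1) trace_tangle_bounds(5)[OF X q(1)] lw(1)] q(2) w(2) e'(2) by (cases q) auto
    qed
    ultimately have "p \<in> trace (place (emap F e) tangle_rest)" using p unfolding C_def by auto
    then obtain q where q: "q \<in> trace tangle_rest" "p = map_prod (emap F e) id q" by (auto simp: trace_place)
    have "q \<in> trace (tangle crossing_pos)" using q(1) by (simp add: tangle_def)
    then have "fst q \<in> edge_box" using trace_tangle_bounds(5)[of crossing_pos] by blast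
    then have "fst q = left_square w" using emap_disjoint(2)[OF e(1) e(1) _ lw(1)] q(2) w(2) by (cases q) auto
    then have "q \<in> left_square ` corners \<times> {1/2}" using trace_tangle_rest_left[OF q(1)] w(1) by auto
    then show "p \<in> \<phi> ` corners \<times> {1/2}" using q(2) by (auto simp: \<phi>_def)
  qed
  have trL: "trace L = trace (arcs \<kappa>)" using L(3) by (simp add: carries_def)
  have sub: "trace L \<subseteq> \<Sigma> \<times> {0<..<1}" using trace_arcs_bounds[OF \<kappa>] interior_subset_surface unfolding trL by fastforce
  obtain L' where L': "closed_curves L'" "L' \<noteq> {}" "carries L' (C \<union> place \<phi> crossing_neg)"
    using skein_switch[OF \<phi>(1,2) op C L(1) sub] L(2,3) unfolding arcs0 by blast
  obtain L0 where L0: "closed_curves L0" "L0 \<noteq> {}" "carries L0 (C \<union> place \<phi> crossing_smooth)"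
    using skein_smooth[OF \<phi>(1,2) C L(1)] L(3) unfolding arcs0 by blast
  have ol: "oriented_link \<Sigma> \<A> M" if "closed_curves M" "M \<noteq> {}" "carries M (arcs \<kappa>')" "range \<kappa>' \<subseteq> resolutions" for M \<kappa>'
    using oriented_link_arcs[OF that(4,1,2)] that(3) by (simp add: carries_def)
  have "skein_triple \<Sigma> \<A> L L' L0" unfolding skein_triple_def
  proof (intro conjI exI[of _ \<phi>] exI[of _ C])
    show "oriented_link \<Sigma> \<A> L" using ol[OF L \<kappa>] .
    show "oriented_link \<Sigma> \<A> L'" by (rule ol[OF L'(1,2) L'(3)[folded arcs]]) (use \<kappa> in auto)
    show "oriented_link \<Sigma> \<A> L0" by (rule ol[OF L0(1,2) L0(3)[folded arcs]]) (use \<kappa> in auto)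
    show "trace C \<inter> (\<phi> ` open_square \<times> UNIV) = {}"
    proof -
      have "\<phi> ` corners \<inter> \<phi> ` open_square = {}"
      proof -
        have "corners \<subseteq> square" "corners \<inter> open_square = {}" by (auto simp: corners_def square_def open_square_def)
        then show ?thesis using \<phi>(2) os by (metis image_empty inj_on_image_Int)
      qed
      then show ?thesis using C os by blast
    qed
  qed (use pe L(3) L'(3) L0(3) arcs0 in auto)
  then show ?thesis using that L' L0 unfolding arcs by blast
qed

end

section \<open>The boundary of a state\<close>

text \<open>A means to refute interior points: if a path leaves a set immediately, every
  neighbourhood of its start contains a later point of it, outside the set.\<close>

lemma openin_path_start:
  assumes "continuous_on {0..1} f" "f ` {0..1} \<subseteq> \<Sigma>" "openin (top_of_set \<Sigma>) T" "f 0 \<in> T"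
  obtains s :: real where "0 < s" "s \<le> 1" "f s \<in> T"
proof -
  have "openin (top_of_set {0..1}) ({0..1} \<inter> f -` T)"
    using continuous_on_open_gen[of f "{0..1}" \<Sigma>] assms by blast
  then obtain \<epsilon> where \<epsilon>: "\<epsilon> > 0" "ball 0 \<epsilon> \<inter> {0..1} \<subseteq> {0..1} \<inter> f -` T"
    using assms(4) unfolding openin_contains_ball by force
  have "min (\<epsilon>/2) 1 \<in> ball 0 \<epsilon> \<inter> {0..1}" using \<epsilon>(1) by (auto simp: dist_real_def min_def)
  then have "f (min (\<epsilon>/2) 1) \<in> T" using \<epsilon>(2) by blast
  then show ?thesis using that[of "min (\<epsilon>/2) 1"] \<epsilon>(1) by auto
qed

text \<open>Each member is closed, and so is the finite union of the others; hence a connected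
  subset that meets a member stays in it.\<close>

lemma components_disjoint_Union:
  fixes \<F> :: "'a::t2_space set set"
  assumes "finite \<F>" "\<And>A. A \<in> \<F> \<Longrightarrow> compact A \<and> connected A \<and> A \<noteq> {}"
    "\<And>A B. A \<in> \<F> \<Longrightarrow> B \<in> \<F> \<Longrightarrow> A \<noteq> B \<Longrightarrow> A \<inter> B = {}"
  shows "components (\<Union>\<F>) = \<F>"
proof -
  have comp: "connected_component_set (\<Union>\<F>) x = A" if A: "A \<in> \<F>" "x \<in> A" for A x
  proof
    show "A \<subseteq> connected_component_set (\<Union>\<F>) x"
      using assms(2)[OF A(1)] A by (intro connected_component_maximal) auto
    let ?C = "connected_component_set (\<Union>\<F>) x" and ?R = "\<Union>(\<F> - {A})"
    have "closed A" "closed ?R" using assms(1,2) A by (auto intro!: closed_Union compact_imp_closed)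
    moreover have "?C \<subseteq> A \<union> ?R" using connected_component_subset[of "\<Union>\<F>" x] by auto
    moreover have "A \<inter> ?R = {}" using assms(3) A(1) by blast
    moreover have "x \<in> A \<inter> ?C" using A by auto
    ultimately have "?R \<inter> ?C = {}"
      using connected_closedD[OF connected_connected_component[of "\<Union>\<F>" x], of A ?R] by blast
    then show "?C \<subseteq> A" using \<open>?C \<subseteq> A \<union> ?R\<close> by blast
  qed
  show ?thesis
  proof
    show "components (\<Union>\<F>) \<subseteq> \<F>" unfolding components_def using comp by auto
    show "\<F> \<subseteq> components (\<Union>\<F>)"
    proof
      fix A assume A: "A \<in> \<F>"
      then obtain x where "x \<in> A" using assms(2) by blast
      then show "A \<in> components (\<Union>\<F>)" unfolding components_def using comp[OF A] A by blast
    qed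
  qed
qed

context ribbon_in_surface
begin

definition boundary :: "'e set \<Rightarrow> 'a set" where
  "boundary H = ((\<Union>v\<in>verts G. vmap F v ` sphere 0 1) - (\<Union>e\<in>H. emap F e ` {z. \<bar>Re z\<bar> = 1 \<and> \<bar>Im z\<bar> < 1/2})) \<union>
     (\<Union>e\<in>H. emap F e ` {z. \<bar>Re z\<bar> \<le> 1 \<and> \<bar>Im z\<bar> = 1/2})"

lemma sphere_in_disc: "v \<in> verts G \<Longrightarrow> vmap F v ` cball 0 1 = vmap F v ` ball 0 1 \<union> vmap F v ` sphere 0 1"
proof -
  have "cball 0 1 = ball 0 1 \<union> sphere (0::complex) 1" by auto
  then show ?thesis by (metis image_Un)
qed

lemma band_in_box: "band \<subseteq> edge_box" by (auto simp: band_def edge_box_def)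

lemma compact_disc: "v \<in> verts G \<Longrightarrow> compact (vmap F v ` cball 0 1)"
  by (rule compact_continuous_image[OF continuous_on_subset[OF vmap(1)]]) auto

lemma compact_band: "e \<in> edges G \<Longrightarrow> compact (emap F e ` band)"
proof (rule compact_continuous_image[OF continuous_on_subset[OF emap(2) band_in_box]])
  have "band = cbox (Complex (-1) (-1/2)) (Complex 1 (1/2))"
    by (auto simp: band_def in_cbox_complex_iff abs_le_iff)
  then show "compact band" by (metis compact_cbox)
qed

lemma compact_box_image: "e \<in> edges G \<Longrightarrow> compact (emap F e ` edge_box)"
  by (rule compact_continuous_image[OF emap(2) compact_edge_box])

lemma box_outside_discs:
  assumes "e \<in> edges G" "z \<in> edge_box" "\<bar>Re z\<bar> < 1"
  shows "emap F e z \<notin> (\<Union>v\<in>verts G. vmap F v ` cball 0 1)"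
  using emap_sphere[OF assms(1,2)] assms(3) sphere_in_disc by auto

lemma state_surface_subset: "H \<subseteq> edges G \<Longrightarrow> state_surface G F H \<subseteq> surface_interior \<A>"
proof -
  assume H: "H \<subseteq> edges G"
  have "vmap F v ` cball 0 1 \<subseteq> surface_interior \<A>" if "v \<in> verts G" for v
    using vmap(3)[OF that] by (rule subset_trans[rotated]) (intro image_mono, auto)
  moreover have "emap F e ` band \<subseteq> surface_interior \<A>" if "e \<in> H" for e
    using emap(4)[of e] band_in_box that H by blast
  ultimately show ?thesis unfolding state_surface_def by blast
qed

lemma boundary_subset: "H \<subseteq> edges G \<Longrightarrow> boundary H \<subseteq> state_surface G F H"
proof -
  have "sphere 0 1 \<subseteq> cball (0::complex) 1" by auto
  then show ?thesis unfolding boundary_def state_surface_def band_def by fastforce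
qed

lemma disc_in_state_surface:
  "(\<Union>v\<in>verts G. vmap F v ` ball 0 1) \<subseteq> state_surface G F H"
  "(\<Union>v\<in>verts G. vmap F v ` sphere 0 1) \<subseteq> state_surface G F H"
  unfolding state_surface_def by (rule le_supI1, intro UN_mono order_refl image_mono, force)+

text \<open>A point of the surface off \<open>boundary H\<close> lies in an open disc or an open
  strip along a band, and both are open in \<Sigma> by invariance of domain. From a point of
  \<open>boundary H\<close> some path leaves the surface at once: in an edge box a segment into the
  collar beside the band, elsewhere a radius prolonged out of a vertex disc.\<close>

lemma frontier_state_surface:
  assumes H: "H \<subseteq> edges G"
  shows "top_of_set \<Sigma> frontier_of state_surface G F H = boundary H"
proof -
  let ?X = "state_surface G F H"
  have XS: "?X \<subseteq> \<Sigma>" using state_surface_subset[OF H] interior_subset_surface by auto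
  have "compact ?X" unfolding state_surface_def using H finite_graph compact_disc compact_band
    by (intro compact_Un compact_UN) (auto intro: finite_subset)
  then have "closedin (top_of_set \<Sigma>) ?X" using XS by (intro closed_subset compact_imp_closed)
  then have fr: "top_of_set \<Sigma> frontier_of ?X = ?X - top_of_set \<Sigma> interior_of ?X"
    by (simp add: frontier_of_def closure_of_closedin)
  show ?thesis unfolding fr
  proof
    show "?X - top_of_set \<Sigma> interior_of ?X \<subseteq> boundary H"
    proof (rule subsetI, rule ccontr)
      fix x assume x: "x \<in> ?X - top_of_set \<Sigma> interior_of ?X" "x \<notin> boundary H"
      have no: "x \<notin> T" if "openin (top_of_set \<Sigma>) T" "T \<subseteq> ?X" for T
        using x(1) interior_of_maximal[OF that(2,1)] by blast
      have nb: "x \<notin> vmap F v ` ball 0 1" if v: "v \<in> verts G" for v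
      proof (rule no)
        show "openin (top_of_set \<Sigma>) (vmap F v ` ball 0 1)"
          by (rule openin_embedding[OF surf vmap[OF v] open_ball]) (auto simp: subset_iff)
        show "vmap F v ` ball 0 1 \<subseteq> ?X" using v disc_in_state_surface(1) by blast
      qed
      have ne: "x \<notin> emap F e ` {z. \<bar>Re z\<bar> < 2 \<and> \<bar>Im z\<bar> < 1/2}" if e: "e \<in> H" for e
      proof (rule no)
        have eG: "e \<in> edges G" using e H by auto
        \<comment> \<open>The strip is prolonged into the vertex discs, up to |Re z| < 2, so that it
          covers the arcs to which the band is attached.\<close>
        have "open {z. \<bar>Re z\<bar> < 2 \<and> \<bar>Im z\<bar> < 1/2}" by (intro open_Collect_conj open_Collect_less continuous_intros)
        moreover have "{z. \<bar>Re z\<bar> < 2 \<and> \<bar>Im z\<bar> < 1/2} \<subseteq> edge_box" by (auto simp: edge_box_def)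
        ultimately show "openin (top_of_set \<Sigma>) (emap F e ` {z. \<bar>Re z\<bar> < 2 \<and> \<bar>Im z\<bar> < 1/2})"
          by (rule openin_embedding[OF surf emap(2-4)[OF eG]])
        show "emap F e ` {z. \<bar>Re z\<bar> < 2 \<and> \<bar>Im z\<bar> < 1/2} \<subseteq> ?X"
        proof (rule image_subsetI)
          fix z assume "z \<in> {z. \<bar>Re z\<bar> < 2 \<and> \<bar>Im z\<bar> < 1/2}"
          then have z: "\<bar>Re z\<bar> < 2" "\<bar>Im z\<bar> < 1/2" "z \<in> edge_box" by (auto simp: edge_box_def)
          show "emap F e z \<in> ?X"
          proof (cases "\<bar>Re z\<bar> > 1")
            case True
            then have "emap F e z \<in> (\<Union>v\<in>verts G. vmap F v ` ball 0 1)" using emap_sphere(1)[OF eG z(3)] by blast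
            then show ?thesis using disc_in_state_surface(1) by blast
          next
            case False
            then have "z \<in> band" using z by (auto simp: band_def)
            then show ?thesis using e unfolding state_surface_def by blast
          qed
        qed
      qed
      consider v where "v \<in> verts G" "x \<in> vmap F v ` sphere 0 1" | e z where "e \<in> H" "z \<in> band" "x = emap F e z"
      proof -
        have "x \<in> (\<Union>v\<in>verts G. vmap F v ` cball 0 1) \<or> x \<in> (\<Union>e\<in>H. emap F e ` band)"
          using x(1) unfolding state_surface_def by blast
        then show ?thesis using that nb sphere_in_disc by (metis (no_types, lifting) UN_E UnE imageE)
      qed
      then show False
      proof cases
        case 1
        then obtain e z where "e \<in> H" "\<bar>Re z\<bar> = 1" "\<bar>Im z\<bar> < 1/2" "x = emap F e z" using x(2) unfolding boundary_def by blast
        then show False using ne[of e] by auto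
      next
        case 2
        have "\<bar>Im z\<bar> \<noteq> 1/2" using 2 x(2) unfolding boundary_def band_def by blast
        then show False using ne[OF 2(1)] 2 by (auto simp: band_def)
      qed
    qed
    show "boundary H \<subseteq> ?X - top_of_set \<Sigma> interior_of ?X"
    proof (rule subsetI, rule DiffI)
      fix x assume x: "x \<in> boundary H"
      show "x \<in> ?X" using x boundary_subset[OF H] by auto
      show "x \<notin> top_of_set \<Sigma> interior_of ?X"
      proof
        assume "x \<in> top_of_set \<Sigma> interior_of ?X"
        then obtain T where T: "openin (top_of_set \<Sigma>) T" "T \<subseteq> ?X" "x \<in> T" by (auto simp: interior_of_def)
        show False
        proof (cases "\<exists>e\<in>H. x \<in> emap F e ` edge_box")
          case True
          then obtain e z where e: "e \<in> H" "z \<in> edge_box" "x = emap F e z" by auto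
          have eG: "e \<in> edges G" using e H by auto
          have z: "\<bar>Re z\<bar> \<le> 1" "1/2 \<le> \<bar>Im z\<bar>"
          proof -
            consider "x \<in> (\<Union>v\<in>verts G. vmap F v ` sphere 0 1)" "x \<notin> emap F e ` {z. \<bar>Re z\<bar> = 1 \<and> \<bar>Im z\<bar> < 1/2}"
              | e' z' where "e' \<in> H" "\<bar>Re z'\<bar> \<le> 1" "\<bar>Im z'\<bar> = 1/2" "x = emap F e' z'"
              using x e(1) unfolding boundary_def by blast
            then have "\<bar>Re z\<bar> \<le> 1 \<and> 1/2 \<le> \<bar>Im z\<bar>"
            proof cases
              case 1
              then have "\<bar>Re z\<bar> = 1" using emap_sphere(2)[OF eG e(2)] e(3) by auto
              moreover have "\<not> \<bar>Im z\<bar> < 1/2" using calculation 1(2) e(3) by blast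
              ultimately show ?thesis by linarith
            next
              case 2
              then have "e' \<in> edges G" "z' \<in> edge_box" "emap F e z = emap F e' z'" using e H by (auto simp: edge_box_def)
              then have "z = z'" using emap_disjoint(2)[OF eG _ e(2)] by blast
              then show ?thesis using 2 by auto
            qed
            then show "\<bar>Re z\<bar> \<le> 1" "1/2 \<le> \<bar>Im z\<bar>" by auto
          qed
          \<comment> \<open>A point beyond the side of the band and between the two vertex discs.
            Apart from its start, the segment towards it avoids the band and the discs.\<close>
          define w where "w = Complex 0 (if Im z > 0 then 3/4 else -3/4)"
          define f where "f = (\<lambda>s. emap F e ((1 - s) *\<^sub>R z + s *\<^sub>R w))"
          have zz: "(1 - s) *\<^sub>R z + s *\<^sub>R w \<in> edge_box" "0 < s \<Longrightarrow> \<bar>Re ((1 - s) *\<^sub>R z + s *\<^sub>R w)\<bar> < 1 \<and> 1/2 < \<bar>Im ((1 - s) *\<^sub>R z + s *\<^sub>R w)\<bar>"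
            if s: "0 \<le> s" "s \<le> 1" for s :: real
          proof -
            have re: "Re ((1 - s) *\<^sub>R z + s *\<^sub>R w) = (1 - s) * Re z" by (simp add: w_def)
            have "\<bar>(1 - s) * Re z\<bar> = (1 - s) * \<bar>Re z\<bar>" using s by (simp add: abs_mult)
            also have "\<dots> \<le> (1 - s) * 1" using s z(1) by (intro mult_left_mono) auto
            finally have r: "\<bar>(1 - s) * Re z\<bar> \<le> 1 - s" by simp
            have im: "\<bar>Im ((1 - s) *\<^sub>R z + s *\<^sub>R w)\<bar> = (1 - s) * \<bar>Im z\<bar> + s * (3/4)"
            proof (cases "Im z > 0")
              case True
              then have "0 \<le> (1 - s) * Im z" "0 \<le> s * (3/4)" using s by auto
              then show ?thesis using True by (simp add: w_def)
            next
              case False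
              then have "(1 - s) * Im z \<le> 0" "0 \<le> s * (3/4)" using s by (auto simp: mult_le_0_iff)
              then show ?thesis using False z(2) by (simp add: w_def)
            qed
            have i1: "(1 - s) * \<bar>Im z\<bar> \<le> (1 - s) * 1" using s e(2) by (intro mult_left_mono) (auto simp: edge_box_def)
            have i2: "(1 - s) * (1/2) \<le> (1 - s) * \<bar>Im z\<bar>" using s z(2) by (intro mult_left_mono) auto
            show "(1 - s) *\<^sub>R z + s *\<^sub>R w \<in> edge_box" unfolding edge_box_def mem_Collect_eq im unfolding re using r i1 s by (auto simp: algebra_simps)
            show "0 < s \<Longrightarrow> \<bar>Re ((1 - s) *\<^sub>R z + s *\<^sub>R w)\<bar> < 1 \<and> 1/2 < \<bar>Im ((1 - s) *\<^sub>R z + s *\<^sub>R w)\<bar>"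
              unfolding im unfolding re
            proof (intro conjI)
              assume s0: "0 < s"
              show "\<bar>(1 - s) * Re z\<bar> < 1" by (rule le_less_trans[OF r]) (use s0 in simp)
              have "1/2 < (1 - s) * (1/2) + s * (3/4)" using s0 by (simp add: field_simps)
              then show "1/2 < (1 - s) * \<bar>Im z\<bar> + s * (3/4)" by (rule less_le_trans[OF _ add_right_mono[OF i2]])
            qed
          qed
          have "continuous_on {0..1} f" unfolding f_def
            by (rule continuous_on_compose2[OF emap(2)[OF eG]]) (use zz(1) in \<open>auto intro!: continuous_intros\<close>)
          moreover have "f ` {0..1} \<subseteq> \<Sigma>"
            using zz(1) emap(4)[OF eG] interior_subset_surface unfolding f_def by fastforce
          moreover have "f 0 \<in> T" using T(3) e(3) by (simp add: f_def)
          ultimately obtain s where s: "0 < s" "s \<le> 1" "f s \<in> T" using openin_path_start T(1) by metis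
          define z' where "z' = (1 - s) *\<^sub>R z + s *\<^sub>R w"
          have z': "z' \<in> edge_box" "\<bar>Re z'\<bar> < 1" "1/2 < \<bar>Im z'\<bar>" using zz[of s] s by (auto simp: z'_def)
          have "emap F e z' \<in> ?X" using s(3) T(2) by (auto simp: f_def z'_def)
          then obtain e' b where b: "e' \<in> H" "b \<in> band" "emap F e z' = emap F e' b"
            using box_outside_discs[OF eG z'(1,2)] unfolding state_surface_def by blast
          then have "z' = b" using emap_disjoint(2)[OF eG _ z'(1)] band_in_box H by blast
          then show False using b(2) z'(3) by (auto simp: band_def)
        next
          case False
          then obtain v \<zeta> where v: "v \<in> verts G" "\<zeta> \<in> sphere 0 1" "x = vmap F v \<zeta>"
            using x unfolding boundary_def edge_box_def by fastforce
          \<comment> \<open>All bands of the state and all other discs. With this compact set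
            removed from the neighbourhood, a nearby point of the surface must lie in the disc of
            \<open>v\<close>; injectivity of \<open>vmap F v\<close> on the disc of radius 2
            excludes this for points of norm greater than 1.\<close>
          define Z where "Z = (\<Union>v'\<in>verts G - {v}. vmap F v' ` cball 0 1) \<union> (\<Union>e\<in>H. emap F e ` band)"
          have "compact Z" unfolding Z_def using H finite_graph compact_disc compact_band
            by (intro compact_Un compact_UN) (auto intro: finite_subset)
          have xZ: "x \<notin> Z"
          proof -
            have "x \<in> vmap F v ` cball 0 1" using v sphere_in_disc[OF v(1)] by blast
            then have "x \<notin> vmap F v' ` cball 0 1" if "v' \<in> verts G - {v}" for v'
              using discs_disjoint v(1) that unfolding pairwise_def disjnt_def by blast
            then show ?thesis using False band_in_box unfolding Z_def by blast
          qed
          have oT: "openin (top_of_set \<Sigma>) (T - Z)"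
          proof -
            obtain T0 where "open T0" "T = \<Sigma> \<inter> T0" using T(1) by (auto simp: openin_open)
            moreover have "open (T0 - Z)" using \<open>open T0\<close> \<open>compact Z\<close> by (intro open_Diff compact_imp_closed)
            ultimately show ?thesis unfolding openin_open by (intro exI[of _ "T0 - Z"]) auto
          qed
          define f where "f = (\<lambda>s::real. vmap F v (of_real (1 + s) * \<zeta>))"
          have n: "norm (of_real (1 + s) * \<zeta>) = 1 + s" if "0 \<le> s" for s :: real
          proof -
            have "norm \<zeta> = 1" using v(2) by simp
            then show ?thesis using that by (simp only: norm_mult norm_of_real) simp
          qed
          have "continuous_on {0..1} f" unfolding f_def
            by (rule continuous_on_compose2[OF vmap(1)[OF v(1)]]) (use n in \<open>auto intro!: continuous_intros\<close>)
          moreover have "f ` {0..1} \<subseteq> \<Sigma>"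
          proof -
            have "of_real (1 + s) * \<zeta> \<in> cball 0 2" if "s \<in> {0..1}" for s :: real using n[of s] that by auto
            then show ?thesis using vmap(3)[OF v(1)] interior_subset_surface unfolding f_def by blast
          qed
          moreover have "f 0 \<in> T - Z" using T(3) xZ v(3) by (simp add: f_def)
          ultimately obtain s where s: "0 < s" "s \<le> 1" "f s \<in> T - Z" using openin_path_start oT by metis
          have "f s \<in> vmap F v ` cball 0 1"
          proof -
            have "f s \<in> (\<Union>v'\<in>verts G. vmap F v' ` cball 0 1) \<union> (\<Union>e\<in>H. emap F e ` band)" "f s \<notin> Z"
              using subsetD[OF T(2), of "f s"] s(3) unfolding state_surface_def by simp_all
            then show ?thesis unfolding Z_def by (metis (no_types, lifting) DiffI UN_E UN_I UnCI UnE singletonD)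
          qed
          then obtain y where y: "y \<in> cball 0 1" "vmap F v (of_real (1 + s) * \<zeta>) = vmap F v y" by (auto simp: f_def)
          moreover have "of_real (1 + s) * \<zeta> \<in> cball 0 2" "y \<in> cball 0 2" using n[of s] s y(1) by auto
          ultimately have "of_real (1 + s) * \<zeta> = y" using vmap(2)[OF v(1)] unfolding inj_on_def by blast
          then show False using n[of s] s y(1) by auto
        qed
      qed
    qed
  qed
qed

text \<open>Describes the boundary by the pieces from which the link is built, so that it can be
  compared with the straightened link piece by piece.\<close>

lemma boundary_eq:
  assumes H: "H \<subseteq> edges G"
  shows "boundary H = fst ` trace (vertex_arcs G F) \<union> (\<Union>e\<in>edges G. emap F e ` (if e \<in> H then banded else unbanded))"
proof
  have bb: "banded \<subseteq> edge_box" "unbanded \<subseteq> edge_box" by (auto simp: banded_def unbanded_def edge_box_def)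
  show "boundary H \<subseteq> fst ` trace (vertex_arcs G F) \<union> (\<Union>e\<in>edges G. emap F e ` (if e \<in> H then banded else unbanded))"
  proof
    fix x assume x: "x \<in> boundary H"
    then consider v \<zeta> where "v \<in> verts G" "\<zeta> \<in> sphere 0 1" "x = vmap F v \<zeta>" "x \<notin> (\<Union>e\<in>H. emap F e ` {z. \<bar>Re z\<bar> = 1 \<and> \<bar>Im z\<bar> < 1/2})"
      | e z where "e \<in> H" "\<bar>Re z\<bar> \<le> 1" "\<bar>Im z\<bar> = 1/2" "x = emap F e z"
      unfolding boundary_def by blast
    then show "x \<in> fst ` trace (vertex_arcs G F) \<union> (\<Union>e\<in>edges G. emap F e ` (if e \<in> H then banded else unbanded))"
    proof cases
      case 1
      show ?thesis
      proof (cases "\<exists>e\<in>edges G. x \<in> emap F e ` edge_box")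
        case True
        then obtain e z where e: "e \<in> edges G" "z \<in> edge_box" "x = emap F e z" by auto
        have "emap F e z \<in> (\<Union>v\<in>verts G. vmap F v ` sphere 0 1)" unfolding e(3)[symmetric] 1(3) using 1(1,2) by (metis UN_I imageI)
        then have re: "\<bar>Re z\<bar> = 1" using emap_sphere(2)[OF e(1,2)] by simp
        have "e \<in> H \<Longrightarrow> \<not> \<bar>Im z\<bar> < 1/2" using 1(4) re e(3) by blast
        then have "z \<in> (if e \<in> H then banded else unbanded)" using re e(2) by (auto simp: banded_def unbanded_def edge_box_def)
        then show ?thesis using e by blast
      next
        case False
        obtain \<theta> where \<theta>: "\<zeta> = cis \<theta>" using 1(2) by (metis cis_Arg mem_sphere_0 norm_eq_zero sgn_div_norm scaleR_one inverse_1 zero_neq_one)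
        \<comment> \<open>The closed boxes form a compact set, so a point of a vertex circle off
          them has a whole arc of the circle off them. With its length bounded by one turn, this arc
          is an element of \<open>vertex_arcs\<close>.\<close>
        define Z where "Z = (\<Union>e\<in>edges G. emap F e ` edge_box)"
        have "compact Z" unfolding Z_def using finite_graph compact_box_image by (intro compact_UN) auto
        define f where "f = (\<lambda>t. vmap F v (cis (\<theta> + t)))"
        have "continuous_on UNIV f" unfolding f_def
          by (rule continuous_on_compose2[OF vmap(1)[OF 1(1)]]) (auto intro!: continuous_intros)
        then have "open (f -` (- Z))" using \<open>compact Z\<close> by (intro open_vimage) (auto intro: compact_imp_closed)
        moreover have "0 \<in> f -` (- Z)" using False 1(3) \<theta> by (auto simp: f_def Z_def)
        ultimately obtain \<delta> where \<delta>: "\<delta> > 0" "cball 0 \<delta> \<subseteq> f -` (- Z)" by (meson open_contains_cball)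
        define \<tau> where "\<tau> = min \<delta> (2 * pi)"
        have \<tau>: "0 < \<tau>" "\<tau> \<le> 2 * pi" "\<tau> \<le> \<delta>" using \<delta>(1) pi_gt_zero by (auto simp: \<tau>_def)
        define a where "a = (\<lambda>s. (vmap F v (cis (\<theta> + s * \<tau>)), 1/2::real))"
        have sub: "{z. \<bar>Re z\<bar> \<le> 2 \<and> \<bar>Im z\<bar> < 1} \<subseteq> edge_box" by (auto simp: edge_box_def)
        have "vmap F v (cis (\<theta> + s * \<tau>)) \<notin> (\<Union>e\<in>edges G. emap F e ` {z. \<bar>Re z\<bar> \<le> 2 \<and> \<bar>Im z\<bar> < 1})" if "s \<in> {0..1}" for s
        proof -
          have "0 \<le> s * \<tau>" "s * \<tau> \<le> \<tau>" using that \<tau> by (auto intro: mult_left_le_one_le)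
          then have "\<bar>s * \<tau>\<bar> \<le> \<delta>" using \<tau> by linarith
          then have "s * \<tau> \<in> cball 0 \<delta>" by (simp add: dist_real_def)
          then have "f (s * \<tau>) \<notin> Z" using \<delta>(2) by blast
          then show ?thesis using sub unfolding f_def Z_def by blast
        qed
        then have "a \<in> vertex_arcs G F" unfolding vertex_arcs_def a_def using 1(1) \<tau> by blast
        moreover have "(x, 1/2) = a 0" using 1(3) \<theta> by (simp add: a_def)
        ultimately have "(x, 1/2) \<in> trace (vertex_arcs G F)" unfolding trace_def path_image_def by (metis UN_I atLeastAtMost_iff imageI order_refl zero_le_one)
        then show ?thesis by force
      qed
    next
      case 2
      then have "z \<in> banded" by (auto simp: banded_def)
      then show ?thesis using 2 H by (intro UnI2 UN_I[of e]) auto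
    qed
  qed
  show "fst ` trace (vertex_arcs G F) \<union> (\<Union>e\<in>edges G. emap F e ` (if e \<in> H then banded else unbanded)) \<subseteq> boundary H"
  proof (rule Un_least)
    show "fst ` trace (vertex_arcs G F) \<subseteq> boundary H"
    proof (rule image_subsetI)
      fix p assume p: "p \<in> trace (vertex_arcs G F)"
      have "{z. \<bar>Re z\<bar> = 1 \<and> \<bar>Im z\<bar> < 1/2} \<subseteq> {z. \<bar>Re z\<bar> \<le> 2 \<and> \<bar>Im z\<bar> < 1}" by auto
      then have "fst p \<notin> (\<Union>e\<in>H. emap F e ` {z. \<bar>Re z\<bar> = 1 \<and> \<bar>Im z\<bar> < 1/2})" using trace_vertex_arcs(3)[OF p] H by blast
      then show "fst p \<in> boundary H" using trace_vertex_arcs(2)[OF p] unfolding boundary_def by blast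
    qed
    show "(\<Union>e\<in>edges G. emap F e ` (if e \<in> H then banded else unbanded)) \<subseteq> boundary H"
    proof (rule UN_least, rule image_subsetI)
      fix e z assume e: "e \<in> edges G" "z \<in> (if e \<in> H then banded else unbanded)"
      have zb: "z \<in> edge_box" using e(2) bb by (auto split: if_splits)
      show "emap F e z \<in> boundary H"
      proof (cases "\<bar>Re z\<bar> = 1 \<and> (e \<in> H \<longrightarrow> 1/2 \<le> \<bar>Im z\<bar>)")
        case True
        then have "emap F e z \<in> (\<Union>v\<in>verts G. vmap F v ` sphere 0 1)" using emap_sphere(2)[OF e(1) zb] by blast
        moreover have "emap F e z \<notin> emap F e' ` {z. \<bar>Re z\<bar> = 1 \<and> \<bar>Im z\<bar> < 1/2}" if e': "e' \<in> H" for e'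
        proof
          assume "emap F e z \<in> emap F e' ` {z. \<bar>Re z\<bar> = 1 \<and> \<bar>Im z\<bar> < 1/2}"
          then obtain z' where z': "emap F e z = emap F e' z'" "\<bar>Re z'\<bar> = 1" "\<bar>Im z'\<bar> < 1/2" by auto
          have "e = e'" "z = z'" using emap_disjoint[OF e(1) _ zb _ z'(1)] e' H z' by (auto simp: edge_box_def)
          then show False using True e' z' by auto
        qed
        ultimately show ?thesis unfolding boundary_def by blast
      next
        case False
        then have "e \<in> H \<and> \<bar>Re z\<bar> \<le> 1 \<and> \<bar>Im z\<bar> = 1/2" using e(2) by (auto simp: banded_def unbanded_def split: if_splits)
        then show ?thesis unfolding boundary_def by blast
      qed
    qed
  qed
qed

end

section \<open>Resolved links are boundaries of states\<close>

lemma corners_in_tangle: "corners \<times> {1/2} \<subseteq> trace (tangle X)"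
proof
  fix p :: "complex \<times> real" assume "p \<in> corners \<times> {1/2}"
  then have p: "p = (Complex 1 1, 1/2) \<or> p = (Complex 1 (-1), 1/2) \<or> p = (Complex (-1) 1, 1/2) \<or> p = (Complex (-1) (-1), 1/2)"
    by (cases p) (auto simp: corners_def complex_eq_iff abs_if split: if_splits)
  have "(a, 1/2) \<in> path_image (strand \<epsilon> a b)" "(b, 1/2) \<in> path_image (strand \<epsilon> a b)" for a b \<epsilon>
    by (metis pathstart_in_path_image strand_ends(1)) (metis pathfinish_in_path_image strand_ends(2))
  then have "p \<in> trace six_strands" using p by (auto simp: six_strands_def)
  then show "p \<in> trace (tangle X)" by (simp add: tangle_def tangle_rest_eq)
qed

lemma ambient_isotopy_homeo:
  assumes "ambient_isotopy \<Sigma> h"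
  shows "continuous_on (\<Sigma> \<times> {0..1}) (h 1)" "inj_on (h 1) (\<Sigma> \<times> {0..1})" "h 1 ` (\<Sigma> \<times> {0..1}) = \<Sigma> \<times> {0..1}"
proof -
  obtain g where g: "homeomorphism (\<Sigma> \<times> {0..1}) (\<Sigma> \<times> {0..1}) (h 1) g"
    using assms unfolding ambient_isotopy_def by (meson atLeastAtMost_iff order_refl zero_le_one)
  then show "continuous_on (\<Sigma> \<times> {0..1}) (h 1)" "h 1 ` (\<Sigma> \<times> {0..1}) = \<Sigma> \<times> {0..1}"
    by (auto simp: homeomorphism_def)
  show "inj_on (h 1) (\<Sigma> \<times> {0..1})" using g unfolding homeomorphism_def by (metis inj_on_inverseI)
qed

text \<open>Since the projection is injective on the compact set \<open>T\<close>, the height is a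
  continuous function on the projection of \<open>T\<close>. Its logit, subtracted from that of 1/2,
  is the shear parameter to be extended.\<close>

lemma flatten_heights:
  fixes \<Sigma> :: "'a::metric_space set"
  assumes T: "compact T" "inj_on fst T" "T \<subseteq> \<Sigma> \<times> {0<..<1::real}"
  obtains M where "continuous_on \<Sigma> M" "\<And>p. p \<in> T \<Longrightarrow> lift_by M 1 p = (fst p, 1/2)"
proof -
  define g where "g = inv_into T fst"
  have gf: "g (fst p) = p" if "p \<in> T" for p using that T(2) by (simp add: g_def)
  have "continuous_on (fst ` T) g" using T(1) gf by (intro continuous_on_inv) (auto intro!: continuous_intros)
  then have c: "continuous_on (fst ` T) (\<lambda>c. logit (1/2) - logit (snd (g c)))"
    using T(3) gf by (intro continuous_intros) (auto simp: subset_iff mem_Times_iff)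
  have "compact (fst ` T)" using T(1) by (intro compact_continuous_image) (auto intro!: continuous_intros)
  moreover have "fst ` T \<subseteq> \<Sigma>" using T(3) by auto
  ultimately obtain M where M: "continuous_on \<Sigma> M" "\<And>c. c \<in> fst ` T \<Longrightarrow> M c = logit (1/2) - logit (snd (g c))"
    using Tietze_compact_real[OF _ _ c] by metis
  have "lift_by M 1 p = (fst p, 1/2)" if "p \<in> T" for p
  proof -
    have "0 < snd p" "snd p < 1" using subsetD[OF T(3) that] by (cases p; simp)+
    then show ?thesis using M(2)[of "fst p"] that gf[OF that] slide_to[of "snd p" "1/2"] by (simp add: lift_by_def)
  qed
  then show ?thesis using that M(1) by blast
qed

lemma connected_in_disjoint_Union:
  fixes Z :: "'i \<Rightarrow> 'b::topological_space set"
  assumes "finite E" "\<And>e. e \<in> E \<Longrightarrow> closed (Z e)" "\<And>e e'. e \<in> E \<Longrightarrow> e' \<in> E \<Longrightarrow> e \<noteq> e' \<Longrightarrow> Z e \<inter> Z e' = {}"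
    "connected Q" "Q \<noteq> {}" "Q \<subseteq> (\<Union>e\<in>E. Z e)"
  obtains e where "e \<in> E" "Q \<subseteq> Z e"
proof -
  obtain e x where e: "e \<in> E" "x \<in> Q" "x \<in> Z e" using assms(5,6) by blast
  have "closed (\<Union>e'\<in>E - {e}. Z e')" using assms(1,2) by (intro closed_UN) auto
  moreover have "Q \<subseteq> Z e \<union> (\<Union>e'\<in>E - {e}. Z e')" using assms(6) by blast
  moreover have "Z e \<inter> (\<Union>e'\<in>E - {e}. Z e') = {}" using assms(3)[OF e(1)] by blast
  ultimately have "(\<Union>e'\<in>E - {e}. Z e') \<inter> Q = {}"
    using connected_closedD[OF assms(4), of "Z e" "\<Union>e'\<in>E - {e}. Z e'"] assms(2)[OF e(1)] e(2,3) by blast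
  then have "Q \<subseteq> Z e" using \<open>Q \<subseteq> Z e \<union> _\<close> by blast
  then show ?thesis using that e(1) by blast
qed

text \<open>The value halfway between those at the parameters 0 and 1/2 is taken on both halves of
  the loop, by the intermediate value theorem.\<close>

lemma no_loop_injective_real:
  fixes f :: "'b::topological_space \<Rightarrow> real"
  assumes g: "simple_path g" "pathfinish g = pathstart g" and f: "continuous_on (path_image g) f" "inj_on f (path_image g)"
  shows False
proof -
  define k where "k = f \<circ> g"
  have ck: "continuous_on {0..1} k" using g(1) f(1) unfolding k_def simple_path_def path_def path_image_def
    by (intro continuous_on_compose) auto
  have kinj: "x = y \<or> x = 0 \<and> y = 1 \<or> x = 1 \<and> y = 0" if "x \<in> {0..1}" "y \<in> {0..1}" "k x = k y" for x y
  proof -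
    have "g x = g y" using that f(2) unfolding k_def path_image_def inj_on_def by auto
    then show ?thesis using g(1) that unfolding simple_path_def loop_free_def by blast
  qed
  have k01: "k 0 = k 1" using g(2) by (simp add: k_def pathfinish_def pathstart_def)
  have ne: "k (1/2) \<noteq> k 0" using kinj[of "1/2" 0] by auto
  define v where "v = (k 0 + k (1/2)) / 2"
  have vv: "v \<noteq> k 0" using ne by (simp add: v_def field_simps)
  have conn: "connected (k ` {0..1/2})" "connected (k ` {1/2..1})"
    using ck by (auto intro!: connected_continuous_image intro: continuous_on_subset)
  have m: "v \<in> {min (k 0) (k (1/2))..max (k 0) (k (1/2))}" by (auto simp: v_def min_def max_def field_simps)
  have "{min (k 0) (k (1/2))..max (k 0) (k (1/2))} \<subseteq> k ` {0..1/2}"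
    by (rule connected_contains_Icc[OF conn(1)]) (auto simp: min_def max_def)
  then obtain x where x: "x \<in> {0..1/2}" "k x = v" using m by blast
  have "{min (k 0) (k (1/2))..max (k 0) (k (1/2))} \<subseteq> k ` {1/2..1}"
    by (rule connected_contains_Icc[OF conn(2)]) (auto simp: min_def max_def k01)
  then obtain y where y: "y \<in> {1/2..1}" "k y = v" using m by blast
  have "x = y \<or> x = 0 \<and> y = 1 \<or> x = 1 \<and> y = 0" using kinj[of x y] x y by auto
  then have "x = 1/2 \<or> x = 0" using x y by auto
  then show False
  proof
    assume "x = 1/2"
    then have "k (1/2) = v" using x(2) by blast
    then show False using ne by (simp add: v_def field_simps)
  next
    assume "x = 0" then show False using x(2) vv by simp
  qed
qed

lemma closed_curves_disjoint:
  "closed_curves L \<Longrightarrow> \<gamma> \<in> L \<Longrightarrow> \<delta> \<in> L \<Longrightarrow> \<gamma> \<noteq> \<delta> \<Longrightarrow> path_image \<gamma> \<inter> path_image \<delta> = {}"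
  by (simp add: closed_curves_def pairwise_def disjnt_def)

lemma fst_image_disjoint:
  assumes "A \<inter> B = {}" "\<And>p. p \<in> A \<Longrightarrow> snd p = c" "\<And>p. p \<in> B \<Longrightarrow> snd p = c"
  shows "fst ` A \<inter> fst ` B = {}"
proof (rule ccontr)
  assume "\<not> ?thesis"
  then obtain p q where "p \<in> A" "q \<in> B" "fst p = fst q" by blast
  then have "p = q" using assms(2,3) by (simp add: prod_eq_iff)
  then show False using assms(1) \<open>p \<in> A\<close> \<open>q \<in> B\<close> by blast
qed

text \<open>The height map that iterated stacking applies to the knot \<open>J\<close>: the first
  knot goes to the upper half, all that is below it is halved. It depends on identifying
  \<open>J\<close> in the list, which therefore has to be free of repetitions.\<close>

fun stack_level :: "'a knot list \<Rightarrow> 'a knot \<Rightarrow> real \<Rightarrow> real" where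
  "stack_level [] J z = z"
| "stack_level [K] J z = z"
| "stack_level (K # K' # Ks) J z = (if J = K then (1 + z) / 2 else stack_level (K' # Ks) J z / 2)"

lemma stack_knots_eq:
  "distinct Ks \<Longrightarrow> stack_knots Ks = (\<lambda>K. map_prod id (stack_level Ks K) \<circ> K) ` set Ks"
proof (induction Ks rule: stack_knots.induct)
  case (2 K)
  have "(\<lambda>z. z) = (id::real\<Rightarrow>real)" by auto
  then have "map_prod id (stack_level [K] K) = id" by (auto simp: fun_eq_iff)
  then show ?case by simp
next
  case (3 K K' Ks)
  have top: "map_prod id (stack_level (K # K' # Ks) K) = (map_prod id (\<lambda>z. (1 + z) / 2) :: 'a \<times> real \<Rightarrow> 'a \<times> real)"
    by (auto simp: fun_eq_iff)
  have "map_prod id (\<lambda>z. z / 2) \<circ> (map_prod id (stack_level (K' # Ks) J) \<circ> J) = map_prod id (stack_level (K # K' # Ks) J) \<circ> J"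
    if "J \<in> set (K' # Ks)" for J
  proof -
    have "J \<noteq> K" using that 3(2) by auto
    then have "stack_level (K # K' # Ks) J = (\<lambda>z. stack_level (K' # Ks) J z / 2)" by (intro ext) simp
    then show ?thesis by (simp only: o_def map_prod_def split_def id_def fst_conv snd_conv)
  qed
  then have below: "(\<lambda>\<gamma>. map_prod id (\<lambda>z. z / 2) \<circ> \<gamma>) ` (\<lambda>J. map_prod id (stack_level (K' # Ks) J) \<circ> J) ` set (K' # Ks) =
     (\<lambda>J. map_prod id (stack_level (K # K' # Ks) J) \<circ> J) ` set (K' # Ks)"
    unfolding image_image by (intro image_cong refl) blast
  have rest: "stack_knots (K' # Ks) = (\<lambda>J. map_prod id (stack_level (K' # Ks) J) \<circ> J) ` set (K' # Ks)"
    by (rule 3(1)) (use 3(2) in simp)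
  show ?case unfolding stack_knots.simps(3) stack_def rest below list.set(2)[of K "K' # Ks"] image_insert top image_empty
    by (rule insert_is_Un[symmetric])
qed simp

lemma stack_level_bounds: "0 < stack_level Ks J (1/2)" "stack_level Ks J (1/2) < 1"
proof -
  have "0 < stack_level Ks J (1/2) \<and> stack_level Ks J (1/2) < 1"
  proof (induction Ks rule: stack_knots.induct)
    case (3 K K' Ks) then show ?case by (cases "J = K") auto
  qed auto
  then show "0 < stack_level Ks J (1/2)" "stack_level Ks J (1/2) < 1" by auto
qed

text \<open>Curves at one level have disjoint compact projections, so a shear parameter that is
  constant on each of them is continuous on their union. It can be chosen to take the level 1/2 to
  the level prescribed for that curve.\<close>

lemma level_curves_stack:
  fixes \<Sigma> :: "'a::metric_space set"
  assumes L: "closed_curves L" "trace L \<subseteq> \<Sigma> \<times> {1/2}" and Ks: "distinct Ks" "set Ks = L"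
  obtains M where "continuous_on \<Sigma> M" "carries (stack_knots Ks) ((\<lambda>\<gamma>. lift_by M 1 \<circ> \<gamma>) ` L)"
proof -
  let ?C = "\<lambda>\<gamma>. fst ` path_image \<gamma>"
  have half: "snd p = 1/2" "fst p \<in> \<Sigma>" if "\<gamma> \<in> L" "p \<in> path_image \<gamma>" for \<gamma> p using L(2) that by (auto simp: trace_def)
  have disj: "?C \<gamma> \<inter> ?C \<delta> = {}" if "\<gamma> \<in> L" "\<delta> \<in> L" "\<gamma> \<noteq> \<delta>" for \<gamma> \<delta>
  proof -
    have "path_image \<gamma> \<inter> path_image \<delta> = {}" using closed_curves_disjoint[OF L(1) that] .
    then show ?thesis by (rule fst_image_disjoint[OF _ half(1)[OF that(1)] half(1)[OF that(2)]])
  qed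
  have comp: "compact (?C \<gamma>)" if "\<gamma> \<in> L" for \<gamma> using L(1) that
    by (intro compact_continuous_image compact_path_image) (auto simp: closed_curves_def simple_path_imp_path intro!: continuous_intros)
  define owner where "owner = (\<lambda>c. SOME \<gamma>. \<gamma> \<in> L \<and> c \<in> ?C \<gamma>)"
  have owner: "owner c = \<gamma>" if "\<gamma> \<in> L" "c \<in> ?C \<gamma>" for c \<gamma>
  proof -
    have "owner c \<in> L \<and> c \<in> ?C (owner c)" unfolding owner_def by (rule someI[of _ \<gamma>]) (use that in blast)
    then show ?thesis using disj[of "owner c" \<gamma>] that by blast
  qed
  define m where "m = (\<lambda>c. logit (stack_level Ks (owner c) (1/2)) - logit (1/2))"
  have "continuous_on (?C \<gamma>) m" if "\<gamma> \<in> L" for \<gamma>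
  proof (rule continuous_on_eq)
    show "continuous_on (?C \<gamma>) (\<lambda>_. logit (stack_level Ks \<gamma> (1/2)) - logit (1/2))" by (rule continuous_on_const)
  qed (use owner that in \<open>simp add: m_def\<close>)
  then have cm: "continuous_on (\<Union>\<gamma>\<in>L. ?C \<gamma>) m"
    using L(1) comp by (intro continuous_on_closed_Union) (auto simp: closed_curves_def intro: compact_imp_closed)
  have "compact (\<Union>\<gamma>\<in>L. ?C \<gamma>)" using comp L(1) by (intro compact_UN) (auto simp: closed_curves_def)
  moreover have "(\<Union>\<gamma>\<in>L. ?C \<gamma>) \<subseteq> \<Sigma>" using half by blast
  ultimately obtain M where M: "continuous_on \<Sigma> M" "\<And>c. c \<in> (\<Union>\<gamma>\<in>L. ?C \<gamma>) \<Longrightarrow> M c = m c"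
    using Tietze_compact_real[OF _ _ cm] by metis
  have lift: "lift_by M 1 (\<gamma> s) = (map_prod id (stack_level Ks \<gamma>) \<circ> \<gamma>) s" if \<gamma>: "\<gamma> \<in> L" and s: "s \<in> {0..1}" for \<gamma> s
  proof -
    have p: "\<gamma> s \<in> path_image \<gamma>" using s by (auto simp: path_image_def)
    then have "M (fst (\<gamma> s)) = logit (stack_level Ks \<gamma> (1/2)) - logit (1/2)" using M(2)[of "fst (\<gamma> s)"] owner[OF \<gamma>, of "fst (\<gamma> s)"] \<gamma>
      by (auto simp: m_def)
    moreover have "\<gamma> s = (fst (\<gamma> s), 1/2)" using half(1)[OF \<gamma> p] by (simp add: prod_eq_iff)
    moreover have "slide (logit (stack_level Ks \<gamma> (1/2)) - logit (1/2)) (1/2) = stack_level Ks \<gamma> (1/2)"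
      using stack_level_bounds[of Ks \<gamma>] by (intro slide_to) auto
    ultimately show ?thesis unfolding lift_by_def o_def by (metis fst_conv id_apply map_prod_simp mult_1 snd_conv)
  qed
  have im: "path_image (lift_by M 1 \<circ> \<gamma>) = path_image (map_prod id (stack_level Ks \<gamma>) \<circ> \<gamma>)" if "\<gamma> \<in> L" for \<gamma>
    using lift[OF that] unfolding path_image_def by (intro image_cong) auto
  have "carries (stack_knots Ks) ((\<lambda>\<gamma>. lift_by M 1 \<circ> \<gamma>) ` L)"
    unfolding carries_def stack_knots_eq[OF Ks(1)] Ks(2)
  proof (intro conjI ballI)
    show "trace ((\<lambda>K. map_prod id (stack_level Ks K) \<circ> K) ` L) = trace ((\<lambda>\<gamma>. lift_by M 1 \<circ> \<gamma>) ` L)"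
      using im by (simp add: trace_def)
    fix a assume "a \<in> (\<lambda>\<gamma>. lift_by M 1 \<circ> \<gamma>) ` L"
    then obtain \<gamma> where \<gamma>: "\<gamma> \<in> L" "a = lift_by M 1 \<circ> \<gamma>" by auto
    have "runs_along a (map_prod id (stack_level Ks \<gamma>) \<circ> \<gamma>)"
    proof (rule runs_along_cong)
      show "pathfinish (map_prod id (stack_level Ks \<gamma>) \<circ> \<gamma>) = pathstart (map_prod id (stack_level Ks \<gamma>) \<circ> \<gamma>)"
        using L(1) \<gamma>(1) by (auto simp: closed_curves_def pathfinish_def pathstart_def)
    qed (use lift[OF \<gamma>(1)] \<gamma>(2) in auto)
    then show "\<exists>\<gamma>\<in>(\<lambda>K. map_prod id (stack_level Ks K) \<circ> K) ` L. runs_along a \<gamma>" using \<gamma>(1) by blast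
  qed
  then show ?thesis using that M(1) by blast
qed

context ribbon_in_surface
begin

definition state_resolution :: "'e set \<Rightarrow> 'e \<Rightarrow> complex knot set" where
  "state_resolution H e = (if e \<in> H then crossing_neg else crossing_smooth)"

lemma range_state_resolution: "range (state_resolution H) \<subseteq> resolutions" by (auto simp: state_resolution_def)

lemma emap_ambient:
  assumes "e \<in> edges G"
  shows "emap F e ` edge_box \<subseteq> \<Sigma>" "openin (top_of_set \<Sigma>) (emap F e ` open_box)"
  using emap(4)[OF assms] interior_subset_surface openin_embedding[OF surf emap(2-4)[OF assms] open_open_box open_box_subset] by auto

text \<open>All edge boxes are straightened simultaneously, which makes the projection of the link
  injective, and then the heights are flattened. That vertex arcs do not move is recorded because
  they later supply a segment of known shape on each curve.\<close>

lemma state_isotopy: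
  assumes H: "H \<subseteq> edges G" and tr: "trace L = trace (arcs (state_resolution H))" and L: "closed_curves L"
  obtains K where "ambient_isotopy \<Sigma> K" "K 1 ` trace L = boundary H \<times> {1/2}"
    "\<And>p. p \<in> trace (vertex_arcs G F) \<Longrightarrow> K 1 p = p"
proof -
  obtain hn where hn: "box_isotopy hn" "inj_on fst (hn 1 ` trace (tangle crossing_neg))"
    "fst ` hn 1 ` trace (tangle crossing_neg) = banded" "snd ` hn 1 ` trace (tangle crossing_neg) \<subseteq> {0<..<1}"
    using straighten_neg by metis
  obtain hs where hs: "box_isotopy hs" "inj_on fst (hs 1 ` trace (tangle crossing_smooth))"
    "fst ` hs 1 ` trace (tangle crossing_smooth) = unbanded" "snd ` hs 1 ` trace (tangle crossing_smooth) \<subseteq> {0<..<1}"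
    using straighten_smooth by metis
  define h where "h = (\<lambda>e. if e \<in> H then hn else hs)"
  let ?X = "state_resolution H"
  have X: "?X e \<in> resolutions" for e using range_state_resolution by blast
  let ?Z = "\<lambda>e. if e \<in> H then banded else unbanded"
  have h: "box_isotopy (h e)" "inj_on fst (h e 1 ` trace (tangle (?X e)))" "fst ` h e 1 ` trace (tangle (?X e)) = ?Z e"
     "snd ` h e 1 ` trace (tangle (?X e)) \<subseteq> {0<..<1}" for e
    using hn hs by (auto simp: h_def state_resolution_def)
  have "\<exists>I. ambient_isotopy \<Sigma> I \<and>
     (\<forall>e\<in>edges G. \<forall>z\<in>edge_box. \<forall>s\<in>{0..1}. I 1 (emap F e z, s) = map_prod (emap F e) id (h e 1 (z, s))) \<and>
     (\<forall>p s. p \<notin> (\<Union>e\<in>edges G. emap F e ` edge_box) \<longrightarrow> I 1 (p, s) = (p, s))"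
    by (rule ambient_isotopy_glue_family[OF finite_graph(1) emap(2) emap(3) emap_ambient boxes_disjoint h(1)])
  then obtain I where I: "ambient_isotopy \<Sigma> I"
     "\<And>e z s. e\<in>edges G \<Longrightarrow> z\<in>edge_box \<Longrightarrow> s\<in>{0..1} \<Longrightarrow> I 1 (emap F e z, s) = map_prod (emap F e) id (h e 1 (z, s))"
     "\<And>p s. p \<notin> (\<Union>e\<in>edges G. emap F e ` edge_box) \<Longrightarrow> I 1 (p, s) = (p, s)" by blast
  have Iq: "I 1 (map_prod (emap F e) id q) = map_prod (emap F e) id (h e 1 q)" if "e \<in> edges G" "q \<in> trace (tangle (?X e))" for e q
    using trace_tangle_bounds[OF X that(2)] I(2)[OF that(1), of "fst q" "snd q"] by (cases q) auto
  have bb: "?Z e \<subseteq> edge_box" for e by (auto simp: banded_def unbanded_def edge_box_def)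
  \<comment> \<open>A corner lies on the rim of the box and is therefore fixed by every box isotopy;
    this is why vertex arcs stay in place.\<close>
  have va: "z \<in> corners" if "p \<in> trace (vertex_arcs G F)" "e \<in> edges G" "z \<in> edge_box" "fst p = emap F e z" for p e z
  proof -
    have "\<bar>Re z\<bar> = 1" using emap_sphere(2)[OF that(2,3)] trace_vertex_arcs(2)[OF that(1)] that(4) by simp
    moreover have "\<not> \<bar>Im z\<bar> < 1" using trace_vertex_arcs(3)[OF that(1)] that by (auto simp: edge_box_def)
    ultimately show ?thesis using that(3) by (auto simp: corners_def edge_box_def)
  qed
  have hcorner: "h e 1 (z, 1/2) = (z, 1/2)" "(z, 1/2) \<in> trace (tangle (?X e))" if "z \<in> corners" for e z
  proof -
    have "z \<in> edge_box - open_box" using that by (auto simp: corners_def edge_box_def open_box_def)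
    then show "h e 1 (z, 1/2) = (z, 1/2)" using h(1)[of e] unfolding box_isotopy_def box_map_def by auto
    show "(z, 1/2) \<in> trace (tangle (?X e))" using corners_in_tangle that by blast
  qed
  have Iv: "I 1 p = p" if p: "p \<in> trace (vertex_arcs G F)" for p
  proof (cases "\<exists>e\<in>edges G. fst p \<in> emap F e ` edge_box")
    case True
    then obtain e z where e: "e \<in> edges G" "z \<in> edge_box" "fst p = emap F e z" by auto
    then have "z \<in> corners" using va[OF p] by blast
    moreover have "p = (emap F e z, 1/2)" using trace_vertex_arcs(1)[OF p] e(3) by (simp add: prod_eq_iff)
    ultimately show ?thesis using I(2)[OF e(1,2), of "1/2"] hcorner(1)[of z e] by simp
  next
    case False
    then show ?thesis using I(3)[of "fst p" "snd p"] by auto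
  qed
  define T where "T = I 1 ` trace L"
  have trb: "trace L \<subseteq> \<Sigma> \<times> {0..1}" using trace_arcs_bounds[OF range_state_resolution] interior_subset_surface unfolding tr by fastforce
  have Teq: "T = trace (vertex_arcs G F) \<union> (\<Union>e\<in>edges G. map_prod (emap F e) id ` (h e 1 ` trace (tangle (?X e))))"
  proof -
    have "I 1 ` trace (vertex_arcs G F) = trace (vertex_arcs G F)" using Iv by force
    moreover have "I 1 ` (\<Union>e\<in>edges G. map_prod (emap F e) id ` trace (tangle (?X e))) = (\<Union>e\<in>edges G. map_prod (emap F e) id ` (h e 1 ` trace (tangle (?X e))))"
      unfolding image_UN image_image using Iq by (intro SUP_cong refl image_cong) auto
    ultimately show ?thesis unfolding T_def tr trace_arcs image_Un by simp
  qed
  have cT: "compact T" unfolding T_def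
    by (rule compact_continuous_image[OF continuous_on_subset[OF ambient_isotopy_homeo(1)[OF I(1)] trb] compact_trace[OF L]])
  have fT: "fst ` T = boundary H"
  proof -
    have "fst ` map_prod (emap F e) id ` (h e 1 ` trace (tangle (?X e))) = emap F e ` ?Z e" for e
      unfolding h(3)[symmetric, of e] by (simp add: image_image)
    then show ?thesis unfolding Teq boundary_eq[OF H] image_Un image_UN by (simp add: image_comp)
  qed
  have T01: "T \<subseteq> \<Sigma> \<times> {0<..<1}"
  proof
    fix p assume p: "p \<in> T"
    have "fst p \<in> \<Sigma>" using p fT boundary_subset[OF H] state_surface_subset[OF H] interior_subset_surface by blast
    moreover have "snd p \<in> {0<..<1}"
    proof (cases "p \<in> trace (vertex_arcs G F)")
      case True then show ?thesis using trace_vertex_arcs(1)[OF True] by simp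
    next
      case False
      then obtain e q where "q \<in> h e 1 ` trace (tangle (?X e))" "p = map_prod (emap F e) id q"
        using p unfolding Teq by (metis (no_types, lifting) UN_E UnE imageE)
      moreover from this have "snd q \<in> {0<..<1}" using h(4)[of e] by blast
      ultimately show ?thesis by (cases q) auto
    qed
    ultimately show "p \<in> \<Sigma> \<times> {0<..<1}" by (simp add: mem_Times_iff)
  qed
  have injT: "inj_on fst T"
  proof -
    have key: "p = p'" if p: "p \<in> T" "p' \<in> T" "fst p = fst p'" and ne: "p' \<notin> trace (vertex_arcs G F)" for p p'
    proof -
      obtain e q where q: "e \<in> edges G" "q \<in> h e 1 ` trace (tangle (?X e))" "p' = map_prod (emap F e) id q"
        using p(2) ne unfolding Teq by (metis (no_types, lifting) UN_E UnE imageE)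
      have qb: "fst q \<in> edge_box" using q(2) h(3)[of e] bb[of e] by blast
      \<comment> \<open>Over a corner the vertex arc and the straightened tangle have the same
        point, at height 1/2. So a point of a vertex arc over a box may be treated as a point of the
        tangle.\<close>
      have q': "\<exists>q'\<in>h e 1 ` trace (tangle (?X e)). fst q' = fst q \<and> p = map_prod (emap F e) id q'"
      proof (cases "p \<in> trace (vertex_arcs G F)")
        case True
        have pe: "fst p = emap F e (fst q)" using p(3) q(3) by (cases q) auto
        then have c: "fst q \<in> corners" using va[OF True q(1) qb] by blast
        have "(fst q, 1/2) \<in> h e 1 ` trace (tangle (?X e))" using hcorner[OF c, of e] by (metis imageI)
        moreover have "p = map_prod (emap F e) id (fst q, 1/2)" using pe trace_vertex_arcs(1)[OF True] by (simp add: prod_eq_iff)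
        ultimately show ?thesis by (intro bexI[of _ "(fst q, 1/2)"]) auto
      next
        case False
        then obtain e' q' where e': "e' \<in> edges G" "q' \<in> h e' 1 ` trace (tangle (?X e'))" "p = map_prod (emap F e') id q'"
          using p(1) unfolding Teq by (metis (no_types, lifting) UN_E UnE imageE)
        have "fst q' \<in> edge_box" using e'(2) h(3)[of e'] bb[of e'] by blast
        moreover have "emap F e (fst q) = emap F e' (fst q')" using p(3) q(3) e'(3) by (cases q; cases q') auto
        ultimately have "e = e'" "fst q = fst q'" using emap_disjoint[OF q(1) e'(1) qb] by blast+
        then show ?thesis using e' by (intro bexI[of _ q']) auto
      qed
      then obtain q' where "q' \<in> h e 1 ` trace (tangle (?X e))" "fst q' = fst q" "p = map_prod (emap F e) id q'" by blast
      then show ?thesis using h(2)[of e] q unfolding inj_on_def by metis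
    qed
    have both: "p = p'" if "p \<in> trace (vertex_arcs G F)" "p' \<in> trace (vertex_arcs G F)" "fst p = fst p'" for p p'
      using trace_vertex_arcs(1) that by (metis prod_eqI)
    show ?thesis by (rule inj_onI) (metis key both)
  qed
  obtain M where M: "continuous_on \<Sigma> M" "\<And>p. p \<in> T \<Longrightarrow> lift_by M 1 p = (fst p, 1/2)"
    using flatten_heights[OF cT injT T01] by metis
  show ?thesis
  proof (rule that[of "\<lambda>t p. lift_by M t (I t p)"])
    show "ambient_isotopy \<Sigma> (\<lambda>t p. lift_by M t (I t p))"
      by (rule ambient_isotopy_compose[OF I(1) ambient_isotopy_lift_by[OF M(1)]])
    have "(\<lambda>p. lift_by M 1 (I 1 p)) ` trace L = (\<lambda>p. (fst p, 1/2)) ` T" unfolding T_def image_image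
      using M(2) by (intro image_cong) (auto simp: T_def)
    also have "\<dots> = boundary H \<times> {1/2}" unfolding fT[symmetric] by auto
    finally show "(\<lambda>p. lift_by M 1 (I 1 p)) ` trace L = boundary H \<times> {1/2}" .
    fix p assume p: "p \<in> trace (vertex_arcs G F)"
    then have "p \<in> T" unfolding Teq by blast
    then have "lift_by M 1 (I 1 p) = (fst p, 1/2)" unfolding Iv[OF p] by (rule M(2))
    then show "lift_by M 1 (I 1 p) = p" unfolding trace_vertex_arcs(1)[OF p, symmetric] by simp
  qed
qed

text \<open>Loops at one level project to pairwise disjoint, compact and connected sets, finitely
  many in number; these are therefore the components of their union.\<close>

lemma card_level_curves:
  fixes L :: "'a link"
  assumes H: "H \<subseteq> edges G" and L: "closed_curves L" "trace L = boundary H \<times> {1/2}"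
  shows "num_boundary_components \<Sigma> G F H = card L"
proof -
  let ?C = "\<lambda>\<gamma>::'a knot. fst ` path_image \<gamma>"
  have half: "snd p = 1/2" if "\<gamma> \<in> L" "p \<in> path_image \<gamma>" for \<gamma> p
  proof -
    have "p \<in> trace L" using that unfolding trace_def by blast
    then show ?thesis unfolding L(2) by auto
  qed
  have disj: "?C \<gamma> \<inter> ?C \<delta> = {}" if "\<gamma> \<in> L" "\<delta> \<in> L" "\<gamma> \<noteq> \<delta>" for \<gamma> \<delta>
  proof -
    have "path_image \<gamma> \<inter> path_image \<delta> = {}" using closed_curves_disjoint[OF L(1) that] .
    then show ?thesis by (rule fst_image_disjoint[OF _ half[OF that(1)] half[OF that(2)]])
  qed
  have ne: "?C \<gamma> \<noteq> {}" for \<gamma> using path_image_nonempty by blast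
  have inj: "inj_on ?C L"
  proof (rule inj_onI, rule ccontr)
    fix \<gamma> \<delta> assume "\<gamma> \<in> L" "\<delta> \<in> L" "?C \<gamma> = ?C \<delta>" "\<gamma> \<noteq> \<delta>"
    then show False using disj[of \<gamma> \<delta>] ne[of \<gamma>] by simp
  qed
  have path: "path \<gamma>" if "\<gamma> \<in> L" for \<gamma> using L(1) that by (auto simp: closed_curves_def simple_path_imp_path)
  have "components (\<Union>(?C ` L)) = ?C ` L"
  proof (rule components_disjoint_Union)
    show "finite (?C ` L)" using L(1) by (auto simp: closed_curves_def)
    fix A assume "A \<in> ?C ` L"
    then obtain \<gamma> where \<gamma>: "\<gamma> \<in> L" "A = ?C \<gamma>" by auto
    show "compact A \<and> connected A \<and> A \<noteq> {}" unfolding \<gamma>(2) using path[OF \<gamma>(1)] ne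
      by (auto intro!: compact_continuous_image connected_continuous_image compact_path_image connected_path_image continuous_intros)
  next
    show "A \<inter> B = {}" if "A \<in> ?C ` L" "B \<in> ?C ` L" "A \<noteq> B" for A B using that disj by blast
  qed
  moreover have "\<Union>(?C ` L) = boundary H"
  proof -
    have "\<Union>(?C ` L) = fst ` trace L" unfolding trace_def by (simp add: image_UN)
    then show ?thesis unfolding L(2) by auto
  qed
  ultimately have "components (boundary H) = ?C ` L" by simp
  then show ?thesis unfolding num_boundary_components_def frontier_state_surface[OF H] using card_image[OF inj] by simp
qed

end

section \<open>Level curves are descending\<close>

text \<open>Change of the base point, used to let a descending knot start at the top of its vertical
  part.\<close>

lemma simple_path_loop_shift:
  assumes "simple_path g" "pathfinish g = pathstart g"
  shows "simple_path (\<lambda>t. g (frac (c + t)))" "pathfinish (\<lambda>t. g (frac (c + t))) = pathstart (\<lambda>t. g (frac (c + t)))"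
    "path_image (\<lambda>t. g (frac (c + t))) = path_image g"
proof -
  have f1: "frac (c + 1) = frac c" using frac_add_int[of c 1] by simp
  show "pathfinish (\<lambda>t. g (frac (c + t))) = pathstart (\<lambda>t. g (frac (c + t)))"
    by (simp add: pathfinish_def pathstart_def f1)
  show "simple_path (\<lambda>t. g (frac (c + t)))" unfolding simple_path_def
  proof
    show "path (\<lambda>t. g (frac (c + t)))" unfolding path_def
      by (rule continuous_on_compose2[OF continuous_loop_frac[OF simple_path_imp_path[OF assms(1)] assms(2)]])
         (auto intro!: continuous_intros)
    show "loop_free (\<lambda>t. g (frac (c + t)))" unfolding loop_free_def
    proof (intro ballI impI)
      fix x y :: real assume *: "x \<in> {0..1}" "y \<in> {0..1}" "g (frac (c + x)) = g (frac (c + y))"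
      then have "c + x = c + y \<or> (c + x = c \<and> c + y = c + 1) \<or> (c + x = c + 1 \<and> c + y = c)"
        by (intro simple_loop_period_inj[OF assms(1)]) auto
      then show "x = y \<or> x = 0 \<and> y = 1 \<or> x = 1 \<and> y = 0" by auto
    qed
  qed
  have "(\<lambda>t. c + t) ` {0..1} = {c..c + 1}" by auto
  then have "path_image (\<lambda>t. g (frac (c + t))) = (\<lambda>w. g (frac w)) ` {c..c + 1}"
    unfolding path_image_def by (metis image_image)
  then show "path_image (\<lambda>t. g (frac (c + t))) = path_image g" using path_image_loop_period[OF assms(2)] by simp
qed

text \<open>The height is prescribed so that it rises along the flat segment and falls along the rest of
  the curve; a shear that depends on the height then makes the rising part vertical.\<close>

lemma descending_knot_flat_segment:
  fixes \<Sigma> :: "'a::metric_space set" and K :: "'a knot"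
  assumes surf: "oriented_surface \<Sigma> \<A>"
    and K: "simple_path K" "pathfinish K = pathstart K" "path_image K \<subseteq> surface_interior \<A> \<times> {1/2}"
    and \<beta>: "continuous_on edge_box \<beta>" "inj_on \<beta> edge_box" "\<beta> ` edge_box \<subseteq> surface_interior \<A>"
    and u: "continuous_on {-2..2} u" "strict_mono_on {-2..2} u" "\<And>x. x \<in> {-2..2} \<Longrightarrow> K (frac (u x)) = (\<beta> (of_real x), 1/2)"
    and flat: "\<And>z. z \<in> edge_box \<Longrightarrow> \<beta> z \<in> fst ` path_image K \<Longrightarrow> Im z = 0"
  shows "descending_knot \<Sigma> \<A> K"
proof -
  have int: "surface_interior \<A> \<subseteq> \<Sigma>" using surf unfolding oriented_surface_def surface_interior_def by blast
  define P where "P = (\<lambda>w. fst (K (frac w)))"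
  have fr: "frac w \<in> {0..1}" for w :: real by (simp add: frac_lt_1 less_imp_le)
  have Kim: "K (frac w) \<in> path_image K" for w using fr by (auto simp: path_image_def)
  have KP: "K (frac w) = (P w, 1/2)" for w
  proof -
    have "snd (K (frac w)) = 1/2" using subsetD[OF K(3) Kim[of w]] by (cases "K (frac w)") auto
    then show ?thesis by (simp add: P_def prod_eq_iff)
  qed
  have P\<beta>: "P (u x) = \<beta> (of_real x)" if "x \<in> {-2..2}" for x using u(3)[OF that] by (simp add: P_def)
  have rb: "complex_of_real x \<in> edge_box" if "x \<in> {-2..2}" for x using that by (auto simp: edge_box_def)
  have P1: "P (w + 1) = P w" for w using frac_add_int[of w 1] by (simp add: P_def)
  \<comment> \<open>The height will rise along the middle half of the segment only, from -1 to 1,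
    which leaves room in the box on both sides.\<close>
  define a c where "a = u (-1)" and "c = u 1"
  have mono: "u x < u y" if "x < y" "x \<in> {-2..2}" "y \<in> {-2..2}" for x y using u(2) that by (auto simp: strict_mono_on_def)
  \<comment> \<open>If the segment filled a whole period, it would return to its initial point,
    against injectivity of \<open>\<beta>\<close>.\<close>
  have u2: "u 2 < u (-2) + 1"
  proof (rule ccontr)
    assume n: "\<not> ?thesis"
    have "u (-2) < u 2" by (rule mono) auto
    then obtain x where x: "-2 \<le> x" "x \<le> 2" "u x = u (-2) + 1"
      using IVT'[of u "-2" "u (-2) + 1" 2] u(1) n by auto
    have "\<beta> (of_real x) = \<beta> (of_real (-2))" using P\<beta>[of x] P\<beta>[of "-2"] P1[of "u (-2)"] x by simp
    moreover have "complex_of_real x \<in> edge_box" "complex_of_real (-2) \<in> edge_box" using x by (intro rb; simp)+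
    ultimately have "complex_of_real x = complex_of_real (-2)" using \<beta>(2) by (simp only: inj_on_eq_iff)
    then have "x = -2" by (simp only: of_real_eq_iff)
    then show False using x by simp
  qed
  have ac: "a < c" "c < a + 1" using mono[of "-1" 1] mono[of "-2" "-1"] mono[of 1 2] u2 by (auto simp: a_def c_def)
  have injP: "w = w' \<or> (w = a \<and> w' = a + 1) \<or> (w = a + 1 \<and> w' = a)" if "P w = P w'" "w \<in> {a..a+1}" "w' \<in> {a..a+1}" for w w'
    using simple_loop_period_inj[OF K(1) _ that(2,3)] that(1) KP by simp
  have cP: "continuous_on S P" for S
  proof -
    have "continuous_on UNIV P" unfolding P_def
      by (intro continuous_on_fst continuous_loop_frac simple_path_imp_path K)
    then show ?thesis using continuous_on_subset by blast
  qed
  define A1 A2 where "A1 = P ` {a..c}" and "A2 = P ` {c..a+1}"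
  have uonto: "\<exists>x\<in>{-1..1}. u x = w" if w: "w \<in> {a..c}" for w
  proof -
    have "continuous_on {-1..1} u" by (rule continuous_on_subset[OF u(1)]) auto
    then show ?thesis using IVT'[of u "-1" w 1] w by (auto simp: a_def c_def)
  qed
  have A1eq: "A1 = (\<lambda>x. \<beta> (of_real x)) ` {-1..1}"
  proof
    show "A1 \<subseteq> (\<lambda>x. \<beta> (of_real x)) ` {-1..1}"
    proof
      fix p assume "p \<in> A1"
      then obtain w where w: "w \<in> {a..c}" "p = P w" by (auto simp: A1_def)
      then obtain x where "x \<in> {-1..1}" "u x = w" using uonto by blast
      then show "p \<in> (\<lambda>x. \<beta> (of_real x)) ` {-1..1}" using P\<beta>[of x] w(2) by auto
    qed
    show "(\<lambda>x. \<beta> (of_real x)) ` {-1..1} \<subseteq> A1"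
    proof (rule image_subsetI)
      fix x :: real assume x: "x \<in> {-1..1}"
      have "u (-1) \<le> u x" "u x \<le> u 1" using strict_mono_on_leD[OF u(2)] x by auto
      then show "\<beta> (of_real x) \<in> A1" using P\<beta>[of x] x unfolding A1_def a_def c_def by (intro image_eqI[of _ _ "u x"]) auto
    qed
  qed
  have Cun: "fst ` path_image K = A1 \<union> A2"
  proof -
    have "{a..a+1} = {a..c} \<union> {c..a+1}" using ac by auto
    then have "path_image K = (\<lambda>w. K (frac w)) ` {a..c} \<union> (\<lambda>w. K (frac w)) ` {c..a+1}"
      unfolding path_image_loop_period[OF K(2), of a] by (simp only: image_Un)
    then show ?thesis unfolding A1_def A2_def P_def by (simp only: image_Un image_image)
  qed
  define X where "X = (\<lambda>p. Re (inv_into edge_box \<beta> p))"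
  define W where "W = inv_into {c..a+1} P"
  \<comment> \<open>The height rises from 1/4 to 3/4 along the segment and falls, linearly in the
    parameter, from 3/4 to 1/4 along the rest of the curve. The formulas agree at the two common
    points, which makes the height continuous.\<close>
  define \<eta> where "\<eta> = (\<lambda>p. if p \<in> A1 then 1/2 + X p / 4 else 3/4 - (1/2) * ((W p - c) / (a + 1 - c)))"
  have X\<beta>: "X (\<beta> (of_real x)) = x" if "x \<in> {-2..2}" for x using rb[OF that] \<beta>(2) by (simp add: X_def)
  have injW: "inj_on P {c..a+1}" using injP ac by (force simp: inj_on_def)
  have WP: "W (P w) = w" if "w \<in> {c..a+1}" for w using that injW by (simp add: W_def)
  have \<eta>1: "\<eta> (\<beta> (of_real x)) = 1/2 + x/4" if "x \<in> {-1..1}" for x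
  proof -
    have "\<beta> (of_real x) \<in> A1" using that unfolding A1eq by blast
    then show ?thesis using X\<beta>[of x] that by (simp add: \<eta>_def)
  qed
  have \<eta>2: "\<eta> (P w) = 3/4 - (1/2) * ((w - c) / (a + 1 - c))" if w: "w \<in> {c..a+1}" for w
  proof (cases "P w \<in> A1")
    case False then show ?thesis using WP[OF w] by (simp add: \<eta>_def)
  next
    case True
    then obtain w' where w': "w' \<in> {a..c}" "P w = P w'" by (auto simp: A1_def)
    have "w = w' \<or> (w = a \<and> w' = a + 1) \<or> (w = a + 1 \<and> w' = a)" by (rule injP[OF w'(2)]) (use w w'(1) ac in auto)
    then have "w = c \<or> w = a + 1" using w w' ac by auto
    then show ?thesis
    proof
      assume "w = c"
      then have "P w = \<beta> (of_real 1)" using P\<beta>[of 1] by (simp add: c_def)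
      then show ?thesis using \<eta>1[of 1] \<open>w = c\<close> by simp
    next
      assume "w = a + 1"
      then have "P w = \<beta> (of_real (-1))" using P\<beta>[of "-1"] P1[of a] by (simp add: a_def)
      then show ?thesis using \<eta>1[of "-1"] \<open>w = a + 1\<close> ac by simp
    qed
  qed
  have c\<eta>: "continuous_on (A1 \<union> A2) \<eta>"
  proof (rule continuous_on_closed_Un)
    show "closed A1" "closed A2" unfolding A1_def A2_def by (intro compact_imp_closed compact_continuous_image cP; simp)+
    have "continuous_on (\<beta> ` edge_box) (inv_into edge_box \<beta>)"
      using \<beta> compact_edge_box by (intro continuous_on_inv) auto
    then have "continuous_on A1 X" unfolding X_def
      by (intro continuous_on_Re) (rule continuous_on_subset, use rb A1eq in auto)
    then have "continuous_on A1 (\<lambda>p. 1/2 + X p / 4)" by (intro continuous_intros) auto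
    then show "continuous_on A1 \<eta>" by (rule continuous_on_eq) (simp add: \<eta>_def)
    have "continuous_on A2 W" unfolding A2_def using WP by (intro continuous_on_inv cP) auto
    then have "continuous_on A2 (\<lambda>p. 3/4 - (1/2) * ((W p - c) / (a + 1 - c)))" using ac by (intro continuous_intros) auto
    then show "continuous_on A2 \<eta>"
      by (rule continuous_on_eq) (use \<eta>2 WP in \<open>auto simp: A2_def\<close>)
  qed
  have \<eta>b: "1/4 \<le> \<eta> p \<and> \<eta> p \<le> 3/4" if "p \<in> A1 \<union> A2" for p
    using that
  proof
    assume "p \<in> A1"
    then obtain x where "x \<in> {-1..1}" "p = \<beta> (of_real x)" unfolding A1eq by auto
    then show ?thesis using \<eta>1[of x] by auto
  next
    assume "p \<in> A2"
    then obtain w where w: "w \<in> {c..a+1}" "p = P w" unfolding A2_def by auto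
    then have "0 \<le> (w - c) / (a + 1 - c)" "(w - c) / (a + 1 - c) \<le> 1" using ac by auto
    moreover have "1/4 \<le> 3/4 - (1/2) * q \<and> 3/4 - (1/2) * q \<le> 3/4" if "0 \<le> q" "q \<le> 1" for q :: real using that by simp
    ultimately show ?thesis unfolding w(2) \<eta>2[OF w(1)] by blast
  qed
  have cm: "continuous_on (A1 \<union> A2) (\<lambda>p. logit (\<eta> p) - logit (1/2))"
  proof (intro continuous_intros c\<eta>)
    show "0 < \<eta> p \<and> \<eta> p < 1" if "p \<in> A1 \<union> A2" for p using \<eta>b[OF that] by auto
  qed
  have "compact (A1 \<union> A2)" unfolding A1_def A2_def by (intro compact_Un compact_continuous_image cP) auto
  moreover have "A1 \<union> A2 \<subseteq> \<Sigma>" unfolding Cun[symmetric] using K(3) int by auto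
  ultimately obtain M where M: "continuous_on \<Sigma> M" "\<And>p. p \<in> A1 \<union> A2 \<Longrightarrow> M p = logit (\<eta> p) - logit (1/2)"
    using Tietze_compact_real[OF _ _ cm] by metis
  have lift: "lift_by M 1 (p, 1/2) = (p, \<eta> p)" if "p \<in> A1 \<union> A2" for p
    using M(2)[OF that] slide_to[of "1/2" "\<eta> p"] \<eta>b[OF that] by (simp add: lift_by_def)
  \<comment> \<open>On the rising part the height s = 1/2 + x/4 reveals the coordinate x = 4 (s -
    1/2), so a parameter that reads the height can send all of it to x = 0. The shear is about -3/2
    with a side of length 7/2, in which 0 lies at 3/7; the factor in y makes it vanish on the
    rim.\<close>
  define N :: "real \<Rightarrow> real \<Rightarrow> real" where
    "N = (\<lambda>y s. (logit (3/7) - logit ((max (-1) (min 1 (4 * (s - 1/2))) + 3/2) / (7/2))) * (1 - \<bar>y\<bar>))"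
  define h where "h = box_slide_Re (-3/2) (\<lambda>y s. 0) N"
  define k where "k = box_slide_Re (-3/2) (\<lambda>y s. 0) (\<lambda>y s. - N y s)"
  have cN: "continuous_on ({-1..1} \<times> {0..1}) (\<lambda>(y, s). N y s)"
  proof -
    have r: "0 < (max (-1) (min 1 v) + 3/2) / (7/2) \<and> (max (-1) (min 1 v) + 3/2) / (7/2) < 1" for v :: real
      by (auto simp: max_def min_def)
    show ?thesis unfolding N_def split_def by (intro continuous_intros r) auto
  qed
  have N0: "\<bar>y\<bar> = 1 \<Longrightarrow> N y s = 0" for y s by (simp add: N_def)
  have hk: "box_isotopy h" "box_isotopy k" unfolding h_def k_def
    using box_isotopy_slide_Re[of "-3/2" "\<lambda>y s. 0" N] box_isotopy_slide_Re[of "-3/2" "\<lambda>y s. 0" "\<lambda>y s. - N y s"] cN N0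
      continuous_on_minus[OF cN] by (simp_all add: split_def)
  \<comment> \<open>The sideways shear preserves heights, so the falling part of the curve keeps
    falling.\<close>
  have snd_h: "snd (h 1 q) = snd q" for q by (simp add: h_def box_slide_Re_def)
  have kh: "k 1 (h 1 (z, s)) = (z, s)" if "z \<in> edge_box" for z s
    using that slide_about_inverse[of "-3/2" "Re z" 0 "N (Im z) s"] by (simp add: h_def k_def box_slide_Re_def edge_box_def complex_eq_iff)
  have \<beta>S: "\<beta> ` edge_box \<subseteq> \<Sigma>" using \<beta>(3) int by auto
  have op: "openin (top_of_set \<Sigma>) (\<beta> ` open_box)"
    by (rule openin_embedding[OF surf \<beta> open_open_box open_box_subset])
  define I where "I = (\<lambda>t p. glue \<beta> (h t) (lift_by M t p))"
  \<comment> \<open>\<open>oriented_link\<close> for the deformed knot asks for an isotopy from it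
    to a knot with a diagram, for which the flat knot \<open>K\<close> serves. The way back consists
    of the opposite shears in the opposite order.\<close>
  define J where "J = (\<lambda>t p. lift_by (\<lambda>x. - M x) t (glue \<beta> (k t) p))"
  have cM: "continuous_on \<Sigma> (\<lambda>x. - M x)" using M(1) by (intro continuous_intros)
  have I: "ambient_isotopy \<Sigma> I" unfolding I_def
    by (rule ambient_isotopy_compose[OF ambient_isotopy_lift_by[OF M(1)] ambient_isotopy_glue[OF \<beta>(1,2) \<beta>S op hk(1)]])
  have J: "ambient_isotopy \<Sigma> J" unfolding J_def
    by (rule ambient_isotopy_compose[OF ambient_isotopy_glue[OF \<beta>(1,2) \<beta>S op hk(2)] ambient_isotopy_lift_by[OF cM]])
  have glue_snd: "snd (glue \<beta> (h 1) p) = snd p" for p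
    unfolding glue_def using snd_h by (auto simp: map_prod_def split_def)
  have hb: "fst (h 1 (z, s)) \<in> edge_box" if "z \<in> edge_box" "s \<in> {0..1}" for z s
    using hk(1) that unfolding box_isotopy_def box_map_def image_subset_iff by (auto simp: mem_Times_iff)
  have kglue: "glue \<beta> (k 1) (glue \<beta> (h 1) p) = p" if ps: "snd p \<in> {0..1}" for p
  proof (cases "fst p \<in> \<beta> ` edge_box")
    case True
    then obtain z s where z: "z \<in> edge_box" "p = (\<beta> z, s)" "s \<in> {0..1}" using ps by (cases p) auto
    have "glue \<beta> (h 1) p = (\<beta> (fst (h 1 (z, s))), snd (h 1 (z, s)))" using z(1,2) \<beta>(2) by (simp add: glue_inside map_prod_def split_def)
    then show ?thesis using hb[OF z(1,3)] \<beta>(2) kh[OF z(1)] z(2) by (simp add: glue_inside)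
  qed (simp add: glue_def)
  define K2 where "K2 = I 1 \<circ> K"
  have PA: "P w \<in> A1 \<union> A2" for w unfolding Cun[symmetric] P_def using Kim[of w] by blast
  have I1: "I 1 (K (frac w)) = glue \<beta> (h 1) (P w, \<eta> (P w))" for w unfolding KP I_def lift[OF PA] ..
  have sndI: "snd (I 1 (K (frac w))) = \<eta> (P w)" for w unfolding I1 glue_snd by simp
  have fstI: "fst (I 1 (K (frac w))) = \<beta> 0" if wac: "w \<in> {a..c}" for w
  proof -
    obtain x where x: "x \<in> {-1..1}" "u x = w" using uonto[OF wac] by blast
    have Pw: "P w = \<beta> (of_real x)" using P\<beta>[of x] x by auto
    have "slide (N 0 (1/2 + x/4)) ((x + 3/2) / (7/2)) = 3/7"
    proof -
      have "max (-1) (min 1 (4 * ((1/2 + x/4) - 1/2))) = x" using x(1) by (auto simp: max_def min_def)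
      then have "N 0 (1/2 + x/4) = logit (3/7) - logit ((x + 3/2) / (7/2))" unfolding N_def by simp
      then show ?thesis using x(1) by (simp only:) (rule slide_to, auto)
    qed
    then have "h 1 (of_real x, 1/2 + x/4) = (0, 1/2 + x/4)" using x(1)
      by (simp add: h_def box_slide_Re_def slide_about_def complex_eq_iff)
    then show ?thesis unfolding I1 Pw \<eta>1[OF x(1)] using glue_inside[OF \<beta>(2) rb[of x], of "h 1" "1/2 + x/4"] x(1) by simp
  qed
  have KS: "path_image K \<subseteq> \<Sigma> \<times> {0..1}" using K(3) int by fastforce
  have sp2: "simple_path K2" unfolding K2_def
    by (rule simple_path_continuous_image[OF K(1) continuous_on_subset[OF ambient_isotopy_homeo(1)[OF I] KS] inj_on_subset[OF ambient_isotopy_homeo(2)[OF I] KS]])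
  have lp2: "pathfinish K2 = pathstart K2" using K(2) by (simp add: K2_def pathfinish_def pathstart_def)
  \<comment> \<open>Starting at \<open>c\<close>, the top of the vertical part, puts the falling
    part first and the vertical return last.\<close>
  define K' where "K' = (\<lambda>t. K2 (frac (c + t)))"
  note K' = simple_path_loop_shift[OF sp2 lp2, of c, folded K'_def]
  have im2: "path_image K2 \<subseteq> surface_interior \<A> \<times> {0<..<1}"
  proof
    fix p assume "p \<in> path_image K2"
    then obtain w where w: "p = I 1 (K (frac w))" unfolding path_image_loop_period[OF lp2, of 0] by (auto simp: K2_def)
    have "snd p \<in> {0<..<1}" unfolding w sndI using \<eta>b[OF PA[of w]] by auto
    moreover have "fst p \<in> surface_interior \<A>"
    proof (cases "P w \<in> \<beta> ` edge_box")
      case True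
      then obtain z where z: "z \<in> edge_box" "P w = \<beta> z" by auto
      have "fst p = \<beta> (fst (h 1 (z, \<eta> (P w))))" unfolding w I1 using z \<beta>(2) by (simp add: glue_inside)
      moreover have "fst (h 1 (z, \<eta> (P w))) \<in> edge_box" using \<eta>b[OF PA[of w]] by (intro hb[OF z(1)]) auto
      ultimately show ?thesis using \<beta>(3) by auto
    next
      case False
      then have "fst p = P w" unfolding w I1 by (simp add: glue_outside)
      then show ?thesis using subsetD[OF K(3) Kim[of w]] KP[of w] by auto
    qed
    ultimately show "p \<in> surface_interior \<A> \<times> {0<..<1}" by (simp add: mem_Times_iff)
  qed
  have cc: "closed_curves {K}" "closed_curves {K'}" using K K'(1,2) by (auto simp: closed_curves_def)
  have lsK: "loop_system \<A> {K}" unfolding closed_curves_loop_system using cc(1) K(3) by auto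
  have lsK': "loop_system \<A> {K'}" unfolding closed_curves_loop_system using cc(2) im2 K'(3) by auto
  have dK: "has_diagram \<A> {K}" unfolding has_diagram_def
  proof (intro exI[of _ "{}"] conjI)
    have "snd p = 1/2" if "p \<in> path_image K" for p using subsetD[OF K(3) that] by auto
    then have "inj_on fst (path_image K)" by (rule inj_on_fst_level)
    then show "inj_on fst (trace {K} - (\<Union>\<phi>\<in>{}. \<phi> ` open_square) \<times> UNIV)" by simp
  qed auto
  have olK: "oriented_link \<Sigma> \<A> {K}" unfolding oriented_link_def using lsK dK isotopic_refl[OF cc(1)] by blast
  have frs: "K (frac s) = K s" if "s \<in> {0..1}" for s
    using that K(2) by (cases "s = 1") (auto simp: frac_eq pathfinish_def pathstart_def)
  have frc: "frac (c + frac (s - c)) = frac s" for s :: real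
  proof -
    have "c + frac (s - c) = s + of_int (- \<lfloor>s - c\<rfloor>)" by (simp add: frac_def)
    then show ?thesis by (simp only: frac_add_int)
  qed
  have JI: "J 1 (I 1 p) = p" if "p \<in> path_image K" for p
  proof -
    have "snd (lift_by M 1 p) \<in> {0..1}" using subsetD[OF KS that] slide_bounds[of "snd p"] by (auto simp: lift_by_def)
    then have "J 1 (I 1 p) = lift_by (\<lambda>x. - M x) 1 (lift_by M 1 p)" unfolding J_def I_def using kglue by simp
    also have "\<dots> = p" using subsetD[OF KS that] by (auto simp: lift_by_def)
    finally show ?thesis .
  qed
  have iKK': "isotopic \<Sigma> {K} {K'}" unfolding isotopic_def
  proof (intro exI conjI)
    show "ambient_isotopy \<Sigma> I" by (rule I)
    have "runs_along K2 K'" unfolding runs_along_def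
    proof (intro exI[of _ "\<lambda>s. s - c"] conjI ballI)
      fix s :: real assume s: "s \<in> {0..1}"
      show "K2 s = K' (frac (s - c))" unfolding K'_def frc K2_def o_def frs[OF s] ..
    qed (auto intro!: continuous_intros simp: strict_mono_on_def)
    then show "carries {K'} ((\<lambda>\<gamma>. I 1 \<circ> \<gamma>) ` {K})" unfolding carries_def using K'(3) by (simp add: K2_def)
  qed
  have iK'K: "isotopic \<Sigma> {K'} {K}" unfolding isotopic_def
  proof (intro exI conjI)
    show "ambient_isotopy \<Sigma> J" by (rule J)
    have eq: "(J 1 \<circ> K') t = K (frac (c + t))" for t unfolding K'_def K2_def o_def using JI[OF Kim] by simp
    have "runs_along (J 1 \<circ> K') K" unfolding runs_along_def
      by (intro exI[of _ "\<lambda>t. c + t"] conjI ballI eq) (auto intro!: continuous_intros simp: strict_mono_on_def)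
    moreover have "path_image (J 1 \<circ> K') = path_image K"
      using simple_path_loop_shift(3)[OF K(1,2), of c] eq unfolding path_image_def by (simp add: image_def)
    ultimately show "carries {K} ((\<lambda>\<gamma>. J 1 \<circ> \<gamma>) ` {K'})" unfolding carries_def by simp
  qed
  have olK': "oriented_link \<Sigma> \<A> {K'}" unfolding oriented_link_def using lsK' lsK dK iK'K by blast
  show ?thesis unfolding descending_knot_def
  proof (intro conjI exI[of _ K'] exI[of _ "a + 1 - c"] ballI impI)
    show "oriented_link \<Sigma> \<A> {K}" "oriented_link \<Sigma> \<A> {K'}" "isotopic \<Sigma> {K} {K'}" by (rule olK olK' iKK')+
    show "0 < a + 1 - c" "a + 1 - c < 1" using ac by auto
    fix s t :: real assume st: "s \<in> {0..a + 1 - c}" "t \<in> {0..a + 1 - c}" "s < t"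
    have v: "snd (K' r) = 3/4 - (1/2) * (r / (a + 1 - c))" if "r \<in> {0..a + 1 - c}" for r
    proof -
      have "snd (K' r) = \<eta> (P (c + r))" unfolding K'_def K2_def o_def sndI ..
      also have "\<dots> = 3/4 - (1/2) * (r / (a + 1 - c))" using \<eta>2[of "c + r"] that by auto
      finally show ?thesis .
    qed
    have "s / (a + 1 - c) < t / (a + 1 - c)" using st(3) ac by (intro divide_strict_right_mono) auto
    then show "snd (K' t) < snd (K' s)" unfolding v[OF st(1)] v[OF st(2)] by linarith
  next
    fix s :: real assume s: "s \<in> {a + 1 - c..1}"
    \<comment> \<open>Subtracting one period brings the parameter into the interval from
      \<open>a\<close> to \<open>c\<close>, the vertical part.\<close>
    have "K' s = I 1 (K (frac (c + s - 1)))"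
      using frac_add_int[of "c + s - 1" 1] by (simp add: K'_def K2_def)
    then have "fst (K' s) = \<beta> 0" using fstI[of "c + s - 1"] s by simp
    moreover have "fst (K' 0) = \<beta> 0" using fstI[of c] ac by (simp add: K'_def K2_def)
    ultimately show "fst (K' s) = fst (K' 0)" by simp
  qed
qed

text \<open>On each half of \<open>banded\<close> the first summand continues the real part past -1
  and 1 along the vertical legs, with values of absolute value at most 3/2. The clamp is the sign of
  the imaginary part there, and the factor 5 keeps the two halves apart.\<close>

definition banded_coordinate :: "complex \<Rightarrow> real" where
  "banded_coordinate z = Re z * (\<bar>Im z\<bar> + 1/2) + 5 * max (-1) (min 1 (2 * Im z))"

lemma inj_on_banded_coordinate: "inj_on banded_coordinate banded"
proof (rule inj_onI)
  fix z w assume *: "z \<in> banded" "w \<in> banded" "banded_coordinate z = banded_coordinate w"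
  define g where "g = (\<lambda>z. Re z * (\<bar>Im z\<bar> + 1/2))"
  define \<sigma> where "\<sigma> = (\<lambda>z. if 0 < Im z then 1 else -1 :: real)"
  have B: "banded_coordinate z = g z + 5 * max (-1) (min 1 (2 * Im z))" for z by (simp add: banded_coordinate_def g_def)
  have b: "banded_coordinate z = g z + 5 * \<sigma> z \<and> \<bar>g z\<bar> \<le> 3/2 \<and>
     (\<bar>g z\<bar> \<le> 1 \<longrightarrow> Re z = g z \<and> \<bar>Im z\<bar> = 1/2) \<and> (1 < \<bar>g z\<bar> \<longrightarrow> \<bar>Im z\<bar> = \<bar>g z\<bar> - 1/2 \<and> Re z = sgn (g z))"
    if "z \<in> banded" for z
  proof (cases "\<bar>Im z\<bar> = 1/2")
    case True
    then have "max (-1) (min 1 (2 * Im z)) = \<sigma> z" by (auto simp: \<sigma>_def abs_if max_def min_def split: if_splits)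
    moreover have "g z = Re z" "\<bar>Re z\<bar> \<le> 1" using True that by (auto simp: g_def banded_def)
    ultimately show ?thesis using True B[of z] by auto
  next
    case False
    then have r: "\<bar>Re z\<bar> = 1" "1/2 < \<bar>Im z\<bar>" "\<bar>Im z\<bar> \<le> 1" using that by (auto simp: banded_def)
    have "max (-1) (min 1 (2 * Im z)) = \<sigma> z" using r by (auto simp: \<sigma>_def abs_if max_def min_def split: if_splits)
    moreover have "\<bar>g z\<bar> = \<bar>Im z\<bar> + 1/2" using r by (simp add: g_def abs_mult)
    moreover have "sgn (g z) = Re z" using r by (auto simp: g_def sgn_mult sgn_if abs_if split: if_splits)
    ultimately show ?thesis using r B[of z] by auto
  qed
  have e: "g z + 5 * \<sigma> z = g w + 5 * \<sigma> w" using b[OF *(1)] b[OF *(2)] *(3) by presburger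
  have gb: "g z \<le> 3/2" "- 3/2 \<le> g z" "g w \<le> 3/2" "- 3/2 \<le> g w" using b[OF *(1)] b[OF *(2)] by linarith+
  have "\<sigma> z = 1 \<or> \<sigma> z = -1" "\<sigma> w = 1 \<or> \<sigma> w = -1" by (simp_all add: \<sigma>_def)
  then have s: "\<sigma> z = \<sigma> w" using e gb by (elim disjE) simp_all
  then have g: "g z = g w" using e by simp
  have "Re z = Re w \<and> \<bar>Im z\<bar> = \<bar>Im w\<bar>" using b[OF *(1)] b[OF *(2)] g by (cases "\<bar>g w\<bar> \<le> 1") auto
  then show "z = w" using s by (auto simp: \<sigma>_def complex_eq_iff abs_if split: if_splits)
qed

lemma inj_on_unbanded_coordinate: "inj_on (\<lambda>z. Im z + 5 * Re z) unbanded"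
  by (auto simp: inj_on_def unbanded_def complex_eq_iff abs_if split: if_splits)

text \<open>Totality compares distinct values of \<open>f\<close> only; equal values are comparable
  by reflexivity, so different elements with the same value do no harm.\<close>

lemma finite_total_preorder_min:
  assumes "finite A" "A \<noteq> {}" "f ` A \<subseteq> S" "preorder_on S R" "total_on S R"
  shows "\<exists>a\<in>A. \<forall>b\<in>A. (f a, f b) \<in> R"
  using assms(1-3)
proof (induction A rule: finite_ne_induct)
  case (singleton x)
  then show ?case using assms(4) by (auto simp: preorder_on_def refl_on_def)
next
  case (insert x A)
  then obtain a where a: "a \<in> A" "\<forall>b\<in>A. (f a, f b) \<in> R" by auto
  have refl: "(f x, f x) \<in> R" "(f a, f a) \<in> R" using assms(4) insert.prems a by (auto simp: preorder_on_def refl_on_def)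
  have tr: "trans R" using assms(4) by (auto simp: preorder_on_def)
  show ?case
  proof (cases "(f a, f x) \<in> R")
    case True then show ?thesis using a by auto
  next
    case False
    moreover have "f x \<in> S" "f a \<in> S" using insert.prems a by auto
    ultimately have "(f x, f a) \<in> R" using assms(5) refl unfolding total_on_def by metis
    then show ?thesis using a refl tr by (auto dest: transD)
  qed
qed

lemma sorted_enumeration:
  assumes "finite A" "f ` A \<subseteq> S" "preorder_on S R" "total_on S R"
  shows "\<exists>xs. distinct xs \<and> set xs = A \<and> sorted_wrt (\<lambda>x y. (f x, f y) \<in> R) xs"
  using assms(1,2)
proof (induction "card A" arbitrary: A)
  case 0 then show ?case by (intro exI[of _ "[]"]) auto
next
  case (Suc n)
  then have "A \<noteq> {}" by auto
  then obtain a where a: "a \<in> A" "\<forall>b\<in>A. (f a, f b) \<in> R" using finite_total_preorder_min[OF Suc(3) _ Suc(4) assms(3,4)] by blast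
  have "\<exists>xs. distinct xs \<and> set xs = A - {a} \<and> sorted_wrt (\<lambda>x y. (f x, f y) \<in> R) xs"
    using Suc a by (intro Suc(1)) auto
  then obtain xs where "distinct xs" "set xs = A - {a}" "sorted_wrt (\<lambda>x y. (f x, f y) \<in> R) xs" by blast
  then show ?case using a by (intro exI[of _ "a # xs"]) auto
qed

lemma cis_eq_imp: "cis s = cis t \<Longrightarrow> \<bar>s - t\<bar> < 2 * pi \<Longrightarrow> s = t"
proof -
  assume c: "cis s = cis t" and l: "\<bar>s - t\<bar> < 2 * pi"
  have "sin s = sin t \<and> cos s = cos t" using c by (simp add: cis.ctr)
  then obtain n :: int where n: "s = t + 2 * pi * of_int n" using sin_cos_eq_iff by metis
  then have "\<bar>of_int n :: real\<bar> < 1" using l by (simp add: abs_mult)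
  then have "n = 0" by linarith
  then show ?thesis using n by simp
qed

context ribbon_in_surface
begin

text \<open>A curve that misses all vertex arcs would, being connected, lie in a single edge box.
  There the boundary of the state has an injective continuous real coordinate, which no closed curve
  admits.\<close>

lemma level_curve_carries_vertex_arc:
  assumes H: "H \<subseteq> edges G" and L: "closed_curves L" "carries L (arcs (state_resolution H))"
    and K: "ambient_isotopy \<Sigma> K" "K 1 ` trace L = boundary H \<times> {1/2}" "\<And>p. p \<in> trace (vertex_arcs G F) \<Longrightarrow> K 1 p = p"
    and \<gamma>: "\<gamma> \<in> L"
  obtains b where "b \<in> vertex_arcs G F" "runs_along b (K 1 \<circ> \<gamma>)"
proof (cases "path_image \<gamma> \<inter> trace (vertex_arcs G F) = {}")
  case False
  then obtain p b where b: "p \<in> path_image \<gamma>" "b \<in> vertex_arcs G F" "p \<in> path_image b" unfolding trace_def by blast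
  then obtain \<delta> where \<delta>: "\<delta> \<in> L" "runs_along b \<delta>" using L(2) unfolding carries_def arcs_def by blast
  then have "p \<in> path_image \<delta>" using runs_along_image b(3) by blast
  then have "\<delta> = \<gamma>" using closed_curves_disjoint[OF L(1) \<delta>(1) \<gamma>] b(1) by blast
  then have "runs_along b \<gamma>" using \<delta> by simp
  then have "runs_along b (K 1 \<circ> \<gamma>)"
  proof (rule runs_along_map)
    fix s :: real assume "s \<in> {0..1}"
    then have "b s \<in> trace (vertex_arcs G F)" using b(2) unfolding trace_def path_image_def by blast
    then show "b s = K 1 (b s)" using K(3) by simp
  qed simp
  then show ?thesis using that b(2) by blast
next
  case True
  have trL: "trace L = trace (arcs (state_resolution H))" using L(2) by (simp add: carries_def)
  have trb: "trace L \<subseteq> \<Sigma> \<times> {0..1}" using trace_arcs_bounds[OF range_state_resolution] interior_subset_surface unfolding trL by fastforce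
  note Kh = ambient_isotopy_homeo[OF K(1)]
  have cc: "closed_curves ((\<lambda>\<gamma>. K 1 \<circ> \<gamma>) ` L)"
    by (rule closed_curves_image(1)[OF L(1) continuous_on_subset[OF Kh(1) trb] inj_on_subset[OF Kh(2) trb]])
  define \<delta> where "\<delta> = K 1 \<circ> \<gamma>"
  have \<delta>: "simple_path \<delta>" "pathfinish \<delta> = pathstart \<delta>" using cc \<gamma> unfolding \<delta>_def closed_curves_def by auto
  have sub: "path_image \<gamma> \<subseteq> trace L" using \<gamma> unfolding trace_def by blast
  let ?Z = "\<lambda>e. if e \<in> H then banded else unbanded"
  have bb: "?Z e \<subseteq> edge_box" for e by (auto simp: banded_def unbanded_def edge_box_def)
  have lev: "snd p = 1/2" "fst p \<in> (\<Union>e\<in>edges G. emap F e ` ?Z e)" if "p \<in> path_image \<delta>" for p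
  proof -
    obtain p0 where p0: "p0 \<in> path_image \<gamma>" "p = K 1 p0" using \<open>p \<in> path_image \<delta>\<close> unfolding \<delta>_def path_image_compose by blast
    have "p \<in> boundary H \<times> {1/2}" using p0 sub K(2) by blast
    then show p2: "snd p = 1/2" by auto
    have "fst p \<notin> fst ` trace (vertex_arcs G F)"
    proof
      assume "fst p \<in> fst ` trace (vertex_arcs G F)"
      then obtain p1 where p1: "p1 \<in> trace (vertex_arcs G F)" "fst p1 = fst p" by auto
      then have "p1 = p" using p2 trace_vertex_arcs(1)[OF p1(1)] by (simp add: prod_eq_iff)
      then have "K 1 p1 = K 1 p0" using K(3)[OF p1(1)] p0(2) by simp
      moreover have "p1 \<in> trace L" using p1(1) unfolding trL trace_arcs by blast
      moreover have "p0 \<in> trace L" using p0(1) sub by blast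
      ultimately have "p1 = p0" using Kh(2) trb unfolding inj_on_def by blast
      then show False using True p1(1) p0(1) by blast
    qed
    then show "fst p \<in> (\<Union>e\<in>edges G. emap F e ` ?Z e)" using \<open>p \<in> boundary H \<times> {1/2}\<close> unfolding boundary_eq[OF H] by (auto simp: mem_Times_iff)
  qed
  obtain e where e: "e \<in> edges G" "fst ` path_image \<delta> \<subseteq> emap F e ` edge_box"
  proof (rule connected_in_disjoint_Union[of "edges G" "\<lambda>e. emap F e ` edge_box" "fst ` path_image \<delta>"])
    show "finite (edges G)" by (rule finite_graph)
    show "closed (emap F e ` edge_box)" if "e \<in> edges G" for e using compact_box_image[OF that] by (rule compact_imp_closed)
    show "emap F e ` edge_box \<inter> emap F e' ` edge_box = {}" if "e \<in> edges G" "e' \<in> edges G" "e \<noteq> e'" for e e'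
      using boxes_disjoint that unfolding pairwise_def disjnt_def by blast
    show "connected (fst ` path_image \<delta>)"
      using \<delta>(1) by (intro connected_continuous_image connected_path_image) (auto simp: simple_path_imp_path intro!: continuous_intros)
    show "fst ` path_image \<delta> \<noteq> {}" by (simp add: path_image_nonempty)
    show "fst ` path_image \<delta> \<subseteq> (\<Union>e\<in>edges G. emap F e ` edge_box)"
    proof (rule image_subsetI)
      fix p assume "p \<in> path_image \<delta>"
      from lev(2)[OF this] obtain e z where "e \<in> edges G" "z \<in> ?Z e" "fst p = emap F e z" by blast
      then show "fst p \<in> (\<Union>e\<in>edges G. emap F e ` edge_box)" using bb[of e] by blast
    qed
  qed blast
  define k where "k = inv_into edge_box (emap F e)"
  have kZ: "k (fst p) \<in> ?Z e" "emap F e (k (fst p)) = fst p" if pd: "p \<in> path_image \<delta>" for p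
  proof -
    obtain z where z: "z \<in> edge_box" "fst p = emap F e z" using e(2) pd by blast
    then have kz: "k (fst p) = z" using emap(3)[OF e(1)] by (simp add: k_def)
    then show "emap F e (k (fst p)) = fst p" using z by simp
    obtain e' z' where z': "e' \<in> edges G" "z' \<in> ?Z e'" "fst p = emap F e' z'" using lev(2)[OF pd] by blast
    have "z' \<in> edge_box" using z'(2) bb by blast
    then have "e = e'" "z = z'" using emap_disjoint[OF e(1) z'(1) z(1), of z'] z(2) z'(3) by auto
    then show "k (fst p) \<in> ?Z e" using z'(2) kz by simp
  qed
  define f where "f = (if e \<in> H then banded_coordinate else (\<lambda>z. Im z + 5 * Re z))"
  have fi: "inj_on f (?Z e)" using inj_on_banded_coordinate inj_on_unbanded_coordinate by (simp add: f_def)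
  have fc: "continuous_on UNIV f" unfolding f_def banded_coordinate_def by (auto intro!: continuous_intros)
  have "continuous_on (emap F e ` edge_box) k" unfolding k_def
    using emap[OF e(1)] compact_edge_box by (intro continuous_on_inv) auto
  then have "continuous_on (path_image \<delta>) (\<lambda>p. k (fst p))"
    by (rule continuous_on_compose2) (use e(2) in \<open>auto intro!: continuous_intros\<close>)
  then have "continuous_on (path_image \<delta>) (\<lambda>p. f (k (fst p)))"
    by (rule continuous_on_compose2[OF fc]) auto
  moreover have "inj_on (\<lambda>p. f (k (fst p))) (path_image \<delta>)"
  proof (rule inj_onI)
    fix p q assume pq: "p \<in> path_image \<delta>" "q \<in> path_image \<delta>" "f (k (fst p)) = f (k (fst q))"
    then have "k (fst p) = k (fst q)" using fi kZ(1) unfolding inj_on_def by blast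
    then have "fst p = fst q" using kZ(2) pq by metis
    then show "p = q" using lev(1)[OF pq(1)] lev(1)[OF pq(2)] by (simp add: prod_eq_iff)
  qed
  ultimately show ?thesis using no_loop_injective_real[OF \<delta>] by blast
qed

text \<open>Polar coordinates about an interior point of the vertex arc give a small box in which
  the vertex circle is the real segment and which nothing else of the boundary of the state
  enters.\<close>

lemma level_curve_descending:
  assumes H: "H \<subseteq> edges G" and K: "simple_path K" "pathfinish K = pathstart K" "path_image K \<subseteq> boundary H \<times> {1/2}"
    and b: "b \<in> vertex_arcs G F" "runs_along b K"
  shows "descending_knot \<Sigma> \<A> K"
proof -
  obtain v \<theta> \<tau> where v: "v \<in> verts G" "0 < \<tau>" "\<tau> \<le> 2 * pi" and bdef: "b = (\<lambda>s. (vmap F v (cis (\<theta> + s * \<tau>)), 1/2))"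
    and av: "\<forall>s\<in>{0..1}. vmap F v (cis (\<theta> + s * \<tau>)) \<notin> (\<Union>e\<in>edges G. emap F e ` {z. \<bar>Re z\<bar> \<le> 2 \<and> \<bar>Im z\<bar> < 1})"
    using b(1) unfolding vertex_arcs_def by blast
  have vinj: "\<zeta> = \<xi>" if "vmap F v \<zeta> = vmap F v \<xi>" "norm \<zeta> \<le> 2" "norm \<xi> \<le> 2" for \<zeta> \<xi>
    using vmap(2)[OF v(1)] that unfolding inj_on_def by auto
  \<comment> \<open>The interior of the vertex arc meets the closed edge boxes in corners only, that
    is, in finitely many points; any other interior parameter will do.\<close>
  obtain s0 where s0: "0 < s0" "s0 < 1" "vmap F v (cis (\<theta> + s0 * \<tau>)) \<notin> (\<Union>e\<in>edges G. emap F e ` edge_box)"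
  proof -
    define B where "B = {s \<in> {0<..<1}. vmap F v (cis (\<theta> + s * \<tau>)) \<in> (\<Union>e\<in>edges G. emap F e ` edge_box)}"
    have sub: "(\<lambda>s. vmap F v (cis (\<theta> + s * \<tau>))) ` B \<subseteq> (\<Union>e\<in>edges G. emap F e ` corners)"
    proof (rule image_subsetI)
      fix s assume s: "s \<in> B"
      then obtain e z where e: "e \<in> edges G" "z \<in> edge_box" "vmap F v (cis (\<theta> + s * \<tau>)) = emap F e z" unfolding B_def by blast
      have "emap F e z \<in> (\<Union>v\<in>verts G. vmap F v ` sphere 0 1)" unfolding e(3)[symmetric]
        by (rule UN_I[OF v(1)]) (rule imageI, simp)
      then have "\<bar>Re z\<bar> = 1" using emap_sphere(2)[OF e(1,2)] by simp
      moreover have "\<not> \<bar>Im z\<bar> < 1"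
      proof
        assume "\<bar>Im z\<bar> < 1"
        then have "emap F e z \<in> (\<Union>e\<in>edges G. emap F e ` {z. \<bar>Re z\<bar> \<le> 2 \<and> \<bar>Im z\<bar> < 1})" by (intro UN_I[OF e(1)] imageI) (use e(2) in \<open>simp add: edge_box_def\<close>)
        moreover have "s \<in> {0..1}" using s by (simp add: B_def)
        from bspec[OF av this] have "emap F e z \<notin> (\<Union>e\<in>edges G. emap F e ` {z. \<bar>Re z\<bar> \<le> 2 \<and> \<bar>Im z\<bar> < 1})" unfolding e(3) .
        ultimately show False by contradiction
      qed
      ultimately have "z \<in> corners" using e(2) by (auto simp: corners_def edge_box_def)
      then show "vmap F v (cis (\<theta> + s * \<tau>)) \<in> (\<Union>e\<in>edges G. emap F e ` corners)" using e by blast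
    qed
    have "finite corners"
    proof -
      have "corners \<subseteq> {Complex 1 1, Complex 1 (-1), Complex (-1) 1, Complex (-1) (-1)}"
        by (auto simp: corners_def complex_eq_iff abs_if split: if_splits)
      then show ?thesis using finite_subset by blast
    qed
    then have "finite (\<Union>e\<in>edges G. emap F e ` corners)" using finite_graph by auto
    then have "finite ((\<lambda>s. vmap F v (cis (\<theta> + s * \<tau>))) ` B)" using finite_subset[OF sub] by blast
    moreover have "inj_on (\<lambda>s. vmap F v (cis (\<theta> + s * \<tau>))) B"
    proof (rule inj_onI)
      fix s t assume st: "s \<in> B" "t \<in> B" "vmap F v (cis (\<theta> + s * \<tau>)) = vmap F v (cis (\<theta> + t * \<tau>))"
      then have c: "cis (\<theta> + s * \<tau>) = cis (\<theta> + t * \<tau>)" using vinj by auto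
      have "\<bar>s - t\<bar> < 1" using st(1,2) by (auto simp: B_def)
      then have "\<bar>s - t\<bar> * \<tau> < 1 * \<tau>" using v(2) by (intro mult_strict_right_mono) auto
      moreover have "\<bar>(\<theta> + s * \<tau>) - (\<theta> + t * \<tau>)\<bar> = \<bar>s - t\<bar> * \<tau>" using v(2) by (simp add: abs_mult flip: left_diff_distrib)
      ultimately have "\<theta> + s * \<tau> = \<theta> + t * \<tau>" using cis_eq_imp[OF c] v(3) by linarith
      then show "s = t" using v(2) by simp
    qed
    ultimately have "finite B" using finite_imageD by blast
    moreover have "infinite {0<..<1::real}" by (simp add: infinite_Ioo)
    ultimately obtain s where "s \<in> {0<..<1}" "s \<notin> B" by (metis finite_subset subsetI)
    then show ?thesis using that unfolding B_def by auto
  qed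
  define \<theta>0 where "\<theta>0 = \<theta> + s0 * \<tau>"
  define Z where "Z = (\<Union>e\<in>edges G. emap F e ` edge_box) \<union> (\<Union>v'\<in>verts G - {v}. vmap F v' ` cball 0 1)"
  have cZ: "closed Z" unfolding Z_def using finite_graph compact_box_image compact_disc by (intro compact_imp_closed compact_Un compact_UN) auto
  have z0: "vmap F v (cis \<theta>0) \<notin> Z"
  proof -
    have "vmap F v (cis \<theta>0) \<in> vmap F v ` cball 0 1" by (rule imageI) simp
    then have "vmap F v (cis \<theta>0) \<notin> vmap F v' ` cball 0 1" if "v' \<in> verts G - {v}" for v'
      using discs_disjoint v(1) that unfolding pairwise_def disjnt_def by blast
    then show ?thesis using s0(3) unfolding Z_def \<theta>0_def by blast
  qed
  define \<Xi> where "\<Xi> = (\<lambda>q::real \<times> real. vmap F v (of_real (fst q) * cis (snd q)))"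
  have c\<Xi>: "continuous_on ({0<..<2} \<times> UNIV) \<Xi>" unfolding \<Xi>_def
    by (rule continuous_on_compose2[OF vmap(1)[OF v(1)]]) (auto intro!: continuous_intros simp: norm_mult)
  have "open (({0<..<2} \<times> UNIV) \<inter> \<Xi> -` (- Z))"
    using c\<Xi> cZ by (intro continuous_open_preimage) (auto intro!: open_Times)
  moreover have "(1, \<theta>0) \<in> ({0<..<2} \<times> UNIV) \<inter> \<Xi> -` (- Z)" using z0 by (simp add: \<Xi>_def)
  ultimately obtain \<delta> where \<delta>: "\<delta> > 0" "cball (1, \<theta>0) \<delta> \<subseteq> ({0<..<2} \<times> UNIV) \<inter> \<Xi> -` (- Z)" by (meson open_contains_cball)
  \<comment> \<open>Small enough for the box to avoid \<open>Z\<close>, for the radius to differ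
    from 1 by at most 1/4, and for angles within \<open>2 * \<epsilon>\<close> of
    \<open>\<theta>0\<close> to belong to the vertex arc.\<close>
  define \<epsilon> where "\<epsilon> = min (min (\<delta>/4) (1/4)) (min (s0 * \<tau> / 2) ((1 - s0) * \<tau> / 2))"
  have \<epsilon>: "0 < \<epsilon>" "\<epsilon> \<le> \<delta>/4" "\<epsilon> \<le> 1/4" "2 * \<epsilon> \<le> s0 * \<tau>" "2 * \<epsilon> \<le> (1 - s0) * \<tau>"
  proof -
    have "0 < s0 * \<tau>" "0 < (1 - s0) * \<tau>" using s0 v(2) by auto
    then show "0 < \<epsilon>" using \<delta>(1) by (simp add: \<epsilon>_def)
    show "\<epsilon> \<le> \<delta>/4" "\<epsilon> \<le> 1/4" by (simp_all add: \<epsilon>_def)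
    have "\<epsilon> \<le> s0 * \<tau> / 2" "\<epsilon> \<le> (1 - s0) * \<tau> / 2" by (simp_all add: \<epsilon>_def)
    then show "2 * \<epsilon> \<le> s0 * \<tau>" "2 * \<epsilon> \<le> (1 - s0) * \<tau>" by linarith+
  qed
  define \<beta> where "\<beta> = (\<lambda>z. \<Xi> (1 + \<epsilon> * Im z, \<theta>0 + \<epsilon> * Re z))"
  have inb: "(1 + \<epsilon> * Im z, \<theta>0 + \<epsilon> * Re z) \<in> cball (1, \<theta>0) \<delta>" and im14: "\<bar>\<epsilon> * Im z\<bar> \<le> 1/4" and re2: "\<bar>\<epsilon> * Re z\<bar> \<le> 2 * \<epsilon>" if "z \<in> edge_box" for z
  proof -
    have m: "\<bar>\<epsilon> * Im z\<bar> \<le> \<epsilon> * 1" "\<bar>\<epsilon> * Re z\<bar> \<le> \<epsilon> * 2" unfolding abs_mult using \<epsilon>(1) that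
      by (auto intro!: mult_left_mono simp: edge_box_def)
    then show "\<bar>\<epsilon> * Im z\<bar> \<le> 1/4" "\<bar>\<epsilon> * Re z\<bar> \<le> 2 * \<epsilon>" using \<epsilon>(3) by linarith+
    have "dist (1, \<theta>0) (1 + \<epsilon> * Im z, \<theta>0 + \<epsilon> * Re z) \<le> \<bar>\<epsilon> * Im z\<bar> + \<bar>\<epsilon> * Re z\<bar>"
      unfolding dist_Pair_Pair dist_real_def using sqrt_sum_squares_le_sum_abs[of "1 - (1 + \<epsilon> * Im z)" "\<theta>0 - (\<theta>0 + \<epsilon> * Re z)"] by simp
    then show "(1 + \<epsilon> * Im z, \<theta>0 + \<epsilon> * Re z) \<in> cball (1, \<theta>0) \<delta>" using m \<epsilon>(2) by simp
  qed
  have dom: "(1 + \<epsilon> * Im z, \<theta>0 + \<epsilon> * Re z) \<in> {0<..<2} \<times> UNIV" "\<beta> z \<notin> Z" if "z \<in> edge_box" for z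
    using inb[OF that] \<delta>(2) unfolding \<beta>_def by blast+
  have nrm: "norm (of_real (1 + \<epsilon> * Im z) * cis t) = 1 + \<epsilon> * Im z" if "z \<in> edge_box" for z t
    using im14[OF that] by (simp only: norm_mult norm_of_real norm_cis) (simp add: abs_le_iff)
  have \<beta>v: "\<beta> z = vmap F v (of_real (1 + \<epsilon> * Im z) * cis (\<theta>0 + \<epsilon> * Re z))" for z by (simp add: \<beta>_def \<Xi>_def)
  have nrm2: "norm (of_real (1 + \<epsilon> * Im z) * cis t) \<le> 2" if "z \<in> edge_box" for z t
    unfolding nrm[OF that] using im14[OF that] by linarith
  obtain u0 where u0: "continuous_on {0..1} u0" "strict_mono_on {0..1} u0" "\<forall>s\<in>{0..1}. b s = K (frac (u0 s))"
    using b(2) unfolding runs_along_def by blast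
  define r where "r = (\<lambda>x. s0 + \<epsilon> * x / \<tau>)"
  have r01: "r x \<in> {0..1}" if "x \<in> {-2..2}" for x
  proof -
    have "\<epsilon> * x \<le> \<epsilon> * 2" "\<epsilon> * (-2) \<le> \<epsilon> * x" by (rule mult_left_mono; use that \<epsilon>(1) in simp)+
    then have "- (s0 * \<tau>) \<le> \<epsilon> * x" "\<epsilon> * x \<le> (1 - s0) * \<tau>" using \<epsilon>(4,5) by linarith+
    then show ?thesis using v(2) by (auto simp: r_def field_simps)
  qed
  show ?thesis
  proof (rule descending_knot_flat_segment[OF surf K(1,2), of \<beta> "\<lambda>x. u0 (r x)"])
    have "boundary H \<subseteq> surface_interior \<A>" using boundary_subset[OF H] state_surface_subset[OF H] by blast
    then show "path_image K \<subseteq> surface_interior \<A> \<times> {1/2}" using K(3) by blast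
    show "continuous_on edge_box \<beta>" unfolding \<beta>_def
      by (rule continuous_on_compose2[OF c\<Xi>]) (use dom in \<open>auto intro!: continuous_intros\<close>)
    show "inj_on \<beta> edge_box"
    proof (rule inj_onI)
      fix z w assume zw: "z \<in> edge_box" "w \<in> edge_box" "\<beta> z = \<beta> w"
      then have eq: "of_real (1 + \<epsilon> * Im z) * cis (\<theta>0 + \<epsilon> * Re z) = of_real (1 + \<epsilon> * Im w) * cis (\<theta>0 + \<epsilon> * Re w)"
        unfolding \<beta>v by (intro vinj nrm2)
      then have i: "1 + \<epsilon> * Im z = 1 + \<epsilon> * Im w" using nrm[OF zw(1)] nrm[OF zw(2)] by metis
      moreover have "1 + \<epsilon> * Im w \<noteq> 0" using im14[OF zw(2)] by linarith
      ultimately have "cis (\<theta>0 + \<epsilon> * Re z) = cis (\<theta>0 + \<epsilon> * Re w)" using eq by (metis mult_left_cancel of_real_eq_0_iff)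
      moreover have "\<bar>(\<theta>0 + \<epsilon> * Re z) - (\<theta>0 + \<epsilon> * Re w)\<bar> < 2 * pi" using re2[OF zw(1)] re2[OF zw(2)] \<epsilon>(3) pi_gt3 by linarith
      ultimately have "\<theta>0 + \<epsilon> * Re z = \<theta>0 + \<epsilon> * Re w" by (rule cis_eq_imp)
      then show "z = w" using i \<epsilon>(1) by (simp add: complex_eq_iff)
    qed
    show "\<beta> ` edge_box \<subseteq> surface_interior \<A>"
    proof (rule image_subsetI)
      fix z assume "z \<in> edge_box"
      then show "\<beta> z \<in> surface_interior \<A>" unfolding \<beta>v using nrm2[of z] by (intro subsetD[OF vmap(3)[OF v(1)]] imageI) simp
    qed
    show "continuous_on {-2..2} (\<lambda>x. u0 (r x))"
      by (rule continuous_on_compose2[OF u0(1)]) (use r01 v(2) in \<open>auto simp: r_def intro!: continuous_intros\<close>)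
    show "strict_mono_on {-2..2} (\<lambda>x. u0 (r x))"
    proof (rule strict_mono_onI)
      fix x y :: real assume xy: "x \<in> {-2..2}" "y \<in> {-2..2}" "x < y"
      have "r x < r y" using xy(3) \<epsilon>(1) v(2) by (simp add: r_def divide_strict_right_mono)
      then show "u0 (r x) < u0 (r y)" using u0(2) r01[OF xy(1)] r01[OF xy(2)] by (auto simp: strict_mono_on_def)
    qed
    show "K (frac (u0 (r x))) = (\<beta> (of_real x), 1/2)" if "x \<in> {-2..2}" for x
    proof -
      have "K (frac (u0 (r x))) = b (r x)" using u0(3) r01[OF that] by simp
      moreover have "\<theta> + r x * \<tau> = \<theta>0 + \<epsilon> * x" using v(2) by (simp add: r_def \<theta>0_def field_simps)
      ultimately show ?thesis by (simp add: bdef \<beta>v)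
    qed
    show "Im z = 0" if z: "z \<in> edge_box" "\<beta> z \<in> fst ` path_image K" for z
    proof -
      have "\<beta> z \<in> boundary H" using z(2) K(3) by auto
      moreover have "\<beta> z \<notin> (\<Union>e\<in>H. emap F e ` {z. \<bar>Re z\<bar> \<le> 1 \<and> \<bar>Im z\<bar> = 1/2})"
      proof
        assume "\<beta> z \<in> (\<Union>e\<in>H. emap F e ` {z. \<bar>Re z\<bar> \<le> 1 \<and> \<bar>Im z\<bar> = 1/2})"
        then obtain e w where "e \<in> H" "\<bar>Re w\<bar> \<le> 1" "\<bar>Im w\<bar> = 1/2" "\<beta> z = emap F e w" by blast
        moreover from this have "w \<in> edge_box" by (auto simp: edge_box_def)
        ultimately have "\<beta> z \<in> Z" unfolding Z_def using H by blast
        then show False using dom(2)[OF z(1)] by blast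
      qed
      ultimately obtain v' \<zeta> where v': "v' \<in> verts G" "\<zeta> \<in> sphere 0 1" "\<beta> z = vmap F v' \<zeta>" unfolding boundary_def by blast
      have "v' = v"
      proof (rule ccontr)
        assume "v' \<noteq> v"
        moreover have "\<beta> z \<in> vmap F v' ` cball 0 1" unfolding v'(3) using v'(2) by (intro imageI) auto
        ultimately have "\<beta> z \<in> Z" unfolding Z_def using v'(1) by blast
        then show False using dom(2)[OF z(1)] by blast
      qed
      then have "of_real (1 + \<epsilon> * Im z) * cis (\<theta>0 + \<epsilon> * Re z) = \<zeta>"
        using v'(2,3) unfolding \<beta>v by (intro vinj nrm2[OF z(1)]) auto
      then have "1 + \<epsilon> * Im z = 1" using nrm[OF z(1)] v'(2) by (metis mem_sphere_0)
      then show ?thesis using \<epsilon>(1) by simp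
    qed
  qed
qed

end

section \<open>Polynomials\<close>

lemma const_simps: "const 1 = 1" "const 0 = 0" "const (a * b) = const a * const b" "const (a + b) = const a + const b"
  "const (a - b) = const a - const b"
  by (simp_all add: const_def mult_single single_add single_diff)

lemma const_power: "const (a ^ n) = const a ^ n"
  by (induction n) (simp_all add: const_simps)

lemma monomial_simps: "monomial 0 = 1" "monomial (m + n) = monomial m * monomial n"
  by (simp_all add: monomial_def mult_single)

lemma lookup_const_mult: "Poly_Mapping.lookup (const r * p) m = r * Poly_Mapping.lookup p m"
proof -
  have "p = (\<Sum>k\<in>Poly_Mapping.keys p. Poly_Mapping.single k (Poly_Mapping.lookup p k))"
    by (rule poly_mapping_eqI) (simp add: lookup_sum lookup_single when_def in_keys_iff)
  from arg_cong[OF this, of "\<lambda>p. const r * p"]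
  have "const r * p = (\<Sum>k\<in>Poly_Mapping.keys p. Poly_Mapping.single k (r * Poly_Mapping.lookup p k))"
    by (simp add: sum_distrib_left const_def mult_single)
  then have "Poly_Mapping.lookup (const r * p) m = (\<Sum>k\<in>Poly_Mapping.keys p. if k = m then r * Poly_Mapping.lookup p k else 0)"
    by (simp add: lookup_sum lookup_single when_def)
  also have "\<dots> = r * Poly_Mapping.lookup p m" by (simp add: in_keys_iff)
  finally show ?thesis .
qed

section \<open>Linear maps prescribed on monomials\<close>

definition linear_extension :: "(('i \<Rightarrow>\<^sub>0 nat) \<Rightarrow> 'j mpoly) \<Rightarrow> 'i mpoly \<Rightarrow> 'j mpoly" where
  "linear_extension \<Phi> p = (\<Sum>m\<in>Poly_Mapping.keys p. const (Poly_Mapping.lookup p m) * \<Phi> m)"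

text \<open>Coefficients outside the support are 0; so two polynomials can be summed over a common
  finite set of exponents.\<close>

lemma linear_extension_superset:
  assumes "finite A" "Poly_Mapping.keys p \<subseteq> A"
  shows "linear_extension \<Phi> p = (\<Sum>m\<in>A. const (Poly_Mapping.lookup p m) * \<Phi> m)"
  unfolding linear_extension_def using assms
  by (intro sum.mono_neutral_left) (auto simp: in_keys_iff const_simps)

lemma linear_extension_add: "linear_extension \<Phi> (p + q) = linear_extension \<Phi> p + linear_extension \<Phi> q"
proof -
  let ?A = "Poly_Mapping.keys p \<union> Poly_Mapping.keys q"
  have "linear_extension \<Phi> (p + q) = (\<Sum>m\<in>?A. const (Poly_Mapping.lookup (p + q) m) * \<Phi> m)"
    by (rule linear_extension_superset) (auto simp: Poly_Mapping.keys_add)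
  also have "\<dots> = (\<Sum>m\<in>?A. const (Poly_Mapping.lookup p m) * \<Phi> m) + (\<Sum>m\<in>?A. const (Poly_Mapping.lookup q m) * \<Phi> m)"
    by (simp add: lookup_add const_simps distrib_right sum.distrib)
  also have "\<dots> = linear_extension \<Phi> p + linear_extension \<Phi> q"
    by (simp add: linear_extension_superset[of ?A])
  finally show ?thesis .
qed

lemma linear_extension_scale: "linear_extension \<Phi> (const r * p) = const r * linear_extension \<Phi> p"
proof -
  have "Poly_Mapping.keys (const r * p) \<subseteq> Poly_Mapping.keys p" by (auto simp: in_keys_iff lookup_const_mult)
  then have "linear_extension \<Phi> (const r * p) = (\<Sum>m\<in>Poly_Mapping.keys p. const (Poly_Mapping.lookup (const r * p) m) * \<Phi> m)"
    by (intro linear_extension_superset) auto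
  then show ?thesis by (simp add: lookup_const_mult const_simps linear_extension_def sum_distrib_left mult.assoc)
qed

lemma linear_extension_monomial: "linear_extension \<Phi> (monomial m) = \<Phi> m"
  by (simp add: linear_extension_def monomial_def const_simps)

lemma linear_extension_sum: "finite A \<Longrightarrow> linear_extension \<Phi> (\<Sum>a\<in>A. g a) = (\<Sum>a\<in>A. linear_extension \<Phi> (g a))"
proof (induction A rule: finite_induct)
  case empty show ?case by (simp add: linear_extension_def)
qed (simp add: linear_extension_add)

text \<open>The exponent of the product of the variables in \<open>H\<close>. For finite
  \<open>H\<close> its support is \<open>H\<close>, so a state can be read off its monomial.\<close>

definition square_free_exponent :: "'i set \<Rightarrow> 'i \<Rightarrow>\<^sub>0 nat" where
  "square_free_exponent H = (\<Sum>e\<in>H. Poly_Mapping.single e 1)"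

lemma keys_square_free_exponent: "finite H \<Longrightarrow> Poly_Mapping.keys (square_free_exponent H) = H"
proof -
  assume H: "finite H"
  have "Poly_Mapping.lookup (square_free_exponent H) e = (if e \<in> H then 1 else 0)" for e
    unfolding square_free_exponent_def using H by (simp add: lookup_sum lookup_single when_def)
  then show ?thesis by (auto simp: in_keys_iff split: if_splits)
qed

lemma prod_var: "finite H \<Longrightarrow> (\<Prod>e\<in>H. var e) = monomial (square_free_exponent H)"
  by (induction H rule: finite_induct) (simp_all add: square_free_exponent_def monomial_simps var_def)

section \<open>Nonvanishing of the denominators\<close>

lemma Fract_1_inject: "Fract p 1 = Fract q 1 \<longleftrightarrow> p = q" for p q :: "int poly poly"
  by (simp add: eq_fract)

lemma x_var_nonzero: "x_var \<noteq> 0"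
proof
  assume "x_var = 0"
  then have "Fract [:[:0, 1:]:] 1 = Fract (0 :: int poly poly) 1" by (simp add: x_var_def Zero_fract_def)
  then show False unfolding Fract_1_inject by simp
qed

lemma y_var_nonzero: "y_var \<noteq> 0"
proof
  assume "y_var = 0"
  then have "Fract [:0, 1:] 1 = Fract (0 :: int poly poly) 1" by (simp add: y_var_def Zero_fract_def)
  then show False unfolding Fract_1_inject by simp
qed

text \<open>Otherwise the square of the variable x would be the polynomial 1. Without this, division
  by x - x^-1 would return the default value 0.\<close>

lemma x_var_minus_inverse_nonzero: "x_var - inverse x_var \<noteq> 0"
proof
  assume "x_var - inverse x_var = 0"
  then have "x_var * x_var = x_var * inverse x_var" by simp
  then have "x_var * x_var = 1" using x_var_nonzero by simp
  then have "Fract ([:[:0, 1:]:] * [:[:0, 1:]:]) 1 = Fract (1 :: int poly poly) 1" by (simp add: x_var_def One_fract_def)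
  then have "[:[:0, 1:]:] * [:[:0, 1:]:] = (1 :: int poly poly)" unfolding Fract_1_inject .
  then show False by (simp add: one_pCons)
qed

section \<open>The state expansion\<close>

text \<open>The contraction of \<open>q\<close> is carried along the connecting path. Consequently
  the representative of a loop that is not contractible is one of the indeterminates.\<close>

lemma null_homotopic_conjugate:
  assumes p: "pi1_conjugate \<Sigma> p q" and q: "null_homotopic \<Sigma> q"
  shows "null_homotopic \<Sigma> p"
proof -
  obtain r where r: "path r" "path_image r \<subseteq> \<Sigma>" "pathstart r = pathstart p" "pathfinish r = pathstart q"
    "homotopic_paths \<Sigma> p (r +++ q +++ reversepath r)" using p unfolding pi1_conjugate_def by blast
  have q': "homotopic_paths \<Sigma> q (\<lambda>_. pathstart q)" using q unfolding null_homotopic_def .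
  have qf: "pathfinish q = pathstart q" using homotopic_paths_imp_pathfinish[OF q'] by (simp add: pathfinish_def)
  have rr: "homotopic_paths \<Sigma> (reversepath r) (reversepath r)" "homotopic_paths \<Sigma> r r"
    using r by simp_all
  have "homotopic_paths \<Sigma> (q +++ reversepath r) ((\<lambda>_. pathstart q) +++ reversepath r)"
    by (rule homotopic_paths_join[OF q' rr(1)]) (simp add: qf r)
  then have "homotopic_paths \<Sigma> (r +++ q +++ reversepath r) (r +++ (\<lambda>_. pathstart q) +++ reversepath r)"
    by (rule homotopic_paths_join[OF rr(2)]) (simp add: r)
  moreover have "homotopic_paths \<Sigma> (r +++ (\<lambda>_. pathstart q) +++ reversepath r) (\<lambda>_. pathstart r)"
  proof -
    \<comment> \<open>Going along \<open>r\<close>, waiting and going back is the image under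
      \<open>r\<close> of a path in the unit interval, where it contracts.\<close>
    let ?i = "linepath 0 (1::real)" and ?c = "linepath 1 (1::real)"
    have i: "path ?i" "path_image ?i \<subseteq> {0..1}" by (simp_all add: closed_segment_eq_real_ivl)
    have "homotopic_paths {0..1} (?c +++ reversepath ?i) (reversepath ?i)"
      using homotopic_paths_lid[of "reversepath ?i" "{0..1}"] by (simp add: closed_segment_eq_real_ivl)
    then have "homotopic_paths {0..1} (?i +++ ?c +++ reversepath ?i) (?i +++ reversepath ?i)"
      using i by (intro homotopic_paths_join) (simp_all del: reversepath_linepath)
    then have "homotopic_paths {0..1} (?i +++ ?c +++ reversepath ?i) (linepath 0 0)"
      using homotopic_paths_rinv[OF i] homotopic_paths_trans by fastforce
    moreover have "continuous_on {0..1} r" "r \<in> {0..1} \<rightarrow> \<Sigma>" using r(1,2) by (auto simp: path_def path_image_def)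
    ultimately have "homotopic_paths \<Sigma> (r \<circ> (?i +++ ?c +++ reversepath ?i)) (r \<circ> linepath 0 0)"
      by (rule homotopic_paths_continuous_image)
    moreover have "r \<circ> ?i = r" "r \<circ> ?c = (\<lambda>_. pathstart q)" "r \<circ> linepath 0 0 = (\<lambda>_. pathstart r)"
      using r(4) by (auto simp: fun_eq_iff linepath_def pathfinish_def pathstart_def)
    ultimately show ?thesis by (simp add: path_compose_join path_compose_reversepath del: reversepath_linepath)
  qed
  ultimately have "homotopic_paths \<Sigma> p (\<lambda>_. pathstart r)" using r(5) homotopic_paths_trans by blast
  then show ?thesis unfolding null_homotopic_def r(3) .
qed

lemma representative_in:
  assumes S: "canonical_representatives \<Sigma> \<A> S" and K: "path (fst \<circ> K)" "path_image (fst \<circ> K) \<subseteq> \<Sigma>" "pathfinish (fst \<circ> K) = pathstart (fst \<circ> K)"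
  shows "representative \<Sigma> S K \<in> S" "pi1_conjugate \<Sigma> (fst \<circ> K) (fst \<circ> representative \<Sigma> S K)"
proof -
  have "\<exists>!s. s \<in> S \<and> pi1_conjugate \<Sigma> (fst \<circ> K) (fst \<circ> s)" using S K unfolding canonical_representatives_def by blast
  from theI'[OF this] show "representative \<Sigma> S K \<in> S" "pi1_conjugate \<Sigma> (fst \<circ> K) (fst \<circ> representative \<Sigma> S K)"
    unfolding representative_def by auto
qed

lemma loop_projection:
  assumes "closed_curves L" "trace L \<subseteq> \<Sigma> \<times> UNIV" "K \<in> L"
  shows "path (fst \<circ> K)" "path_image (fst \<circ> K) \<subseteq> \<Sigma>" "pathfinish (fst \<circ> K) = pathstart (fst \<circ> K)"
proof -
  have K: "simple_path K" "pathfinish K = pathstart K" using assms by (auto simp: closed_curves_def)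
  show "path (fst \<circ> K)" using K(1) by (intro path_continuous_image) (auto simp: simple_path_imp_path intro!: continuous_intros)
  show "path_image (fst \<circ> K) \<subseteq> \<Sigma>" using assms(2,3) unfolding path_image_compose trace_def by auto
  show "pathfinish (fst \<circ> K) = pathstart (fst \<circ> K)" using K(2) by (simp add: pathfinish_def pathstart_def)
qed

text \<open>Contractible components contribute 1, and every other component contributes the
  indeterminate of its conjugacy class.\<close>

lemma t_link_monomial:
  assumes S: "canonical_representatives \<Sigma> \<A> S" and L: "closed_curves L" "trace L \<subseteq> \<Sigma> \<times> UNIV"
  shows "\<exists>n. Poly_Mapping.keys n \<subseteq> indeterminates \<Sigma> S \<and> t_link \<Sigma> S L = monomial n"
proof -
  have knot: "\<exists>n. Poly_Mapping.keys n \<subseteq> indeterminates \<Sigma> S \<and> t_knot \<Sigma> S K = monomial n" if K: "K \<in> L" for K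
  proof (cases "null_homotopic \<Sigma> (fst \<circ> K)")
    case True
    then show ?thesis by (intro exI[of _ 0]) (simp add: t_knot_def monomial_simps)
  next
    case False
    note r = representative_in[OF S loop_projection[OF L K]]
    have "representative \<Sigma> S K \<in> indeterminates \<Sigma> S"
      using r False null_homotopic_conjugate unfolding indeterminates_def by blast
    then show ?thesis using False by (intro exI[of _ "Poly_Mapping.single (representative \<Sigma> S K) 1"]) (simp add: t_knot_def var_def)
  qed
  have "finite L" using L by (simp add: closed_curves_def)
  have "L' \<subseteq> L \<Longrightarrow> \<exists>n. Poly_Mapping.keys n \<subseteq> indeterminates \<Sigma> S \<and> (\<Prod>K\<in>L'. t_knot \<Sigma> S K) = monomial n" if "finite L'" for L'
    using that
  proof (induction L' rule: finite_induct)
    case empty then show ?case by (intro exI[of _ 0]) (simp add: monomial_simps)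
  next
    case (insert K L')
    obtain n where n: "Poly_Mapping.keys n \<subseteq> indeterminates \<Sigma> S" "(\<Prod>K\<in>L'. t_knot \<Sigma> S K) = monomial n" using insert by auto
    obtain m where m: "Poly_Mapping.keys m \<subseteq> indeterminates \<Sigma> S" "t_knot \<Sigma> S K = monomial m" using knot[of K] insert.prems by blast
    show ?case using n m insert.hyps Poly_Mapping.keys_add[of m n] by (intro exI[of _ "m + n"]) (auto simp: monomial_simps)
  qed
  from this[OF \<open>finite L\<close> order_refl] show ?thesis unfolding t_link_def .
qed

context ribbon_in_surface
begin

text \<open>The isotopy to the boundary of the state is followed by stacking its curves. The order
  of stacking must respect \<open>R\<close> on representatives; a list sorted in this way exists
  because \<open>R\<close> is a total preorder on \<open>S\<close>.\<close>

lemma descending_state_link: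
  assumes S: "canonical_representatives \<Sigma> \<A> S" "preorder_on S R" "total_on S R"
    and H: "H \<subseteq> edges G" and L: "closed_curves L" "L \<noteq> {}" "carries L (arcs (state_resolution H))"
  shows "descending_link \<Sigma> \<A> S R L" "num_boundary_components \<Sigma> G F H = card L"
proof -
  have tr: "trace L = trace (arcs (state_resolution H))" using L(3) by (simp add: carries_def)
  obtain K where K: "ambient_isotopy \<Sigma> K" "K 1 ` trace L = boundary H \<times> {1/2}"
    "\<And>p. p \<in> trace (vertex_arcs G F) \<Longrightarrow> K 1 p = p"
    using state_isotopy[OF H tr L(1)] by blast
  have trb: "trace L \<subseteq> \<Sigma> \<times> {0..1}" using trace_arcs_bounds[OF range_state_resolution] interior_subset_surface unfolding tr by fastforce
  note Kh = ambient_isotopy_homeo[OF K(1)]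
  define L' where "L' = (\<lambda>\<gamma>. K 1 \<circ> \<gamma>) ` L"
  have L': "closed_curves L'" "trace L' = boundary H \<times> {1/2}" "card L' = card L"
    using closed_curves_image[OF L(1) continuous_on_subset[OF Kh(1) trb] inj_on_subset[OF Kh(2) trb]] K(2) by (simp_all add: L'_def)
  show "num_boundary_components \<Sigma> G F H = card L" using card_level_curves[OF H L'(1,2)] L'(3) by simp
  have bS: "boundary H \<subseteq> \<Sigma>" using boundary_subset[OF H] state_surface_subset[OF H] interior_subset_surface by blast
  have desc: "descending_knot \<Sigma> \<A> J" if J: "J \<in> L'" for J
  proof -
    obtain \<gamma> where \<gamma>: "\<gamma> \<in> L" "J = K 1 \<circ> \<gamma>" using J unfolding L'_def by blast
    obtain b where b: "b \<in> vertex_arcs G F" "runs_along b J"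
      using level_curve_carries_vertex_arc[OF H L(1,3) K \<gamma>(1)] unfolding \<gamma>(2) by blast
    show ?thesis
    proof (rule level_curve_descending[OF H _ _ _ b])
      show "simple_path J" "pathfinish J = pathstart J" using L'(1) J by (auto simp: closed_curves_def)
      show "path_image J \<subseteq> boundary H \<times> {1/2}" using J unfolding L'(2)[symmetric] trace_def by blast
    qed
  qed
  have rep: "representative \<Sigma> S J \<in> S" if "J \<in> L'" for J
    by (rule representative_in(1)[OF S(1)]; rule loop_projection[OF L'(1) _ that]) (use L'(2) bS in auto)
  obtain Ks where Ks: "distinct Ks" "set Ks = L'" "sorted_wrt (\<lambda>x y. (representative \<Sigma> S x, representative \<Sigma> S y) \<in> R) Ks"
    using sorted_enumeration[of L' "representative \<Sigma> S" S R] L'(1) rep S(2,3) by (auto simp: closed_curves_def)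
  obtain M where M: "continuous_on \<Sigma> M" "carries (stack_knots Ks) ((\<lambda>\<gamma>. lift_by M 1 \<circ> \<gamma>) ` L')"
    by (rule level_curves_stack[OF L'(1) _ Ks(1,2), of \<Sigma>]) (use L'(2) bS in auto)
  have "isotopic \<Sigma> L (stack_knots Ks)" unfolding isotopic_def
  proof (intro exI conjI)
    show "ambient_isotopy \<Sigma> (\<lambda>t p. lift_by M t (K t p))"
      by (rule ambient_isotopy_compose[OF K(1) ambient_isotopy_lift_by[OF M(1)]])
    show "carries (stack_knots Ks) ((\<lambda>\<gamma>. (\<lambda>p. lift_by M 1 (K 1 p)) \<circ> \<gamma>) ` L)"
      using M(2) unfolding L'_def image_image by (simp add: o_def)
  qed
  moreover have "Ks \<noteq> []" using Ks(2) L(2) by (auto simp: L'_def)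
  ultimately show "descending_link \<Sigma> \<A> S R L" unfolding descending_link_def
    using oriented_link_arcs[OF range_state_resolution L(1,2) tr] desc Ks by blast
qed

lemma arcs_cong: "(\<And>e. e \<in> edges G \<Longrightarrow> \<kappa> e = \<kappa>' e) \<Longrightarrow> arcs \<kappa> = arcs \<kappa>'"
  unfolding arcs_def by auto

lemma homfly_skein:
  assumes P: "homfly_polynomial \<Sigma> \<A> S R P" and "skein_triple \<Sigma> \<A> L L' L0"
  shows "P L = const (1 / x_var\<^sup>2) * P L' + const (y_var / x_var) * P L0"
proof -
  have "const x_var * P L - const (inverse x_var) * P L' = const y_var * P L0"
    using P assms(2) unfolding homfly_polynomial_def by blast
  then have e: "const x_var * P L = const (inverse x_var) * P L' + const y_var * P L0" by (simp add: algebra_simps)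
  have "P L = const (inverse x_var) * (const x_var * P L)"
    using x_var_nonzero by (simp add: mult.assoc[symmetric] const_simps(3)[symmetric]) (simp add: const_simps(1))
  also have "\<dots> = const (inverse x_var * inverse x_var) * P L' + const (inverse x_var * y_var) * P L0"
    unfolding e by (simp add: algebra_simps const_simps)
  finally show ?thesis by (simp add: power2_eq_square divide_inverse mult.commute)
qed

text \<open>Induction on the set of edges still to be resolved. The filling outside \<open>J\<close>
  is arbitrary because one edge is filled anew before the induction hypothesis is applied. For every
  state a link with value \<open>q H\<close> is kept, to be evaluated afterwards.\<close>

lemma state_expansion:
  assumes P: "homfly_polynomial \<Sigma> \<A> S R P" and "finite J"
  shows "J \<subseteq> edges G \<Longrightarrow> range \<kappa> \<subseteq> resolutions \<Longrightarrow> (\<And>e. e \<in> J \<Longrightarrow> \<kappa> e = crossing_pos) \<Longrightarrow>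
    closed_curves L \<Longrightarrow> L \<noteq> {} \<Longrightarrow> carries L (arcs \<kappa>) \<Longrightarrow>
    \<exists>q. P L = (\<Sum>H\<in>Pow J. const (1 / x_var\<^sup>2) ^ card H * const (y_var / x_var) ^ (card J - card H) * q H) \<and>
      (\<forall>H\<in>Pow J. \<exists>L'. closed_curves L' \<and> L' \<noteq> {} \<and> P L' = q H \<and>
         carries L' (arcs (\<lambda>e. if e \<in> J then state_resolution H e else \<kappa> e)))"
  using assms(2)
proof (induction J arbitrary: \<kappa> L rule: finite_induct)
  case empty
  then show ?case by (intro exI[of _ "\<lambda>_. P L"]) auto
next
  case (insert e J)
  let ?a = "const (1 / x_var\<^sup>2)" and ?b = "const (y_var / x_var)"
  have e: "e \<in> edges G" "\<kappa> e = crossing_pos" using insert.prems by auto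
  obtain L1 L0 where L1: "closed_curves L1" "L1 \<noteq> {}" "carries L1 (arcs (\<kappa>(e := crossing_neg)))"
    and L0: "closed_curves L0" "L0 \<noteq> {}" "carries L0 (arcs (\<kappa>(e := crossing_smooth)))" and sk: "skein_triple \<Sigma> \<A> L L1 L0"
    using skein_step[OF insert.prems(2) e insert.prems(4-6)] by blast
  have J: "J \<subseteq> edges G" using insert.prems by auto
  have rng: "range (\<kappa>(e := X)) \<subseteq> resolutions" if "X \<in> resolutions" for X using insert.prems(2) that by auto
  have pos: "(\<kappa>(e := X)) e' = crossing_pos" if "e' \<in> J" for X e' using insert.prems(3)[of e'] insert.hyps that by auto
  have neg_res: "crossing_neg \<in> resolutions" and sm_res: "crossing_smooth \<in> resolutions" by simp_all
  obtain q1 where q1: "P L1 = (\<Sum>H\<in>Pow J. ?a ^ card H * ?b ^ (card J - card H) * q1 H)"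
    "\<forall>H\<in>Pow J. \<exists>L'. closed_curves L' \<and> L' \<noteq> {} \<and> P L' = q1 H \<and>
         carries L' (arcs (\<lambda>e'. if e' \<in> J then state_resolution H e' else (\<kappa>(e := crossing_neg)) e'))"
    using insert.IH[OF J rng[OF neg_res] pos L1] by blast
  obtain q0 where q0: "P L0 = (\<Sum>H\<in>Pow J. ?a ^ card H * ?b ^ (card J - card H) * q0 H)"
    "\<forall>H\<in>Pow J. \<exists>L'. closed_curves L' \<and> L' \<noteq> {} \<and> P L' = q0 H \<and>
         carries L' (arcs (\<lambda>e'. if e' \<in> J then state_resolution H e' else (\<kappa>(e := crossing_smooth)) e'))"
    using insert.IH[OF J rng[OF sm_res] pos L0] by blast
  \<comment> \<open>States containing \<open>e\<close> come from the switched link, the others from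
    the smoothed one.\<close>
  define q where "q = (\<lambda>H. if e \<in> H then q1 (H - {e}) else q0 H)"
  show ?case
  proof (intro exI[of _ q] conjI ballI)
    have fin: "finite (Pow J)" "finite (Pow (insert e J))" using insert.hyps by auto
    let ?t = "\<lambda>H. ?a ^ card H * ?b ^ (card (insert e J) - card H) * q H"
    have "(\<Sum>H\<in>Pow (insert e J). ?t H) = (\<Sum>H\<in>Pow J. ?t H) + (\<Sum>H\<in>Pow J. ?t (insert e H))"
    proof -
      have inj: "inj_on (insert e) (Pow J)" using insert.hyps by (auto simp: inj_on_def)
      have "Pow J \<inter> insert e ` Pow J = {}" using insert.hyps by auto
      then show ?thesis unfolding Pow_insert using fin(1) by (simp add: sum.union_disjoint sum.reindex[OF inj])
    qed
    also have "(\<Sum>H\<in>Pow J. ?t H) = ?b * P L0"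
    proof -
      have "?t H = ?b * (?a ^ card H * ?b ^ (card J - card H) * q0 H)" if "H \<in> Pow J" for H
      proof -
        have "finite H" "H \<subseteq> J" "e \<notin> H" using that insert.hyps finite_subset by auto
        then have "card (insert e J) - card H = Suc (card J - card H)" using insert.hyps card_mono[of J H] by (simp add: Suc_diff_le)
        then show ?thesis using \<open>e \<notin> H\<close> by (simp add: q_def mult_ac)
      qed
      then show ?thesis unfolding q0(1) sum_distrib_left by (intro sum.cong) auto
    qed
    also have "(\<Sum>H\<in>Pow J. ?t (insert e H)) = ?a * P L1"
    proof -
      have "?t (insert e H) = ?a * (?a ^ card H * ?b ^ (card J - card H) * q1 H)" if "H \<in> Pow J" for H
      proof -
        have H: "finite H" "H \<subseteq> J" "e \<notin> H" using that insert.hyps finite_subset by auto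
        then have "card (insert e J) - card (insert e H) = card J - card H" "insert e H - {e} = H" using insert.hyps by auto
        then show ?thesis using H by (simp add: q_def mult_ac)
      qed
      then show ?thesis unfolding q1(1) sum_distrib_left by (intro sum.cong) auto
    qed
    finally show "P L = (\<Sum>H\<in>Pow (insert e J). ?t H)" using homfly_skein[OF P sk] by (simp add: add.commute)
  next
    fix H assume H: "H \<in> Pow (insert e J)"
    show "\<exists>L'. closed_curves L' \<and> L' \<noteq> {} \<and> P L' = q H \<and> carries L' (arcs (\<lambda>e'. if e' \<in> insert e J then state_resolution H e' else \<kappa> e'))"
    proof (cases "e \<in> H")
      case True
      have "H - {e} \<in> Pow J" using H by auto
      then obtain L' where "closed_curves L'" "L' \<noteq> {}" "P L' = q1 (H - {e})"
         "carries L' (arcs (\<lambda>e'. if e' \<in> J then state_resolution (H - {e}) e' else (\<kappa>(e := crossing_neg)) e'))" using q1(2) by blast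
      moreover have "(\<lambda>e'. if e' \<in> J then state_resolution (H - {e}) e' else (\<kappa>(e := crossing_neg)) e') =
          (\<lambda>e'. if e' \<in> insert e J then state_resolution H e' else \<kappa> e')"
        using True insert.hyps by (auto simp: fun_eq_iff state_resolution_def)
      ultimately show ?thesis using True by (auto simp: q_def)
    next
      case False
      then have "H \<in> Pow J" using H by auto
      then obtain L' where "closed_curves L'" "L' \<noteq> {}" "P L' = q0 H"
         "carries L' (arcs (\<lambda>e'. if e' \<in> J then state_resolution H e' else (\<kappa>(e := crossing_smooth)) e'))" using q0(2) by blast
      moreover have "(\<lambda>e'. if e' \<in> J then state_resolution H e' else (\<kappa>(e := crossing_smooth)) e') =
          (\<lambda>e'. if e' \<in> insert e J then state_resolution H e' else \<kappa> e')"
        using False insert.hyps by (auto simp: fun_eq_iff state_resolution_def)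
      ultimately show ?thesis using False by (auto simp: q_def)
    qed
  qed
qed

end

section \<open>Comparison of the expansion with the weighted polynomial\<close>

theorem theorem4p1:
  fixes \<Sigma> :: "'a::metric_space set" and \<A> :: "'a atlas"
    and G :: "('a, 'v, 'e) egraph" and F :: "('a, 'v, 'e) ribbon"
    and S :: "'a knot set" and R :: "'a knot rel"
    and P :: "'a link \<Rightarrow> 'a knot mpoly" and L :: "'a link"
  assumes "oriented_surface \<Sigma> \<A>"
    and "embedded_graph \<A> G"
    and "regular_neighbourhood \<A> G F"
    and "canonical_representatives \<Sigma> \<A> S"
    and "preorder_on S R" and "total_on S R"
    and "homfly_polynomial \<Sigma> \<A> S R P"
    and "jaeger_link \<Sigma> \<A> G F L"
  shows "\<exists>f :: 'e mpoly \<Rightarrow> 'a knot mpoly.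
    (\<forall>p q. f (p + q) = f p + f q) \<and>
    (\<forall>r p. f (const r * p) = const r * f p) \<and>
    (\<forall>m. f (monomial m) = 0 \<or>
       (\<exists>n. Poly_Mapping.keys n \<subseteq> indeterminates \<Sigma> S \<and> f (monomial m) = monomial n)) \<and>
    P L = f (const (y_var / (x_var - inverse x_var)) * const (y_var / x_var) ^ card (edges G) *
             bollobas_riordan \<Sigma> G F 1
               (\<lambda>e. const (1 / (x_var * y_var)) * var e)
               (const ((x_var - inverse x_var) / y_var)))"
proof -
  interpret ribbon_in_surface \<Sigma> \<A> G F using assms(1-3) by unfold_locales
  let ?a = "1 / x_var\<^sup>2" and ?b = "y_var / x_var" and ?\<delta> = "(x_var - inverse x_var) / y_var"
  let ?E = "edges G"
  have "oriented_link \<Sigma> \<A> L" using assms(8) by (simp add: jaeger_link_def)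
  then have "loop_system \<A> L" by (simp add: oriented_link_def)
  then have L: "closed_curves L" "L \<noteq> {}" unfolding closed_curves_loop_system by auto
  have cL: "carries L (arcs (\<lambda>_. crossing_pos))" using assms(8) unfolding jaeger_link_def arcs_def jaeger_tangle_eq by blast
  have "\<exists>q. P L = (\<Sum>H\<in>Pow ?E. const ?a ^ card H * const ?b ^ (card ?E - card H) * q H) \<and>
      (\<forall>H\<in>Pow ?E. \<exists>L'. closed_curves L' \<and> L' \<noteq> {} \<and> P L' = q H \<and>
         carries L' (arcs (\<lambda>e. if e \<in> ?E then state_resolution H e else crossing_pos)))"
    by (rule state_expansion[OF assms(7) finite_graph(1) order_refl _ _ L cL]) auto
  then obtain q where q: "P L = (\<Sum>H\<in>Pow ?E. const ?a ^ card H * const ?b ^ (card ?E - card H) * q H)"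
    "\<forall>H\<in>Pow ?E. \<exists>L'. closed_curves L' \<and> L' \<noteq> {} \<and> P L' = q H \<and>
         carries L' (arcs (\<lambda>e. if e \<in> ?E then state_resolution H e else crossing_pos))" by blast
  \<comment> \<open>Positivity of the number of boundary components is recorded because the exponent
    is a truncated difference of natural numbers.\<close>
  have "\<forall>H\<in>Pow ?E. \<exists>n. Poly_Mapping.keys n \<subseteq> indeterminates \<Sigma> S \<and>
      q H = monomial n * const ?\<delta> ^ (num_boundary_components \<Sigma> G F H - 1) \<and> 0 < num_boundary_components \<Sigma> G F H"
  proof
    fix H assume H: "H \<in> Pow ?E"
    obtain L' where L': "closed_curves L'" "L' \<noteq> {}" "P L' = q H"
         "carries L' (arcs (\<lambda>e. if e \<in> ?E then state_resolution H e else crossing_pos))" using q(2) H by blast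
    have "arcs (\<lambda>e. if e \<in> ?E then state_resolution H e else crossing_pos) = arcs (state_resolution H)" by (rule arcs_cong) simp
    then have c': "carries L' (arcs (state_resolution H))" using L'(4) by simp
    have HE: "H \<subseteq> ?E" using H by auto
    note d = descending_state_link[OF assms(4-6) HE L'(1,2) c']
    have "trace L' \<subseteq> \<Sigma> \<times> UNIV"
      using trace_arcs_bounds[OF range_state_resolution, of H] interior_subset_surface c' unfolding carries_def by fastforce
    then obtain n where n: "Poly_Mapping.keys n \<subseteq> indeterminates \<Sigma> S" "t_link \<Sigma> S L' = monomial n"
      using t_link_monomial[OF assms(4) L'(1)] by blast
    have "P L' = t_link \<Sigma> S L' * const ?\<delta> ^ (card L' - 1)" using assms(7) d(1) unfolding homfly_polynomial_def by blast
    moreover have "0 < card L'" using L'(1,2) by (auto simp: closed_curves_def card_gt_0_iff)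
    ultimately show "\<exists>n. Poly_Mapping.keys n \<subseteq> indeterminates \<Sigma> S \<and>
      q H = monomial n * const ?\<delta> ^ (num_boundary_components \<Sigma> G F H - 1) \<and> 0 < num_boundary_components \<Sigma> G F H"
      using n d(2) L'(3) by auto
  qed
  then obtain n where n: "\<And>H. H \<subseteq> ?E \<Longrightarrow> Poly_Mapping.keys (n H) \<subseteq> indeterminates \<Sigma> S"
    "\<And>H. H \<subseteq> ?E \<Longrightarrow> q H = monomial (n H) * const ?\<delta> ^ (num_boundary_components \<Sigma> G F H - 1)"
    "\<And>H. H \<subseteq> ?E \<Longrightarrow> 0 < num_boundary_components \<Sigma> G F H" by (metis Pow_iff)
  \<comment> \<open>A monomial gets a nonzero value exactly if it is the square-free monomial of a
    set of edges, which is then its support.\<close>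
  define \<Phi> :: "('e \<Rightarrow>\<^sub>0 nat) \<Rightarrow> 'a knot mpoly" where
    "\<Phi> m = (if Poly_Mapping.keys m \<subseteq> ?E \<and> m = square_free_exponent (Poly_Mapping.keys m) then monomial (n (Poly_Mapping.keys m)) else 0)" for m
  have \<Phi>: "\<Phi> (square_free_exponent H) = monomial (n H)" if "H \<subseteq> ?E" for H
    using that keys_square_free_exponent[of H] finite_subset[OF that finite_graph(1)] by (simp add: \<Phi>_def)
  show ?thesis
  proof (intro exI[of _ "linear_extension \<Phi>"] conjI allI)
    show "linear_extension \<Phi> (p + q) = linear_extension \<Phi> p + linear_extension \<Phi> q" for p q by (rule linear_extension_add)
    show "linear_extension \<Phi> (const r * p) = const r * linear_extension \<Phi> p" for r p by (rule linear_extension_scale)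
    show "linear_extension \<Phi> (monomial m) = 0 \<or>
       (\<exists>n. Poly_Mapping.keys n \<subseteq> indeterminates \<Sigma> S \<and> linear_extension \<Phi> (monomial m) = monomial n)" for m
      unfolding linear_extension_monomial \<Phi>_def using n(1)[of "Poly_Mapping.keys m"] by simp blast
    let ?c = "\<lambda>H. ?a ^ card H * ?b ^ (card ?E - card H) * ?\<delta> ^ (num_boundary_components \<Sigma> G F H - 1)"
    \<comment> \<open>The prefactor cancels one factor (x - x^-1) / y. Each edge in \<open>H\<close>
      combines y / x with 1 / (x y) to x^-2, and each edge outside \<open>H\<close> keeps y /
      x.\<close>
    have coeff: "y_var / (x_var - inverse x_var) * ?b ^ card ?E * ((1 / (x_var * y_var)) ^ card H * ?\<delta> ^ num_boundary_components \<Sigma> G F H) = ?c H"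
      if H: "H \<subseteq> ?E" for H
    proof -
      have "num_boundary_components \<Sigma> G F H = Suc (num_boundary_components \<Sigma> G F H - 1)" using n(3)[OF H] by simp
      then have d: "?\<delta> ^ num_boundary_components \<Sigma> G F H = ?\<delta> * ?\<delta> ^ (num_boundary_components \<Sigma> G F H - 1)" by (metis power_Suc)
      have "card ?E = card H + (card ?E - card H)" using card_mono[OF finite_graph(1) H] by simp
      then have b: "?b ^ card ?E = ?b ^ card H * ?b ^ (card ?E - card H)" by (metis power_add)
      have i1: "y_var / (x_var - inverse x_var) * ?\<delta> = 1" using x_var_minus_inverse_nonzero y_var_nonzero by simp
      have i2: "?b ^ card H * (1 / (x_var * y_var)) ^ card H = ?a ^ card H"
        unfolding power_mult_distrib[symmetric] using x_var_nonzero y_var_nonzero by (simp add: power2_eq_square)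
      have "u * (v * w) * (z * (d * k)) = (u * d) * (v * z) * w * k" for u v w z d k :: ratfun by (simp add: mult_ac)
      then show ?thesis unfolding d b by (simp only: i1 i2 mult_1_left)
    qed
    have summand: "const (y_var / (x_var - inverse x_var)) * const ?b ^ card ?E *
        (1 ^ num_components G F H * (\<Prod>e\<in>H. const (1 / (x_var * y_var)) * var e) * const ?\<delta> ^ num_boundary_components \<Sigma> G F H) =
        const (?c H) * monomial (square_free_exponent H)" if H: "H \<subseteq> ?E" for H
    proof -
      have "(\<Prod>e\<in>H. const (1 / (x_var * y_var)) * var e) = const ((1 / (x_var * y_var)) ^ card H) * monomial (square_free_exponent H)"
        using finite_subset[OF H finite_graph(1)] by (simp add: prod.distrib prod_var const_power)
      then show ?thesis unfolding coeff[OF H, symmetric] const_simps(3) const_power by (simp add: mult_ac)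
    qed
    have "const (y_var / (x_var - inverse x_var)) * const ?b ^ card ?E *
             bollobas_riordan \<Sigma> G F 1 (\<lambda>e. const (1 / (x_var * y_var)) * var e) (const ?\<delta>) =
          (\<Sum>H\<in>Pow ?E. const (?c H) * monomial (square_free_exponent H))"
      unfolding bollobas_riordan_def states_def sum_distrib_left using summand by (intro sum.cong) auto
    then have "linear_extension \<Phi> (const (y_var / (x_var - inverse x_var)) * const ?b ^ card ?E *
             bollobas_riordan \<Sigma> G F 1 (\<lambda>e. const (1 / (x_var * y_var)) * var e) (const ?\<delta>)) =
          (\<Sum>H\<in>Pow ?E. const (?c H) * monomial (n H))"
      using finite_graph(1) \<Phi> by (simp add: linear_extension_sum linear_extension_scale linear_extension_monomial)
    also have "\<dots> = P L" unfolding q(1) using n(2) by (intro sum.cong) (auto simp: const_simps const_power mult_ac)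
    finally show "P L = linear_extension \<Phi> (const (y_var / (x_var - inverse x_var)) * const ?b ^ card ?E *
             bollobas_riordan \<Sigma> G F 1 (\<lambda>e. const (1 / (x_var * y_var)) * var e) (const ?\<delta>))" by simp
  qed
qed

end
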